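(* Let $k$ be a field of characteristic $\neq 2$, and let $X=\mathbf{P}^2_k$ with homogeneous coordinates $(x:y:z)$. Let $C\subset X$ be the curve $y^2+z^2-2xz=0$ and let $p=(1:0:0)\in C$. Take local parameters at $p$ $$t=\frac{y}{x},\qquad u=\Big(\frac{y}{x}\Big)^2+\Big(\frac{z}{x}\Big)^2-2\,\frac{z}{x},$$ and identify $K_{p,C}=k((t))((u))$. Let $W\subset k((t))((u))$ be the subspace attached by the two-dimensional Krichever map to the sheaf $\mathcal{O}_X$ (with trivialization $1$). Then $$W=k[\alpha]\Big(\Big(\frac{\alpha^2}{t^2}\,u\Big)\Big),\qquad \alpha=\frac{t\,\big(1+(1+u-t^2)^{1/2}\big)}{t^2-u},$$ where $(1+u-t^2)^{1/2}\in k[[t,u]]$ denotes the square root with constant term $1$.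
   Context: Krichever map for the structure sheaf. Let $X$ be a projective irreducible normal surface over $k$, $C\subset X$ an irreducible reduced curve that is an ample Cartier divisor, and $p$ a $k$-point that is smooth on both $X$ and $C$. Let $t,u$ be local parameters at $p$ such that $u=0$ is a local equation of $C$ near $p$. For a closed point $q\in C$ let $\hat{\mathcal{O}}_q$ be the completed local ring of $X$ at $q$ and $f_q$ a local equation of $C$ at $q$. Put $B_q=\hat{\mathcal{O}}_q[f_q^{-1}]$ (independent of the choice of $f_q$). Let $K_{q,C}$ be the ring obtained from $\hat{\mathcal{O}}_q$ by localizing at the complement of the union of the minimal primes over $(f_q)$, completing $f_q$-adically, and then inverting $f_q$. For $q=p$ this is a two-dimensional local field, identified with $k((t))((u))$ by $t,u$. Let $K_C$ be the completion of the function field $k(X)$ with respect to the discrete valuation given by $C$. It embeds canonically in every $K_{q,C}$. The Krichever map attaches to this data (with the sheaf $\mathcal{O}_X$ and trivialization $1$) the $k$-subspace $$W=\{g\in K_C:\ \text{the image of } g \text{ in } K_{q,C}\text{ lies in }B_q\text{ for all closed points } q\in C,\ q\ne p\},$$ viewed inside $K_{p,C}=k((t))((u))$ via $K_C\subset K_{p,C}$. For a subring $R\subset k((t))((u))$ and an element $f$, $R((f))$ denotes the set of all sums $\sum_{n\ge N}c_nf^n$ with $N\in\mathbb{Z}$, $c_n\in R$ (convergent in $k((t))((u))$). *)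

theory Defs
  imports
    Complex_Main
    "HOL-Algebra.Ideal_Product"
    "HOL-Algebra.QuotRing"
    "HOL-Computational_Algebra.Polynomial"
    "HOL-Computational_Algebra.Fraction_Field"
    "HOL-Computational_Algebra.Formal_Laurent_Series"
begin

section \<open>Localization and completion of commutative rings\<close>

definition ring_on :: "'a::comm_ring_1 set \<Rightarrow> 'a ring" where
  "ring_on A = \<lparr>carrier = A, monoid.mult = (*), one = 1, zero = 0, add = (+)\<rparr>"

definition loc_rel :: "('a, 'b) ring_scheme \<Rightarrow> 'a set \<Rightarrow> (('a \<times> 'a) \<times> ('a \<times> 'a)) set" where
  "loc_rel R S = {((a, s), (b, t)). a \<in> carrier R \<and> s \<in> S \<and> b \<in> carrier R \<and> t \<in> S \<and>
     (\<exists>w\<in>S. w \<otimes>\<^bsub>R\<^esub> (a \<otimes>\<^bsub>R\<^esub> t \<ominus>\<^bsub>R\<^esub> b \<otimes>\<^bsub>R\<^esub> s) = \<zero>\<^bsub>R\<^esub>)}"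

definition loc_frac :: "('a, 'b) ring_scheme \<Rightarrow> 'a set \<Rightarrow> 'a \<Rightarrow> 'a \<Rightarrow> ('a \<times> 'a) set" where
  "loc_frac R S a s = loc_rel R S `` {(a, s)}"

definition localization :: "('a, 'b) ring_scheme \<Rightarrow> 'a set \<Rightarrow> ('a \<times> 'a) set ring" where
  "localization R S =
     \<lparr>carrier = (carrier R \<times> S) // loc_rel R S,
      monoid.mult = (\<lambda>A B. \<Union>(a, s)\<in>A. \<Union>(b, t)\<in>B. loc_frac R S (a \<otimes>\<^bsub>R\<^esub> b) (s \<otimes>\<^bsub>R\<^esub> t)),
      one = loc_frac R S \<one>\<^bsub>R\<^esub> \<one>\<^bsub>R\<^esub>,
      zero = loc_frac R S \<zero>\<^bsub>R\<^esub> \<one>\<^bsub>R\<^esub>,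
      add = (\<lambda>A B. \<Union>(a, s)\<in>A. \<Union>(b, t)\<in>B.
               loc_frac R S (a \<otimes>\<^bsub>R\<^esub> t \<oplus>\<^bsub>R\<^esub> b \<otimes>\<^bsub>R\<^esub> s) (s \<otimes>\<^bsub>R\<^esub> t))\<rparr>"

definition powers :: "('a, 'b) ring_scheme \<Rightarrow> 'a \<Rightarrow> 'a set" where
  "powers R x = range (\<lambda>n::nat. x [^]\<^bsub>R\<^esub> n)"

text \<open>Completions are taken with respect to a descending filtration \<open>I\<close> by additive subgroups:
  Cauchy sequences modulo null sequences. The filtration is by powers of an ideal for adic
  completions, and by \<open>v \<ge> n\<close> for a discretely valued field.\<close>

definition converges_to ::
    "('a, 'b) ring_scheme \<Rightarrow> (nat \<Rightarrow> 'a set) \<Rightarrow> (nat \<Rightarrow> 'a) \<Rightarrow> 'a \<Rightarrow> bool" where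
  "converges_to R I s l \<longleftrightarrow> (\<forall>n. \<exists>M. \<forall>i\<ge>M. s i \<ominus>\<^bsub>R\<^esub> l \<in> I n)"

definition cauchy_ring :: "('a, 'b) ring_scheme \<Rightarrow> (nat \<Rightarrow> 'a set) \<Rightarrow> (nat \<Rightarrow> 'a) ring" where
  "cauchy_ring R I =
     \<lparr>carrier = {s. range s \<subseteq> carrier R \<and>
                    (\<forall>n. \<exists>M. \<forall>i\<ge>M. \<forall>j\<ge>M. s i \<ominus>\<^bsub>R\<^esub> s j \<in> I n)},
      monoid.mult = (\<lambda>s s' i. s i \<otimes>\<^bsub>R\<^esub> s' i),
      one = (\<lambda>i. \<one>\<^bsub>R\<^esub>),
      zero = (\<lambda>i. \<zero>\<^bsub>R\<^esub>),
      add = (\<lambda>s s' i. s i \<oplus>\<^bsub>R\<^esub> s' i)\<rparr>"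

definition null_seqs :: "('a, 'b) ring_scheme \<Rightarrow> (nat \<Rightarrow> 'a set) \<Rightarrow> (nat \<Rightarrow> 'a) set" where
  "null_seqs R I = {s \<in> carrier (cauchy_ring R I). converges_to R I s \<zero>\<^bsub>R\<^esub>}"

definition completion :: "('a, 'b) ring_scheme \<Rightarrow> (nat \<Rightarrow> 'a set) \<Rightarrow> (nat \<Rightarrow> 'a) set ring" where
  "completion R I = cauchy_ring R I Quot null_seqs R I"

definition cauchy_class ::
    "('a, 'b) ring_scheme \<Rightarrow> (nat \<Rightarrow> 'a set) \<Rightarrow> (nat \<Rightarrow> 'a) \<Rightarrow> (nat \<Rightarrow> 'a) set" where
  "cauchy_class R I s = null_seqs R I +>\<^bsub>cauchy_ring R I\<^esub> s"

primrec ideal_power :: "('a, 'b) ring_scheme \<Rightarrow> 'a set \<Rightarrow> nat \<Rightarrow> 'a set" where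
  "ideal_power R I 0 = carrier R"
| "ideal_power R I (Suc n) = ideal_prod R I (ideal_power R I n)"

definition minimal_primes_over :: "('a, 'b) ring_scheme \<Rightarrow> 'a set \<Rightarrow> 'a set set" where
  "minimal_primes_over R I = {P. primeideal P R \<and> I \<subseteq> P \<and>
     (\<forall>Q. primeideal Q R \<longrightarrow> I \<subseteq> Q \<longrightarrow> Q \<subseteq> P \<longrightarrow> Q = P)}"


section \<open>The projective plane as Proj of k[x,y,z]\<close>

text \<open>\<open>k[x,y,z]\<close> is represented as \<open>k[x][y][z]\<close>.\<close>

type_synonym 'a poly3 = "'a poly poly poly"

definition xvar :: "'a::field poly3" where "xvar = [:[:[:0, 1:]:]:]"
definition yvar :: "'a::field poly3" where "yvar = [:[:0, 1:]:]"
definition zvar :: "'a::field poly3" where "zvar = [:0, 1:]"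
definition const3 :: "'a::field \<Rightarrow> 'a poly3" where "const3 c = [:[:[:c:]:]:]"

abbreviation ratio :: "'a::field poly3 \<Rightarrow> 'a poly3 \<Rightarrow> 'a poly3 fract" where
  "ratio \<equiv> Fraction_Field.Fract"

definition homogeneous :: "nat \<Rightarrow> 'a::field poly3 \<Rightarrow> bool" where
  "homogeneous d P \<longleftrightarrow> (\<forall>i j l. coeff (coeff (coeff P l) j) i \<noteq> 0 \<longrightarrow> i + j + l = d)"

abbreviation poly3_ring :: "'a::field poly3 ring" where
  "poly3_ring \<equiv> ring_on UNIV"

definition plane_points :: "'a::field poly3 set set" where
  "plane_points = {q. primeideal q poly3_ring \<and>
     q = genideal poly3_ring {a \<in> q. \<exists>d. homogeneous d a} \<and>
     \<not> {xvar, yvar, zvar} \<subseteq> q}"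

definition closed_points :: "'a::field poly3 set set" where
  "closed_points = {q \<in> plane_points. \<forall>q'\<in>plane_points. q \<subseteq> q' \<longrightarrow> q' = q}"

text \<open>All local rings are realized inside \<open>Frac k[x,y,z]\<close>, as the degree zero part of the homogeneous
  localization at \<open>q\<close>. For \<open>q = {0}\<close>, the generic point, this is the function field.\<close>

definition stalk :: "'a::field poly3 set \<Rightarrow> 'a poly3 fract ring" where
  "stalk q = ring_on {ratio a b | a b d. homogeneous d a \<and> homogeneous d b \<and> b \<notin> q}"

definition stalk_max :: "'a::field poly3 set \<Rightarrow> 'a poly3 fract set" where
  "stalk_max q = {ratio a b | a b d. homogeneous d a \<and> homogeneous d b \<and> a \<in> q \<and> b \<notin> q}"

abbreviation function_field :: "'a::field poly3 fract ring" where
  "function_field \<equiv> stalk {0}"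


section \<open>Rings attached to the flag of a curve F = 0 and a closed point\<close>

text \<open>A curve is given by an irreducible homogeneous polynomial \<open>F\<close>; it contains the point \<open>q\<close> iff
  \<open>F \<in> q\<close>.\<close>

definition curve_ideal :: "'a::field poly3 \<Rightarrow> 'a poly3 set \<Rightarrow> 'a poly3 fract set" where
  "curve_ideal F q =
     {ratio a b | a b d. homogeneous d a \<and> homogeneous d b \<and> F dvd a \<and> b \<notin> q}"

definition local_equation :: "'a::field poly3 \<Rightarrow> 'a poly3 set \<Rightarrow> 'a poly3 fract \<Rightarrow> bool" where
  "local_equation F q f \<longleftrightarrow> f \<in> carrier (stalk q) \<and> cgenideal (stalk q) f = curve_ideal F q"

definition ord_along :: "'a::field poly3 \<Rightarrow> 'a poly3 \<Rightarrow> nat" where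
  "ord_along F a = (GREATEST n. F ^ n dvd a)"

definition val_along :: "'a::field poly3 \<Rightarrow> 'a poly3 fract \<Rightarrow> int" where
  "val_along F g = (THE v. \<exists>a b d. homogeneous d a \<and> homogeneous d b \<and> a \<noteq> 0 \<and> b \<noteq> 0 \<and>
     g = ratio a b \<and> v = int (ord_along F a) - int (ord_along F b))"

definition val_filt :: "'a::field poly3 \<Rightarrow> nat \<Rightarrow> 'a poly3 fract set" where
  "val_filt F n = {g \<in> carrier function_field. g = 0 \<or> int n \<le> val_along F g}"

definition K_curve :: "'a::field poly3 \<Rightarrow> (nat \<Rightarrow> 'a poly3 fract) set ring" where
  "K_curve F = completion function_field (val_filt F)"

definition hat_stalk :: "'a::field poly3 set \<Rightarrow> (nat \<Rightarrow> 'a poly3 fract) set ring" where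
  "hat_stalk q = completion (stalk q) (ideal_power (stalk q) (stalk_max q))"

definition to_hat :: "'a::field poly3 set \<Rightarrow> 'a poly3 fract \<Rightarrow> (nat \<Rightarrow> 'a poly3 fract) set" where
  "to_hat q a = cauchy_class (stalk q) (ideal_power (stalk q) (stalk_max q)) (\<lambda>_. a)"

text \<open>In the following, \<open>f\<close> is a local equation of the curve at \<open>q\<close>; different choices of \<open>f\<close> give
  canonically isomorphic rings. The ring \<open>K\<^sub>q\<^sub>,\<^sub>C\<close> is built in three
  steps \<open>loc_hat\<close> (localization), \<open>int_ring\<close> (\<open>f\<close>-adic completion) and \<open>K_flag\<close> (inverting \<open>f\<close>).\<close>

definition loc_hat_denoms ::
    "'a::field poly3 set \<Rightarrow> 'a poly3 fract \<Rightarrow> (nat \<Rightarrow> 'a poly3 fract) set set" where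
  "loc_hat_denoms q f =
     carrier (hat_stalk q) -
       \<Union> (minimal_primes_over (hat_stalk q) (cgenideal (hat_stalk q) (to_hat q f)))"

definition loc_hat where
  "loc_hat q f = localization (hat_stalk q) (loc_hat_denoms q f)"

definition to_loc_hat where
  "to_loc_hat q f a = loc_frac (hat_stalk q) (loc_hat_denoms q f) a \<one>\<^bsub>hat_stalk q\<^esub>"

definition int_ring_filt where
  "int_ring_filt q f =
     ideal_power (loc_hat q f) (cgenideal (loc_hat q f) (to_loc_hat q f (to_hat q f)))"

definition int_ring where
  "int_ring q f = completion (loc_hat q f) (int_ring_filt q f)"

definition to_int_ring where
  "to_int_ring q f a = cauchy_class (loc_hat q f) (int_ring_filt q f) (\<lambda>_. to_loc_hat q f a)"

definition int_ring_eq where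
  "int_ring_eq q f = to_int_ring q f (to_hat q f)"

definition K_flag where
  "K_flag q f = localization (int_ring q f) (powers (int_ring q f) (int_ring_eq q f))"

definition K_flag_frac where
  "K_flag_frac q f a s = loc_frac (int_ring q f) (powers (int_ring q f) (int_ring_eq q f)) a s"

definition hat_to_K_flag where
  "hat_to_K_flag q f a = K_flag_frac q f (to_int_ring q f a) \<one>\<^bsub>int_ring q f\<^esub>"

text \<open>The \<open>f\<close>-adic topology of \<open>K_flag q f\<close>.\<close>

definition K_flag_filt where
  "K_flag_filt q f n =
     (\<lambda>e. K_flag_frac q f e \<one>\<^bsub>int_ring q f\<^esub>) `
       ideal_power (int_ring q f) (cgenideal (int_ring q f) (int_ring_eq q f)) n"

definition K_flag_lim where
  "K_flag_lim q f s = (THE h. h \<in> carrier (K_flag q f) \<and>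
     converges_to (K_flag q f) (K_flag_filt q f) s h)"

definition B_ring where
  "B_ring q f = localization (hat_stalk q) (powers (hat_stalk q) (to_hat q f))"

text \<open>The map \<open>B_ring q f \<rightarrow> K_flag q f\<close>, \<open>a / s \<mapsto> a / s\<close>.\<close>

definition B_to_K_flag where
  "B_to_K_flag q f b = (THE h. \<exists>a\<in>carrier (hat_stalk q). \<exists>s\<in>powers (hat_stalk q) (to_hat q f).
     b = loc_frac (hat_stalk q) (powers (hat_stalk q) (to_hat q f)) a s \<and>
     h = K_flag_frac q f (to_int_ring q f a) (to_int_ring q f s))"

text \<open>The canonical map from the function field, which is the fraction field of every stalk, and its
  extension to the completion \<open>K_curve F\<close> by continuity.\<close>

definition rat_to_K_flag where
  "rat_to_K_flag q f g = (THE h. \<exists>a\<in>carrier (stalk q). \<exists>b\<in>carrier (stalk q). b \<noteq> 0 \<and> g = a / b \<and>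
     h = hat_to_K_flag q f (to_hat q a) \<otimes>\<^bsub>K_flag q f\<^esub>
           inv\<^bsub>K_flag q f\<^esub> (hat_to_K_flag q f (to_hat q b)))"

definition K_curve_to_K_flag where
  "K_curve_to_K_flag q f g = (THE h. h \<in> carrier (K_flag q f) \<and>
     (\<forall>s\<in>g. converges_to (K_flag q f) (K_flag_filt q f) (\<lambda>i. rat_to_K_flag q f (s i)) h))"


section \<open>The Krichever map\<close>

definition krichever_K ::
    "'a::field poly3 \<Rightarrow> 'a poly3 set \<Rightarrow> (nat \<Rightarrow> 'a poly3 fract) set set" where
  "krichever_K F p = {g \<in> carrier (K_curve F).
     \<forall>q f. q \<in> closed_points \<longrightarrow> F \<in> q \<longrightarrow> q \<noteq> p \<longrightarrow> local_equation F q f \<longrightarrow>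
       K_curve_to_K_flag q f g \<in> B_to_K_flag q f ` carrier (B_ring q f)}"

text \<open>The identification of \<open>k((t))((u))\<close> with \<open>K_flag p u\<close> for a \<open>k\<close>-point \<open>p\<close> with local parameters
  \<open>t\<close>, \<open>u\<close>, where \<open>u\<close> is a local equation of the curve. It sends \<open>\<Sum>c\<^sub>j u\<^sup>j\<close> to the sum of the same
  \<open>u\<close>-adically convergent series, after \<open>k((t))\<close> has been embedded by summing power series in \<open>t\<close> in
  the completed local ring at \<open>p\<close>.\<close>

definition power_series_to_hat ::
    "'a::field poly3 set \<Rightarrow> 'a poly3 fract \<Rightarrow> 'a fps \<Rightarrow> (nat \<Rightarrow> 'a poly3 fract) set" where
  "power_series_to_hat p t c = cauchy_class (stalk p) (ideal_power (stalk p) (stalk_max p))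
     (\<lambda>n. \<Sum>i<n. ratio (const3 (fps_nth c i)) 1 * t ^ i)"

definition laurent_coeff_to_K_flag where
  "laurent_coeff_to_K_flag p t u (c :: 'a::field fls) =
     hat_to_K_flag p u (power_series_to_hat p t (fls_base_factor_to_fps c)) \<otimes>\<^bsub>K_flag p u\<^esub>
     hat_to_K_flag p u (to_hat p t) [^]\<^bsub>K_flag p u\<^esub> fls_subdegree c"

definition laurent_to_K_flag where
  "laurent_to_K_flag p t u (h :: 'a::field fls fls) =
     K_flag_lim p u (\<lambda>n. \<Oplus>\<^bsub>K_flag p u\<^esub>j\<in>{fls_subdegree h..int n}.
       laurent_coeff_to_K_flag p t u (fls_nth h j) \<otimes>\<^bsub>K_flag p u\<^esub>
       hat_to_K_flag p u (to_hat p u) [^]\<^bsub>K_flag p u\<^esub> j)"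

definition krichever ::
    "'a::field poly3 \<Rightarrow> 'a poly3 set \<Rightarrow> 'a poly3 fract \<Rightarrow> 'a poly3 fract \<Rightarrow> 'a fls fls set" where
  "krichever F p t u =
     {h. laurent_to_K_flag p t u h \<in> K_curve_to_K_flag p u ` krichever_K F p}"


section \<open>The conic and its Laurent series\<close>

definition conic :: "'a::field poly3" where
  "conic = yvar ^ 2 + zvar ^ 2 - 2 * xvar * zvar"

text \<open>The homogeneous prime ideal of the point \<open>(1:0:0)\<close>.\<close>

definition conic_point :: "'a::field poly3 set" where
  "conic_point = genideal poly3_ring {yvar, zvar}"

definition conic_t :: "'a::field poly3 fract" where
  "conic_t = ratio yvar xvar"

definition conic_u :: "'a::field poly3 fract" where
  "conic_u = (ratio yvar xvar) ^ 2 + (ratio zvar xvar) ^ 2 - 2 * ratio zvar xvar"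

text \<open>In \<open>k((t))((u)) = 'a fls fls\<close> the inner variable is \<open>t\<close> and the outer one is \<open>u\<close>.\<close>

definition lt :: "'a::field fls fls" where "lt = fls_const fls_X"
definition lu :: "'a::field fls fls" where "lu = fls_X"

text \<open>\<open>k[[t,u]]\<close> is represented as \<open>k[[t]][[u]]\<close>.\<close>

definition fps2_to_fls2 :: "'a::field fps fps \<Rightarrow> 'a fls fls" where
  "fps2_to_fls2 w = fps_to_fls (Abs_fps (\<lambda>j. fps_to_fls (fps_nth w j)))"

definition conic_root :: "'a::field fps fps" where
  "conic_root = (THE w. w ^ 2 = 1 + fps_X - (fps_const fps_X) ^ 2 \<and> fps_nth (fps_nth w 0) 0 = 1)"

definition conic_alpha :: "'a::field fls fls" where
  "conic_alpha = lt * (1 + fps2_to_fls2 conic_root) / (lt ^ 2 - lu)"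

definition poly_values :: "'a::field fls fls \<Rightarrow> 'a fls fls set" where
  "poly_values a = range (\<lambda>P :: 'a poly. poly (map_poly (\<lambda>c. fls_const (fls_const c)) P) a)"

text \<open>\<open>R((f))\<close>. Convergence is with respect to the library metric on \<open>'a fls fls\<close>, i.e. \<open>u\<close>-adic.\<close>

definition laurent_sums :: "'a::field fls fls set \<Rightarrow> 'a fls fls \<Rightarrow> 'a fls fls set" where
  "laurent_sums R f = {h. \<exists>(N::int) c. (\<forall>n. c n \<in> R) \<and> (\<lambda>n::nat. c n * f powi (N + int n)) sums h}"

end

theory Submission
  imports Defs "HOL-Computational_Algebra.Polynomial_Factorial"
begin

text \<open>Since \<open>2 \<noteq> 0\<close>, the functions \<open>\<alpha> = y/z\<close> and \<open>f = (y\<^sup>2 + z\<^sup>2 - 2xz)/z\<^sup>2\<close> are coordinates on the affine plane \<open>z \<noteq> 0\<close>,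
  which is therefore the spectrum of \<open>k[\<alpha>][f]\<close>, with \<open>C\<close> given by \<open>f = 0\<close>; the line \<open>z = 0\<close> meets \<open>C\<close> only in \<open>p\<close>. At \<open>p\<close> one
  has \<open>z/x = 1 - (1 + u - t\<^sup>2)\<^sup>1\<^sup>/\<^sup>2\<close>, which turns \<open>\<alpha>\<close> and \<open>f\<close> into the series of the theorem. A series \<open>\<Sum>c\<^sub>n f\<^sup>n\<close> with
  \<open>c\<^sub>n \<in> k[\<alpha>]\<close> lies in every \<open>B\<^sub>q\<close>, \<open>q \<noteq> p\<close>. Conversely, an element of \<open>K\<^sub>C\<close> has an expansion in powers of \<open>f\<close> with
  coefficients in \<open>k(\<alpha>)\<close>. If it lies in every \<open>B\<^sub>q\<close>, then its leading coefficient has no pole on \<open>C - {p}\<close>, hence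
  lies in \<open>k[\<alpha>]\<close>; subtract the leading term and iterate.\<close>

text \<open>The obstacle is that \<open>K_flag\<close> is a localization of a completion of a
  localization of a completion, all given by equivalence classes. It becomes tractable because the
  conic is smooth: at each of its closed points the local ring has parameters \<open>\<tau>\<close>
  and f, and modulo f it behaves as a discrete valuation ring in \<open>\<tau>\<close>. Orders
  modulo f therefore add, which forces f to be a prime element of the completed local ring. So (f)
  is its own only minimal prime, and the property of being a domain with a separated prime element
  (\<open>prime_elt\<close>) passes through all later steps. Membership in B_q then says that some
  power of f carries the element into the completed local ring. A denominator b(\<alpha>) of a
  leading coefficient is excluded point by point, so for a prime \<pi> dividing b a closed point of
  the plane with \<pi>(\<alpha>) = 0 has to be produced; the delicate part of its maximality is that
  it does not specialize to p. At p the second parameter is t, and separatedness modulo u comes from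
  the rational parametrization of the conic.\<close>

lemma ring_on_simps [simp]:
  "carrier (ring_on A) = A" "x \<otimes>\<^bsub>ring_on A\<^esub> y = x * y" "\<one>\<^bsub>ring_on A\<^esub> = 1"
  "\<zero>\<^bsub>ring_on A\<^esub> = 0" "x \<oplus>\<^bsub>ring_on A\<^esub> y = x + y"
  by (simp_all add: ring_on_def)

definition subring_on :: "'a::comm_ring_1 set \<Rightarrow> bool" where
  "subring_on A \<longleftrightarrow> 1 \<in> A \<and> (\<forall>x\<in>A. \<forall>y\<in>A. x - y \<in> A \<and> x * y \<in> A)"

lemma subring_onD:
  assumes "subring_on A"
  shows "1 \<in> A" "0 \<in> A" "x \<in> A \<Longrightarrow> y \<in> A \<Longrightarrow> x - y \<in> A" "x \<in> A \<Longrightarrow> y \<in> A \<Longrightarrow> x * y \<in> A"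
    "x \<in> A \<Longrightarrow> - x \<in> A" "x \<in> A \<Longrightarrow> y \<in> A \<Longrightarrow> x + y \<in> A" "x \<in> A \<Longrightarrow> x ^ n \<in> A"
proof -
  show 1: "1 \<in> A" and 2: "x \<in> A \<Longrightarrow> y \<in> A \<Longrightarrow> x - y \<in> A"
    and 3: "x \<in> A \<Longrightarrow> y \<in> A \<Longrightarrow> x * y \<in> A" for x y
    using assms by (auto simp: subring_on_def)
  show 0: "0 \<in> A" using 2[OF 1 1] by simp
  show 4: "x \<in> A \<Longrightarrow> - x \<in> A" for x using 2[OF 0, of x] by simp
  show "x \<in> A \<Longrightarrow> y \<in> A \<Longrightarrow> x + y \<in> A" using 2[OF _ 4, of x y] by simp
  show "x \<in> A \<Longrightarrow> x ^ n \<in> A" by (induction n) (auto intro: 1 3)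
qed

lemma cring_ring_on:
  assumes "subring_on A"
  shows "cring (ring_on A)"
proof (rule cringI)
  note [simp] = subring_onD[OF assms]
  show "abelian_group (ring_on A)"
    by (rule abelian_groupI) (auto simp: algebra_simps intro: bexI[of _ "- x" for x])
  show "comm_monoid (ring_on A)"
    by (rule comm_monoidI) (auto simp: algebra_simps)
qed (auto simp: algebra_simps)

lemma ring_on_uminus:
  assumes "subring_on A" "x \<in> A"
  shows "\<ominus>\<^bsub>ring_on A\<^esub> x = - x"
proof -
  interpret cring "ring_on A" using assms(1) by (rule cring_ring_on)
  show ?thesis
    using minus_equality[of "- x" x] assms by (auto simp: subring_onD)
qed

lemma ring_on_minus [simp]:
  assumes "subring_on A" "x \<in> A" "y \<in> A"
  shows "x \<ominus>\<^bsub>ring_on A\<^esub> y = x - y"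
  using assms by (simp add: a_minus_def ring_on_uminus)

lemma ring_on_pow [simp]: "x [^]\<^bsub>ring_on A\<^esub> (n::nat) = x ^ n"
  by (induction n) (simp_all add: mult.commute)

section \<open>Completions\<close>

text \<open>Covers the maximal-adic filtration of a stalk and the f-adic one of its localization.
  The valuation filtration of the function field is not by ideals, so the elements of
  \<open>K_curve\<close> are handled separately.\<close>

locale filtered_ring = cring R for R (structure) +
  fixes I :: "nat \<Rightarrow> 'a set"
  assumes I_ideal: "ideal (I n) R"
    and I_decr: "I (Suc n) \<subseteq> I n"
begin

lemma I_mono: "m \<le> n \<Longrightarrow> I n \<subseteq> I m"
  by (metis I_decr lift_Suc_antimono_le)

lemma I_carr: "x \<in> I n \<Longrightarrow> x \<in> carrier R"
  using I_ideal ideal.Icarr by fast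

lemma I_add: "x \<in> I n \<Longrightarrow> y \<in> I n \<Longrightarrow> x \<oplus> y \<in> I n"
  using I_ideal additive_subgroup.a_closed ideal.axioms(1) by fast

lemma I_zero: "\<zero> \<in> I n"
  using I_ideal additive_subgroup.zero_closed ideal.axioms(1) by fast

lemma I_uminus: "x \<in> I n \<Longrightarrow> \<ominus> x \<in> I n"
  using I_ideal additive_subgroup.a_inv_closed ideal.axioms(1) by fast

lemma I_minus: "x \<in> I n \<Longrightarrow> y \<in> I n \<Longrightarrow> x \<ominus> y \<in> I n"
  by (simp add: a_minus_def I_add I_uminus)

lemma I_l_mult: "x \<in> carrier R \<Longrightarrow> y \<in> I n \<Longrightarrow> x \<otimes> y \<in> I n"
  using I_ideal ideal.I_l_closed by fast

lemma I_r_mult: "x \<in> carrier R \<Longrightarrow> y \<in> I n \<Longrightarrow> y \<otimes> x \<in> I n"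
  using I_ideal ideal.I_r_closed by fast

abbreviation "CR \<equiv> cauchy_ring R I"
abbreviation "NS \<equiv> null_seqs R I"
abbreviation "Rh \<equiv> completion R I"
abbreviation "cls \<equiv> cauchy_class R I"

lemma CR_simps:
  "s \<otimes>\<^bsub>CR\<^esub> s' = (\<lambda>i. s i \<otimes> s' i)" "s \<oplus>\<^bsub>CR\<^esub> s' = (\<lambda>i. s i \<oplus> s' i)"
  "\<one>\<^bsub>CR\<^esub> = (\<lambda>_. \<one>)" "\<zero>\<^bsub>CR\<^esub> = (\<lambda>_. \<zero>)"
  by (simp_all add: cauchy_ring_def)

lemma CR_iff: "s \<in> carrier CR \<longleftrightarrow>
    (\<forall>i. s i \<in> carrier R) \<and> (\<forall>n. \<exists>M. \<forall>i\<ge>M. \<forall>j\<ge>M. s i \<ominus> s j \<in> I n)"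
  by (auto simp: cauchy_ring_def)

lemma CR_I: "(\<And>i. s i \<in> carrier R) \<Longrightarrow> (\<And>n. \<exists>M. \<forall>i\<ge>M. \<forall>j\<ge>M. s i \<ominus> s j \<in> I n) \<Longrightarrow> s \<in> carrier CR"
  by (auto simp: CR_iff)

lemma CR_carr: "s \<in> carrier CR \<Longrightarrow> s i \<in> carrier R"
  by (auto simp: CR_iff)

lemma CR_D: "s \<in> carrier CR \<Longrightarrow> \<exists>M. \<forall>i\<ge>M. \<forall>j\<ge>M. s i \<ominus> s j \<in> I n"
  by (auto simp: CR_iff)

lemma CR_add: 
  assumes "s \<in> carrier CR" "s' \<in> carrier CR"
  shows "(\<lambda>i. s i \<oplus> s' i) \<in> carrier CR"
proof (rule CR_I)
  show "s i \<oplus> s' i \<in> carrier R" for i using assms by (simp add: CR_carr)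
  fix n
  obtain M M' where M: "\<forall>i\<ge>M. \<forall>j\<ge>M. s i \<ominus> s j \<in> I n" "\<forall>i\<ge>M'. \<forall>j\<ge>M'. s' i \<ominus> s' j \<in> I n"
    using assms CR_D by meson
  have "s i \<oplus> s' i \<ominus> (s j \<oplus> s' j) \<in> I n" if "i \<ge> max M M'" "j \<ge> max M M'" for i j
  proof -
    have "s i \<oplus> s' i \<ominus> (s j \<oplus> s' j) = (s i \<ominus> s j) \<oplus> (s' i \<ominus> s' j)"
      using CR_carr[OF assms(1)] CR_carr[OF assms(2)] by algebra
    then show ?thesis using M that by (simp add: I_add)
  qed
  then show "\<exists>M. \<forall>i\<ge>M. \<forall>j\<ge>M. s i \<oplus> s' i \<ominus> (s j \<oplus> s' j) \<in> I n" by meson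
qed

lemma CR_mult: 
  assumes "s \<in> carrier CR" "s' \<in> carrier CR"
  shows "(\<lambda>i. s i \<otimes> s' i) \<in> carrier CR"
proof (rule CR_I)
  show "s i \<otimes> s' i \<in> carrier R" for i using assms by (simp add: CR_carr)
  fix n
  obtain M M' where M: "\<forall>i\<ge>M. \<forall>j\<ge>M. s i \<ominus> s j \<in> I n" "\<forall>i\<ge>M'. \<forall>j\<ge>M'. s' i \<ominus> s' j \<in> I n"
    using assms CR_D by meson
  have "s i \<otimes> s' i \<ominus> (s j \<otimes> s' j) \<in> I n" if "i \<ge> max M M'" "j \<ge> max M M'" for i j
  proof -
    have "s i \<otimes> s' i \<ominus> (s j \<otimes> s' j) = s i \<otimes> (s' i \<ominus> s' j) \<oplus> s' j \<otimes> (s i \<ominus> s j)"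
      using CR_carr[OF assms(1)] CR_carr[OF assms(2)] by algebra
    then show ?thesis using M that assms by (simp add: I_add I_l_mult CR_carr)
  qed
  then show "\<exists>M. \<forall>i\<ge>M. \<forall>j\<ge>M. s i \<otimes> s' i \<ominus> (s j \<otimes> s' j) \<in> I n" by meson
qed

lemma CR_uminus: 
  assumes "s \<in> carrier CR"
  shows "(\<lambda>i. \<ominus> s i) \<in> carrier CR"
proof (rule CR_I)
  show "\<ominus> s i \<in> carrier R" for i using assms by (simp add: CR_carr)
  fix n
  obtain M where M: "\<forall>i\<ge>M. \<forall>j\<ge>M. s i \<ominus> s j \<in> I n"
    using assms CR_D by meson
  have "\<ominus> s i \<ominus> (\<ominus> s j) \<in> I n" if "i \<ge> M" "j \<ge> M" for i j
  proof -
    have "\<ominus> s i \<ominus> (\<ominus> s j) = \<ominus> (s i \<ominus> s j)"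
      using CR_carr[OF assms(1)] by algebra
    then show ?thesis using M that by (simp add: I_uminus)
  qed
  then show "\<exists>M. \<forall>i\<ge>M. \<forall>j\<ge>M. \<ominus> s i \<ominus> (\<ominus> s j) \<in> I n" by meson
qed

lemma CR_const: "a \<in> carrier R \<Longrightarrow> (\<lambda>_. a) \<in> carrier CR"
  by (rule CR_I) (simp_all add: a_minus_def r_neg I_zero)

lemma CR_cring: "cring CR"
proof (rule cringI)
  show "abelian_group CR"
  proof (rule abelian_groupI)
    show "\<exists>y\<in>carrier CR. y \<oplus>\<^bsub>CR\<^esub> x = \<zero>\<^bsub>CR\<^esub>" if "x \<in> carrier CR" for x
      using that by (intro bexI[of _ "\<lambda>i. \<ominus> x i"]) (auto simp: CR_simps CR_uminus CR_carr l_neg)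
  qed (auto simp: CR_simps CR_add CR_const CR_carr a_ac)
  show "comm_monoid CR"
    by (rule comm_monoidI) (auto simp: CR_simps CR_mult CR_const CR_carr m_ac)
qed (auto simp: CR_simps CR_carr l_distr)

lemma CR_inv: "s \<in> carrier CR \<Longrightarrow> \<ominus>\<^bsub>CR\<^esub> s = (\<lambda>i. \<ominus> s i)"
proof -
  interpret C: cring CR by (rule CR_cring)
  show "s \<in> carrier CR \<Longrightarrow> \<ominus>\<^bsub>CR\<^esub> s = (\<lambda>i. \<ominus> s i)"
    by (rule C.minus_equality) (auto simp: CR_simps CR_uminus CR_carr l_neg)
qed

lemma CR_minus: "s \<in> carrier CR \<Longrightarrow> s' \<in> carrier CR \<Longrightarrow> s \<ominus>\<^bsub>CR\<^esub> s' = (\<lambda>i. s i \<ominus> s' i)"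
  by (simp add: a_minus_def CR_inv CR_simps)

lemma NS_iff: "s \<in> NS \<longleftrightarrow> (\<forall>i. s i \<in> carrier R) \<and> (\<forall>n. \<exists>M. \<forall>i\<ge>M. s i \<in> I n)"
proof safe
  assume s: "s \<in> NS"
  then show c: "s i \<in> carrier R" for i by (auto simp: null_seqs_def CR_carr)
  fix n show "\<exists>M. \<forall>i\<ge>M. s i \<in> I n"
    using s c by (auto simp: null_seqs_def converges_to_def a_minus_def)
next
  assume s: "\<forall>i. s i \<in> carrier R" "\<forall>n. \<exists>M. \<forall>i\<ge>M. s i \<in> I n"
  have "s \<in> carrier CR"
    by (rule CR_I) (use s I_minus in \<open>simp, meson\<close>)
  then show "s \<in> NS" using s by (auto simp: null_seqs_def converges_to_def a_minus_def)
qed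

lemma NS_ideal: "ideal NS CR"
proof (rule ideal.intro)
  interpret C: cring CR by (rule CR_cring)
  show "ring CR" by unfold_locales
  have sub: "s \<in> NS \<Longrightarrow> s \<in> carrier CR" for s by (simp add: null_seqs_def)
  show "additive_subgroup NS CR"
  proof (rule additive_subgroup.intro, rule C.add.subgroupI)
    show "NS \<subseteq> carrier CR" using sub by auto
    show "NS \<noteq> {}" using NS_iff[of "\<lambda>_. \<zero>"] I_zero by auto
    show "\<ominus>\<^bsub>CR\<^esub> a \<in> NS" if "a \<in> NS" for a
      using that sub[OF that] by (auto simp: CR_inv NS_iff) (meson I_uminus)
    show "a \<oplus>\<^bsub>CR\<^esub> b \<in> NS" if ab: "a \<in> NS" "b \<in> NS" for a b
      unfolding NS_iff CR_simps
    proof safe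
      show "a i \<oplus> b i \<in> carrier R" for i using ab by (auto simp: NS_iff)
      fix n
      obtain M M' where "\<forall>i\<ge>M. a i \<in> I n" "\<forall>i\<ge>M'. b i \<in> I n" using ab NS_iff by meson
      then show "\<exists>M. \<forall>i\<ge>M. a i \<oplus> b i \<in> I n"
        by (intro exI[of _ "max M M'"]) (auto intro: I_add)
    qed
  qed
  have l: "x \<otimes>\<^bsub>CR\<^esub> a \<in> NS" if "a \<in> NS" "x \<in> carrier CR" for a x
    using that unfolding NS_iff CR_simps by (auto simp: CR_carr) (meson I_l_mult CR_carr)
  show "ideal_axioms NS CR"
    by (rule ideal_axioms.intro) (use l C.m_comm sub in auto)
qed

lemma Rh_cring: "cring Rh"
  unfolding completion_def by (rule ideal.quotient_is_cring[OF NS_ideal CR_cring])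

lemma cls_eq:
  assumes "s \<in> carrier CR" "s' \<in> carrier CR"
  shows "cls s = cls s' \<longleftrightarrow> (\<forall>n. \<exists>M. \<forall>i\<ge>M. s i \<ominus> s' i \<in> I n)"
proof -
  interpret C: cring CR by (rule CR_cring)
  interpret N: ideal NS CR by (rule NS_ideal)
  have "cls s = cls s' \<longleftrightarrow> s \<ominus>\<^bsub>CR\<^esub> s' \<in> NS"
    unfolding cauchy_class_def using C.quotient_eq_iff_same_a_r_cos[OF NS_ideal assms] by simp
  also have "\<dots> \<longleftrightarrow> (\<forall>n. \<exists>M. \<forall>i\<ge>M. s i \<ominus> s' i \<in> I n)"
    using assms by (simp add: CR_minus NS_iff CR_carr)
  finally show ?thesis .
qed

lemma Rh_carrier: "carrier Rh = cls ` carrier CR"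
  by (auto simp: completion_def FactRing_def A_RCOSETS_def' cauchy_class_def)

lemma cls_carr: "s \<in> carrier CR \<Longrightarrow> cls s \<in> carrier Rh"
  by (simp add: Rh_carrier)

lemma RhE: 
  assumes "e \<in> carrier Rh" obtains s where "s \<in> carrier CR" "e = cls s"
  using assms by (auto simp: Rh_carrier)

lemma cls_mult: "s \<in> carrier CR \<Longrightarrow> s' \<in> carrier CR \<Longrightarrow>
    cls s \<otimes>\<^bsub>Rh\<^esub> cls s' = cls (\<lambda>i. s i \<otimes> s' i)"
  by (simp add: completion_def FactRing_def cauchy_class_def ideal.rcoset_mult_add[OF NS_ideal] CR_simps)

lemma cls_add: "s \<in> carrier CR \<Longrightarrow> s' \<in> carrier CR \<Longrightarrow>
    cls s \<oplus>\<^bsub>Rh\<^esub> cls s' = cls (\<lambda>i. s i \<oplus> s' i)"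
proof -
  interpret C: cring CR by (rule CR_cring)
  interpret N: ideal NS CR by (rule NS_ideal)
  show "s \<in> carrier CR \<Longrightarrow> s' \<in> carrier CR \<Longrightarrow> cls s \<oplus>\<^bsub>Rh\<^esub> cls s' = cls (\<lambda>i. s i \<oplus> s' i)"
    by (simp add: completion_def FactRing_def cauchy_class_def N.a_rcos_sum CR_simps)
qed

lemma cls_one: "\<one>\<^bsub>Rh\<^esub> = cls (\<lambda>_. \<one>)"
  by (simp add: completion_def FactRing_def cauchy_class_def CR_simps)

lemma cls_zero: "\<zero>\<^bsub>Rh\<^esub> = cls (\<lambda>_. \<zero>)"
proof -
  interpret C: cring CR by (rule CR_cring)
  interpret N: ideal NS CR by (rule NS_ideal)
  have "cls (\<lambda>_. \<zero>) = NS"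
    using N.a_rcos_const[OF N.zero_closed] by (simp add: cauchy_class_def CR_simps)
  then show ?thesis by (simp add: completion_def FactRing_def)
qed

lemma cls_uminus: "s \<in> carrier CR \<Longrightarrow> \<ominus>\<^bsub>Rh\<^esub> cls s = cls (\<lambda>i. \<ominus> s i)"
proof -
  interpret C: cring Rh by (rule Rh_cring)
  assume s: "s \<in> carrier CR"
  show "\<ominus>\<^bsub>Rh\<^esub> cls s = cls (\<lambda>i. \<ominus> s i)"
    by (rule C.minus_equality)
      (use s in \<open>auto simp: cls_add CR_uminus cls_zero cls_carr CR_carr l_neg\<close>)
qed

lemma cls_minus: "s \<in> carrier CR \<Longrightarrow> s' \<in> carrier CR \<Longrightarrow>
    cls s \<ominus>\<^bsub>Rh\<^esub> cls s' = cls (\<lambda>i. s i \<ominus> s' i)"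
  by (simp add: a_minus_def cls_uminus cls_add CR_uminus)

lemma cls_zero_iff: "s \<in> carrier CR \<Longrightarrow> cls s = \<zero>\<^bsub>Rh\<^esub> \<longleftrightarrow> (\<forall>n. \<exists>M. \<forall>i\<ge>M. s i \<in> I n)"
  by (simp add: cls_zero cls_eq CR_const minus_eq CR_carr)

lemma cls_pow: "s \<in> carrier CR \<Longrightarrow> cls s [^]\<^bsub>Rh\<^esub> (n::nat) = cls (\<lambda>i. s i [^] n)
    \<and> (\<lambda>i. s i [^] n) \<in> carrier CR"
  by (induction n) (auto simp: cls_one CR_const cls_mult CR_mult)

end

section \<open>Localizations of domains\<close>

locale mult_subset = domain R for R (structure) +
  fixes S :: "'a set"
  assumes S_carr: "s \<in> S \<Longrightarrow> s \<in> carrier R"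
    and S_one: "\<one> \<in> S"
    and S_mult: "s \<in> S \<Longrightarrow> t \<in> S \<Longrightarrow> s \<otimes> t \<in> S"
    and S_zero: "\<zero> \<notin> S"
begin

abbreviation "RS \<equiv> localization R S"
abbreviation "fr \<equiv> loc_frac R S"

lemma S_nonzero: "s \<in> S \<Longrightarrow> s \<noteq> \<zero>"
  using S_zero by auto

text \<open>The multiplier \<open>w\<close> in \<open>loc_rel\<close> is nonzero and cancels in a
  domain, so that only the cross products remain.\<close>

lemma loc_rel_iff: "((a, s), (b, t)) \<in> loc_rel R S \<longleftrightarrow>
    a \<in> carrier R \<and> s \<in> S \<and> b \<in> carrier R \<and> t \<in> S \<and> a \<otimes> t = b \<otimes> s"
proof -
  have "(\<exists>w\<in>S. w \<otimes> (a \<otimes> t \<ominus> b \<otimes> s) = \<zero>) \<longleftrightarrow> a \<otimes> t = b \<otimes> s"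
    if c: "a \<in> carrier R" "s \<in> S" "b \<in> carrier R" "t \<in> S"
  proof
    assume "\<exists>w\<in>S. w \<otimes> (a \<otimes> t \<ominus> b \<otimes> s) = \<zero>"
    then have "a \<otimes> t \<ominus> b \<otimes> s = \<zero>"
      using c S_carr S_nonzero integral by (metis m_closed minus_closed)
    moreover have "a \<otimes> t = (a \<otimes> t \<ominus> b \<otimes> s) \<oplus> b \<otimes> s"
      using c(1,3) S_carr[OF c(2)] S_carr[OF c(4)] by algebra
    ultimately show "a \<otimes> t = b \<otimes> s" using c by (simp add: S_carr)
  next
    assume "a \<otimes> t = b \<otimes> s"
    then show "\<exists>w\<in>S. w \<otimes> (a \<otimes> t \<ominus> b \<otimes> s) = \<zero>"
      using c S_one S_carr by (intro bexI[of _ \<one>]) (auto simp: a_minus_def r_neg)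
  qed
  then show ?thesis by (auto simp: loc_rel_def)
qed

lemma loc_rel_equiv: "equiv (carrier R \<times> S) (loc_rel R S)"
proof (rule equivI)
  show "refl_on (carrier R \<times> S) (loc_rel R S)" by (auto simp: refl_on_def loc_rel_iff)
  show "loc_rel R S \<subseteq> (carrier R \<times> S) \<times> (carrier R \<times> S)" by (auto simp: loc_rel_iff)
  show "sym (loc_rel R S)" by (auto simp: sym_def loc_rel_iff)
  show "trans (loc_rel R S)"
  proof (rule transI)
    fix p q r assume pq: "(p, q) \<in> loc_rel R S" and qr: "(q, r) \<in> loc_rel R S"
    obtain a s b t c u where eq: "p = (a, s)" "q = (b, t)" "r = (c, u)" by (metis surj_pair)
    note h = pq[unfolded eq loc_rel_iff] qr[unfolded eq loc_rel_iff]
    have cs: "s \<in> carrier R" "t \<in> carrier R" "u \<in> carrier R" using h S_carr by auto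
    have ca: "a \<in> carrier R" "b \<in> carrier R" "c \<in> carrier R"
      and eqs: "a \<otimes> t = b \<otimes> s" "b \<otimes> u = c \<otimes> t" using h by auto
    have "t \<otimes> (a \<otimes> u) = (a \<otimes> t) \<otimes> u" using ca cs by algebra
    also have "\<dots> = (b \<otimes> u) \<otimes> s" unfolding eqs(1) using ca cs by algebra
    also have "\<dots> = t \<otimes> (c \<otimes> s)" unfolding eqs(2) using ca cs by algebra
    finally have "a \<otimes> u = c \<otimes> s" using m_lcancel[of t] h cs S_nonzero by simp
    then show "(p, r) \<in> loc_rel R S" using h by (simp add: eq loc_rel_iff)
  qed
qed

lemma fr_eq: "a \<in> carrier R \<Longrightarrow> s \<in> S \<Longrightarrow> b \<in> carrier R \<Longrightarrow> t \<in> S \<Longrightarrow>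
    fr a s = fr b t \<longleftrightarrow> a \<otimes> t = b \<otimes> s"
  unfolding loc_frac_def using eq_equiv_class_iff[OF loc_rel_equiv, of "(a, s)" "(b, t)"]
  by (simp add: loc_rel_iff)

lemma RS_carrier: "carrier RS = {fr a s | a s. a \<in> carrier R \<and> s \<in> S}"
  by (auto simp: localization_def quotient_def loc_frac_def)

lemma fr_carr: "a \<in> carrier R \<Longrightarrow> s \<in> S \<Longrightarrow> fr a s \<in> carrier RS"
  by (auto simp: RS_carrier)

lemma RSE: assumes "z \<in> carrier RS" obtains a s where "a \<in> carrier R" "s \<in> S" "z = fr a s"
  using assms by (auto simp: RS_carrier)

lemma in_fr: "(b, t) \<in> fr a s \<longleftrightarrow> a \<in> carrier R \<and> s \<in> S \<and> b \<in> carrier R \<and> t \<in> S \<and> a \<otimes> t = b \<otimes> s"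
  by (simp add: loc_frac_def loc_rel_iff)

text \<open>The product in \<open>localization\<close> is a union over all pairs of representatives.
  It collapses because every pair yields the same class and neither union is over an empty
  set.\<close>

lemma fr_mult:
  assumes "a \<in> carrier R" "s \<in> S" "b \<in> carrier R" "t \<in> S"
  shows "fr a s \<otimes>\<^bsub>RS\<^esub> fr b t = fr (a \<otimes> b) (s \<otimes> t)"
proof -
  have *: "fr (a' \<otimes> b') (s' \<otimes> t') = fr (a \<otimes> b) (s \<otimes> t)"
    if h: "(a', s') \<in> fr a s" "(b', t') \<in> fr b t" for a' s' b' t'
  proof -
    note h = h[unfolded in_fr]
    have cs: "s \<in> carrier R" "t \<in> carrier R" "s' \<in> carrier R" "t' \<in> carrier R"
      "a' \<in> carrier R" "b' \<in> carrier R" using h S_carr by auto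
    have "a' \<otimes> b' \<otimes> (s \<otimes> t) = (a' \<otimes> s) \<otimes> (b' \<otimes> t)" using cs by algebra
    also have "\<dots> = (a \<otimes> s') \<otimes> (b \<otimes> t')" using h by simp
    also have "\<dots> = a \<otimes> b \<otimes> (s' \<otimes> t')" using assms(1,3) cs by algebra
    finally show ?thesis using h by (subst fr_eq) (auto simp: S_mult)
  qed
  have ne: "fr a s \<noteq> {}" "fr b t \<noteq> {}" using in_fr[of a s a s] in_fr[of b t b t] assms by auto
  have "(\<Union>(a', s')\<in>fr a s. \<Union>(b', t')\<in>fr b t. fr (a' \<otimes> b') (s' \<otimes> t')) = fr (a \<otimes> b) (s \<otimes> t)"
    by (intro SUP_eq_const[OF ne(1)]) (auto intro!: SUP_eq_const[OF ne(2)] *)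
  then show ?thesis by (simp add: localization_def)
qed

lemma fr_add:
  assumes "a \<in> carrier R" "s \<in> S" "b \<in> carrier R" "t \<in> S"
  shows "fr a s \<oplus>\<^bsub>RS\<^esub> fr b t = fr (a \<otimes> t \<oplus> b \<otimes> s) (s \<otimes> t)"
proof -
  have *: "fr (a' \<otimes> t' \<oplus> b' \<otimes> s') (s' \<otimes> t') = fr (a \<otimes> t \<oplus> b \<otimes> s) (s \<otimes> t)"
    if h: "(a', s') \<in> fr a s" "(b', t') \<in> fr b t" for a' s' b' t'
  proof -
    note h = h[unfolded in_fr]
    have cs: "s \<in> carrier R" "t \<in> carrier R" "s' \<in> carrier R" "t' \<in> carrier R"
      "a' \<in> carrier R" "b' \<in> carrier R" using h S_carr by auto
    have "(a' \<otimes> t' \<oplus> b' \<otimes> s') \<otimes> (s \<otimes> t) = (a' \<otimes> s) \<otimes> (t' \<otimes> t) \<oplus> (b' \<otimes> t) \<otimes> (s \<otimes> s')"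
      using cs by algebra
    also have "\<dots> = (a \<otimes> s') \<otimes> (t' \<otimes> t) \<oplus> (b \<otimes> t') \<otimes> (s \<otimes> s')" using h by simp
    also have "\<dots> = (a \<otimes> t \<oplus> b \<otimes> s) \<otimes> (s' \<otimes> t')" using assms(1,3) cs by algebra
    finally show ?thesis using h cs by (subst fr_eq) (auto simp: S_mult)
  qed
  have ne: "fr a s \<noteq> {}" "fr b t \<noteq> {}" using in_fr[of a s a s] in_fr[of b t b t] assms by auto
  have "(\<Union>(a', s')\<in>fr a s. \<Union>(b', t')\<in>fr b t. fr (a' \<otimes> t' \<oplus> b' \<otimes> s') (s' \<otimes> t')) =
      fr (a \<otimes> t \<oplus> b \<otimes> s) (s \<otimes> t)"
    by (intro SUP_eq_const[OF ne(1)]) (auto intro!: SUP_eq_const[OF ne(2)] *)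
  then show ?thesis by (simp add: localization_def)
qed

lemma RS_one: "\<one>\<^bsub>RS\<^esub> = fr \<one> \<one>" and RS_zero: "\<zero>\<^bsub>RS\<^esub> = fr \<zero> \<one>"
  by (simp_all add: localization_def)

lemma fr_zero_iff: "a \<in> carrier R \<Longrightarrow> s \<in> S \<Longrightarrow> fr a s = \<zero>\<^bsub>RS\<^esub> \<longleftrightarrow> a = \<zero>"
  by (simp add: RS_zero fr_eq S_one S_carr)

lemma fr_one_iff: "a \<in> carrier R \<Longrightarrow> s \<in> S \<Longrightarrow> fr a s = \<one>\<^bsub>RS\<^esub> \<longleftrightarrow> a = s"
  by (simp add: RS_one fr_eq S_one S_carr)

lemma RS_cring: "cring RS"
proof (rule cringI)
  have c: "s \<in> S \<Longrightarrow> s \<in> carrier R" for s by (rule S_carr)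
  note s = S_one S_mult fr_carr S_carr
  show "abelian_group RS"
  proof (rule abelian_groupI)
    fix x assume "x \<in> carrier RS"
    then obtain a s' where x: "a \<in> carrier R" "s' \<in> S" "x = fr a s'" by (rule RSE)
    have "fr (\<ominus> a) s' \<oplus>\<^bsub>RS\<^esub> x = \<zero>\<^bsub>RS\<^esub>"
      using x c by (simp add: fr_add fr_zero_iff s l_minus l_neg)
    then show "\<exists>y\<in>carrier RS. y \<oplus>\<^bsub>RS\<^esub> x = \<zero>\<^bsub>RS\<^esub>" using x by (intro bexI) (auto simp: s)
    show "\<zero>\<^bsub>RS\<^esub> \<oplus>\<^bsub>RS\<^esub> x = x" using x c by (simp add: RS_zero fr_add fr_eq s)
  next
    fix x y assume "x \<in> carrier RS" "y \<in> carrier RS"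
    then show "x \<oplus>\<^bsub>RS\<^esub> y \<in> carrier RS" "x \<oplus>\<^bsub>RS\<^esub> y = y \<oplus>\<^bsub>RS\<^esub> x"
      by (auto elim!: RSE simp: fr_add s c a_comm m_comm)
  next
    fix x y z assume "x \<in> carrier RS" "y \<in> carrier RS" "z \<in> carrier RS"
    note cxyz = this
    obtain a s1 where x: "a \<in> carrier R" "s1 \<in> S" "x = fr a s1" using cxyz(1) by (rule RSE)
    obtain b s2 where y: "b \<in> carrier R" "s2 \<in> S" "y = fr b s2" using cxyz(2) by (rule RSE)
    obtain d s3 where z: "d \<in> carrier R" "s3 \<in> S" "z = fr d s3" using cxyz(3) by (rule RSE)
    note xyz = x y z
    have "(a \<otimes> s2 \<oplus> b \<otimes> s1) \<otimes> s3 \<oplus> d \<otimes> (s1 \<otimes> s2) = a \<otimes> (s2 \<otimes> s3) \<oplus> (b \<otimes> s3 \<oplus> d \<otimes> s2) \<otimes> s1"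
      "s1 \<otimes> s2 \<otimes> s3 = s1 \<otimes> (s2 \<otimes> s3)"
      using xyz(1,4,7) xyz(2,5,8)[THEN c] by algebra+
    then show "x \<oplus>\<^bsub>RS\<^esub> y \<oplus>\<^bsub>RS\<^esub> z = x \<oplus>\<^bsub>RS\<^esub> (y \<oplus>\<^bsub>RS\<^esub> z)"
      using xyz c by (simp add: fr_add s)
  qed (simp add: RS_zero s)
  show "comm_monoid RS"
  proof (rule comm_monoidI)
    fix x y assume "x \<in> carrier RS" "y \<in> carrier RS"
    then show "x \<otimes>\<^bsub>RS\<^esub> y \<in> carrier RS" "x \<otimes>\<^bsub>RS\<^esub> y = y \<otimes>\<^bsub>RS\<^esub> x"
      by (auto elim!: RSE simp: fr_mult s c m_comm)
  next
    fix x y z assume "x \<in> carrier RS" "y \<in> carrier RS" "z \<in> carrier RS"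
    then show "x \<otimes>\<^bsub>RS\<^esub> y \<otimes>\<^bsub>RS\<^esub> z = x \<otimes>\<^bsub>RS\<^esub> (y \<otimes>\<^bsub>RS\<^esub> z)"
      by (auto elim!: RSE simp: fr_mult s c m_ac)
  next
    fix x assume "x \<in> carrier RS"
    then show "\<one>\<^bsub>RS\<^esub> \<otimes>\<^bsub>RS\<^esub> x = x" by (auto elim!: RSE simp: fr_mult s c RS_one)
  qed (simp add: RS_one s)
  fix x y z assume "x \<in> carrier RS" "y \<in> carrier RS" "z \<in> carrier RS"
  note cxyz = this
  obtain a s1 where x: "a \<in> carrier R" "s1 \<in> S" "x = fr a s1" using cxyz(1) by (rule RSE)
  obtain b s2 where y: "b \<in> carrier R" "s2 \<in> S" "y = fr b s2" using cxyz(2) by (rule RSE)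
  obtain d s3 where z: "d \<in> carrier R" "s3 \<in> S" "z = fr d s3" using cxyz(3) by (rule RSE)
  note xyz = x y z
  have "(a \<otimes> s2 \<oplus> b \<otimes> s1) \<otimes> d \<otimes> (s1 \<otimes> s3 \<otimes> (s2 \<otimes> s3)) =
      (a \<otimes> d \<otimes> (s2 \<otimes> s3) \<oplus> b \<otimes> d \<otimes> (s1 \<otimes> s3)) \<otimes> (s1 \<otimes> s2 \<otimes> s3)"
    using xyz(1,4,7) xyz(2,5,8)[THEN c] by algebra
  then show "(x \<oplus>\<^bsub>RS\<^esub> y) \<otimes>\<^bsub>RS\<^esub> z = x \<otimes>\<^bsub>RS\<^esub> z \<oplus>\<^bsub>RS\<^esub> y \<otimes>\<^bsub>RS\<^esub> z"
    using xyz c by (simp add: fr_add fr_mult s fr_eq)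
qed

lemma RS_domain: "domain RS"
proof (rule domain.intro[OF RS_cring], rule domain_axioms.intro)
  show "\<one>\<^bsub>RS\<^esub> \<noteq> \<zero>\<^bsub>RS\<^esub>" by (simp add: RS_one fr_zero_iff S_one)
  fix x y assume xy: "x \<otimes>\<^bsub>RS\<^esub> y = \<zero>\<^bsub>RS\<^esub>" "x \<in> carrier RS" "y \<in> carrier RS"
  obtain a s where a: "a \<in> carrier R" "s \<in> S" "x = fr a s" using xy(2) by (rule RSE)
  obtain b t where b: "b \<in> carrier R" "t \<in> S" "y = fr b t" using xy(3) by (rule RSE)
  have "a \<otimes> b = \<zero>"
    using xy(1) unfolding a(3) b(3) fr_mult[OF a(1,2) b(1,2)]
      fr_zero_iff[OF m_closed[OF a(1) b(1)] S_mult[OF a(2) b(2)]] .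
  then show "x = \<zero>\<^bsub>RS\<^esub> \<or> y = \<zero>\<^bsub>RS\<^esub>"
    unfolding a(3) b(3) fr_zero_iff[OF a(1,2)] fr_zero_iff[OF b(1,2)]
    by (rule integral[OF _ a(1) b(1)])
qed

lemma fr_inverse: "s \<in> S \<Longrightarrow> t \<in> S \<Longrightarrow> fr s t \<otimes>\<^bsub>RS\<^esub> fr t s = \<one>\<^bsub>RS\<^esub>"
  by (simp add: fr_mult fr_one_iff S_carr S_mult m_comm)

lemma fr_hom: "(\<lambda>a. fr a \<one>) \<in> ring_hom R RS"
  by (rule ring_hom_memI) (auto simp: fr_carr S_one fr_mult fr_add RS_one)

lemma fr_inj: "a \<in> carrier R \<Longrightarrow> b \<in> carrier R \<Longrightarrow> fr a \<one> = fr b \<one> \<longleftrightarrow> a = b"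
  by (simp add: fr_eq S_one)

lemma fr_pow: "a \<in> carrier R \<Longrightarrow> fr a \<one> [^]\<^bsub>RS\<^esub> (n::nat) = fr (a [^] n) \<one>"
  by (induction n) (auto simp: RS_one fr_mult S_one)

end

section \<open>Powers of a prime element\<close>

text \<open>Elementwise form of the n-th power of the principal ideal (x): an iterated ideal product
  would carry sums of products through every argument.\<close>

definition pw :: "('a, 'b) ring_scheme \<Rightarrow> 'a \<Rightarrow> nat \<Rightarrow> 'a set" where
  "pw R x n = (\<lambda>r. x [^]\<^bsub>R\<^esub> n \<otimes>\<^bsub>R\<^esub> r) ` carrier R"

context cring
begin

lemma set_addI: "a \<in> A \<Longrightarrow> b \<in> B \<Longrightarrow> a \<oplus> b \<in> set_add R A B"
  by (auto simp: set_add_def set_mult_def)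

lemma pw_0: "pw R x 0 = carrier R"
  by (force simp: pw_def)

lemma pw_1: "x \<in> carrier R \<Longrightarrow> pw R x (Suc 0) = PIdl x"
  by (auto simp: pw_def cgenideal_def m_comm)

lemma pw_I: "r \<in> carrier R \<Longrightarrow> x [^] n \<otimes> r \<in> pw R x n"
  by (auto simp: pw_def)

lemma pw_E:
  assumes "a \<in> pw R x n" obtains r where "r \<in> carrier R" "a = x [^] n \<otimes> r"
  using assms by (auto simp: pw_def)

lemma pw_zero: "x \<in> carrier R \<Longrightarrow> \<zero> \<in> pw R x n"
  using pw_I[of \<zero> x n] by simp

lemma pw_carr: "x \<in> carrier R \<Longrightarrow> a \<in> pw R x n \<Longrightarrow> a \<in> carrier R"
  by (auto simp: pw_def)

lemma pw_ideal: 
  assumes "x \<in> carrier R" shows "ideal (pw R x n) R"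
proof -
  have "pw R x n = PIdl (x [^] n)" using assms by (auto simp: pw_def cgenideal_def m_comm)
  then show ?thesis using assms by (simp add: cgenideal_ideal)
qed

lemma pw_Suc: "x \<in> carrier R \<Longrightarrow> a \<in> pw R x n \<Longrightarrow> x \<otimes> a \<in> pw R x (Suc n)"
  by (auto simp: pw_def m_ac)

lemma pw_SucE: 
  assumes "x \<in> carrier R" "a \<in> pw R x (Suc n)"
  obtains b where "b \<in> pw R x n" "a = x \<otimes> b" "b \<in> carrier R"
proof -
  obtain r where r: "r \<in> carrier R" "a = x [^] Suc n \<otimes> r" using assms(2) by (auto simp: pw_def)
  then show ?thesis using assms(1) that[of "x [^] n \<otimes> r"] by (auto simp: pw_def m_ac)
qed

lemma pw_decr: 
  assumes "x \<in> carrier R" shows "pw R x (Suc n) \<subseteq> pw R x n"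
proof
  fix a assume "a \<in> pw R x (Suc n)"
  then obtain r where "r \<in> carrier R" "a = x [^] n \<otimes> (x \<otimes> r)" using assms by (auto simp: pw_def m_assoc)
  then show "a \<in> pw R x n" using assms by (auto simp: pw_def)
qed

lemma pw_add: "x \<in> carrier R \<Longrightarrow> a \<in> pw R x n \<Longrightarrow> x [^] m \<otimes> a \<in> pw R x (m + n)"
  by (auto simp: pw_def nat_pow_mult[symmetric] m_ac)

lemma ideal_power_pw:
  assumes x: "x \<in> carrier R"
  shows "ideal_power R (PIdl x) n = pw R x n"
proof (induction n)
  case 0 show ?case by (simp add: pw_0)
next
  case (Suc n)
  interpret J: ideal "pw R x (Suc n)" R by (rule pw_ideal[OF x])
  have "ideal_prod R (PIdl x) (pw R x n) = pw R x (Suc n)"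
  proof
    show "ideal_prod R (PIdl x) (pw R x n) \<subseteq> pw R x (Suc n)"
    proof
      fix z assume "z \<in> ideal_prod R (PIdl x) (pw R x n)"
      then show "z \<in> pw R x (Suc n)"
      proof induction
        case (prod i j)
        then obtain r b where "i = r \<otimes> x" "r \<in> carrier R" "j = x [^] n \<otimes> b" "b \<in> carrier R"
          by (auto simp: cgenideal_def pw_def)
        then have "i \<otimes> j = x [^] Suc n \<otimes> (r \<otimes> b)" using x by (simp add: m_ac)
        then show ?case using pw_I[of "r \<otimes> b" x "Suc n"] \<open>r \<in> carrier R\<close> \<open>b \<in> carrier R\<close> by simp
      next
        case (sum s1 s2) then show ?case by (intro J.a_closed)
      qed
    qed
    show "pw R x (Suc n) \<subseteq> ideal_prod R (PIdl x) (pw R x n)"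
    proof
      fix z assume "z \<in> pw R x (Suc n)"
      then obtain b where "b \<in> pw R x n" "z = x \<otimes> b" by (rule pw_SucE[OF x])
      then show "z \<in> ideal_prod R (PIdl x) (pw R x n)"
        using cgenideal_self[OF x] ideal_prod.prod by metis
    qed
  qed
  then show ?case using Suc by simp
qed

end

text \<open>The one property carried through the tower of rings: a domain with a nonzero nonunit
  prime whose powers intersect in zero. Localization at the complement of (x) keeps it
  (\<open>localization_prime_elt\<close>), and so does x-adic completion
  (\<open>pw_flag_ring\<close> with \<open>completion_prime_elt\<close>).\<close>

locale prime_elt = domain R for R (structure) +
  fixes x :: 'a
  assumes x_carr: "x \<in> carrier R"
    and x_nz: "x \<noteq> \<zero>"
    and x_nu: "\<one> \<notin> pw R x (Suc 0)"
    and x_prime: "a \<in> carrier R \<Longrightarrow> b \<in> carrier R \<Longrightarrow> a \<otimes> b \<in> pw R x (Suc 0) \<Longrightarrow>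
      a \<in> pw R x (Suc 0) \<or> b \<in> pw R x (Suc 0)"
    and x_sep: "a \<in> carrier R \<Longrightarrow> (\<And>n. a \<in> pw R x n) \<Longrightarrow> a = \<zero>"
begin

lemma pw_x_cancel: "a \<in> carrier R \<Longrightarrow> x \<otimes> a \<in> pw R x (Suc n) \<Longrightarrow> a \<in> pw R x n"
  using x_carr x_nz by (auto simp: m_lcancel elim!: pw_SucE[OF x_carr])

lemma pw_xn_cancel: "a \<in> carrier R \<Longrightarrow> x [^] m \<otimes> a \<in> pw R x (m + n) \<Longrightarrow> a \<in> pw R x n"
proof (induction m)
  case (Suc m)
  have "x [^] Suc m \<otimes> a = x \<otimes> (x [^] m \<otimes> a)" using Suc.prems x_carr by (simp add: m_ac)
  then have "x \<otimes> (x [^] m \<otimes> a) \<in> pw R x (Suc (m + n))" using Suc.prems(2) by (metis add_Suc)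
  then have "x [^] m \<otimes> a \<in> pw R x (m + n)"
    by (rule pw_x_cancel[rotated]) (use Suc.prems(1) x_carr in simp)
  then show ?case by (rule Suc.IH[OF Suc.prems(1)])
qed simp

lemma pw_mult_cancel:
  assumes "b \<in> carrier R" "b \<notin> pw R x (Suc 0)"
  shows "a \<in> carrier R \<Longrightarrow> a \<otimes> b \<in> pw R x n \<Longrightarrow> a \<in> pw R x n"
proof (induction n arbitrary: a)
  case (Suc n)
  obtain c where c: "c \<in> pw R x n" "a \<otimes> b = x \<otimes> c" "c \<in> carrier R"
    by (rule pw_SucE[OF x_carr Suc.prems(2)])
  have "a \<otimes> b \<in> pw R x (Suc 0)" unfolding c(2) using pw_I[OF c(3), of x "Suc 0"] x_carr by simp
  then have "a \<in> pw R x (Suc 0)" using x_prime[OF Suc.prems(1) assms(1)] assms(2) by blast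
  then obtain a' where a': "a' \<in> carrier R" "a = x \<otimes> a'"
    using x_carr by (elim pw_E) simp
  have "x \<otimes> (a' \<otimes> b) = a \<otimes> b" unfolding a'(2) using a'(1) assms(1) x_carr by (simp add: m_ac)
  then have "a' \<otimes> b = c"
    unfolding c(2) using m_lcancel[OF x_nz x_carr, of "a' \<otimes> b" c] a'(1) c(3) assms(1) by simp
  then have "a' \<in> pw R x n" using Suc.IH[OF a'(1)] c(1) by simp
  then show ?case unfolding a'(2) by (rule pw_Suc[OF x_carr])
qed (simp add: pw_0)

lemma factor:
  assumes "a \<in> carrier R" "a \<noteq> \<zero>"
  obtains n b where "b \<in> carrier R" "b \<notin> pw R x (Suc 0)" "a = x [^] (n::nat) \<otimes> b" "b \<noteq> \<zero>"
proof -
  obtain n where "a \<notin> pw R x n" using x_sep assms by metis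
  then obtain m where m: "a \<in> pw R x m" "a \<notin> pw R x (Suc m)"
    using assms pw_0 by (induction n) auto
  then obtain b where b: "b \<in> carrier R" "a = x [^] m \<otimes> b" by (auto simp: pw_def)
  have "b \<notin> pw R x (Suc 0)"
    using m(2) pw_add[OF x_carr, of b "Suc 0" m] unfolding b(2) by auto
  moreover have "b \<noteq> \<zero>" using b assms(2) x_carr by auto
  ultimately show ?thesis using that[OF b(1)] b(2) by blast
qed

lemma zero_pw: "\<zero> \<in> pw R x n"
  using x_carr by (rule pw_zero)

lemma S_mult_subset: "mult_subset R (carrier R - pw R x (Suc 0))"
  by unfold_locales (use x_nu zero_pw x_prime in auto)

lemma primeideal_x: "primeideal (PIdl x) R"
proof (rule primeidealI)
  show "ideal (PIdl x) R" by (rule cgenideal_ideal[OF x_carr])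
  show "cring R" by (rule cring_axioms)
  show "carrier R \<noteq> PIdl x" using x_nu pw_1[OF x_carr] by auto
qed (use x_prime pw_1[OF x_carr] in auto)

text \<open>Since (x) is itself prime, the union of minimal primes in \<open>loc_hat_denoms\<close>
  is just (x): the curve has a single branch at the point.\<close>

lemma minimal_primes_x: "minimal_primes_over R (PIdl x) = {PIdl x}"
proof -
  have "PIdl x \<subseteq> PIdl x" by simp
  then show ?thesis unfolding minimal_primes_over_def using primeideal_x by (auto 0 3)
qed

end

sublocale prime_elt \<subseteq> L: mult_subset R "carrier R - pw R x (Suc 0)"
  by (rule S_mult_subset)

context prime_elt
begin

text \<open>Denominators lie outside the prime ideal (x), so passing to a fraction changes no
  x-order (\<open>pw_mult_cancel\<close>).\<close>

lemma fr_in_pw: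
  assumes "a \<in> carrier R" "s \<in> carrier R - pw R x (Suc 0)"
  shows "L.fr a s \<in> pw L.RS (L.fr x \<one>) n \<longleftrightarrow> a \<in> pw R x n"
proof
  assume "L.fr a s \<in> pw L.RS (L.fr x \<one>) n"
  then obtain z where z: "z \<in> carrier L.RS"
    "L.fr a s = L.fr x \<one> [^]\<^bsub>L.RS\<^esub> n \<otimes>\<^bsub>L.RS\<^esub> z"
    unfolding pw_def by blast
  then obtain b t where bt: "b \<in> carrier R" "t \<in> carrier R - pw R x (Suc 0)"
    "L.fr a s = L.fr x \<one> [^]\<^bsub>L.RS\<^esub> n \<otimes>\<^bsub>L.RS\<^esub> L.fr b t"
    by (metis L.RSE)
  then have "L.fr a s = L.fr (x [^] n \<otimes> b) t"
    using x_carr by (simp add: L.fr_pow L.fr_mult L.S_one x_nu)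
  then have "a \<otimes> t = x [^] n \<otimes> b \<otimes> s" using bt assms x_carr by (simp add: L.fr_eq)
  also have "\<dots> = x [^] n \<otimes> (b \<otimes> s)" using bt assms x_carr by (simp add: m_ac)
  finally have "a \<otimes> t \<in> pw R x n" using bt assms x_carr by (auto simp: pw_def)
  then show "a \<in> pw R x n" using pw_mult_cancel[of t a n] bt assms by auto
next
  assume "a \<in> pw R x n"
  then obtain b where "b \<in> carrier R" "a = x [^] n \<otimes> b" by (auto simp: pw_def)
  then have "L.fr a s = L.fr x \<one> [^]\<^bsub>L.RS\<^esub> n \<otimes>\<^bsub>L.RS\<^esub> L.fr b s"
    using assms x_carr by (simp add: L.fr_pow L.fr_mult L.S_one x_nu)
  then show "L.fr a s \<in> pw L.RS (L.fr x \<one>) n"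
    using assms \<open>b \<in> carrier R\<close> L.fr_carr unfolding pw_def by blast
qed

lemma localization_prime_elt: "prime_elt L.RS (L.fr x \<one>)"
proof -
  interpret D: domain L.RS by (rule L.RS_domain)
  show ?thesis
  proof unfold_locales
    show "L.fr x \<one> \<in> carrier L.RS" using x_carr by (simp add: L.fr_carr x_nu)
    show "L.fr x \<one> \<noteq> \<zero>\<^bsub>L.RS\<^esub>" 
      unfolding L.fr_zero_iff[OF x_carr L.S_one] by (rule x_nz)
    show "\<one>\<^bsub>L.RS\<^esub> \<notin> pw L.RS (L.fr x \<one>) (Suc 0)"
      unfolding L.RS_one fr_in_pw[OF one_closed L.S_one] by (rule x_nu)
    fix a assume a: "a \<in> carrier L.RS"
    then obtain a' s where a': "a' \<in> carrier R" "s \<in> carrier R - pw R x (Suc 0)" "a = L.fr a' s" by (rule L.RSE)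
    show "a = \<zero>\<^bsub>L.RS\<^esub>" if "\<And>n. a \<in> pw L.RS (L.fr x \<one>) n"
    proof -
      have "a' = \<zero>"
        by (rule x_sep[OF a'(1)]) (use that in \<open>unfold a'(3) fr_in_pw[OF a'(1,2)]\<close>)
      then show ?thesis unfolding a'(3) L.fr_zero_iff[OF a'(1,2)] .
    qed
    fix b assume b: "b \<in> carrier L.RS" "a \<otimes>\<^bsub>L.RS\<^esub> b \<in> pw L.RS (L.fr x \<one>) (Suc 0)"
    obtain b' t where b': "b' \<in> carrier R" "t \<in> carrier R - pw R x (Suc 0)" "b = L.fr b' t"
      by (rule L.RSE[OF b(1)])
    have "L.fr (a' \<otimes> b') (s \<otimes> t) \<in> pw L.RS (L.fr x \<one>) (Suc 0)"
      using b(2) unfolding a'(3) b'(3) L.fr_mult[OF a'(1,2) b'(1,2)] .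
    then have "a' \<otimes> b' \<in> pw R x (Suc 0)" 
      unfolding fr_in_pw[OF m_closed[OF a'(1) b'(1)] L.S_mult[OF a'(2) b'(2)]] .
    then show "a \<in> pw L.RS (L.fr x \<one>) (Suc 0) \<or> b \<in> pw L.RS (L.fr x \<one>) (Suc 0)"
      unfolding a'(3) b'(3) fr_in_pw[OF a'(1,2)] fr_in_pw[OF b'(1,2)]
      by (rule x_prime[OF a'(1) b'(1)])
  qed
qed

end

section \<open>Completion of a ring along a filtration with a distinguished prime\<close>

text \<open>\<open>f_shift\<close> says that multiplication by the degree one symbol of f is
  injective on the associated graded ring. \<open>f_prime\<close> is a weak additivity of orders
  modulo f: orders below m and n give a product of order below m + n. The instances are a stalk with
  its maximal-adic filtration (\<open>R_flag_ring\<close>) and a ring with a prime element and its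
  adic filtration (\<open>pw_flag_ring\<close>), so that one theorem serves both
  completions.\<close>

locale flag_ring = filtered_ring R I for R (structure) and I +
  fixes f :: 'a
  assumes f_carr: "f \<in> carrier R"
    and I_0: "I 0 = carrier R"
    and f_shift: "r \<in> carrier R \<Longrightarrow> f \<otimes> r \<in> I (Suc k) \<Longrightarrow> r \<in> I k"
    and f_pow: "r \<in> carrier R \<Longrightarrow> f [^] n \<otimes> r \<in> I n"
    and f_prime: "a \<in> carrier R \<Longrightarrow> b \<in> carrier R \<Longrightarrow> a \<notin> set_add R (pw R f (Suc 0)) (I m) \<Longrightarrow>
      b \<notin> set_add R (pw R f (Suc 0)) (I n) \<Longrightarrow> a \<otimes> b \<notin> set_add R (pw R f (Suc 0)) (I (m + n))"
    and f_nu: "\<one> \<notin> set_add R (pw R f (Suc 0)) (I (Suc 0))"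
begin

abbreviation "J k \<equiv> set_add R (pw R f (Suc 0)) (I k)"
abbreviation "fh \<equiv> cls (\<lambda>_. f)"

lemma J_iff: "a \<in> J k \<longleftrightarrow> (\<exists>r\<in>carrier R. \<exists>e\<in>I k. a = f \<otimes> r \<oplus> e)"
proof -
  have 1: "f [^] Suc 0 = f" using f_carr by simp
  show ?thesis unfolding set_add_def set_mult_def pw_def 1 by auto
qed

lemma J_add_I: "a \<in> J k \<Longrightarrow> e \<in> I k \<Longrightarrow> a \<oplus> e \<in> J k"
proof -
  assume a: "a \<in> J k" and e: "e \<in> I k"
  obtain r e' where r: "r \<in> carrier R" "e' \<in> I k" "a = f \<otimes> r \<oplus> e'" using a unfolding J_iff by blast
  have "a \<oplus> e = f \<otimes> r \<oplus> (e' \<oplus> e)"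
    unfolding r(3) using r(1) I_carr[OF r(2)] I_carr[OF e] f_carr by (simp add: a_assoc)
  then show "a \<oplus> e \<in> J k" unfolding J_iff using r(1) I_add[OF r(2) e] by blast
qed

lemma J_0: "a \<in> carrier R \<Longrightarrow> a \<in> J 0"
  unfolding J_iff using f_carr by (intro bexI[of _ \<zero>] bexI[of _ a]) (simp_all add: I_0)

lemma fh_carr: "fh \<in> carrier Rh"
  by (simp add: cls_carr CR_const f_carr)

lemma cls_f_mult: "s \<in> carrier CR \<Longrightarrow> fh \<otimes>\<^bsub>Rh\<^esub> cls s = cls (\<lambda>i. f \<otimes> s i)"
  by (simp add: cls_mult CR_const f_carr)

lemma fh_pow_mult: "s \<in> carrier CR \<Longrightarrow> fh [^]\<^bsub>Rh\<^esub> (n::nat) \<otimes>\<^bsub>Rh\<^esub> cls s = cls (\<lambda>i. f [^] n \<otimes> s i)"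
  using cls_pow[OF CR_const[OF f_carr], of n] by (simp add: cls_mult)

lemma CR_f_cancel:
  assumes "\<And>i. r i \<in> carrier R" "(\<lambda>i. f \<otimes> r i) \<in> carrier CR"
  shows "r \<in> carrier CR"
proof (rule CR_I)
  fix n
  obtain M where M: "\<forall>i\<ge>M. \<forall>j\<ge>M. f \<otimes> r i \<ominus> f \<otimes> r j \<in> I (Suc n)"
    using CR_D[OF assms(2)] by meson
  have "r i \<ominus> r j \<in> I n" if "i \<ge> M" "j \<ge> M" for i j
  proof -
    have "f \<otimes> r i \<ominus> f \<otimes> r j = f \<otimes> (r i \<ominus> r j)" using assms(1) f_carr by algebra
    then show ?thesis using M that f_shift assms(1) by (metis minus_closed)
  qed
  then show "\<exists>M. \<forall>i\<ge>M. \<forall>j\<ge>M. r i \<ominus> r j \<in> I n" by blast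
qed (use assms in auto)

text \<open>Terms divisible by f up to ever smaller errors give a class divisible by f: the errors
  form a null sequence, and \<open>f_shift\<close> makes the quotients Cauchy.\<close>

lemma fh_divides:
  assumes s: "s \<in> carrier CR" and J: "\<And>k. \<exists>M. \<forall>i\<ge>M. s i \<in> J k"
  obtains r where "r \<in> carrier CR" "cls s = fh \<otimes>\<^bsub>Rh\<^esub> cls r"
proof -
  \<comment> \<open>The cap \<open>k \<le> i\<close> keeps the maximum finite when
    \<open>s i\<close> lies in every \<open>J k\<close>; \<open>J_0\<close> provides the candidate
    0.\<close>
  define k where "k i = (GREATEST k. k \<le> i \<and> s i \<in> J k)" for i
  have k: "k i \<le> i \<and> s i \<in> J (k i)" for i
    unfolding k_def by (rule GreatestI_nat[of _ 0 i]) (use s in \<open>auto simp: J_0 CR_carr\<close>)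
  have k_ge: "\<exists>M. \<forall>i\<ge>M. a \<le> k i" for a
  proof -
    obtain M where M: "\<forall>i\<ge>M. s i \<in> J a" using J by meson
    have "a \<le> k i" if "i \<ge> max M a" for i
      unfolding k_def by (rule Greatest_le_nat[of _ _ i]) (use M that in auto)
    then show ?thesis by blast
  qed
  have "\<forall>i. \<exists>r e. r \<in> carrier R \<and> e \<in> I (k i) \<and> s i = f \<otimes> r \<oplus> e"
    using k unfolding J_iff by blast
  then obtain r e where re: "\<And>i. r i \<in> carrier R" "\<And>i. e i \<in> I (k i)" "\<And>i. s i = f \<otimes> r i \<oplus> e i"
    by metis
  have e: "\<exists>M. \<forall>i\<ge>M. e i \<in> I n" for n using k_ge re(2) I_mono by (meson subsetD)
  have ec: "e i \<in> carrier R" for i using re I_carr by blast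
  have eN: "e \<in> NS" unfolding NS_iff using e ec by blast
  then have eC: "e \<in> carrier CR" by (simp add: null_seqs_def)
  have "f \<otimes> r i = s i \<oplus> \<ominus> e i" for i
    unfolding re(3) using re(1) ec f_carr by algebra
  then have fr: "(\<lambda>i. f \<otimes> r i) \<in> carrier CR"
    using CR_add[OF s CR_uminus[OF eC]] by simp
  then have r: "r \<in> carrier CR" using CR_f_cancel re(1) by blast
  have "s i \<ominus> f \<otimes> r i = e i" for i unfolding re(3) using re(1) ec f_carr by algebra
  then have "cls s = cls (\<lambda>i. f \<otimes> r i)" using cls_eq[OF s fr] e by simp
  then show ?thesis using that r cls_f_mult by metis
qed

lemma fh_divides_J:
  assumes s: "s \<in> carrier CR" and d: "cls s \<in> pw Rh fh (Suc 0)"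
  shows "\<exists>M. \<forall>i\<ge>M. s i \<in> J k"
proof -
  interpret C: cring Rh by (rule Rh_cring)
  obtain z where z: "z \<in> carrier CR" "cls s = fh \<otimes>\<^bsub>Rh\<^esub> cls z"
    using d fh_carr by (auto simp: pw_def elim!: RhE)
  have fz: "(\<lambda>i. f \<otimes> z i) \<in> carrier CR" using CR_mult[OF CR_const[OF f_carr] z(1)] .
  have "cls s = cls (\<lambda>i. f \<otimes> z i)" using z by (simp add: cls_f_mult)
  then obtain M where M: "\<forall>i\<ge>M. s i \<ominus> f \<otimes> z i \<in> I k" using cls_eq[OF s fz] by meson
  have "s i \<in> J k" if "i \<ge> M" for i
  proof -
    have "s i = f \<otimes> z i \<oplus> (s i \<ominus> f \<otimes> z i)"
      using CR_carr[OF s] CR_carr[OF z(1)] f_carr by algebra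
    then show ?thesis unfolding J_iff using M that CR_carr[OF z(1)] by blast
  qed
  then show ?thesis by blast
qed

text \<open>A Cauchy sequence with terms outside \<open>J k\<close> at arbitrarily late places is
  eventually outside, because \<open>J k\<close> is stable under adding elements of
  \<open>I k\<close>. Such a \<open>k\<close> exists by \<open>fh_divides\<close>.\<close>

lemma not_J_eventually:
  assumes s: "s \<in> carrier CR" and nd: "cls s \<notin> pw Rh fh (Suc 0)"
  obtains k M where "\<And>i. i \<ge> M \<Longrightarrow> s i \<notin> J k"
proof -
  interpret C: cring Rh by (rule Rh_cring)
  have "\<not> (\<forall>k. \<exists>M. \<forall>i\<ge>M. s i \<in> J k)"
  proof
    assume "\<forall>k. \<exists>M. \<forall>i\<ge>M. s i \<in> J k"
    then obtain r where "r \<in> carrier CR" "cls s = fh \<otimes>\<^bsub>Rh\<^esub> cls r" using fh_divides[OF s] by blast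
    then show False using nd fh_carr by (auto simp: pw_def cls_carr)
  qed
  then obtain k where k: "\<And>M. \<exists>i\<ge>M. s i \<notin> J k" by meson
  obtain M where M: "\<forall>i\<ge>M. \<forall>j\<ge>M. s i \<ominus> s j \<in> I k" using CR_D[OF s] by meson
  have "s i \<notin> J k" if i: "i \<ge> M" for i
  proof
    assume a: "s i \<in> J k"
    obtain j where j: "j \<ge> M" "s j \<notin> J k" using k by meson
    have "s j = s i \<oplus> (s j \<ominus> s i)" using CR_carr[OF s] by algebra
    then show False using J_add_I[OF a] M i j by metis
  qed
  then show ?thesis using that by blast
qed

text \<open>Primality in the completion is \<open>f_prime\<close> for late terms of two sequences
  that stay outside \<open>J k\<close> and \<open>J l\<close>. The domain property follows from
  primality: strip all powers of f from both factors and cancel them, f being a nonzerodivisor by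
  \<open>f_shift\<close>.\<close>

lemma completion_prime_elt: "prime_elt Rh fh"
proof -
  interpret C: cring Rh by (rule Rh_cring)
  have nzd: "y = \<zero>\<^bsub>Rh\<^esub>" if y: "y \<in> carrier Rh" "fh \<otimes>\<^bsub>Rh\<^esub> y = \<zero>\<^bsub>Rh\<^esub>" for y
  proof -
    obtain s where s: "s \<in> carrier CR" "y = cls s" using y by (auto elim: RhE)
    have fs: "(\<lambda>i. f \<otimes> s i) \<in> carrier CR" using CR_mult[OF CR_const[OF f_carr] s(1)] .
    have "\<forall>n. \<exists>M. \<forall>i\<ge>M. f \<otimes> s i \<in> I n" using y s cls_zero_iff[OF fs] by (simp add: cls_f_mult)
    then have "\<forall>n. \<exists>M. \<forall>i\<ge>M. s i \<in> I n" using f_shift CR_carr[OF s(1)] by meson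
    then show ?thesis using s cls_zero_iff by simp
  qed
  \<comment> \<open>By \<open>f_pow\<close>, divisibility by the n-th power of f puts the late terms
    into \<open>I n\<close>, for every n.\<close>
  have sep: "y = \<zero>\<^bsub>Rh\<^esub>" if y: "y \<in> carrier Rh" "\<And>n. y \<in> pw Rh fh n" for y
  proof -
    obtain s where s: "s \<in> carrier CR" "y = cls s" using y by (auto elim: RhE)
    have "\<exists>M. \<forall>i\<ge>M. s i \<in> I n" for n
    proof -
      obtain z where z: "z \<in> carrier CR" "cls s = cls (\<lambda>i. f [^] n \<otimes> z i)"
        using y(2)[of n] s fh_pow_mult by (auto simp: pw_def elim!: RhE)
      have fz: "(\<lambda>i. f [^] n \<otimes> z i) \<in> carrier CR"
        using CR_mult[OF CR_const z(1)] f_carr by simp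
      obtain M where M: "\<forall>i\<ge>M. s i \<ominus> f [^] n \<otimes> z i \<in> I n" using z cls_eq[OF s(1) fz] by meson
      have "s i \<in> I n" if "i \<ge> M" for i
      proof -
        have fn: "f [^] n \<in> carrier R" using f_carr by simp
        have "s i = (s i \<ominus> f [^] n \<otimes> z i) \<oplus> f [^] n \<otimes> z i"
          using CR_carr[OF s(1)] CR_carr[OF z(1)] fn by algebra
        then show ?thesis using M that I_add f_pow CR_carr[OF z(1)] by metis
      qed
      then show ?thesis by blast
    qed
    then show ?thesis using s cls_zero_iff by simp
  qed
  have nu: "\<one>\<^bsub>Rh\<^esub> \<notin> pw Rh fh (Suc 0)"
    using fh_divides_J[of "\<lambda>_. \<one>" "Suc 0"] f_nu by (auto simp: cls_one CR_const)
  have prime: "a \<in> pw Rh fh (Suc 0) \<or> b \<in> pw Rh fh (Suc 0)"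
    if ab: "a \<in> carrier Rh" "b \<in> carrier Rh" "a \<otimes>\<^bsub>Rh\<^esub> b \<in> pw Rh fh (Suc 0)" for a b
  proof (rule ccontr)
    assume n: "\<not> (a \<in> pw Rh fh (Suc 0) \<or> b \<in> pw Rh fh (Suc 0))"
    obtain s where s: "s \<in> carrier CR" "a = cls s" using ab by (auto elim: RhE)
    obtain t where t: "t \<in> carrier CR" "b = cls t" using ab by (auto elim: RhE)
    obtain k M where k: "\<And>i. i \<ge> M \<Longrightarrow> s i \<notin> J k" using not_J_eventually[OF s(1)] n s by metis
    obtain l N where l: "\<And>i. i \<ge> N \<Longrightarrow> t i \<notin> J l" using not_J_eventually[OF t(1)] n t by metis
    have "cls (\<lambda>i. s i \<otimes> t i) \<in> pw Rh fh (Suc 0)" using ab s t by (simp add: cls_mult)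
    then obtain M' where M': "\<forall>i\<ge>M'. s i \<otimes> t i \<in> J (k + l)"
      using fh_divides_J[OF CR_mult[OF s(1) t(1)]] by meson
    define i where "i = max M (max N M')"
    show False using f_prime[OF CR_carr[OF s(1)] CR_carr[OF t(1)], of i k i l] k[of i] l[of i] M'
      by (auto simp: i_def)
  qed
  have fh_nz: "fh \<noteq> \<zero>\<^bsub>Rh\<^esub>"
  proof
    assume "fh = \<zero>\<^bsub>Rh\<^esub>"
    then have "f \<otimes> \<one> \<in> I (Suc (Suc 0))" using cls_zero_iff[OF CR_const[OF f_carr]] f_carr by auto
    then have "\<one> \<in> I (Suc 0)" using f_shift by blast
    then have "f \<otimes> \<zero> \<oplus> \<one> \<in> J (Suc 0)" unfolding J_iff by blast
    then show False using f_nu f_carr by simp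
  qed
  have nzd_pow: "y = \<zero>\<^bsub>Rh\<^esub>" if "fh [^]\<^bsub>Rh\<^esub> (n::nat) \<otimes>\<^bsub>Rh\<^esub> y = \<zero>\<^bsub>Rh\<^esub>" "y \<in> carrier Rh" for y n
    using that
  proof (induction n)
    case (Suc n)
    have "fh [^]\<^bsub>Rh\<^esub> Suc n \<otimes>\<^bsub>Rh\<^esub> y = fh \<otimes>\<^bsub>Rh\<^esub> (fh [^]\<^bsub>Rh\<^esub> n \<otimes>\<^bsub>Rh\<^esub> y)"
      using Suc.prems(2) fh_carr by (simp add: C.m_ac)
    then have "fh [^]\<^bsub>Rh\<^esub> n \<otimes>\<^bsub>Rh\<^esub> y = \<zero>\<^bsub>Rh\<^esub>"
      using Suc.prems fh_carr nzd[of "fh [^]\<^bsub>Rh\<^esub> n \<otimes>\<^bsub>Rh\<^esub> y"] by simp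
    then show ?case using Suc.IH Suc.prems(2) by blast
  qed simp
  have factor: "\<exists>n b. b \<in> carrier Rh \<and> b \<notin> pw Rh fh (Suc 0) \<and> a = fh [^]\<^bsub>Rh\<^esub> (n::nat) \<otimes>\<^bsub>Rh\<^esub> b"
    if a: "a \<in> carrier Rh" "a \<noteq> \<zero>\<^bsub>Rh\<^esub>" for a
  proof -
    obtain n where "a \<notin> pw Rh fh n" using sep a by metis
    then obtain m where m: "a \<in> pw Rh fh m" "a \<notin> pw Rh fh (Suc m)"
      using a C.pw_0 by (induction n) auto
    then obtain b where b: "b \<in> carrier Rh" "a = fh [^]\<^bsub>Rh\<^esub> m \<otimes>\<^bsub>Rh\<^esub> b" by (auto simp: pw_def)
    have "b \<notin> pw Rh fh (Suc 0)" using m(2) C.pw_add[OF fh_carr, of b "Suc 0" m] unfolding b(2) by auto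
    then show ?thesis using b by blast
  qed
  show ?thesis
  proof unfold_locales
    show "\<one>\<^bsub>Rh\<^esub> \<noteq> \<zero>\<^bsub>Rh\<^esub>"
    proof
      assume "\<one>\<^bsub>Rh\<^esub> = \<zero>\<^bsub>Rh\<^esub>"
      then have "fh = \<zero>\<^bsub>Rh\<^esub>" using C.l_one[OF fh_carr] C.l_null[OF fh_carr] by simp
      then show False using fh_nz by simp
    qed
    fix a b assume ab: "a \<otimes>\<^bsub>Rh\<^esub> b = \<zero>\<^bsub>Rh\<^esub>" "a \<in> carrier Rh" "b \<in> carrier Rh"
    show "a = \<zero>\<^bsub>Rh\<^esub> \<or> b = \<zero>\<^bsub>Rh\<^esub>"
    proof (rule ccontr)
      assume "\<not> ?thesis"
      then obtain n a' m b' where a': "a' \<in> carrier Rh" "a' \<notin> pw Rh fh (Suc 0)"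
          "a = fh [^]\<^bsub>Rh\<^esub> (n::nat) \<otimes>\<^bsub>Rh\<^esub> a'"
        and b': "b' \<in> carrier Rh" "b' \<notin> pw Rh fh (Suc 0)" "b = fh [^]\<^bsub>Rh\<^esub> (m::nat) \<otimes>\<^bsub>Rh\<^esub> b'"
        using factor ab by meson
      have "fh [^]\<^bsub>Rh\<^esub> (n + m) \<otimes>\<^bsub>Rh\<^esub> (a' \<otimes>\<^bsub>Rh\<^esub> b') = \<zero>\<^bsub>Rh\<^esub>"
        unfolding C.nat_pow_mult[OF fh_carr, symmetric] ab(1)[symmetric] a'(3) b'(3)
        using a'(1) b'(1) fh_carr by (simp add: C.m_ac)
      then have "a' \<otimes>\<^bsub>Rh\<^esub> b' = \<zero>\<^bsub>Rh\<^esub>"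
        by (rule nzd_pow) (use a'(1) b'(1) in simp)
      moreover have "\<zero>\<^bsub>Rh\<^esub> \<in> pw Rh fh (Suc 0)" using fh_carr by (rule C.pw_zero)
      ultimately show False using prime[OF a'(1) b'(1)] a'(2) b'(2) by metis
    qed
  qed (use fh_carr fh_nz nu prime sep in auto)
qed

lemma cls_in_pw:
  assumes "s \<in> carrier CR" "\<exists>M. \<forall>i\<ge>M. s i \<in> pw R f n"
  shows "cls s \<in> pw Rh fh n"
  using assms
proof (induction n arbitrary: s)
  case 0
  interpret C: cring Rh by (rule Rh_cring)
  show ?case using 0 by (simp add: C.pw_0 cls_carr)
next
  case (Suc n)
  interpret C: cring Rh by (rule Rh_cring)
  obtain M where M: "\<forall>i\<ge>M. s i \<in> pw R f (Suc n)" using Suc.prems by blast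
  have "\<forall>i. \<exists>r. r \<in> pw R f n \<and> r \<in> carrier R \<and> (i \<ge> M \<longrightarrow> s i = f \<otimes> r)"
  proof
    fix i
    \<comment> \<open>Below the index \<open>M\<close> nothing is known about \<open>s i\<close>,
      and 0 serves as a dummy quotient there.\<close>
    have "\<zero> \<in> pw R f n" using f_carr by (rule pw_zero)
    then show "\<exists>r. r \<in> pw R f n \<and> r \<in> carrier R \<and> (i \<ge> M \<longrightarrow> s i = f \<otimes> r)"
      using M pw_SucE[OF f_carr, of "s i" n] by (cases "i \<ge> M") auto
  qed
  then obtain r where r: "\<And>i. r i \<in> pw R f n" "\<And>i. r i \<in> carrier R" "\<And>i. i \<ge> M \<Longrightarrow> s i = f \<otimes> r i"
    by metis
  have fr: "(\<lambda>i. f \<otimes> r i) \<in> carrier CR"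
  proof (rule CR_I)
    show "f \<otimes> r i \<in> carrier R" for i using r f_carr by simp
    fix n obtain M' where "\<forall>i\<ge>M'. \<forall>j\<ge>M'. s i \<ominus> s j \<in> I n"
      using CR_D[OF Suc.prems(1)] by meson
    then show "\<exists>M. \<forall>i\<ge>M. \<forall>j\<ge>M. f \<otimes> r i \<ominus> f \<otimes> r j \<in> I n"
      using r(3)[symmetric] by (intro exI[of _ "max M M'"]) simp
  qed
  then have rC: "r \<in> carrier CR" using CR_f_cancel r by blast
  have "s i \<ominus> f \<otimes> r i = \<zero>" if "i \<ge> M" for i
    using r that f_carr by (simp add: a_minus_def r_neg)
  then have "cls s = cls (\<lambda>i. f \<otimes> r i)" using cls_eq[OF Suc.prems(1) fr] I_zero by metis
  also have "\<dots> = fh \<otimes>\<^bsub>Rh\<^esub> cls r" using rC by (simp add: cls_f_mult)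
  also have "\<dots> \<in> pw Rh fh (Suc n)" using Suc.IH[OF rC] r C.pw_Suc[OF fh_carr] by blast
  finally show ?case .
qed

lemma cls_pw_D:
  assumes s: "s \<in> carrier CR" and d: "cls s \<in> pw Rh fh n"
  shows "\<exists>M. \<forall>i\<ge>M. \<exists>r\<in>carrier R. s i \<ominus> f [^] n \<otimes> r \<in> I k"
proof -
  obtain z where z: "z \<in> carrier CR" "cls s = cls (\<lambda>i. f [^] n \<otimes> z i)"
    using d fh_pow_mult by (auto simp: pw_def elim!: RhE)
  have fz: "(\<lambda>i. f [^] n \<otimes> z i) \<in> carrier CR"
    using CR_mult[OF CR_const z(1)] f_carr by simp
  obtain M where "\<forall>i\<ge>M. s i \<ominus> f [^] n \<otimes> z i \<in> I k" using z cls_eq[OF s(1) fz] by meson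
  then show ?thesis using CR_carr[OF z(1)] by blast
qed

end

context prime_elt
begin

lemma pw_mono: "m \<le> n \<Longrightarrow> pw R x n \<subseteq> pw R x m"
  using pw_decr[OF x_carr] by (metis lift_Suc_antimono_le)

text \<open>Here (x) absorbs all positive levels of the filtration, so the set
  \<open>J (Suc k)\<close> of \<open>flag_ring\<close> is (x), while \<open>J 0\<close> is the whole
  ring. Elements outside \<open>J m\<close> and \<open>J n\<close> thus have m and n positive, and
  \<open>f_prime\<close> reduces to the primality of x.\<close>

lemma pw_flag_ring: "flag_ring R (ideal_power R (PIdl x)) x"
proof -
  have eq: "ideal_power R (PIdl x) = pw R x" using ideal_power_pw[OF x_carr] by auto
  have J: "set_add R (pw R x (Suc 0)) (pw R x (Suc k)) = pw R x (Suc 0)" for k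
  proof -
    interpret P: ideal "pw R x (Suc 0)" R by (rule pw_ideal[OF x_carr])
    have sub: "pw R x (Suc k) \<subseteq> pw R x (Suc 0)" by (rule pw_mono) simp
    show ?thesis
    proof
      show "set_add R (pw R x (Suc 0)) (pw R x (Suc k)) \<subseteq> pw R x (Suc 0)"
        using sub P.a_closed by (auto simp: set_add_def set_mult_def)
      show "pw R x (Suc 0) \<subseteq> set_add R (pw R x (Suc 0)) (pw R x (Suc k))"
      proof
        fix a assume a: "a \<in> pw R x (Suc 0)"
        show "a \<in> set_add R (pw R x (Suc 0)) (pw R x (Suc k))"
          using set_addI[OF a zero_pw, of "Suc k"] pw_carr[OF x_carr a] by simp
      qed
    qed
  qed
  have J0: "a \<in> set_add R (pw R x (Suc 0)) (pw R x 0)" if a: "a \<in> carrier R" for a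
  proof -
    show ?thesis using set_addI[OF zero_pw, of a "pw R x 0" "Suc 0"] a by (simp add: pw_0)
  qed
  have prime: "a \<otimes> b \<notin> set_add R (pw R x (Suc 0)) (pw R x (m + n))"
    if ab: "a \<in> carrier R" "b \<in> carrier R" "a \<notin> set_add R (pw R x (Suc 0)) (pw R x m)"
      "b \<notin> set_add R (pw R x (Suc 0)) (pw R x n)" for a b m n
  proof -
    obtain m' where m: "m = Suc m'" using J0[OF ab(1)] ab(3) by (cases m) auto
    obtain n' where n: "n = Suc n'" using J0[OF ab(2)] ab(4) by (cases n) auto
    show ?thesis using ab(3,4) x_prime[OF ab(1,2)] unfolding m n J add_Suc by fast
  qed
  show ?thesis unfolding eq
  proof (intro flag_ring.intro filtered_ring.intro filtered_ring_axioms.intro flag_ring_axioms.intro)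
    show "cring R" by (rule cring_axioms)
    show "ideal (pw R x n) R" for n by (rule pw_ideal[OF x_carr])
    show "pw R x (Suc n) \<subseteq> pw R x n" for n by (rule pw_decr[OF x_carr])
    show "x \<in> carrier R" by (rule x_carr)
    show "pw R x 0 = carrier R" by (rule pw_0)
    show "r \<in> pw R x k" if "r \<in> carrier R" "x \<otimes> r \<in> pw R x (Suc k)" for r k
      using that by (rule pw_x_cancel)
    show "x [^] n \<otimes> r \<in> pw R x n" if "r \<in> carrier R" for r n using that by (rule pw_I)
    show "\<one> \<notin> set_add R (pw R x (Suc 0)) (pw R x (Suc 0))" unfolding J by (rule x_nu)
  qed (rule prime)
qed

end

section \<open>The field attached to a curve and a point\<close>

text \<open>Primality of f in the completed local ring is the only input: the chain of sublocales
  below makes every ring in the construction of K_q,C a domain in which f-orders are under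
  control.\<close>

locale flag_pt =
  fixes q :: "'a::field poly3 set" and f :: "'a poly3 fract"
  assumes hat_prime_elt: "prime_elt (hat_stalk q) (to_hat q f)"

sublocale flag_pt \<subseteq> H: prime_elt "hat_stalk q" "to_hat q f"
  by (rule hat_prime_elt)

context flag_pt
begin

abbreviation "H \<equiv> hat_stalk q"
abbreviation "x \<equiv> to_hat q f"
abbreviation "A \<equiv> loc_hat q f"
abbreviation "xA \<equiv> to_loc_hat q f (to_hat q f)"
abbreviation "E \<equiv> int_ring q f"
abbreviation "xE \<equiv> int_ring_eq q f"
abbreviation "K \<equiv> K_flag q f"
abbreviation "filt \<equiv> K_flag_filt q f"
abbreviation "\<eta> \<equiv> hat_to_K_flag q f"

lemma denoms: "loc_hat_denoms q f = carrier H - pw H x (Suc 0)"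
  using H.pw_1[OF H.x_carr] by (simp add: loc_hat_denoms_def H.minimal_primes_x)

lemma A_eq: "A = localization H (carrier H - pw H x (Suc 0))"
  by (simp add: loc_hat_def denoms)

lemma to_A_eq: "to_loc_hat q f a = loc_frac H (carrier H - pw H x (Suc 0)) a \<one>\<^bsub>H\<^esub>"
  by (simp add: to_loc_hat_def denoms)

lemma A_prime_elt: "prime_elt A xA"
  unfolding A_eq to_A_eq by (rule H.localization_prime_elt)

end

sublocale flag_pt \<subseteq> A: prime_elt "loc_hat q f" "to_loc_hat q f (to_hat q f)"
  by (rule A_prime_elt)

sublocale flag_pt \<subseteq> AF: flag_ring "loc_hat q f" "int_ring_filt q f" "to_loc_hat q f (to_hat q f)"
  unfolding int_ring_filt_def by (rule A.pw_flag_ring)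

context flag_pt
begin

lemma int_ring_filt_eq: "int_ring_filt q f n = pw A xA n"
  unfolding int_ring_filt_def by (rule A.ideal_power_pw[OF A.x_carr])

lemma E_prime_elt: "prime_elt E xE"
  unfolding int_ring_def int_ring_eq_def to_int_ring_def by (rule AF.completion_prime_elt)

end

sublocale flag_pt \<subseteq> E: prime_elt "int_ring q f" "int_ring_eq q f"
  by (rule E_prime_elt)

context flag_pt
begin

lemma E_pow_nz: "xE [^]\<^bsub>E\<^esub> (n::nat) \<noteq> \<zero>\<^bsub>E\<^esub>"
proof (induction n)
  case (Suc n) then show ?case using E.integral[OF _ E.nat_pow_closed[OF E.x_carr] E.x_carr] E.x_nz by auto
qed simp

lemma K_mult_subset: "mult_subset E (powers E xE)"
proof (intro mult_subset.intro mult_subset_axioms.intro)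
  show "domain E" by (rule E.domain_axioms)
  show "s \<in> carrier E" if "s \<in> powers E xE" for s using that E.x_carr by (auto simp: powers_def)
  show "\<one>\<^bsub>E\<^esub> \<in> powers E xE" unfolding powers_def by (rule range_eqI[of _ _ "0::nat"]) simp
  show "s \<otimes>\<^bsub>E\<^esub> t \<in> powers E xE" if "s \<in> powers E xE" "t \<in> powers E xE" for s t
    using that E.x_carr E.nat_pow_mult by (auto simp: powers_def)
  show "\<zero>\<^bsub>E\<^esub> \<notin> powers E xE" using E_pow_nz unfolding powers_def by auto
qed

end

sublocale flag_pt \<subseteq> KL: mult_subset "int_ring q f" "powers (int_ring q f) (int_ring_eq q f)"
  by (rule K_mult_subset)

context flag_pt
begin

lemma K_eq: "K = KL.RS"
  by (simp add: K_flag_def)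

lemma K_frac_eq: "K_flag_frac q f = KL.fr"
  by (simp add: K_flag_frac_def fun_eq_iff)

lemma K_domain: "domain K"
  unfolding K_eq by (rule KL.RS_domain)

end

sublocale flag_pt \<subseteq> K: domain "K_flag q f"
  by (rule K_domain)

context flag_pt
begin

text \<open>Together with \<open>\<eta>\<close> these are the canonical maps to K_q,C from the
  f-adic completion, from the localization and from the completed local ring; \<open>X\<close> is
  the image of the local equation.\<close>

definition "\<eta>E e = K_flag_frac q f e \<one>\<^bsub>E\<^esub>"
definition "\<eta>A y = \<eta>E (AF.cls (\<lambda>_. y))"
definition "X = \<eta> x"

lemma \<eta>E_hom: "\<eta>E \<in> ring_hom E K"
  using KL.fr_hom unfolding \<eta>E_def[abs_def] K_frac_eq K_eq .

lemmas \<eta>E_simps = ring_hom_closed[OF \<eta>E_hom] ring_hom_mult[OF \<eta>E_hom] ring_hom_add[OF \<eta>E_hom] ring_hom_one[OF \<eta>E_hom]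

lemma \<eta>E_inj: "e \<in> carrier E \<Longrightarrow> e' \<in> carrier E \<Longrightarrow> \<eta>E e = \<eta>E e' \<longleftrightarrow> e = e'"
  unfolding \<eta>E_def K_frac_eq by (rule KL.fr_inj)

lemma AF_const_hom: "(\<lambda>y. AF.cls (\<lambda>_. y)) \<in> ring_hom A E"
  unfolding int_ring_def
  by (rule ring_hom_memI) (simp_all add: AF.cls_carr AF.CR_const AF.cls_mult AF.cls_add AF.cls_one)

lemma \<eta>A_hom: "\<eta>A \<in> ring_hom A K"
  using ring_hom_trans[OF AF_const_hom \<eta>E_hom] by (simp add: \<eta>A_def[abs_def] comp_def)

lemmas \<eta>A_simps = ring_hom_closed[OF \<eta>A_hom] ring_hom_mult[OF \<eta>A_hom] ring_hom_add[OF \<eta>A_hom] ring_hom_one[OF \<eta>A_hom]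

lemma \<eta>_eq: "\<eta> a = \<eta>A (to_loc_hat q f a)"
  by (simp add: hat_to_K_flag_def \<eta>A_def \<eta>E_def to_int_ring_def)

lemma \<eta>_hom: "\<eta> \<in> ring_hom H K"
proof -
  have "to_loc_hat q f \<in> ring_hom H A"
    unfolding A_eq to_A_eq[abs_def] by (rule H.L.fr_hom)
  from ring_hom_trans[OF this \<eta>A_hom] show ?thesis by (simp add: \<eta>_eq[abs_def] comp_def)
qed

lemmas \<eta>_simps = ring_hom_closed[OF \<eta>_hom] ring_hom_mult[OF \<eta>_hom] ring_hom_add[OF \<eta>_hom] ring_hom_one[OF \<eta>_hom]

lemma \<eta>_zero: "\<eta> \<zero>\<^bsub>H\<^esub> = \<zero>\<^bsub>K\<^esub>"
  using \<eta>_simps(3)[of "\<zero>\<^bsub>H\<^esub>" "\<zero>\<^bsub>H\<^esub>"] \<eta>_simps(1)[of "\<zero>\<^bsub>H\<^esub>"] K.add.l_cancel_one by simp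

lemma \<eta>_uminus: "a \<in> carrier H \<Longrightarrow> \<eta> (\<ominus>\<^bsub>H\<^esub> a) = \<ominus>\<^bsub>K\<^esub> \<eta> a"
  by (rule K.minus_equality[symmetric]) (simp_all add: \<eta>_simps \<eta>_zero H.l_neg flip: \<eta>_simps(3))

lemma \<eta>_minus: "a \<in> carrier H \<Longrightarrow> b \<in> carrier H \<Longrightarrow> \<eta> (a \<ominus>\<^bsub>H\<^esub> b) = \<eta> a \<ominus>\<^bsub>K\<^esub> \<eta> b"
  by (simp add: a_minus_def \<eta>_simps \<eta>_uminus)

lemma \<eta>_pow: "a \<in> carrier H \<Longrightarrow> \<eta> (a [^]\<^bsub>H\<^esub> (n::nat)) = \<eta> a [^]\<^bsub>K\<^esub> n"
  by (induction n) (simp_all add: \<eta>_simps)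

lemma X_carr: "X \<in> carrier K" unfolding X_def by (simp add: \<eta>_simps H.x_carr)

lemma X_eq: "X = \<eta>E xE"
  unfolding X_def \<eta>_eq \<eta>A_def int_ring_eq_def to_int_ring_def ..

lemma \<eta>E_pow: "e \<in> carrier E \<Longrightarrow> \<eta>E (e [^]\<^bsub>E\<^esub> (n::nat)) = \<eta>E e [^]\<^bsub>K\<^esub> n"
  by (induction n) (simp_all add: \<eta>E_simps)

lemma X_pow: "X [^]\<^bsub>K\<^esub> (n::nat) = \<eta>E (xE [^]\<^bsub>E\<^esub> n)"
  unfolding X_eq by (rule \<eta>E_pow[OF E.x_carr, symmetric])

lemma X_unit: "X \<in> Units K"
proof -
  have x: "xE \<in> powers E xE" unfolding powers_def using E.x_carr by (intro range_eqI[of _ _ "1::nat"]) simp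
  have "X \<otimes>\<^bsub>K\<^esub> KL.fr \<one>\<^bsub>E\<^esub> xE = \<one>\<^bsub>K\<^esub>"
    unfolding X_eq \<eta>E_def K_frac_eq K_eq using x KL.S_one by (rule KL.fr_inverse)
  moreover have "KL.fr \<one>\<^bsub>E\<^esub> xE \<in> carrier K" unfolding K_eq using x by (simp add: KL.fr_carr)
  ultimately show ?thesis using X_carr K.m_comm unfolding Units_def by fastforce
qed

lemma X_pow_unit: "X [^]\<^bsub>K\<^esub> (n::nat) \<in> Units K"
  using X_unit by (induction n) (simp_all add: K.Units_m_closed)

lemma X_pow_nz: "X [^]\<^bsub>K\<^esub> (n::nat) \<noteq> \<zero>\<^bsub>K\<^esub>"
  using X_pow_unit by (metis K.Units_r_inv K.l_null K.one_not_zero K.Units_inv_closed)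

lemma KE:
  assumes "z \<in> carrier K"
  obtains e n where "e \<in> carrier E" "X [^]\<^bsub>K\<^esub> (n::nat) \<otimes>\<^bsub>K\<^esub> z = \<eta>E e"
proof -
  obtain e s where e: "e \<in> carrier E" "s \<in> powers E xE" "z = KL.fr e s"
    using assms unfolding K_eq by (rule KL.RSE)
  obtain n where n: "s = xE [^]\<^bsub>E\<^esub> (n::nat)" using e(2) by (auto simp: powers_def)
  have c: "s \<in> carrier E" by (rule KL.S_carr[OF e(2)])
  have "X [^]\<^bsub>K\<^esub> n \<otimes>\<^bsub>K\<^esub> z = \<eta>E s \<otimes>\<^bsub>K\<^esub> z" by (simp add: X_pow n)
  also have "\<dots> = KL.fr (s \<otimes>\<^bsub>E\<^esub> e) (\<one>\<^bsub>E\<^esub> \<otimes>\<^bsub>E\<^esub> s)"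
    unfolding \<eta>E_def K_frac_eq K_eq e(3) by (rule KL.fr_mult[OF c KL.S_one e(1,2)])
  also have "\<dots> = \<eta>E e" unfolding \<eta>E_def K_frac_eq
    using c e KL.S_one by (subst KL.fr_eq) (auto simp: KL.S_mult E.m_comm)
  finally show ?thesis using that e(1) by blast
qed

subsection \<open>The filtration\<close>

lemma filt_eq: "filt n = \<eta>E ` pw E xE n"
  unfolding K_flag_filt_def E.ideal_power_pw[OF E.x_carr] \<eta>E_def ..

lemma \<eta>E_filt: "e \<in> carrier E \<Longrightarrow> \<eta>E e \<in> filt n \<longleftrightarrow> e \<in> pw E xE n"
  unfolding filt_eq using \<eta>E_inj E.pw_carr[OF E.x_carr] by (auto simp: image_iff)

lemma filtE: assumes "z \<in> filt n" obtains e where "e \<in> carrier E" "z = X [^]\<^bsub>K\<^esub> n \<otimes>\<^bsub>K\<^esub> \<eta>E e"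
  using assms E.x_carr unfolding filt_eq X_pow by (auto elim!: E.pw_E simp: \<eta>E_simps)

lemma filtI: "e \<in> carrier E \<Longrightarrow> X [^]\<^bsub>K\<^esub> n \<otimes>\<^bsub>K\<^esub> \<eta>E e \<in> filt n"
  unfolding filt_eq X_pow using E.x_carr by (intro image_eqI[OF _ E.pw_I]) (auto simp: \<eta>E_simps)

lemma filt_add: assumes "z \<in> filt n" "w \<in> filt n" shows "z \<oplus>\<^bsub>K\<^esub> w \<in> filt n"
proof -
  obtain d where d: "d \<in> carrier E" "z = X [^]\<^bsub>K\<^esub> n \<otimes>\<^bsub>K\<^esub> \<eta>E d" using assms(1) by (rule filtE)
  obtain e where e: "e \<in> carrier E" "w = X [^]\<^bsub>K\<^esub> n \<otimes>\<^bsub>K\<^esub> \<eta>E e" using assms(2) by (rule filtE)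
  have "z \<oplus>\<^bsub>K\<^esub> w = X [^]\<^bsub>K\<^esub> n \<otimes>\<^bsub>K\<^esub> \<eta>E (d \<oplus>\<^bsub>E\<^esub> e)"
    unfolding d(2) e(2) using d(1) e(1) X_carr by (simp add: \<eta>E_simps K.r_distr)
  then show ?thesis using filtI[of "d \<oplus>\<^bsub>E\<^esub> e" n] d(1) e(1) by simp
qed

lemma filt_mult: assumes "z \<in> filt m" "w \<in> filt n" shows "z \<otimes>\<^bsub>K\<^esub> w \<in> filt (m + n)"
proof -
  obtain d where d: "d \<in> carrier E" "z = X [^]\<^bsub>K\<^esub> m \<otimes>\<^bsub>K\<^esub> \<eta>E d" using assms(1) by (rule filtE)
  obtain e where e: "e \<in> carrier E" "w = X [^]\<^bsub>K\<^esub> n \<otimes>\<^bsub>K\<^esub> \<eta>E e" using assms(2) by (rule filtE)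
  have "z \<otimes>\<^bsub>K\<^esub> w = X [^]\<^bsub>K\<^esub> (m + n) \<otimes>\<^bsub>K\<^esub> \<eta>E (d \<otimes>\<^bsub>E\<^esub> e)"
    unfolding d(2) e(2) K.nat_pow_mult[OF X_carr, symmetric]
    using d(1) e(1) X_carr by (simp add: \<eta>E_simps K.m_ac)
  then show ?thesis using filtI[of "d \<otimes>\<^bsub>E\<^esub> e" "m + n"] d(1) e(1) by simp
qed

lemma filt_zero: "\<zero>\<^bsub>K\<^esub> \<in> filt n"
proof -
  have "\<eta>E \<zero>\<^bsub>E\<^esub> = \<zero>\<^bsub>K\<^esub>" unfolding \<eta>E_def K_frac_eq K_eq KL.RS_zero ..
  then show ?thesis using filtI[of "\<zero>\<^bsub>E\<^esub>" n] X_carr by simp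
qed

lemma \<eta>E_uminus: "e \<in> carrier E \<Longrightarrow> \<eta>E (\<ominus>\<^bsub>E\<^esub> e) = \<ominus>\<^bsub>K\<^esub> \<eta>E e"
proof -
  have z: "\<eta>E \<zero>\<^bsub>E\<^esub> = \<zero>\<^bsub>K\<^esub>" unfolding \<eta>E_def K_frac_eq K_eq KL.RS_zero ..
  show "e \<in> carrier E \<Longrightarrow> \<eta>E (\<ominus>\<^bsub>E\<^esub> e) = \<ominus>\<^bsub>K\<^esub> \<eta>E e"
    by (rule K.minus_equality[symmetric]) (simp_all add: \<eta>E_simps z E.l_neg flip: \<eta>E_simps(3))
qed

lemma filt_uminus: assumes "z \<in> filt n" shows "\<ominus>\<^bsub>K\<^esub> z \<in> filt n"
proof -
  obtain d where d: "d \<in> carrier E" "z = X [^]\<^bsub>K\<^esub> n \<otimes>\<^bsub>K\<^esub> \<eta>E d" using assms(1) by (rule filtE)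
  have "\<ominus>\<^bsub>K\<^esub> z = X [^]\<^bsub>K\<^esub> n \<otimes>\<^bsub>K\<^esub> \<eta>E (\<ominus>\<^bsub>E\<^esub> d)"
    unfolding d(2) using d(1) X_carr by (simp add: \<eta>E_simps \<eta>E_uminus K.r_minus)
  then show ?thesis using filtI[of "\<ominus>\<^bsub>E\<^esub> d" n] d(1) by simp
qed

lemma filt_minus: "z \<in> filt n \<Longrightarrow> w \<in> filt n \<Longrightarrow> z \<ominus>\<^bsub>K\<^esub> w \<in> filt n"
  by (simp add: a_minus_def filt_add filt_uminus)

lemma filt_mono: "m \<le> n \<Longrightarrow> filt n \<subseteq> filt m"
  unfolding filt_eq using E.pw_mono by blast

lemma X_filt: "z \<in> filt n \<Longrightarrow> X [^]\<^bsub>K\<^esub> m \<otimes>\<^bsub>K\<^esub> z \<in> filt (m + n)"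
proof -
  have "X [^]\<^bsub>K\<^esub> m \<in> filt m" using filtI[of "\<one>\<^bsub>E\<^esub>" m] X_carr by (simp add: \<eta>E_simps)
  then show "z \<in> filt n \<Longrightarrow> X [^]\<^bsub>K\<^esub> m \<otimes>\<^bsub>K\<^esub> z \<in> filt (m + n)" by (rule filt_mult)
qed

lemma X_filt_cancel: 
  assumes z: "z \<in> carrier K" and "X [^]\<^bsub>K\<^esub> m \<otimes>\<^bsub>K\<^esub> z \<in> filt (m + n)" 
  shows "z \<in> filt n"
proof -
  obtain e where e: "e \<in> carrier E" "X [^]\<^bsub>K\<^esub> m \<otimes>\<^bsub>K\<^esub> z = X [^]\<^bsub>K\<^esub> (m + n) \<otimes>\<^bsub>K\<^esub> \<eta>E e"
    using assms(2) by (rule filtE)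
  have "X [^]\<^bsub>K\<^esub> (m + n) \<otimes>\<^bsub>K\<^esub> \<eta>E e = X [^]\<^bsub>K\<^esub> m \<otimes>\<^bsub>K\<^esub> (X [^]\<^bsub>K\<^esub> n \<otimes>\<^bsub>K\<^esub> \<eta>E e)"
    unfolding K.nat_pow_mult[OF X_carr, symmetric] using e(1) X_carr by (simp add: \<eta>E_simps K.m_assoc)
  then have "z = X [^]\<^bsub>K\<^esub> n \<otimes>\<^bsub>K\<^esub> \<eta>E e"
    using e K.m_lcancel[OF X_pow_nz, of m z] z X_carr by (simp add: \<eta>E_simps)
  then show ?thesis using filtI[OF e(1)] by simp
qed

lemma filt_sep:
  assumes z: "z \<in> carrier K" "\<And>n. z \<in> filt n" shows "z = \<zero>\<^bsub>K\<^esub>"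
proof -
  obtain e where e: "e \<in> carrier E" "z = \<eta>E e"
    using filtE[OF z(2)[of 0]] \<eta>E_simps(1) by (metis K.nat_pow_0 K.l_one)
  have "e = \<zero>\<^bsub>E\<^esub>" using z(2) unfolding e(2) \<eta>E_filt[OF e(1)] by (rule E.x_sep[OF e(1)])
  then show ?thesis unfolding e(2) \<eta>E_def K_frac_eq K_eq KL.RS_zero by simp
qed

text \<open>No order is gained in the completion: if f^n divides the class of a constant sequence y,
  then y is a multiple of f^n up to an element of the n-th step of the filtration, which is again a
  multiple of f^n.\<close>

lemma \<eta>A_filt:
  assumes y: "y \<in> carrier A" shows "\<eta>A y \<in> filt n \<longleftrightarrow> y \<in> pw A xA n"
proof -
  have cE: "AF.cls (\<lambda>_. y) \<in> carrier E"
    unfolding int_ring_def by (rule AF.cls_carr[OF AF.CR_const[OF y]])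
  have xE: "xE = AF.fh" unfolding int_ring_eq_def to_int_ring_def ..
  have "AF.cls (\<lambda>_. y) \<in> pw E xE n \<longleftrightarrow> y \<in> pw A xA n"
  proof
    assume "AF.cls (\<lambda>_. y) \<in> pw E xE n"
    then obtain r where r: "r \<in> carrier A" "y \<ominus>\<^bsub>A\<^esub> xA [^]\<^bsub>A\<^esub> n \<otimes>\<^bsub>A\<^esub> r \<in> pw A xA n"
      using AF.cls_pw_D[OF AF.CR_const[OF y], of n n] unfolding xE int_ring_def int_ring_filt_eq by auto
    interpret P: ideal "pw A xA n" A by (rule A.pw_ideal[OF A.x_carr])
    have "(y \<ominus>\<^bsub>A\<^esub> xA [^]\<^bsub>A\<^esub> n \<otimes>\<^bsub>A\<^esub> r) \<oplus>\<^bsub>A\<^esub> xA [^]\<^bsub>A\<^esub> n \<otimes>\<^bsub>A\<^esub> r \<in> pw A xA n"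
      by (rule P.a_closed[OF r(2) A.pw_I[OF r(1)]])
    moreover have "(y \<ominus>\<^bsub>A\<^esub> xA [^]\<^bsub>A\<^esub> n \<otimes>\<^bsub>A\<^esub> r) \<oplus>\<^bsub>A\<^esub> xA [^]\<^bsub>A\<^esub> n \<otimes>\<^bsub>A\<^esub> r = y"
      using A.nat_pow_closed[OF A.x_carr, of n] r(1) y by (simp add: a_minus_def A.a_assoc A.l_neg)
    ultimately show "y \<in> pw A xA n" by simp
  next
    assume "y \<in> pw A xA n"
    then show "AF.cls (\<lambda>_. y) \<in> pw E xE n"
      unfolding xE int_ring_def by (intro AF.cls_in_pw AF.CR_const y) auto
  qed
  then show ?thesis unfolding \<eta>A_def \<eta>E_filt[OF cE] .
qed

lemma \<eta>_filt: "a \<in> carrier H \<Longrightarrow> \<eta> a \<in> filt n \<longleftrightarrow> a \<in> pw H x n"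
proof -
  assume a: "a \<in> carrier H"
  have "to_loc_hat q f a \<in> carrier A" unfolding A_eq to_A_eq by (rule H.L.fr_carr[OF a H.L.S_one])
  then show "\<eta> a \<in> filt n \<longleftrightarrow> a \<in> pw H x n"
    using H.fr_in_pw[OF a H.L.S_one, of n] unfolding \<eta>_eq \<eta>A_filt[of "to_loc_hat q f a"]
    by (simp add: \<eta>A_filt A_eq to_A_eq)
qed

lemma \<eta>A_inverse: 
  assumes "b \<in> carrier H - pw H x (Suc 0)" "a \<in> carrier H"
  shows "\<eta> b \<otimes>\<^bsub>K\<^esub> \<eta>A (H.L.fr a b) = \<eta> a"
proof -
  have c: "b \<in> carrier H" using assms(1) by simp
  have "\<eta> b \<otimes>\<^bsub>K\<^esub> \<eta>A (H.L.fr a b) = \<eta>A (H.L.fr b \<one>\<^bsub>H\<^esub> \<otimes>\<^bsub>A\<^esub> H.L.fr a b)"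
    unfolding \<eta>_eq to_A_eq
    using H.L.fr_carr[OF c H.L.S_one] H.L.fr_carr[OF assms(2,1)]
    by (intro \<eta>A_simps(2)[symmetric]) (simp_all only: A_eq)
  also have "H.L.fr b \<one>\<^bsub>H\<^esub> \<otimes>\<^bsub>A\<^esub> H.L.fr a b = H.L.fr (b \<otimes>\<^bsub>H\<^esub> a) (\<one>\<^bsub>H\<^esub> \<otimes>\<^bsub>H\<^esub> b)"
    unfolding A_eq by (rule H.L.fr_mult[OF c H.L.S_one assms(2,1)])
  also have "\<dots> = H.L.fr a \<one>\<^bsub>H\<^esub>"
    using H.L.fr_eq[OF H.m_closed[OF c assms(2)] H.L.S_mult[OF H.L.S_one assms(1)] assms(2) H.L.S_one]
      assms(2) c by (simp add: H.m_comm)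
  finally show ?thesis unfolding \<eta>_eq to_A_eq .
qed

lemma fr_A_carr: "a \<in> carrier H \<Longrightarrow> b \<in> carrier H - pw H x (Suc 0) \<Longrightarrow> H.L.fr a b \<in> carrier A"
  unfolding A_eq by (rule H.L.fr_carr)

lemma \<eta>_unit0: assumes b: "b \<in> carrier H" "b \<notin> pw H x (Suc 0)" shows "\<eta> b \<in> Units K"
proof -
  have b': "b \<in> carrier H - pw H x (Suc 0)" using b by blast
  have c: "H.L.fr \<one>\<^bsub>H\<^esub> b \<in> carrier A" by (rule fr_A_carr[OF H.one_closed b'])
  have "\<eta> b \<otimes>\<^bsub>K\<^esub> \<eta>A (H.L.fr \<one>\<^bsub>H\<^esub> b) = \<one>\<^bsub>K\<^esub>"
    using \<eta>A_inverse[OF b' H.one_closed] \<eta>_simps(4) by simp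
  then show ?thesis using K.m_comm[of "\<eta> b" "\<eta>A (H.L.fr \<one>\<^bsub>H\<^esub> b)"] \<eta>_simps(1)[OF b(1)] \<eta>A_simps(1)[OF c]
    unfolding Units_def by auto
qed

text \<open>Splitting off the powers of the local equation leaves an element that is inverted in
  \<open>loc_hat\<close>; the powers themselves are inverted in the last step. This is what allows
  fractions, hence rational functions, to be sent to K_q,C.\<close>

lemma \<eta>_unit: assumes b: "b \<in> carrier H" "b \<noteq> \<zero>\<^bsub>H\<^esub>" shows "\<eta> b \<in> Units K"
proof -
  obtain n c where c: "c \<in> carrier H" "c \<notin> pw H x (Suc 0)" "b = x [^]\<^bsub>H\<^esub> (n::nat) \<otimes>\<^bsub>H\<^esub> c"
    using H.factor[OF b] by metis
  have "\<eta> b = X [^]\<^bsub>K\<^esub> n \<otimes>\<^bsub>K\<^esub> \<eta> c"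
    unfolding c(3) X_def using c(1) H.x_carr by (simp add: \<eta>_simps \<eta>_pow)
  then show ?thesis using X_pow_unit \<eta>_unit0[OF c(1,2)] K.Units_m_closed by simp
qed

text \<open>The image of the fraction field of the completed local ring. All sequences whose limits
  are taken later have their terms in it, so convergence is studied only there.\<close>

definition "FK = {\<eta> a \<otimes>\<^bsub>K\<^esub> inv\<^bsub>K\<^esub> \<eta> b | a b. a \<in> carrier H \<and> b \<in> carrier H \<and> b \<noteq> \<zero>\<^bsub>H\<^esub>}"

lemma FK_carr:
  assumes "z \<in> FK" shows "z \<in> carrier K"
proof -
  from assms obtain a b where ab: "a \<in> carrier H" "b \<in> carrier H" "b \<noteq> \<zero>\<^bsub>H\<^esub>" "z = \<eta> a \<otimes>\<^bsub>K\<^esub> inv\<^bsub>K\<^esub> \<eta> b"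
    unfolding FK_def by blast
  show ?thesis unfolding ab(4) using \<eta>_unit[OF ab(2,3)] \<eta>_simps(1)[OF ab(1)] by simp
qed

lemma FKE:
  assumes "z \<in> FK" 
  obtains a b where "a \<in> carrier H" "b \<in> carrier H" "b \<noteq> \<zero>\<^bsub>H\<^esub>" "z = \<eta> a \<otimes>\<^bsub>K\<^esub> inv\<^bsub>K\<^esub> \<eta> b"
    "\<eta> b \<otimes>\<^bsub>K\<^esub> z = \<eta> a"
proof -
  obtain a b where ab: "a \<in> carrier H" "b \<in> carrier H" "b \<noteq> \<zero>\<^bsub>H\<^esub>" "z = \<eta> a \<otimes>\<^bsub>K\<^esub> inv\<^bsub>K\<^esub> \<eta> b"
    using assms by (auto simp: FK_def)
  have u: "\<eta> b \<in> Units K" by (rule \<eta>_unit[OF ab(2,3)])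
  have "\<eta> b \<otimes>\<^bsub>K\<^esub> z = \<eta> a \<otimes>\<^bsub>K\<^esub> (\<eta> b \<otimes>\<^bsub>K\<^esub> inv\<^bsub>K\<^esub> \<eta> b)"
    unfolding ab(4) using u ab(1,2) by (simp add: \<eta>_simps K.m_ac)
  also have "\<dots> = \<eta> a" using u ab(1) by (simp add: \<eta>_simps)
  finally show ?thesis using that ab by blast
qed

text \<open>Write the denominator as a power of the local equation times an admissible denominator
  of \<open>loc_hat\<close>. Integrality of z makes the same power divide the numerator, where it
  cancels.\<close>

lemma FK_A:
  assumes "z \<in> FK" "z \<in> filt 0" obtains y where "y \<in> carrier A" "z = \<eta>A y"
proof -
  obtain a b where ab: "a \<in> carrier H" "b \<in> carrier H" "b \<noteq> \<zero>\<^bsub>H\<^esub>" "\<eta> b \<otimes>\<^bsub>K\<^esub> z = \<eta> a"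
    using assms(1) by (rule FKE)
  have z: "z \<in> carrier K" by (rule FK_carr[OF assms(1)])
  obtain j b' where b': "b' \<in> carrier H" "b' \<notin> pw H x (Suc 0)" "b = x [^]\<^bsub>H\<^esub> (j::nat) \<otimes>\<^bsub>H\<^esub> b'"
    using H.factor[OF ab(2,3)] by metis
  have \<eta>b: "\<eta> b = X [^]\<^bsub>K\<^esub> j \<otimes>\<^bsub>K\<^esub> \<eta> b'"
    unfolding b'(3) X_def using b'(1) H.x_carr by (simp add: \<eta>_simps \<eta>_pow)
  have "\<eta> b' \<in> filt 0" using \<eta>_filt[OF b'(1)] b'(1) by (simp add: H.pw_0)
  then have "X [^]\<^bsub>K\<^esub> j \<otimes>\<^bsub>K\<^esub> (\<eta> b' \<otimes>\<^bsub>K\<^esub> z) \<in> filt (j + (0 + 0))"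
    using assms(2) by (intro X_filt filt_mult)
  also have \<eta>a: "X [^]\<^bsub>K\<^esub> j \<otimes>\<^bsub>K\<^esub> (\<eta> b' \<otimes>\<^bsub>K\<^esub> z) = \<eta> a"
    using ab(4) \<eta>b z X_carr b'(1) by (simp add: K.m_assoc \<eta>_simps)
  finally have "a \<in> pw H x j" using \<eta>_filt[OF ab(1)] by simp
  then obtain a' where a': "a' \<in> carrier H" "a = x [^]\<^bsub>H\<^esub> j \<otimes>\<^bsub>H\<^esub> a'" by (rule H.pw_E)
  have "\<eta> a = X [^]\<^bsub>K\<^esub> j \<otimes>\<^bsub>K\<^esub> \<eta> a'"
    unfolding a'(2) X_def using a'(1) H.x_carr by (simp add: \<eta>_simps \<eta>_pow)
  with \<eta>a have "X [^]\<^bsub>K\<^esub> j \<otimes>\<^bsub>K\<^esub> (\<eta> b' \<otimes>\<^bsub>K\<^esub> z) = X [^]\<^bsub>K\<^esub> j \<otimes>\<^bsub>K\<^esub> \<eta> a'" by (rule trans)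
  then have 1: "\<eta> b' \<otimes>\<^bsub>K\<^esub> z = \<eta> a'"
    using K.m_lcancel[OF X_pow_nz, of j] X_carr z a'(1) b'(1) by (simp add: \<eta>_simps)
  have b'': "b' \<in> carrier H - pw H x (Suc 0)" using b' by blast
  have c: "H.L.fr a' b' \<in> carrier A" by (rule fr_A_carr[OF a'(1) b''])
  have "\<eta> b' \<otimes>\<^bsub>K\<^esub> z = \<eta> b' \<otimes>\<^bsub>K\<^esub> \<eta>A (H.L.fr a' b')"
    unfolding 1 by (rule \<eta>A_inverse[OF b'' a'(1), symmetric])
  then have "z = \<eta>A (H.L.fr a' b')"
    using K.Units_l_cancel[OF \<eta>_unit0[OF b'(1,2)] z \<eta>A_simps(1)[OF c]] by simp
  then show ?thesis using that c by blast
qed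

lemma FK_X_pow: "z \<in> FK \<Longrightarrow> X [^]\<^bsub>K\<^esub> (n::nat) \<otimes>\<^bsub>K\<^esub> z \<in> FK"
proof -
  assume z: "z \<in> FK"
  obtain a b where ab: "a \<in> carrier H" "b \<in> carrier H" "b \<noteq> \<zero>\<^bsub>H\<^esub>" "z = \<eta> a \<otimes>\<^bsub>K\<^esub> inv\<^bsub>K\<^esub> \<eta> b"
    using z by (rule FKE)
  have "X [^]\<^bsub>K\<^esub> n \<otimes>\<^bsub>K\<^esub> z = \<eta> (x [^]\<^bsub>H\<^esub> n \<otimes>\<^bsub>H\<^esub> a) \<otimes>\<^bsub>K\<^esub> inv\<^bsub>K\<^esub> \<eta> b"
    unfolding ab(4) X_def using ab(1-3) H.x_carr \<eta>_unit[OF ab(2,3)] by (simp add: \<eta>_simps \<eta>_pow K.m_assoc)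
  then show ?thesis unfolding FK_def using ab(1-3) H.x_carr by blast
qed

lemma limit_unique:
  assumes "h \<in> carrier K" "h' \<in> carrier K" "\<And>i. s i \<in> carrier K"
    "converges_to K filt s h" "converges_to K filt s h'"
  shows "h = h'"
proof -
  have "h \<ominus>\<^bsub>K\<^esub> h' \<in> filt n" for n
  proof -
    obtain M M' where M: "\<forall>i\<ge>M. s i \<ominus>\<^bsub>K\<^esub> h \<in> filt n" "\<forall>i\<ge>M'. s i \<ominus>\<^bsub>K\<^esub> h' \<in> filt n"
      using assms(4,5) unfolding converges_to_def by meson
    define i where "i = max M M'"
    have "h \<ominus>\<^bsub>K\<^esub> h' = (s i \<ominus>\<^bsub>K\<^esub> h') \<ominus>\<^bsub>K\<^esub> (s i \<ominus>\<^bsub>K\<^esub> h)" using assms(1,2,3) by algebra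
    then show ?thesis using M filt_minus unfolding i_def by (metis max.cobounded1 max.cobounded2)
  qed
  then have "h \<ominus>\<^bsub>K\<^esub> h' = \<zero>\<^bsub>K\<^esub>" using filt_sep assms by simp
  moreover have "h = (h \<ominus>\<^bsub>K\<^esub> h') \<oplus>\<^bsub>K\<^esub> h'" using assms(1,2) by algebra
  ultimately show ?thesis using assms(2) by simp
qed

lemma \<eta>A_minus: "y \<in> carrier A \<Longrightarrow> z \<in> carrier A \<Longrightarrow> \<eta>A (y \<ominus>\<^bsub>A\<^esub> z) = \<eta>A y \<ominus>\<^bsub>K\<^esub> \<eta>A z"
proof -
  assume yz: "y \<in> carrier A" "z \<in> carrier A"
  have "\<eta>A (y \<ominus>\<^bsub>A\<^esub> z) \<oplus>\<^bsub>K\<^esub> \<eta>A z = \<eta>A (y \<ominus>\<^bsub>A\<^esub> z \<oplus>\<^bsub>A\<^esub> z)"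
    using yz by (simp add: \<eta>A_simps)
  also have "y \<ominus>\<^bsub>A\<^esub> z \<oplus>\<^bsub>A\<^esub> z = y" using yz by (simp add: a_minus_def A.a_assoc A.l_neg)
  finally have 1: "\<eta>A y = \<eta>A (y \<ominus>\<^bsub>A\<^esub> z) \<oplus>\<^bsub>K\<^esub> \<eta>A z" by simp
  show "\<eta>A (y \<ominus>\<^bsub>A\<^esub> z) = \<eta>A y \<ominus>\<^bsub>K\<^esub> \<eta>A z"
    unfolding 1 using yz \<eta>A_simps(1)[of z] \<eta>A_simps(1)[of "y \<ominus>\<^bsub>A\<^esub> z"]
    by (simp add: a_minus_def K.a_assoc K.r_neg)
qed

text \<open>After scaling by a power of \<open>X\<close> the tail lies in the image of
  \<open>loc_hat\<close> by \<open>FK_A\<close>, and a Cauchy sequence there is by construction an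
  element of \<open>int_ring\<close>. The restriction to \<open>FK\<close> spares a diagonal
  argument with sequences of classes.\<close>

lemma limit_exists:
  assumes FK: "\<And>i. s i \<in> FK"
    and cauchy: "\<And>n. \<exists>M. \<forall>i\<ge>M. \<forall>j\<ge>M. s i \<ominus>\<^bsub>K\<^esub> s j \<in> filt n"
  shows "\<exists>h\<in>carrier K. converges_to K filt s h"
proof -
  have sc: "s i \<in> carrier K" for i by (rule FK_carr[OF FK])
  obtain M where M: "\<forall>i\<ge>M. \<forall>j\<ge>M. s i \<ominus>\<^bsub>K\<^esub> s j \<in> filt 0" using cauchy by meson
  \<comment> \<open>This exponent clears the pole of a single term; the later terms differ from it
    by elements of \<open>filt 0\<close>.\<close>
  obtain e n where e: "e \<in> carrier E" "X [^]\<^bsub>K\<^esub> (n::nat) \<otimes>\<^bsub>K\<^esub> s M = \<eta>E e" using KE[OF sc] by blast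
  have X0: "X [^]\<^bsub>K\<^esub> n \<in> carrier K" using X_carr by simp
  have "X [^]\<^bsub>K\<^esub> n \<otimes>\<^bsub>K\<^esub> s i \<in> filt 0" if "i \<ge> M" for i
  proof -
    have "X [^]\<^bsub>K\<^esub> n \<otimes>\<^bsub>K\<^esub> s i = X [^]\<^bsub>K\<^esub> n \<otimes>\<^bsub>K\<^esub> (s i \<ominus>\<^bsub>K\<^esub> s M) \<oplus>\<^bsub>K\<^esub> X [^]\<^bsub>K\<^esub> n \<otimes>\<^bsub>K\<^esub> s M"
      using sc X0 by algebra
    moreover have "X [^]\<^bsub>K\<^esub> n \<otimes>\<^bsub>K\<^esub> (s i \<ominus>\<^bsub>K\<^esub> s M) \<in> filt 0"
      using X_filt[of _ 0 n] M that filt_mono[of 0 n] by auto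
    moreover have "X [^]\<^bsub>K\<^esub> n \<otimes>\<^bsub>K\<^esub> s M \<in> filt 0" unfolding e(2) \<eta>E_filt[OF e(1)] using e(1) by (simp add: E.pw_0)
    ultimately show ?thesis using filt_add by simp
  qed
  then have "\<forall>i. \<exists>y. y \<in> carrier A \<and> (i \<ge> M \<longrightarrow> X [^]\<^bsub>K\<^esub> n \<otimes>\<^bsub>K\<^esub> s i = \<eta>A y)"
    using FK_A[OF FK_X_pow[OF FK]] A.zero_closed by metis
  then obtain y where y: "\<And>i. y i \<in> carrier A" "\<And>i. i \<ge> M \<Longrightarrow> X [^]\<^bsub>K\<^esub> n \<otimes>\<^bsub>K\<^esub> s i = \<eta>A (y i)" by metis
  have ydiff: "y i \<ominus>\<^bsub>A\<^esub> y j \<in> pw A xA k" 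
    if ij: "i \<ge> M" "j \<ge> M" "s i \<ominus>\<^bsub>K\<^esub> s j \<in> filt k" for i j k
  proof -
    have "\<eta>A (y i \<ominus>\<^bsub>A\<^esub> y j) = X [^]\<^bsub>K\<^esub> n \<otimes>\<^bsub>K\<^esub> (s i \<ominus>\<^bsub>K\<^esub> s j)"
      unfolding \<eta>A_minus[OF y(1) y(1)] y(2)[OF ij(1), symmetric] y(2)[OF ij(2), symmetric]
      using sc X0 by algebra
    then have "\<eta>A (y i \<ominus>\<^bsub>A\<^esub> y j) \<in> filt k" using X_filt[OF ij(3), of n] filt_mono[of k "n + k"] by auto
    then show ?thesis using \<eta>A_filt[OF A.minus_closed[OF y(1) y(1)]] by simp
  qed
  have yC: "y \<in> carrier AF.CR"
  proof (rule AF.CR_I[OF y(1)])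
    fix k
    obtain M' where "\<forall>i\<ge>M'. \<forall>j\<ge>M'. s i \<ominus>\<^bsub>K\<^esub> s j \<in> filt k" using cauchy by meson
    then show "\<exists>M. \<forall>i\<ge>M. \<forall>j\<ge>M. y i \<ominus>\<^bsub>A\<^esub> y j \<in> int_ring_filt q f k"
      unfolding int_ring_filt_eq using ydiff by (intro exI[of _ "max M M'"]) simp
  qed
  define h0 where "h0 = \<eta>E (AF.cls y)"
  have clsE: "AF.cls y \<in> carrier E" unfolding int_ring_def by (rule AF.cls_carr[OF yC])
  have h0: "h0 \<in> carrier K" unfolding h0_def by (rule \<eta>E_simps(1)[OF clsE])
  define h where "h = inv\<^bsub>K\<^esub> (X [^]\<^bsub>K\<^esub> n) \<otimes>\<^bsub>K\<^esub> h0"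
  have ic: "inv\<^bsub>K\<^esub> (X [^]\<^bsub>K\<^esub> n) \<in> carrier K" using X_pow_unit by simp
  have h: "h \<in> carrier K" unfolding h_def using ic h0 by simp
  have Xh: "X [^]\<^bsub>K\<^esub> n \<otimes>\<^bsub>K\<^esub> h = h0"
    unfolding h_def using X_pow_unit[of n] ic h0 X0 by (simp add: K.m_assoc[symmetric])
  have "\<exists>M'. \<forall>i\<ge>M'. s i \<ominus>\<^bsub>K\<^esub> h \<in> filt k" for k
  proof -
    obtain M' where M': "\<forall>i\<ge>M'. \<forall>j\<ge>M'. s i \<ominus>\<^bsub>K\<^esub> s j \<in> filt (n + k)" using cauchy by meson
    have "s i \<ominus>\<^bsub>K\<^esub> h \<in> filt k" if i: "i \<ge> max M M'" for i
    proof -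
      have cC: "(\<lambda>_. y i) \<in> carrier AF.CR" by (rule AF.CR_const[OF y(1)])
      have "AF.cls (\<lambda>j. y i \<ominus>\<^bsub>A\<^esub> y j) \<in> pw AF.Rh AF.fh (n + k)"
      proof (rule AF.cls_in_pw)
        show "(\<lambda>j. y i \<ominus>\<^bsub>A\<^esub> y j) \<in> carrier AF.CR"
          using AF.CR_add[OF cC AF.CR_uminus[OF yC]] by (simp add: a_minus_def)
        show "\<exists>M. \<forall>j\<ge>M. y i \<ominus>\<^bsub>A\<^esub> y j \<in> pw A xA (n + k)"
          using ydiff M' i by (intro exI[of _ "max M M'"]) simp
      qed
      then have "AF.cls (\<lambda>_. y i) \<ominus>\<^bsub>AF.Rh\<^esub> AF.cls y \<in> pw AF.Rh AF.fh (n + k)"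
        by (simp add: AF.cls_minus[OF cC yC])
      then have d: "AF.cls (\<lambda>_. y i) \<ominus>\<^bsub>E\<^esub> AF.cls y \<in> pw E xE (n + k)"
        unfolding int_ring_def int_ring_eq_def to_int_ring_def .
      have cE: "AF.cls (\<lambda>_. y i) \<in> carrier E" unfolding int_ring_def by (rule AF.cls_carr[OF cC])
      have "X [^]\<^bsub>K\<^esub> n \<otimes>\<^bsub>K\<^esub> (s i \<ominus>\<^bsub>K\<^esub> h) = X [^]\<^bsub>K\<^esub> n \<otimes>\<^bsub>K\<^esub> s i \<ominus>\<^bsub>K\<^esub> X [^]\<^bsub>K\<^esub> n \<otimes>\<^bsub>K\<^esub> h"
        using sc h X0 by algebra
      also have "\<dots> = \<eta>E (AF.cls (\<lambda>_. y i)) \<ominus>\<^bsub>K\<^esub> \<eta>E (AF.cls y)"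
        using y(2)[of i] i Xh by (simp add: \<eta>A_def h0_def)
      also have "\<dots> = \<eta>E (AF.cls (\<lambda>_. y i) \<ominus>\<^bsub>E\<^esub> AF.cls y)"
        using cE clsE by (simp add: a_minus_def \<eta>E_simps \<eta>E_uminus)
      also have "\<dots> \<in> filt (n + k)" using d \<eta>E_filt[OF E.minus_closed[OF cE clsE]] by simp
      finally show ?thesis using X_filt_cancel[OF K.minus_closed[OF sc h]] by blast
    qed
    then show ?thesis by blast
  qed
  then show ?thesis using h unfolding converges_to_def by blast
qed

end

section \<open>Regular local rings of the plane along a curve\<close>

text \<open>The pair \<open>\<tau>\<close>, \<open>f\<close> is a regular system of parameters at q:
  \<open>regular\<close> says that \<open>\<tau>\<close> is a nonzerodivisor modulo f, and
  \<open>sep\<close> that the stalk modulo f is separated for the powers of \<open>\<tau>\<close>.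
  \<open>FF_factor\<close> identifies the valuation along the curve with the f-order. In this form
  the axioms cover the affine points of the conic and p alike.\<close>

locale local_flag =
  fixes F :: "'a::field poly3" and q :: "'a poly3 set" and f \<tau> :: "'a poly3 fract"
  assumes R_sub: "subring_on (carrier (stalk q))"
    and R_FF: "carrier (stalk q) \<subseteq> carrier function_field"
    and FF_sub: "subring_on (carrier (function_field :: 'a poly3 fract ring))"
    and max_eq: "stalk_max q = {\<tau> * a + f * b | a b. a \<in> carrier (stalk q) \<and> b \<in> carrier (stalk q)}"
    and R_inverse: "r \<in> carrier (stalk q) \<Longrightarrow> r \<notin> stalk_max q \<Longrightarrow> inverse r \<in> carrier (stalk q)"
    and one_notin_max: "1 \<notin> stalk_max q"
    and \<tau>_carr: "\<tau> \<in> carrier (stalk q)"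
    and f_carr: "f \<in> carrier (stalk q)"
    and f_nz: "f \<noteq> 0"
    and regular: "a \<in> carrier (stalk q) \<Longrightarrow> b \<in> carrier (stalk q) \<Longrightarrow> \<tau> * a = f * b \<Longrightarrow>
      \<exists>c\<in>carrier (stalk q). a = f * c"
    and sep: "r \<in> carrier (stalk q) \<Longrightarrow>
      (\<And>k. \<exists>a\<in>carrier (stalk q). \<exists>b\<in>carrier (stalk q). r = f * a + \<tau> ^ k * b) \<Longrightarrow>
      \<exists>a\<in>carrier (stalk q). r = f * a"
    and val_minus: "r \<in> val_filt F n \<Longrightarrow> s \<in> val_filt F n \<Longrightarrow> r - s \<in> val_filt F n"
    and val_zero: "0 \<in> val_filt F n"
    and FF_factor: "r \<in> carrier function_field \<Longrightarrow> r \<noteq> 0 \<Longrightarrow> \<exists>N a b. a \<in> carrier (stalk q) \<and>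
      b \<in> carrier (stalk q) \<and> (\<nexists>c. c \<in> carrier (stalk q) \<and> a = f * c) \<and>
      (\<nexists>c. c \<in> carrier (stalk q) \<and> b = f * c) \<and> r = f powi N * (a / b) \<and>
      (\<forall>n. r \<in> val_filt F n \<longleftrightarrow> int n \<le> N)"
begin

abbreviation "R \<equiv> carrier (stalk q)"
abbreviation "\<mm> \<equiv> stalk_max q"
abbreviation "mp \<equiv> ideal_power (stalk q) (stalk_max q)"

lemma stalk_ring_on: "stalk q = ring_on R"
  by (simp add: stalk_def)

lemma stalk_cring: "cring (stalk q)"
  by (subst stalk_ring_on) (rule cring_ring_on[OF R_sub])

lemma stalk_simps [simp]:
  "a \<otimes>\<^bsub>stalk q\<^esub> b = a * b" "\<one>\<^bsub>stalk q\<^esub> = 1" "\<zero>\<^bsub>stalk q\<^esub> = 0" "a \<oplus>\<^bsub>stalk q\<^esub> b = a + b"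
  "a [^]\<^bsub>stalk q\<^esub> (n::nat) = a ^ n"
  unfolding stalk_def by simp_all

lemma stalk_minus [simp]: "a \<in> R \<Longrightarrow> b \<in> R \<Longrightarrow> a \<ominus>\<^bsub>stalk q\<^esub> b = a - b"
  by (subst stalk_ring_on) (rule ring_on_minus[OF R_sub])

lemmas R_closed [simp] = subring_onD[OF R_sub]
declare \<tau>_carr [simp] f_carr [simp]
lemmas FF_closed = subring_onD[OF FF_sub]

lemma max_sub: "a \<in> \<mm> \<Longrightarrow> a \<in> R"
  unfolding max_eq by auto

lemma maxE: assumes "r \<in> \<mm>" obtains a b where "a \<in> R" "b \<in> R" "r = \<tau> * a + f * b"
  using assms unfolding max_eq by blast

lemma maxI: "a \<in> R \<Longrightarrow> b \<in> R \<Longrightarrow> \<tau> * a + f * b \<in> \<mm>"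
  unfolding max_eq by blast

lemma f_max: "f \<in> \<mm>" and \<tau>_max: "\<tau> \<in> \<mm>"
  using maxI[of 0 1] maxI[of 1 0] by simp_all

lemma max_add: "r \<in> \<mm> \<Longrightarrow> s \<in> \<mm> \<Longrightarrow> r + s \<in> \<mm>"
proof -
  assume "r \<in> \<mm>" "s \<in> \<mm>"
  then obtain a b c d where "a \<in> R" "b \<in> R" "r = \<tau> * a + f * b" "c \<in> R" "d \<in> R" "s = \<tau> * c + f * d"
    by (elim maxE) blast
  then show ?thesis using maxI[of "a + c" "b + d"] by (simp add: algebra_simps)
qed

lemma max_mult: "r \<in> \<mm> \<Longrightarrow> s \<in> R \<Longrightarrow> r * s \<in> \<mm>"
proof -
  assume "r \<in> \<mm>" "s \<in> R"
  then obtain a b where "a \<in> R" "b \<in> R" "r = \<tau> * a + f * b" by (elim maxE) blast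
  then show ?thesis using maxI[of "a * s" "b * s"] \<open>s \<in> R\<close> by (simp add: algebra_simps)
qed

lemma max_ideal: "ideal \<mm> (stalk q)"
proof -
  interpret S: cring "stalk q" by (rule stalk_cring)
  have um: "- a \<in> \<mm>" if "a \<in> \<mm>" for a using max_mult[OF that, of "- 1"] by simp
  show ?thesis
  proof (intro idealI S.ring_axioms S.add.subgroupI)
    show "\<mm> \<subseteq> carrier (stalk q)" using max_sub by blast
    show "\<mm> \<noteq> {}" using f_max by blast
    show "\<ominus>\<^bsub>stalk q\<^esub> a \<in> \<mm>" if "a \<in> \<mm>" for a
    proof -
      have "\<ominus>\<^bsub>stalk q\<^esub> a = - a"
        by (subst stalk_ring_on) (rule ring_on_uminus[OF R_sub max_sub[OF that]])
      then show ?thesis using um[OF that] by simp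
    qed
  qed (use max_add max_mult in \<open>auto simp: mult.commute\<close>)
qed

lemma mp_ideal: "ideal (mp n) (stalk q)"
proof (induction n)
  case 0
  interpret S: cring "stalk q" by (rule stalk_cring)
  show ?case by (simp add: S.oneideal)
next
  case (Suc n)
  interpret S: cring "stalk q" by (rule stalk_cring)
  show ?case unfolding ideal_power.simps by (rule S.ideal_prod_is_ideal[OF max_ideal Suc])
qed

lemma mp_filtered: "filtered_ring (stalk q) mp"
proof (intro filtered_ring.intro filtered_ring_axioms.intro stalk_cring mp_ideal)
  interpret S: cring "stalk q" by (rule stalk_cring)
  show "mp (Suc n) \<subseteq> mp n" for n
    using S.ideal_prod_inter[OF max_ideal mp_ideal[of n]] by simp
qed

end

sublocale local_flag \<subseteq> M: filtered_ring "stalk q" "ideal_power (stalk q) (stalk_max q)"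
  by (rule mp_filtered)

context local_flag
begin

lemma mp_add: "a \<in> mp n \<Longrightarrow> b \<in> mp n \<Longrightarrow> a + b \<in> mp n"
  using M.I_add[of a n b] by simp

lemma mp_mult: "a \<in> mp n \<Longrightarrow> b \<in> R \<Longrightarrow> a * b \<in> mp n"
  using M.I_r_mult[of b a n] by simp

lemma mp_max: "a \<in> \<mm> \<Longrightarrow> b \<in> mp n \<Longrightarrow> a * b \<in> mp (Suc n)"
  using ideal_prod.prod[of a \<mm> b "mp n" "stalk q"] by simp

lemma mp_pow: "a \<in> \<mm> \<Longrightarrow> b \<in> R \<Longrightarrow> a ^ n * b \<in> mp n"
  by (induction n) (auto simp: mult.assoc mp_max simp del: ideal_power.simps(2))

text \<open>In the expansion of a product of k + 1 elements of the maximal ideal only one term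
  avoids f, the one with the pure power of \<open>\<tau>\<close>; all others are f times an element
  of the k-th power.\<close>

lemma mp_Suc: "e \<in> mp (Suc k) \<Longrightarrow> \<exists>a\<in>R. \<exists>b\<in>mp k. e = \<tau> ^ Suc k * a + f * b"
proof (induction k arbitrary: e)
  case 0
  have "e \<in> ideal_prod (stalk q) \<mm> R" using 0 by simp
  then show ?case
  proof induction
    case (prod i j)
    then obtain a b where "a \<in> R" "b \<in> R" "i = \<tau> * a + f * b" by (elim maxE) blast
    then show ?case using prod
      by (intro bexI[of _ "a * j"] bexI[of _ "b * j"]) (auto simp: algebra_simps)
  next
    case (sum s1 s2)
    then obtain a b c d where "a \<in> R" "b \<in> R" "s1 = \<tau> ^ Suc 0 * a + f * b" "c \<in> R" "d \<in> R" "s2 = \<tau> ^ Suc 0 * c + f * d"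
      by auto
    then show ?case
      by (intro bexI[of _ "a + c"] bexI[of _ "b + d"]) (auto simp: algebra_simps)
  qed
next
  case (Suc k)
  have "e \<in> ideal_prod (stalk q) \<mm> (mp (Suc k))" using Suc.prems by simp
  then show ?case
  proof induction
    case (prod i j)
    then obtain c d where c: "c \<in> R" "d \<in> R" "i = \<tau> * c + f * d" by (elim maxE) blast
    obtain a b where a: "a \<in> R" "b \<in> mp k" "j = \<tau> ^ Suc k * a + f * b" using Suc.IH[OF prod(2)] by blast
    have "b * (\<tau> * c) + d * j \<in> mp (Suc k)"
    proof (rule mp_add)
      have "\<tau> * b * c \<in> mp (Suc k)" by (rule mp_mult[OF mp_max[OF \<tau>_max a(2)] c(1)])
      then show "b * (\<tau> * c) \<in> mp (Suc k)" by (simp add: mult_ac del: ideal_power.simps)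
      show "d * j \<in> mp (Suc k)" using mp_mult[OF prod(2) c(2)] by (simp add: mult.commute del: ideal_power.simps)
    qed
    moreover have "i \<otimes>\<^bsub>stalk q\<^esub> j = \<tau> ^ Suc (Suc k) * (a * c) + f * (b * (\<tau> * c) + d * j)"
      using a(3) c(3) by (simp add: algebra_simps)
    ultimately show ?case using R_closed(4)[OF a(1) c(1)] by blast
  next
    case (sum s1 s2)
    then obtain a b c d where "a \<in> R" "b \<in> mp (Suc k)" "s1 = \<tau> ^ Suc (Suc k) * a + f * b"
        "c \<in> R" "d \<in> mp (Suc k)" "s2 = \<tau> ^ Suc (Suc k) * c + f * d"
      by auto
    then show ?case using mp_add[of b "Suc k" d]
      by (intro bexI[of _ "a + c"] bexI[of _ "b + d"]) (auto simp: algebra_simps simp del: ideal_power.simps)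
  qed
qed

lemma regular_pow: "a \<in> R \<Longrightarrow> b \<in> R \<Longrightarrow> \<tau> ^ n * a = f * b \<Longrightarrow> \<exists>c\<in>R. a = f * c"
proof (induction n arbitrary: b)
  case (Suc n)
  have "\<tau> * (\<tau> ^ n * a) = f * b" using Suc.prems by (simp add: mult_ac)
  then obtain c where "c \<in> R" "\<tau> ^ n * a = f * c"
    using regular[of "\<tau> ^ n * a" b] Suc.prems(1,2) by auto
  then show ?case using Suc.IH Suc.prems by blast
qed auto

abbreviation "J k \<equiv> set_add (stalk q) (pw (stalk q) f (Suc 0)) (mp k)"

text \<open>By \<open>mp_Suc\<close>, the maximal-adic filtration becomes modulo f the filtration by
  powers of \<open>\<tau>\<close>.\<close>

lemma J_iff: "a \<in> J k \<longleftrightarrow> (\<exists>r\<in>R. \<exists>s\<in>R. a = f * r + \<tau> ^ k * s)"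
proof -
  have 1: "a \<in> J k \<longleftrightarrow> (\<exists>r\<in>R. \<exists>e\<in>mp k. a = f * r + e)"
    by (auto simp: set_add_def set_mult_def pw_def)
  show ?thesis
  proof
    assume "a \<in> J k"
    then obtain r e where r: "r \<in> R" "e \<in> mp k" "a = f * r + e" using 1 by blast
    show "\<exists>r\<in>R. \<exists>s\<in>R. a = f * r + \<tau> ^ k * s"
    proof (cases k)
      case 0
      then show ?thesis using r by auto
    next
      case (Suc k')
      obtain c b where c: "c \<in> R" "b \<in> mp k'" "e = \<tau> ^ k * c + f * b" using mp_Suc r(2) Suc by blast
      have "b \<in> R" by (rule M.I_carr[OF c(2)])
      then show ?thesis using r c
        by (intro bexI[of _ "r + b"] bexI[of _ c]) (auto simp: algebra_simps)
    qed
  next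
    assume "\<exists>r\<in>R. \<exists>s\<in>R. a = f * r + \<tau> ^ k * s"
    then show "a \<in> J k" using 1 mp_pow[OF \<tau>_max] by blast
  qed
qed

text \<open>Modulo f the stalk behaves as a discrete valuation ring with uniformizer
  \<open>\<tau>\<close>. At the last level \<open>i\<close> with \<open>r\<close> in
  \<open>J i\<close> the cofactor of the power of \<open>\<tau>\<close> is a unit, since otherwise
  \<open>r\<close> would lie in the next \<open>J\<close>.\<close>

lemma not_J: "r \<in> R \<Longrightarrow> r \<notin> J k \<Longrightarrow> \<exists>i<k. \<exists>u\<in>R. \<exists>c\<in>R. u \<notin> \<mm> \<and> r = \<tau> ^ i * u + f * c"
proof (induction k)
  case 0
  have "r = f * 0 + \<tau> ^ 0 * r" by simp
  then show ?case using 0 R_closed(2) unfolding J_iff by blast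
next
  case (Suc k)
  show ?case
  proof (cases "r \<in> J k")
    case False then show ?thesis using Suc less_Suc_eq by blast
  next
    case True
    then obtain c s where c: "c \<in> R" "s \<in> R" "r = f * c + \<tau> ^ k * s" unfolding J_iff by blast
    have "s \<notin> \<mm>"
    proof
      assume "s \<in> \<mm>"
      then obtain a b where ab: "a \<in> R" "b \<in> R" "s = \<tau> * a + f * b" by (elim maxE) blast
      have "r = f * (c + \<tau> ^ k * b) + \<tau> ^ Suc k * a" using c ab by (simp add: algebra_simps)
      moreover have "c + \<tau> ^ k * b \<in> R" using c ab by simp
      ultimately show False using Suc.prems(2) ab(1) unfolding J_iff by blast
    qed
    then show ?thesis using c by (intro exI[of _ k]) (auto simp: add.commute)
  qed
qed

lemma R_prod_notin_max: "u \<in> R \<Longrightarrow> v \<in> R \<Longrightarrow> u \<notin> \<mm> \<Longrightarrow> v \<notin> \<mm> \<Longrightarrow> u * v \<notin> \<mm>"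
proof
  assume uv: "u \<in> R" "v \<in> R" "u \<notin> \<mm>" "v \<notin> \<mm>" "u * v \<in> \<mm>"
  have "u * v * (inverse u * inverse v) \<in> \<mm>"
    by (rule max_mult[OF uv(5)]) (rule R_closed(4)[OF R_inverse[OF uv(1,3)] R_inverse[OF uv(2,4)]])
  moreover have "0 \<in> \<mm>" using max_mult[OF f_max, of 0] by simp
  then have "u \<noteq> 0" "v \<noteq> 0" using uv(3,4) by auto
  then have "u * v * (inverse u * inverse v) = 1" by (simp add: field_simps)
  ultimately show False using one_notin_max by simp
qed

lemma J_prime:
  assumes "a \<in> R" "b \<in> R" "a \<notin> J m" "b \<notin> J n"
  shows "a * b \<notin> J (m + n)"
proof
  assume ab: "a * b \<in> J (m + n)"
  obtain i u c where u: "i < m" "u \<in> R" "c \<in> R" "u \<notin> \<mm>" "a = \<tau> ^ i * u + f * c"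
    using not_J assms by blast
  obtain j v d where v: "j < n" "v \<in> R" "d \<in> R" "v \<notin> \<mm>" "b = \<tau> ^ j * v + f * d"
    using not_J assms by blast
  obtain r s where r: "r \<in> R" "s \<in> R" "a * b = f * r + \<tau> ^ (m + n) * s" using ab unfolding J_iff by blast
  \<comment> \<open>Since \<open>i < m\<close> and \<open>j < n\<close>, at least one factor
    \<open>\<tau>\<close> is left after cancelling \<open>i + j\<close> of them, enough to put
    \<open>u * v\<close> into the maximal ideal.\<close>
  define l where "l = m + n - Suc (i + j)"
  have l: "m + n = (i + j) + Suc l" using u(1) v(1) by (simp add: l_def)
  define g where "g = r - (\<tau> ^ i * u * d + c * b)"
  have bR: "b \<in> R" by fact
  have g: "g \<in> R" unfolding g_def using r u v bR by simp
  have "\<tau> ^ (i + j) * (u * v - \<tau> ^ Suc l * s) = f * g"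
    using r(3) unfolding l power_add[of \<tau> "i + j"] u(5) v(5) g_def by (simp add: algebra_simps power_add)
  moreover have "u * v - \<tau> ^ Suc l * s \<in> R" using u v r by simp
  ultimately obtain e where e: "e \<in> R" "u * v - \<tau> ^ Suc l * s = f * e" using regular_pow g by blast
  have "u * v = \<tau> * (\<tau> ^ l * s) + f * e" using e(2) by (simp add: algebra_simps)
  moreover have "\<tau> ^ l * s \<in> R" using r by simp
  ultimately have "u * v \<in> \<mm>" using maxI e(1) by metis
  then show False using R_prod_notin_max u v by blast
qed

lemma R_flag_ring: "flag_ring (stalk q) mp f"
proof (intro flag_ring.intro flag_ring_axioms.intro mp_filtered)
  show "f \<in> R" by (rule f_carr)
  show "mp 0 = R" by simp
  show "r \<in> mp k" if r: "r \<in> R" "f \<otimes>\<^bsub>stalk q\<^esub> r \<in> mp (Suc k)" for r k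
  proof -
    obtain a b where a: "a \<in> R" "b \<in> mp k" "f * r = \<tau> ^ Suc k * a + f * b"
      using mp_Suc[OF r(2)] by auto
    have b: "b \<in> R" by (rule M.I_carr[OF a(2)])
    \<comment> \<open>f divides the left side, hence \<open>a\<close> by regularity, and can then be
      cancelled from the whole equation.\<close>
    have "\<tau> ^ Suc k * a = f * (r - b)" using a(3) by (simp add: algebra_simps)
    then obtain c where c: "c \<in> R" "a = f * c" using regular_pow[OF a(1)] R_closed(3)[OF r(1) b] by blast
    have "f * r = f * (\<tau> ^ Suc k * c + b)" using a(3) c(2) by (simp add: algebra_simps)
    then have "r = \<tau> ^ k * (\<tau> * c) + b" using f_nz by (simp add: mult_ac)
    then show ?thesis using mp_add[OF mp_pow[OF \<tau>_max R_closed(4)[OF \<tau>_carr c(1)]] a(2)] by metis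
  qed
  show "f [^]\<^bsub>stalk q\<^esub> n \<otimes>\<^bsub>stalk q\<^esub> r \<in> mp n" if "r \<in> R" for r n
    using mp_pow[OF f_max that] by simp
  show "a \<otimes>\<^bsub>stalk q\<^esub> b \<notin> J (m + n)" if "a \<in> R" "b \<in> R" "a \<notin> J m" "b \<notin> J n" for a b m n
    using J_prime[OF that] by simp
  show "\<one>\<^bsub>stalk q\<^esub> \<notin> J (Suc 0)"
    using one_notin_max maxI unfolding J_iff by (auto simp: add.commute) (metis add.commute)
qed

end

sublocale local_flag \<subseteq> M: flag_ring "stalk q" "ideal_power (stalk q) (stalk_max q)" f
  by (rule R_flag_ring)

lemma (in local_flag) local_flag_pt: "flag_pt q f"
  by (rule flag_pt.intro) (unfold hat_stalk_def to_hat_def, rule M.completion_prime_elt)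

sublocale local_flag \<subseteq> flag_pt q f
  by (rule local_flag_pt)

section \<open>The stalk and the function field inside the completed rings\<close>

context local_flag
begin

lemma hat_eq: "hat_stalk q = M.Rh" and to_hat_eq: "to_hat q a = M.cls (\<lambda>_. a)"
  by (simp_all add: hat_stalk_def to_hat_def)

lemma to_hat_carr [simp]: "a \<in> R \<Longrightarrow> to_hat q a \<in> carrier H"
  unfolding hat_eq to_hat_eq by (rule M.cls_carr[OF M.CR_const])

lemma to_hat_add: "a \<in> R \<Longrightarrow> b \<in> R \<Longrightarrow> to_hat q (a + b) = to_hat q a \<oplus>\<^bsub>H\<^esub> to_hat q b"
  unfolding hat_eq to_hat_eq using M.cls_add[OF M.CR_const M.CR_const, of a b] by simp

lemma to_hat_mult: "a \<in> R \<Longrightarrow> b \<in> R \<Longrightarrow> to_hat q (a * b) = to_hat q a \<otimes>\<^bsub>H\<^esub> to_hat q b"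
  unfolding hat_eq to_hat_eq using M.cls_mult[OF M.CR_const M.CR_const, of a b] by simp

lemma to_hat_one: "to_hat q 1 = \<one>\<^bsub>H\<^esub>"
  unfolding hat_eq to_hat_eq using M.cls_one by simp

lemma to_hat_zero: "to_hat q 0 = \<zero>\<^bsub>H\<^esub>"
  unfolding hat_eq to_hat_eq using M.cls_zero by simp

lemma to_hat_pow: "a \<in> R \<Longrightarrow> to_hat q (a ^ n) = to_hat q a [^]\<^bsub>H\<^esub> n"
  by (induction n) (simp_all add: to_hat_one to_hat_mult H.m_comm)

text \<open>Divisibility by f in the completion gives divisibility up to a k-th power of
  \<open>\<tau>\<close> for every k, and \<open>sep\<close> turns this into divisibility in the
  stalk.\<close>

lemma to_hat_pw:
  assumes r: "r \<in> R" "to_hat q r \<in> pw H x (Suc 0)" shows "\<exists>c\<in>R. r = f * c"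
proof (rule sep[OF r(1)])
  fix k
  have "M.cls (\<lambda>_. r) \<in> pw M.Rh M.fh (Suc 0)" using r(2) unfolding hat_eq to_hat_eq .
  from M.fh_divides_J[OF M.CR_const[OF r(1)] this, of k] obtain M0 :: nat where "\<forall>i\<ge>M0. r \<in> J k" by blast
  then have "r \<in> J k" by blast
  then show "\<exists>a\<in>R. \<exists>b\<in>R. r = f * a + \<tau> ^ k * b" unfolding J_iff .
qed

text \<open>Injectivity of the stalk in its completion, by f-orders: r is f^N a/b with neither a nor
  b divisible by f, and if r became zero, then f would divide a in the completion and hence in the
  stalk.\<close>

lemma to_hat_nz:
  assumes r: "r \<in> R" "r \<noteq> 0" shows "to_hat q r \<noteq> \<zero>\<^bsub>H\<^esub>"
proof
  assume z: "to_hat q r = \<zero>\<^bsub>H\<^esub>"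
  obtain N a b where N: "a \<in> R" "b \<in> R" "\<nexists>c. c \<in> R \<and> a = f * c" "\<nexists>c. c \<in> R \<and> b = f * c"
    "r = f powi N * (a / b)" using FF_factor R_FF r by blast
  have b0: "b \<noteq> 0" using N(4) R_closed(2) by force
  show False
  proof (cases "N < 0")
    case True
    \<comment> \<open>A negative order contradicts r lying in the stalk: a would be a multiple of
      f.\<close>
    obtain m where m: "- N = int (Suc m)" using True by (metis add.inverse_neutral neg_less_iff_less zero_less_imp_eq_int gr0_implies_Suc)
    have "f powi N = inverse (f ^ Suc m)" using m by (metis add.inverse_inverse power_int_minus power_int_of_nat)
    then have "f * (f ^ m * r * b) = f ^ Suc m * (inverse (f ^ Suc m) * (a / b)) * b"
      unfolding N(5) by (simp add: mult_ac)
    also have "\<dots> = a" using b0 f_nz by (simp add: field_simps)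
    finally have "a = f * (f ^ m * r * b)" ..
    moreover have "f ^ m * r * b \<in> R" using r(1) N(2) by simp
    ultimately show False using N(3) by blast
  next
    case False
    then obtain n where n: "N = int n" by (metis not_less nonneg_int_cases)
    have "r * b = f ^ n * a" using N(5) b0 n by simp
    then have "to_hat q r \<otimes>\<^bsub>H\<^esub> to_hat q b = x [^]\<^bsub>H\<^esub> n \<otimes>\<^bsub>H\<^esub> to_hat q a"
      using r(1) N(1,2) by (metis to_hat_mult to_hat_pow f_carr R_closed(7))
    then have "x [^]\<^bsub>H\<^esub> n \<otimes>\<^bsub>H\<^esub> to_hat q a = \<zero>\<^bsub>H\<^esub>" using z N(2) by simp
    then have "x [^]\<^bsub>H\<^esub> n \<otimes>\<^bsub>H\<^esub> to_hat q a \<in> pw H x (n + Suc 0)" using H.zero_pw by metis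
    then have "to_hat q a \<in> pw H x (Suc 0)" by (rule H.pw_xn_cancel[OF to_hat_carr[OF N(1)]])
    then show False using to_hat_pw[OF N(1)] N(3) by blast
  qed
qed

definition "e r = \<eta> (to_hat q r)"

lemma e_carr [simp]: "r \<in> R \<Longrightarrow> e r \<in> carrier K"
  unfolding e_def by (simp add: \<eta>_simps)

lemma e_add: "r \<in> R \<Longrightarrow> s \<in> R \<Longrightarrow> e (r + s) = e r \<oplus>\<^bsub>K\<^esub> e s"
  unfolding e_def by (simp add: to_hat_add \<eta>_simps)

lemma e_mult: "r \<in> R \<Longrightarrow> s \<in> R \<Longrightarrow> e (r * s) = e r \<otimes>\<^bsub>K\<^esub> e s"
  unfolding e_def by (simp add: to_hat_mult \<eta>_simps)

lemma e_one: "e 1 = \<one>\<^bsub>K\<^esub>"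
  unfolding e_def by (simp add: to_hat_one \<eta>_simps)

lemma e_zero: "e 0 = \<zero>\<^bsub>K\<^esub>"
  unfolding e_def by (simp add: to_hat_zero \<eta>_zero)

lemma e_f: "e f = X"
  unfolding e_def X_def ..

lemma e_pow: "r \<in> R \<Longrightarrow> e (r ^ n) = e r [^]\<^bsub>K\<^esub> n"
  by (induction n) (simp_all add: e_one e_mult K.m_comm)

lemma e_filt: "r \<in> R \<Longrightarrow> e r \<in> filt 0"
  unfolding e_def using \<eta>_filt[of "to_hat q r" 0] by (simp add: H.pw_0)

lemma e_unit: "r \<in> R \<Longrightarrow> r \<noteq> 0 \<Longrightarrow> e r \<in> Units K"
  unfolding e_def by (rule \<eta>_unit[OF to_hat_carr to_hat_nz])

lemma e_cancel: 
  assumes "z \<in> carrier K" "w \<in> carrier K" "r \<in> R" "r \<noteq> 0" "z \<otimes>\<^bsub>K\<^esub> e r = w \<otimes>\<^bsub>K\<^esub> e r"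
  shows "z = w"
proof -
  have "e r \<otimes>\<^bsub>K\<^esub> z = e r \<otimes>\<^bsub>K\<^esub> w" using assms K.m_comm by simp
  then show ?thesis using K.Units_l_cancel[OF e_unit[OF assms(3,4)] assms(1,2)] by simp
qed

lemma FF_frac: assumes "r \<in> carrier function_field" obtains a b where "a \<in> R" "b \<in> R" "b \<noteq> 0" "r = a / b"
proof (cases "r = 0")
  case True then show ?thesis using that[of 0 1] by simp
next
  case False
  obtain N a b where N: "a \<in> R" "b \<in> R" "\<nexists>c. c \<in> R \<and> a = f * c" "\<nexists>c. c \<in> R \<and> b = f * c"
    "r = f powi N * (a / b)" using FF_factor[OF assms False] by blast
  have b0: "b \<noteq> 0" using N(4) R_closed(2) by force
  show ?thesis
  proof (cases "N \<ge> 0")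
    case True
    then obtain n where "N = int n" by (metis nonneg_int_cases)
    then have "r = (f ^ n * a) / b" using N(5) by simp
    then show ?thesis using that[of "f ^ n * a" b] N b0 by simp
  next
    case False
    then obtain n where "- N = int n" by (metis linorder_not_le nonneg_int_cases neg_0_le_iff_le order_less_imp_le)
    then have "f powi N = inverse (f ^ n)" by (metis add.inverse_inverse power_int_minus power_int_of_nat)
    then have "r = a / (f ^ n * b)" unfolding N(5) by (simp add: field_simps)
    then show ?thesis using that[of a "f ^ n * b"] N b0 f_nz by simp
  qed
qed

abbreviation "\<rho> \<equiv> rat_to_K_flag q f"

lemma \<rho>_frac:
  assumes ab: "a \<in> R" "b \<in> R" "b \<noteq> 0"
  shows "\<rho> (a / b) = e a \<otimes>\<^bsub>K\<^esub> inv\<^bsub>K\<^esub> e b"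
  unfolding rat_to_K_flag_def
proof (rule the_equality)
  show "\<exists>c\<in>R. \<exists>d\<in>R. d \<noteq> 0 \<and> a / b = c / d \<and>
      e a \<otimes>\<^bsub>K\<^esub> inv\<^bsub>K\<^esub> e b = \<eta> (to_hat q c) \<otimes>\<^bsub>K\<^esub> inv\<^bsub>K\<^esub> \<eta> (to_hat q d)"
    using ab unfolding e_def by blast
next
  fix h assume "\<exists>c\<in>R. \<exists>d\<in>R. d \<noteq> 0 \<and> a / b = c / d \<and> h = \<eta> (to_hat q c) \<otimes>\<^bsub>K\<^esub> inv\<^bsub>K\<^esub> \<eta> (to_hat q d)"
  then obtain c d where cd: "c \<in> R" "d \<in> R" "d \<noteq> 0" "a / b = c / d" "h = e c \<otimes>\<^bsub>K\<^esub> inv\<^bsub>K\<^esub> e d"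
    unfolding e_def by blast
  have u: "e b \<in> Units K" "e d \<in> Units K" using e_unit ab cd by auto
  have "c * b = a * d" using cd ab by (simp add: field_simps)
  then have eq: "e c \<otimes>\<^bsub>K\<^esub> e b = e a \<otimes>\<^bsub>K\<^esub> e d" using ab cd by (metis e_mult)
  have ic: "inv\<^bsub>K\<^esub> e d \<in> carrier K" "inv\<^bsub>K\<^esub> e b \<in> carrier K" using u by simp_all
  have "h = e c \<otimes>\<^bsub>K\<^esub> e b \<otimes>\<^bsub>K\<^esub> inv\<^bsub>K\<^esub> e b \<otimes>\<^bsub>K\<^esub> inv\<^bsub>K\<^esub> e d"
    unfolding cd(5) using ab cd ic u by (simp add: K.m_assoc)
  also have "\<dots> = e a \<otimes>\<^bsub>K\<^esub> inv\<^bsub>K\<^esub> e b \<otimes>\<^bsub>K\<^esub> (e d \<otimes>\<^bsub>K\<^esub> inv\<^bsub>K\<^esub> e d)"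
    unfolding eq using e_carr[OF ab(1)] e_carr[OF cd(2)] ic by algebra
  also have "\<dots> = e a \<otimes>\<^bsub>K\<^esub> inv\<^bsub>K\<^esub> e b" using u ab ic by simp
  finally show "h = e a \<otimes>\<^bsub>K\<^esub> inv\<^bsub>K\<^esub> e b" .
qed

lemma \<rho>_FK: assumes "r \<in> carrier function_field" shows "\<rho> r \<in> FK"
proof -
  obtain a b where ab: "a \<in> R" "b \<in> R" "b \<noteq> 0" "r = a / b" using assms by (rule FF_frac)
  show ?thesis unfolding ab(4) \<rho>_frac[OF ab(1-3)] FK_def e_def
    using to_hat_nz[OF ab(2,3)] to_hat_carr[OF ab(1)] to_hat_carr[OF ab(2)] by blast
qed

lemma \<rho>_carr [simp]: "r \<in> carrier function_field \<Longrightarrow> \<rho> r \<in> carrier K"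
  by (rule FK_carr[OF \<rho>_FK])

text \<open>Describes the image independently of the fraction chosen for r; identities for
  \<open>\<rho>\<close> are then proved by clearing denominators and applying
  \<open>e_cancel\<close>.\<close>

lemma \<rho>_char: 
  assumes "r \<in> carrier function_field" "a \<in> R" "b \<in> R" "r * b = a"
  shows "\<rho> r \<otimes>\<^bsub>K\<^esub> e b = e a"
proof -
  obtain c d where cd: "c \<in> R" "d \<in> R" "d \<noteq> 0" "r = c / d" using assms(1) by (rule FF_frac)
  have u: "e d \<in> Units K" "inv\<^bsub>K\<^esub> e d \<in> carrier K" using e_unit cd by auto
  have "c * b = a * d" using assms(4) cd by (simp add: field_simps)
  then have eq: "e c \<otimes>\<^bsub>K\<^esub> e b = e a \<otimes>\<^bsub>K\<^esub> e d" using assms cd by (metis e_mult)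
  have "\<rho> r \<otimes>\<^bsub>K\<^esub> e b = (e c \<otimes>\<^bsub>K\<^esub> e b) \<otimes>\<^bsub>K\<^esub> inv\<^bsub>K\<^esub> e d"
    unfolding cd(4) \<rho>_frac[OF cd(1-3)] using e_carr[OF cd(1)] e_carr[OF assms(3)] u(2) by algebra
  also have "\<dots> = e a" unfolding eq using u assms(2) cd(2) by (simp add: K.m_assoc)
  finally show ?thesis .
qed

lemma \<rho>_R: "r \<in> R \<Longrightarrow> \<rho> r = e r"
  using \<rho>_char[of r r 1] R_FF by (auto simp: e_one)

lemma \<rho>_mult: assumes "r \<in> carrier function_field" "s \<in> carrier function_field"
  shows "\<rho> (r * s) = \<rho> r \<otimes>\<^bsub>K\<^esub> \<rho> s"
proof -
  obtain a b where ab: "a \<in> R" "b \<in> R" "b \<noteq> 0" "r = a / b" using assms(1) by (rule FF_frac)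
  obtain c d where cd: "c \<in> R" "d \<in> R" "d \<noteq> 0" "s = c / d" using assms(2) by (rule FF_frac)
  have 1: "\<rho> r \<otimes>\<^bsub>K\<^esub> e b = e a" "\<rho> s \<otimes>\<^bsub>K\<^esub> e d = e c" using \<rho>_char assms ab cd by auto
  have 2: "\<rho> (r * s) \<otimes>\<^bsub>K\<^esub> e (b * d) = e (a * c)"
    by (rule \<rho>_char[OF FF_closed(4)[OF assms]]) (use ab cd in \<open>auto simp: field_simps\<close>)
  have "\<rho> r \<otimes>\<^bsub>K\<^esub> \<rho> s \<otimes>\<^bsub>K\<^esub> e (b * d) = (\<rho> r \<otimes>\<^bsub>K\<^esub> e b) \<otimes>\<^bsub>K\<^esub> (\<rho> s \<otimes>\<^bsub>K\<^esub> e d)"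
    unfolding e_mult[OF ab(2) cd(2)]
    using \<rho>_carr[OF assms(1)] \<rho>_carr[OF assms(2)] e_carr[OF ab(2)] e_carr[OF cd(2)] by algebra
  also have "\<dots> = e (a * c)" unfolding 1 using ab cd by (simp add: e_mult)
  finally have 3: "\<rho> r \<otimes>\<^bsub>K\<^esub> \<rho> s \<otimes>\<^bsub>K\<^esub> e (b * d) = e (a * c)" .
  show ?thesis
    by (rule e_cancel[OF \<rho>_carr[OF FF_closed(4)[OF assms]] _ R_closed(4)[OF ab(2) cd(2)]])
      (use assms ab(3) cd(3) 2 3 in simp_all)
qed

lemma \<rho>_add: assumes "r \<in> carrier function_field" "s \<in> carrier function_field"
  shows "\<rho> (r + s) = \<rho> r \<oplus>\<^bsub>K\<^esub> \<rho> s"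
proof -
  obtain a b where ab: "a \<in> R" "b \<in> R" "b \<noteq> 0" "r = a / b" using assms(1) by (rule FF_frac)
  obtain c d where cd: "c \<in> R" "d \<in> R" "d \<noteq> 0" "s = c / d" using assms(2) by (rule FF_frac)
  have 1: "\<rho> r \<otimes>\<^bsub>K\<^esub> e b = e a" "\<rho> s \<otimes>\<^bsub>K\<^esub> e d = e c" using \<rho>_char assms ab cd by auto
  have 2: "\<rho> (r + s) \<otimes>\<^bsub>K\<^esub> e (b * d) = e (a * d + c * b)"
    by (rule \<rho>_char[OF FF_closed(6)[OF assms]]) (use ab cd in \<open>auto simp: field_simps\<close>)
  have "(\<rho> r \<oplus>\<^bsub>K\<^esub> \<rho> s) \<otimes>\<^bsub>K\<^esub> e (b * d) = (\<rho> r \<otimes>\<^bsub>K\<^esub> e b) \<otimes>\<^bsub>K\<^esub> e d \<oplus>\<^bsub>K\<^esub> (\<rho> s \<otimes>\<^bsub>K\<^esub> e d) \<otimes>\<^bsub>K\<^esub> e b"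
    unfolding e_mult[OF ab(2) cd(2)]
    using \<rho>_carr[OF assms(1)] \<rho>_carr[OF assms(2)] e_carr[OF ab(2)] e_carr[OF cd(2)] by algebra
  also have "\<dots> = e (a * d + c * b)" unfolding 1 using ab cd by (simp add: e_mult e_add)
  finally have 3: "(\<rho> r \<oplus>\<^bsub>K\<^esub> \<rho> s) \<otimes>\<^bsub>K\<^esub> e (b * d) = e (a * d + c * b)" .
  show ?thesis
    by (rule e_cancel[OF \<rho>_carr[OF FF_closed(6)[OF assms]] _ R_closed(4)[OF ab(2) cd(2)]])
      (use assms ab(3) cd(3) 2 3 in simp_all)
qed

lemma \<rho>_minus: assumes "r \<in> carrier function_field" "s \<in> carrier function_field"
  shows "\<rho> (r - s) = \<rho> r \<ominus>\<^bsub>K\<^esub> \<rho> s"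
proof -
  have "\<rho> r = \<rho> (r - s) \<oplus>\<^bsub>K\<^esub> \<rho> s" using \<rho>_add[of "r - s" s] assms by (simp add: FF_closed)
  then show ?thesis using assms by (simp add: a_minus_def K.a_assoc K.r_neg FF_closed)
qed

lemma val_filt_FF: "r \<in> val_filt F n \<Longrightarrow> r \<in> carrier function_field"
  by (simp add: val_filt_def)

text \<open>An element prime to f is already a unit of \<open>loc_hat\<close>, so its inverse is
  integral.\<close>

lemma e_notf: assumes "r \<in> R" "\<nexists>c. c \<in> R \<and> r = f * c" shows "inv\<^bsub>K\<^esub> e r \<in> filt 0" "r \<noteq> 0"
proof -
  show r0: "r \<noteq> 0" using assms(2) R_closed(2) by force
  have n: "to_hat q r \<notin> pw H x (Suc 0)" using to_hat_pw[OF assms(1)] assms(2) by blast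
  then have d: "to_hat q r \<in> carrier H - pw H x (Suc 0)" using assms(1) by simp
  have c: "H.L.fr \<one>\<^bsub>H\<^esub> (to_hat q r) \<in> carrier A" by (rule fr_A_carr[OF H.one_closed d])
  have "e r \<otimes>\<^bsub>K\<^esub> \<eta>A (H.L.fr \<one>\<^bsub>H\<^esub> (to_hat q r)) = \<one>\<^bsub>K\<^esub>"
    unfolding e_def using \<eta>A_inverse[OF d H.one_closed] \<eta>_simps(4) by simp
  then have "inv\<^bsub>K\<^esub> e r = \<eta>A (H.L.fr \<one>\<^bsub>H\<^esub> (to_hat q r))"
    using K.inv_unique'[of "e r" "\<eta>A (H.L.fr \<one>\<^bsub>H\<^esub> (to_hat q r))"] e_carr[OF assms(1)] \<eta>A_simps(1)[OF c] K.m_comm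
    by metis
  then show "inv\<^bsub>K\<^esub> e r \<in> filt 0" using \<eta>A_filt[OF c, of 0] c by (simp add: A.pw_0)
qed

text \<open>Continuity of the embedding of the function field. In the normal form of
  \<open>FF_factor\<close> the denominator has an integral inverse, so the image is f^N times an
  integral element.\<close>

lemma \<rho>_filt: assumes "r \<in> val_filt F n" shows "\<rho> r \<in> filt n"
proof (cases "r = 0")
  case True then show ?thesis using \<rho>_R[of 0] e_zero filt_zero by simp
next
  case False
  obtain N a b where N: "a \<in> R" "b \<in> R" "\<nexists>c. c \<in> R \<and> b = f * c"
    "r = f powi N * (a / b)" "r \<in> val_filt F n \<longleftrightarrow> int n \<le> N"
    using FF_factor[OF val_filt_FF[OF assms] False] by blast
  have nN: "int n \<le> N" using N(5) assms by simp
  define m where "m = nat N"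
  have m: "N = int m" "n \<le> m" using nN by (simp_all add: m_def)
  have r: "r = (f ^ m * a) / b" using N(4) m by simp
  have fm: "f ^ m * a \<in> R" using N by simp
  have b: "inv\<^bsub>K\<^esub> e b \<in> filt 0" "b \<noteq> 0" using e_notf N by auto
  have "\<rho> r = X [^]\<^bsub>K\<^esub> m \<otimes>\<^bsub>K\<^esub> (e a \<otimes>\<^bsub>K\<^esub> inv\<^bsub>K\<^esub> e b)"
    unfolding r \<rho>_frac[OF fm N(2) b(2)] using N(1,2) b e_unit[of b] X_carr
    by (simp add: e_mult e_pow e_f K.m_assoc)
  also have "\<dots> \<in> filt (m + (0 + 0))" by (intro X_filt filt_mult e_filt N(1) b(1))
  finally show ?thesis using filt_mono[OF m(2)] by auto
qed

subsection \<open>The completion along the curve\<close>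

abbreviation "FFC \<equiv> carrier (cauchy_ring function_field (val_filt F))"
abbreviation "kcls \<equiv> cauchy_class function_field (val_filt F)"

lemma FF_minus:
  fixes r s :: "'a poly3 fract"
  assumes "r \<in> carrier function_field" "s \<in> carrier function_field"
  shows "r \<ominus>\<^bsub>function_field\<^esub> s = r - s"
proof -
  have eq: "(function_field :: 'a poly3 fract ring) = ring_on (carrier function_field)" by (simp add: stalk_def)
  show ?thesis by (subst eq) (rule ring_on_minus[OF FF_sub assms])
qed

lemma FFC_iff: "s \<in> FFC \<longleftrightarrow> (\<forall>i. s i \<in> carrier function_field) \<and>
    (\<forall>n. \<exists>M. \<forall>i\<ge>M. \<forall>j\<ge>M. s i - s j \<in> val_filt F n)"
  by (auto simp: cauchy_ring_def image_subset_iff FF_minus)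

lemma kcls_D: "s' \<in> kcls s \<Longrightarrow> s \<in> FFC \<Longrightarrow> (\<forall>i. s' i \<in> carrier function_field) \<and>
    (\<forall>n. \<exists>M. \<forall>i\<ge>M. s' i - s i \<in> val_filt F n)"
proof -
  have ops: "a \<oplus>\<^bsub>function_field\<^esub> b = a + b" "\<zero>\<^bsub>function_field\<^esub> = (0 :: 'a poly3 fract)" for a b :: "'a poly3 fract"
    by (simp_all add: stalk_def)
  assume s': "s' \<in> kcls s" and s: "s \<in> FFC"
  then obtain n where n: "n \<in> null_seqs function_field (val_filt F)" "s' = (\<lambda>i. n i + s i)"
    by (auto simp: cauchy_class_def a_r_coset_def r_coset_def cauchy_ring_def ops)
  have nC: "n i \<in> carrier function_field" for i using n(1) FFC_iff by (auto simp: null_seqs_def)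
  have "\<exists>M. \<forall>i\<ge>M. n i \<in> val_filt F k" for k
  proof -
    have "n i \<ominus>\<^bsub>function_field\<^esub> \<zero>\<^bsub>function_field\<^esub> = n i" for i
      using FF_minus[OF nC FF_closed(2)] unfolding ops by simp
    then show ?thesis using n(1) by (simp add: null_seqs_def converges_to_def)
  qed
  then show ?thesis using n(2) s nC by (simp add: FF_closed FFC_iff)
qed

lemma kcls_self: "s \<in> FFC \<Longrightarrow> s \<in> kcls s"
proof -
  have ops: "a \<oplus>\<^bsub>function_field\<^esub> b = a + b" "\<zero>\<^bsub>function_field\<^esub> = (0 :: 'a poly3 fract)" for a b :: "'a poly3 fract"
    by (simp_all add: stalk_def)
  have "(\<lambda>_. 0) \<in> null_seqs function_field (val_filt F)"
    unfolding null_seqs_def converges_to_def ops using FF_closed(2) val_zero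
    by (auto simp: FFC_iff FF_minus)
  then show ?thesis
    by (auto simp: cauchy_class_def a_r_coset_def r_coset_def cauchy_ring_def ops intro!: bexI[of _ "\<lambda>_. 0"])
qed

lemma K_curve_carrier: "carrier (K_curve F) = kcls ` FFC"
  by (auto simp: K_curve_def completion_def FactRing_def A_RCOSETS_def' cauchy_class_def)

abbreviation "\<kappa> \<equiv> K_curve_to_K_flag q f"

text \<open>\<open>K_curve_to_K_flag\<close> demands convergence along every representative.
  Representatives differ by null sequences, and these stay null by
  \<open>\<rho>_filt\<close>.\<close>

lemma \<kappa>_eq:
  assumes s: "s \<in> FFC" and h: "h \<in> carrier K" "converges_to K filt (\<lambda>i. \<rho> (s i)) h"
  shows "\<kappa> (kcls s) = h"
  unfolding K_curve_to_K_flag_def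
proof (rule the_equality, intro conjI ballI)
  show "h \<in> carrier K" by fact
  fix s' assume "s' \<in> kcls s"
  note s' = kcls_D[OF this s]
  have "\<exists>M. \<forall>i\<ge>M. \<rho> (s' i) \<ominus>\<^bsub>K\<^esub> h \<in> filt n" for n
  proof -
    obtain M1 M2 where M: "\<forall>i\<ge>M1. s' i - s i \<in> val_filt F n" "\<forall>i\<ge>M2. \<rho> (s i) \<ominus>\<^bsub>K\<^esub> h \<in> filt n"
      using s' h(2) unfolding converges_to_def by meson
    have "\<rho> (s' i) \<ominus>\<^bsub>K\<^esub> h \<in> filt n" if i: "i \<ge> max M1 M2" for i
    proof -
      have c: "s i \<in> carrier function_field" "s' i \<in> carrier function_field" using s s' by (auto simp: FFC_iff)
      have "\<rho> (s' i) \<ominus>\<^bsub>K\<^esub> h = (\<rho> (s' i) \<ominus>\<^bsub>K\<^esub> \<rho> (s i)) \<oplus>\<^bsub>K\<^esub> (\<rho> (s i) \<ominus>\<^bsub>K\<^esub> h)"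
        using \<rho>_carr[OF c(1)] \<rho>_carr[OF c(2)] h(1) by algebra
      also have "\<dots> \<in> filt n"
        using M i \<rho>_filt[of "s' i - s i" n] by (intro filt_add) (simp_all add: \<rho>_minus[OF c(2,1)])
      finally show ?thesis .
    qed
    then show ?thesis by blast
  qed
  then show "converges_to K filt (\<lambda>i. \<rho> (s' i)) h" unfolding converges_to_def by blast
next
  fix h' assume h': "h' \<in> carrier K \<and> (\<forall>s\<in>kcls s. converges_to K filt (\<lambda>i. \<rho> (s i)) h')"
  show "h' = h"
    by (rule limit_unique[of h' h "\<lambda>i. \<rho> (s i)"]) (use h h' kcls_self[OF s] s in \<open>auto simp: FFC_iff\<close>)
qed

lemma \<kappa>_spec:
  assumes s: "s \<in> FFC"
  shows "\<kappa> (kcls s) \<in> carrier K" "converges_to K filt (\<lambda>i. \<rho> (s i)) (\<kappa> (kcls s))"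
proof -
  have c: "s i \<in> carrier function_field" for i using s by (simp add: FFC_iff)
  have "\<exists>h\<in>carrier K. converges_to K filt (\<lambda>i. \<rho> (s i)) h"
  proof (rule limit_exists)
    show "\<rho> (s i) \<in> FK" for i by (rule \<rho>_FK[OF c])
    fix n obtain M where "\<forall>i\<ge>M. \<forall>j\<ge>M. s i - s j \<in> val_filt F n" using s unfolding FFC_iff by meson
    then show "\<exists>M. \<forall>i\<ge>M. \<forall>j\<ge>M. \<rho> (s i) \<ominus>\<^bsub>K\<^esub> \<rho> (s j) \<in> filt n"
      using \<rho>_filt by (metis \<rho>_minus c)
  qed
  then obtain h where "h \<in> carrier K" "converges_to K filt (\<lambda>i. \<rho> (s i)) h" by blast
  then show "\<kappa> (kcls s) \<in> carrier K" "converges_to K filt (\<lambda>i. \<rho> (s i)) (\<kappa> (kcls s))"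
    using \<kappa>_eq[OF s] by auto
qed

section \<open>The image of B_q in K_q,C\<close>

lemma B_mult_subset: "mult_subset H (powers H x)"
proof (intro mult_subset.intro mult_subset_axioms.intro)
  show "domain H" by (rule H.domain_axioms)
  show "s \<in> carrier H" if "s \<in> powers H x" for s using that H.x_carr by (auto simp: powers_def)
  show "\<one>\<^bsub>H\<^esub> \<in> powers H x" unfolding powers_def by (rule range_eqI[of _ _ "0::nat"]) simp
  show "s \<otimes>\<^bsub>H\<^esub> t \<in> powers H x" if "s \<in> powers H x" "t \<in> powers H x" for s t
    using that H.x_carr H.nat_pow_mult by (auto simp: powers_def)
  have "to_hat q (f ^ n) \<noteq> \<zero>\<^bsub>H\<^esub>" for n by (rule to_hat_nz) (simp_all add: f_nz)
  then show "\<zero>\<^bsub>H\<^esub> \<notin> powers H x" unfolding powers_def using to_hat_pow[OF f_carr] by auto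
qed

text \<open>Removes the localization and the definite description from the condition that defines W;
  what remains can be tested on limits of sequences.\<close>

lemma B_image_iff: "h \<in> B_to_K_flag q f ` carrier (B_ring q f) \<longleftrightarrow>
    h \<in> carrier K \<and> (\<exists>n::nat. \<exists>a\<in>carrier H. X [^]\<^bsub>K\<^esub> n \<otimes>\<^bsub>K\<^esub> h = \<eta> a)"
proof -
  interpret B: mult_subset H "powers H x" by (rule B_mult_subset)
  have to_E: "to_int_ring q f a \<in> carrier E" "\<eta>E (to_int_ring q f a) = \<eta> a" if "a \<in> carrier H" for a
  proof -
    have "to_loc_hat q f a \<in> carrier A" unfolding A_eq to_A_eq by (rule H.L.fr_carr[OF that H.L.S_one])
    then show "to_int_ring q f a \<in> carrier E"
      unfolding int_ring_def to_int_ring_def by (intro AF.cls_carr AF.CR_const)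
    show "\<eta>E (to_int_ring q f a) = \<eta> a" unfolding \<eta>_eq \<eta>A_def to_int_ring_def ..
  qed
  have to_E_pow: "to_int_ring q f (x [^]\<^bsub>H\<^esub> n) = xE [^]\<^bsub>E\<^esub> n" for n :: nat
  proof -
    have "\<eta>E (to_int_ring q f (x [^]\<^bsub>H\<^esub> n)) = \<eta>E (xE [^]\<^bsub>E\<^esub> n)"
      using to_E(2)[of "x [^]\<^bsub>H\<^esub> n"] H.x_carr by (simp add: \<eta>_pow X_pow[symmetric] X_def)
    then show ?thesis using \<eta>E_inj to_E(1)[of "x [^]\<^bsub>H\<^esub> n"] H.x_carr E.x_carr by simp
  qed
  have frac: "K_flag_frac q f (to_int_ring q f a) (to_int_ring q f (x [^]\<^bsub>H\<^esub> n)) = h \<longleftrightarrow>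
      h \<in> carrier K \<and> X [^]\<^bsub>K\<^esub> n \<otimes>\<^bsub>K\<^esub> h = \<eta> a" if a: "a \<in> carrier H" for a h and n :: nat
  proof -
    have p: "xE [^]\<^bsub>E\<^esub> n \<in> powers E xE" by (auto simp: powers_def)
    define h0 where "h0 = KL.fr (to_int_ring q f a) (xE [^]\<^bsub>E\<^esub> n)"
    have h0: "h0 \<in> carrier K" unfolding h0_def K_eq by (rule KL.fr_carr[OF to_E(1)[OF a] p])
    have "X [^]\<^bsub>K\<^esub> n \<otimes>\<^bsub>K\<^esub> h0 = KL.fr (xE [^]\<^bsub>E\<^esub> n \<otimes>\<^bsub>E\<^esub> to_int_ring q f a) (\<one>\<^bsub>E\<^esub> \<otimes>\<^bsub>E\<^esub> xE [^]\<^bsub>E\<^esub> n)"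
      unfolding X_pow unfolding \<eta>E_def K_frac_eq K_eq h0_def by (rule KL.fr_mult[OF KL.S_carr[OF p] KL.S_one to_E(1)[OF a] p])
    also have "\<dots> = \<eta>E (to_int_ring q f a)" unfolding \<eta>E_def K_frac_eq
      using KL.S_carr[OF p] to_E(1)[OF a] KL.S_one p by (subst KL.fr_eq) (auto simp: KL.S_mult E.m_comm)
    finally have 1: "X [^]\<^bsub>K\<^esub> n \<otimes>\<^bsub>K\<^esub> h0 = \<eta> a" using to_E(2)[OF a] by simp
    have "h0 = h \<longleftrightarrow> h \<in> carrier K \<and> X [^]\<^bsub>K\<^esub> n \<otimes>\<^bsub>K\<^esub> h = \<eta> a"
      using 1 h0 K.Units_l_cancel[OF X_pow_unit] by metis
    then show ?thesis unfolding to_E_pow K_frac_eq h0_def .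
  qed
  have BK: "B_to_K_flag q f (B.fr a (x [^]\<^bsub>H\<^esub> n)) = K_flag_frac q f (to_int_ring q f a) (to_int_ring q f (x [^]\<^bsub>H\<^esub> n))"
    if a: "a \<in> carrier H" for a and n :: nat
    unfolding B_to_K_flag_def
  proof (rule the_equality)
    show "\<exists>b\<in>carrier H. \<exists>s\<in>powers H x. B.fr a (x [^]\<^bsub>H\<^esub> n) = B.fr b s \<and>
        K_flag_frac q f (to_int_ring q f a) (to_int_ring q f (x [^]\<^bsub>H\<^esub> n)) =
        K_flag_frac q f (to_int_ring q f b) (to_int_ring q f s)"
      using a by (intro bexI[of _ a] bexI[of _ "x [^]\<^bsub>H\<^esub> n"]) (auto simp: powers_def)
    fix h assume "\<exists>b\<in>carrier H. \<exists>s\<in>powers H x. B.fr a (x [^]\<^bsub>H\<^esub> n) = B.fr b s \<and>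
        h = K_flag_frac q f (to_int_ring q f b) (to_int_ring q f s)"
    then obtain b m where b: "b \<in> carrier H" "B.fr a (x [^]\<^bsub>H\<^esub> n) = B.fr b (x [^]\<^bsub>H\<^esub> (m::nat))"
        "h = K_flag_frac q f (to_int_ring q f b) (to_int_ring q f (x [^]\<^bsub>H\<^esub> m))"
      by (auto simp: powers_def)
    have p: "x [^]\<^bsub>H\<^esub> n \<in> powers H x" "x [^]\<^bsub>H\<^esub> m \<in> powers H x" by (auto simp: powers_def)
    have "a \<otimes>\<^bsub>H\<^esub> x [^]\<^bsub>H\<^esub> m = b \<otimes>\<^bsub>H\<^esub> x [^]\<^bsub>H\<^esub> n" using B.fr_eq[OF a p(1) b(1) p(2)] b(2) by simp
    then have "\<eta> (a \<otimes>\<^bsub>H\<^esub> x [^]\<^bsub>H\<^esub> m) = \<eta> (b \<otimes>\<^bsub>H\<^esub> x [^]\<^bsub>H\<^esub> n)" by simp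
    then have eq: "\<eta> a \<otimes>\<^bsub>K\<^esub> X [^]\<^bsub>K\<^esub> m = \<eta> b \<otimes>\<^bsub>K\<^esub> X [^]\<^bsub>K\<^esub> n"
      using a b(1) H.x_carr by (simp add: \<eta>_simps \<eta>_pow X_def)
    have h: "h \<in> carrier K" "X [^]\<^bsub>K\<^esub> m \<otimes>\<^bsub>K\<^esub> h = \<eta> b" using frac[OF b(1), of m h] b(3) by auto
    have Xc: "X [^]\<^bsub>K\<^esub> n \<in> carrier K" "X [^]\<^bsub>K\<^esub> m \<in> carrier K" using X_carr by auto
    have "X [^]\<^bsub>K\<^esub> m \<otimes>\<^bsub>K\<^esub> (X [^]\<^bsub>K\<^esub> n \<otimes>\<^bsub>K\<^esub> h) = X [^]\<^bsub>K\<^esub> n \<otimes>\<^bsub>K\<^esub> (X [^]\<^bsub>K\<^esub> m \<otimes>\<^bsub>K\<^esub> h)"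
      using Xc h(1) by algebra
    also have "\<dots> = X [^]\<^bsub>K\<^esub> m \<otimes>\<^bsub>K\<^esub> \<eta> a"
      unfolding h(2) using eq Xc \<eta>_simps(1)[OF a] \<eta>_simps(1)[OF b(1)] by (simp add: K.m_comm)
    finally have "X [^]\<^bsub>K\<^esub> n \<otimes>\<^bsub>K\<^esub> h = \<eta> a"
      using K.Units_l_cancel[OF X_pow_unit[of m]] Xc h(1) \<eta>_simps(1)[OF a] by simp
    then show "h = K_flag_frac q f (to_int_ring q f a) (to_int_ring q f (x [^]\<^bsub>H\<^esub> n))"
      using frac[OF a, of n h] h(1) by simp
  qed
  show ?thesis
  proof
    assume "h \<in> B_to_K_flag q f ` carrier (B_ring q f)"
    then obtain b where b: "b \<in> carrier (B_ring q f)" "h = B_to_K_flag q f b" by blast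
    obtain a n where a: "a \<in> carrier H" "b = B.fr a (x [^]\<^bsub>H\<^esub> (n::nat))"
      using b(1) unfolding B_ring_def by (elim B.RSE) (auto simp: powers_def)
    show "h \<in> carrier K \<and> (\<exists>n::nat. \<exists>a\<in>carrier H. X [^]\<^bsub>K\<^esub> n \<otimes>\<^bsub>K\<^esub> h = \<eta> a)"
      using b(2) unfolding a(2) BK[OF a(1)] using frac[OF a(1), of n h] a(1) by metis
  next
    assume "h \<in> carrier K \<and> (\<exists>n::nat. \<exists>a\<in>carrier H. X [^]\<^bsub>K\<^esub> n \<otimes>\<^bsub>K\<^esub> h = \<eta> a)"
    then obtain n :: nat and a where a: "h \<in> carrier K" "a \<in> carrier H" "X [^]\<^bsub>K\<^esub> n \<otimes>\<^bsub>K\<^esub> h = \<eta> a" by blast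
    have "h = B_to_K_flag q f (B.fr a (x [^]\<^bsub>H\<^esub> n))"
      unfolding BK[OF a(2)] using frac[OF a(2), of n h] a by metis
    moreover have "B.fr a (x [^]\<^bsub>H\<^esub> n) \<in> carrier (B_ring q f)"
      unfolding B_ring_def by (rule B.fr_carr[OF a(2)]) (auto simp: powers_def)
    ultimately show "h \<in> B_to_K_flag q f ` carrier (B_ring q f)" by blast
  qed
qed

end

context local_flag
begin

lemma FFC_carr: "s \<in> FFC \<Longrightarrow> s i \<in> carrier function_field"
  by (simp add: FFC_iff)

text \<open>The two directions of the criterion for \<open>g \<in> K\<^sub>C\<close> to lie in \<open>B\<^sub>q\<close>: a series all of whose
  coefficients are regular at \<open>q\<close> does, and the leading coefficient \<open>a/b\<close> of an element of \<open>B\<^sub>q\<close>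
  cannot have a pole at \<open>q\<close>.\<close>

lemma in_B_ring:
  assumes s: "s \<in> FFC" and r: "\<And>i. r i \<in> R" "\<And>i j. i \<le> j \<Longrightarrow> \<exists>c\<in>R. r j - r i = f ^ i * c"
    and sr: "\<And>i. s i * f ^ N = r i"
  shows "\<kappa> (kcls s) \<in> B_to_K_flag q f ` carrier (B_ring q f)"
proof -
  have dm: "\<exists>c\<in>R. r i - r j = f ^ min i j * c" for i j
  proof (cases "i \<le> j")
    case True
    then obtain c where "c \<in> R" "r j - r i = f ^ i * c" using r(2) by blast
    then show ?thesis using True by (intro bexI[of _ "- c"]) (auto simp: algebra_simps min_def)
  next
    case False
    then show ?thesis using r(2)[of j i] by (simp add: min_def)
  qed
  have rC: "r \<in> carrier M.CR"
  proof (rule M.CR_I)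
    fix n
    have "r i \<ominus>\<^bsub>stalk q\<^esub> r j \<in> mp n" if "i \<ge> n" "j \<ge> n" for i j
    proof -
      obtain c where c: "c \<in> R" "r i - r j = f ^ min i j * c" using dm by blast
      have "f ^ min i j * c \<in> mp (min i j)" by (rule mp_pow[OF f_max c(1)])
      then show ?thesis using M.I_mono[of n "min i j"] that c(2) r(1) by auto
    qed
    then show "\<exists>M. \<forall>i\<ge>M. \<forall>j\<ge>M. r i \<ominus>\<^bsub>stalk q\<^esub> r j \<in> mp n" by blast
  qed (rule r(1))
  \<comment> \<open>The candidate for f^N times the limit: differences of terms are divisible by
    growing powers of f, so \<open>r\<close> is Cauchy for the maximal-adic filtration as
    well.\<close>
  define h where "h = M.cls r"
  have h: "h \<in> carrier H" unfolding h_def hat_eq by (rule M.cls_carr[OF rC])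
  have hr: "\<eta> h \<ominus>\<^bsub>K\<^esub> e (r i) \<in> filt i" for i
  proof -
    have cC: "(\<lambda>_. r i) \<in> carrier M.CR" by (rule M.CR_const[OF r(1)])
    have "M.cls (\<lambda>j. r j \<ominus>\<^bsub>stalk q\<^esub> r i) \<in> pw M.Rh M.fh i"
    proof (rule M.cls_in_pw)
      show "(\<lambda>j. r j \<ominus>\<^bsub>stalk q\<^esub> r i) \<in> carrier M.CR"
        using M.CR_add[OF rC M.CR_uminus[OF cC]] by (simp add: a_minus_def)
      have "r j \<ominus>\<^bsub>stalk q\<^esub> r i \<in> pw (stalk q) f i" if "j \<ge> i" for j
        using r(2)[OF that] r(1) by (auto simp: pw_def)
      then show "\<exists>M. \<forall>j\<ge>M. r j \<ominus>\<^bsub>stalk q\<^esub> r i \<in> pw (stalk q) f i" by blast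
    qed
    then have "h \<ominus>\<^bsub>H\<^esub> to_hat q (r i) \<in> pw H x i"
      unfolding h_def hat_eq to_hat_eq M.cls_minus[OF rC cC] .
    moreover have "h \<ominus>\<^bsub>H\<^esub> to_hat q (r i) \<in> carrier H" using h r(1) by simp
    ultimately show ?thesis using \<eta>_filt \<eta>_minus[OF h to_hat_carr[OF r(1)]] unfolding e_def by metis
  qed
  have \<kappa>: "\<kappa> (kcls s) \<in> carrier K" "converges_to K filt (\<lambda>i. \<rho> (s i)) (\<kappa> (kcls s))"
    using \<kappa>_spec[OF s] by auto
  have XN: "X [^]\<^bsub>K\<^esub> N \<in> carrier K" using X_carr by simp
  have \<eta>h: "\<eta> h \<in> carrier K" using h by (simp add: \<eta>_simps)
  have "X [^]\<^bsub>K\<^esub> N \<otimes>\<^bsub>K\<^esub> \<kappa> (kcls s) \<ominus>\<^bsub>K\<^esub> \<eta> h \<in> filt n" for n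
  proof -
    obtain M0 where M0: "\<forall>i\<ge>M0. \<rho> (s i) \<ominus>\<^bsub>K\<^esub> \<kappa> (kcls s) \<in> filt n" using \<kappa>(2) unfolding converges_to_def by blast
    define i where "i = max M0 n"
    have si: "\<rho> (s i) \<in> carrier K" by (rule \<rho>_carr[OF FFC_carr[OF s]])
    have "\<rho> (s i) \<otimes>\<^bsub>K\<^esub> e (f ^ N) = e (r i)"
      by (rule \<rho>_char[OF FFC_carr[OF s] r(1) _ sr]) simp
    then have 1: "X [^]\<^bsub>K\<^esub> N \<otimes>\<^bsub>K\<^esub> \<rho> (s i) = e (r i)" using si XN by (simp add: e_pow e_f K.m_comm)
    have "X [^]\<^bsub>K\<^esub> N \<otimes>\<^bsub>K\<^esub> \<kappa> (kcls s) \<ominus>\<^bsub>K\<^esub> \<eta> h =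
        \<ominus>\<^bsub>K\<^esub> (X [^]\<^bsub>K\<^esub> N \<otimes>\<^bsub>K\<^esub> (\<rho> (s i) \<ominus>\<^bsub>K\<^esub> \<kappa> (kcls s)) \<oplus>\<^bsub>K\<^esub> (\<eta> h \<ominus>\<^bsub>K\<^esub> X [^]\<^bsub>K\<^esub> N \<otimes>\<^bsub>K\<^esub> \<rho> (s i)))"
      using XN \<kappa>(1) \<eta>h si by algebra
    also have "\<dots> \<in> filt n"
    proof (intro filt_uminus filt_add)
      have "X [^]\<^bsub>K\<^esub> N \<otimes>\<^bsub>K\<^esub> (\<rho> (s i) \<ominus>\<^bsub>K\<^esub> \<kappa> (kcls s)) \<in> filt (N + n)"
        by (rule X_filt) (use M0 in \<open>simp add: i_def\<close>)
      then show "X [^]\<^bsub>K\<^esub> N \<otimes>\<^bsub>K\<^esub> (\<rho> (s i) \<ominus>\<^bsub>K\<^esub> \<kappa> (kcls s)) \<in> filt n" using filt_mono[of n "N + n"] by auto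
      show "\<eta> h \<ominus>\<^bsub>K\<^esub> X [^]\<^bsub>K\<^esub> N \<otimes>\<^bsub>K\<^esub> \<rho> (s i) \<in> filt n"
        unfolding 1 using hr[of i] filt_mono[of n i] by (auto simp: i_def)
    qed
    finally show ?thesis .
  qed
  then have "X [^]\<^bsub>K\<^esub> N \<otimes>\<^bsub>K\<^esub> \<kappa> (kcls s) \<ominus>\<^bsub>K\<^esub> \<eta> h = \<zero>\<^bsub>K\<^esub>" using XN \<kappa>(1) \<eta>h by (intro filt_sep) auto
  moreover have "X [^]\<^bsub>K\<^esub> N \<otimes>\<^bsub>K\<^esub> \<kappa> (kcls s) = (X [^]\<^bsub>K\<^esub> N \<otimes>\<^bsub>K\<^esub> \<kappa> (kcls s) \<ominus>\<^bsub>K\<^esub> \<eta> h) \<oplus>\<^bsub>K\<^esub> \<eta> h"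
    using XN \<kappa>(1) \<eta>h by algebra
  ultimately have "X [^]\<^bsub>K\<^esub> N \<otimes>\<^bsub>K\<^esub> \<kappa> (kcls s) = \<eta> h" using \<eta>h by simp
  then show ?thesis unfolding B_image_iff using \<kappa>(1) h by blast
qed

lemma B_ring_leading_coeff:
  assumes s: "s \<in> FFC" and B: "\<kappa> (kcls s) \<in> B_to_K_flag q f ` carrier (B_ring q f)"
    and P: "P \<in> carrier function_field" "f ^ k * P \<in> R"
    and u: "u \<in> carrier function_field" "f ^ k * u \<in> R"
    and ab: "a \<in> R" "b \<in> R" "\<nexists>c. c \<in> R \<and> b = f * c"
    and lead: "\<exists>M. \<forall>i\<ge>M. b * ((s i - P) * u) - a \<in> val_filt F (Suc 0)"
    and bm: "b \<in> \<mm>"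
  shows "a \<in> \<mm>"
proof -
  define \<zeta> where "\<zeta> = \<kappa> (kcls s)"
  have \<zeta>: "\<zeta> \<in> carrier K" "converges_to K filt (\<lambda>i. \<rho> (s i)) \<zeta>"
    using \<kappa>_spec[OF s] unfolding \<zeta>_def by auto
  obtain n :: nat and h where h: "h \<in> carrier H" "X [^]\<^bsub>K\<^esub> n \<otimes>\<^bsub>K\<^esub> \<zeta> = \<eta> h"
    using B unfolding B_image_iff \<zeta>_def by blast
  \<comment> \<open>One exponent for all three denominators: \<open>n\<close> for the limit,
    \<open>k\<close> for \<open>P\<close> and \<open>k\<close> for \<open>u\<close>.\<close>
  define L where "L = n + k + k"
  define \<gamma> where "\<gamma> = (\<zeta> \<ominus>\<^bsub>K\<^esub> \<rho> P) \<otimes>\<^bsub>K\<^esub> \<rho> u"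
  have c: "\<rho> P \<in> carrier K" "\<rho> u \<in> carrier K" using P(1) u(1) by simp_all
  have \<gamma>: "\<gamma> \<in> carrier K" unfolding \<gamma>_def using c \<zeta>(1) by simp
  have Xc: "X [^]\<^bsub>K\<^esub> (m::nat) \<in> carrier K" for m using X_carr by simp
  have XP: "X [^]\<^bsub>K\<^esub> k \<otimes>\<^bsub>K\<^esub> \<rho> P = e (f ^ k * P)"
    using \<rho>_char[OF P(1) P(2), of "f ^ k"] c Xc by (simp add: mult.commute e_pow e_f K.m_comm)
  have Xu: "X [^]\<^bsub>K\<^esub> k \<otimes>\<^bsub>K\<^esub> \<rho> u = e (f ^ k * u)"
    using \<rho>_char[OF u(1) u(2), of "f ^ k"] c Xc by (simp add: mult.commute e_pow e_f K.m_comm)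
  define g where "g = (x [^]\<^bsub>H\<^esub> k \<otimes>\<^bsub>H\<^esub> h \<ominus>\<^bsub>H\<^esub> x [^]\<^bsub>H\<^esub> n \<otimes>\<^bsub>H\<^esub> to_hat q (f ^ k * P)) \<otimes>\<^bsub>H\<^esub> to_hat q (f ^ k * u)"
  have xc: "x [^]\<^bsub>H\<^esub> (m::nat) \<in> carrier H" for m using H.x_carr by simp
  have g: "g \<in> carrier H" unfolding g_def using h(1) P(2) u(2) xc by simp
  have Xx: "X [^]\<^bsub>K\<^esub> (m::nat) = \<eta> (x [^]\<^bsub>H\<^esub> m)" for m using H.x_carr by (simp add: X_def \<eta>_pow)
  have XL: "X [^]\<^bsub>K\<^esub> L = X [^]\<^bsub>K\<^esub> n \<otimes>\<^bsub>K\<^esub> X [^]\<^bsub>K\<^esub> k \<otimes>\<^bsub>K\<^esub> X [^]\<^bsub>K\<^esub> k"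
    unfolding L_def using X_carr K.nat_pow_mult by simp
  have "X [^]\<^bsub>K\<^esub> L \<otimes>\<^bsub>K\<^esub> \<gamma> =
      (X [^]\<^bsub>K\<^esub> k \<otimes>\<^bsub>K\<^esub> (X [^]\<^bsub>K\<^esub> n \<otimes>\<^bsub>K\<^esub> \<zeta>) \<ominus>\<^bsub>K\<^esub> X [^]\<^bsub>K\<^esub> n \<otimes>\<^bsub>K\<^esub> (X [^]\<^bsub>K\<^esub> k \<otimes>\<^bsub>K\<^esub> \<rho> P)) \<otimes>\<^bsub>K\<^esub> (X [^]\<^bsub>K\<^esub> k \<otimes>\<^bsub>K\<^esub> \<rho> u)"
    unfolding XL \<gamma>_def using Xc[of n] Xc[of k] c \<zeta>(1) by algebra
  also have "\<dots> = \<eta> g"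
    unfolding h(2) XP Xu unfolding g_def e_def Xx using h(1) P(2) u(2) xc by (simp add: \<eta>_simps \<eta>_minus)
  finally have X\<gamma>: "X [^]\<^bsub>K\<^esub> L \<otimes>\<^bsub>K\<^esub> \<gamma> = \<eta> g" .
  have eb: "e b \<in> carrier K" "e a \<in> carrier K" using ab by simp_all
  \<comment> \<open>Along the curve, \<open>\<gamma>\<close> has residue a/b; this is the hypothesis
    \<open>lead\<close> passed to the limit.\<close>
  have "e b \<otimes>\<^bsub>K\<^esub> \<gamma> \<ominus>\<^bsub>K\<^esub> e a \<in> filt (Suc 0)"
  proof -
    obtain M1 where M1: "\<forall>i\<ge>M1. b * ((s i - P) * u) - a \<in> val_filt F (Suc 0)" using lead by blast
    obtain M2 where M2: "\<forall>i\<ge>M2. \<rho> (s i) \<ominus>\<^bsub>K\<^esub> \<zeta> \<in> filt (Suc k)" using \<zeta>(2) unfolding converges_to_def by blast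
    define i where "i = max M1 M2"
    have sF: "s i \<in> carrier function_field" by (rule FFC_carr[OF s])
    have si: "\<rho> (s i) \<in> carrier K" by (rule \<rho>_carr[OF sF])
    have bF: "b \<in> carrier function_field" "a \<in> carrier function_field" using ab R_FF by auto
    have "\<rho> (b * ((s i - P) * u) - a) = e b \<otimes>\<^bsub>K\<^esub> ((\<rho> (s i) \<ominus>\<^bsub>K\<^esub> \<rho> P) \<otimes>\<^bsub>K\<^esub> \<rho> u) \<ominus>\<^bsub>K\<^esub> e a"
      using bF sF P(1) u(1) ab by (simp add: \<rho>_minus \<rho>_mult FF_closed \<rho>_R)
    then have 1: "e b \<otimes>\<^bsub>K\<^esub> ((\<rho> (s i) \<ominus>\<^bsub>K\<^esub> \<rho> P) \<otimes>\<^bsub>K\<^esub> \<rho> u) \<ominus>\<^bsub>K\<^esub> e a \<in> filt (Suc 0)"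
      using \<rho>_filt M1 by (metis i_def max.cobounded1)
    have 2: "(\<rho> (s i) \<ominus>\<^bsub>K\<^esub> \<zeta>) \<otimes>\<^bsub>K\<^esub> \<rho> u \<in> filt (Suc 0)"
    proof (rule X_filt_cancel[of _ k])
      have "X [^]\<^bsub>K\<^esub> k \<otimes>\<^bsub>K\<^esub> ((\<rho> (s i) \<ominus>\<^bsub>K\<^esub> \<zeta>) \<otimes>\<^bsub>K\<^esub> \<rho> u) = (\<rho> (s i) \<ominus>\<^bsub>K\<^esub> \<zeta>) \<otimes>\<^bsub>K\<^esub> (X [^]\<^bsub>K\<^esub> k \<otimes>\<^bsub>K\<^esub> \<rho> u)"
        using Xc[of k] si \<zeta>(1) c by algebra
      also have "\<dots> \<in> filt (Suc k + 0)" unfolding Xu using M2 by (intro filt_mult e_filt u(2)) (simp add: i_def)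
      finally show "X [^]\<^bsub>K\<^esub> k \<otimes>\<^bsub>K\<^esub> ((\<rho> (s i) \<ominus>\<^bsub>K\<^esub> \<zeta>) \<otimes>\<^bsub>K\<^esub> \<rho> u) \<in> filt (k + Suc 0)" by simp
    qed (use si \<zeta>(1) c in simp)
    have "e b \<otimes>\<^bsub>K\<^esub> \<gamma> \<ominus>\<^bsub>K\<^esub> e a = (e b \<otimes>\<^bsub>K\<^esub> ((\<rho> (s i) \<ominus>\<^bsub>K\<^esub> \<rho> P) \<otimes>\<^bsub>K\<^esub> \<rho> u) \<ominus>\<^bsub>K\<^esub> e a) \<ominus>\<^bsub>K\<^esub>
        e b \<otimes>\<^bsub>K\<^esub> ((\<rho> (s i) \<ominus>\<^bsub>K\<^esub> \<zeta>) \<otimes>\<^bsub>K\<^esub> \<rho> u)"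
      unfolding \<gamma>_def using eb si \<zeta>(1) c by algebra
    also have "\<dots> \<in> filt (Suc 0)"
      using filt_minus[OF 1] filt_mult[OF e_filt[OF ab(2)] 2] by simp
    finally show ?thesis .
  qed
  then have "X [^]\<^bsub>K\<^esub> L \<otimes>\<^bsub>K\<^esub> (e b \<otimes>\<^bsub>K\<^esub> \<gamma> \<ominus>\<^bsub>K\<^esub> e a) \<in> filt (L + Suc 0)" by (rule X_filt)
  also have "X [^]\<^bsub>K\<^esub> L \<otimes>\<^bsub>K\<^esub> (e b \<otimes>\<^bsub>K\<^esub> \<gamma> \<ominus>\<^bsub>K\<^esub> e a) = e b \<otimes>\<^bsub>K\<^esub> (X [^]\<^bsub>K\<^esub> L \<otimes>\<^bsub>K\<^esub> \<gamma>) \<ominus>\<^bsub>K\<^esub> X [^]\<^bsub>K\<^esub> L \<otimes>\<^bsub>K\<^esub> e a"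
    using Xc[of L] eb \<gamma> by algebra
  also have "\<dots> = \<eta> (to_hat q b \<otimes>\<^bsub>H\<^esub> g \<ominus>\<^bsub>H\<^esub> x [^]\<^bsub>H\<^esub> L \<otimes>\<^bsub>H\<^esub> to_hat q a)"
    unfolding X\<gamma> unfolding e_def Xx using ab g xc by (simp add: \<eta>_simps \<eta>_minus)
  finally have D: "to_hat q b \<otimes>\<^bsub>H\<^esub> g \<ominus>\<^bsub>H\<^esub> x [^]\<^bsub>H\<^esub> L \<otimes>\<^bsub>H\<^esub> to_hat q a \<in> pw H x (L + Suc 0)"
    using \<eta>_filt[of "to_hat q b \<otimes>\<^bsub>H\<^esub> g \<ominus>\<^bsub>H\<^esub> x [^]\<^bsub>H\<^esub> L \<otimes>\<^bsub>H\<^esub> to_hat q a"] ab g xc by simp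
  have tb: "to_hat q b \<in> carrier H" "to_hat q a \<in> carrier H" using ab by simp_all
  interpret PL: ideal "pw H x L" H by (rule H.pw_ideal[OF H.x_carr])
  \<comment> \<open>The product is divisible by f^L and f does not divide b, so f^L divides
    \<open>g\<close>: after cancelling it, \<open>\<gamma>\<close> comes from the completed local
    ring.\<close>
  have "to_hat q b \<otimes>\<^bsub>H\<^esub> g = (to_hat q b \<otimes>\<^bsub>H\<^esub> g \<ominus>\<^bsub>H\<^esub> x [^]\<^bsub>H\<^esub> L \<otimes>\<^bsub>H\<^esub> to_hat q a) \<oplus>\<^bsub>H\<^esub> x [^]\<^bsub>H\<^esub> L \<otimes>\<^bsub>H\<^esub> to_hat q a"
    using tb g xc[of L] by algebra
  also have "\<dots> \<in> pw H x L"
    using D H.pw_mono[of L "L + Suc 0"] H.pw_I[OF tb(2)] by (intro PL.a_closed) auto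
  finally have "g \<otimes>\<^bsub>H\<^esub> to_hat q b \<in> pw H x L" using H.m_comm[OF g tb(1)] by simp
  moreover have "to_hat q b \<notin> pw H x (Suc 0)" using to_hat_pw[OF ab(2)] ab(3) by blast
  ultimately have "g \<in> pw H x L" using H.pw_mult_cancel[OF tb(1) _ g] by blast
  then obtain g' where g': "g' \<in> carrier H" "g = x [^]\<^bsub>H\<^esub> L \<otimes>\<^bsub>H\<^esub> g'" by (rule H.pw_E)
  have "to_hat q b \<otimes>\<^bsub>H\<^esub> g \<ominus>\<^bsub>H\<^esub> x [^]\<^bsub>H\<^esub> L \<otimes>\<^bsub>H\<^esub> to_hat q a = x [^]\<^bsub>H\<^esub> L \<otimes>\<^bsub>H\<^esub> (to_hat q b \<otimes>\<^bsub>H\<^esub> g' \<ominus>\<^bsub>H\<^esub> to_hat q a)"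
    unfolding g'(2) using tb g'(1) xc[of L] by algebra
  then have D': "to_hat q b \<otimes>\<^bsub>H\<^esub> g' \<ominus>\<^bsub>H\<^esub> to_hat q a \<in> pw H x (Suc 0)"
    using D H.pw_xn_cancel[of "to_hat q b \<otimes>\<^bsub>H\<^esub> g' \<ominus>\<^bsub>H\<^esub> to_hat q a" L "Suc 0"] tb g'(1) by simp
  obtain z where z: "z \<in> carrier M.CR" "g' = M.cls z" using g'(1) unfolding hat_eq by (rule M.RhE)
  have bC: "(\<lambda>_. b) \<in> carrier M.CR" "(\<lambda>_. a) \<in> carrier M.CR" using M.CR_const ab by auto
  have bz: "(\<lambda>i. b * z i) \<in> carrier M.CR" using M.CR_mult[OF bC(1) z(1)] by simp
  have dC: "(\<lambda>i. b * z i \<ominus>\<^bsub>stalk q\<^esub> a) \<in> carrier M.CR"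
    using M.CR_add[OF bz M.CR_uminus[OF bC(2)]] unfolding a_minus_def .
  have "to_hat q b \<otimes>\<^bsub>H\<^esub> g' \<ominus>\<^bsub>H\<^esub> to_hat q a = M.cls (\<lambda>i. b * z i \<ominus>\<^bsub>stalk q\<^esub> a)"
    unfolding hat_eq to_hat_eq z(2) M.cls_mult[OF bC(1) z(1)] stalk_simps by (rule M.cls_minus[OF bz bC(2)])
  then have "M.cls (\<lambda>i. b * z i \<ominus>\<^bsub>stalk q\<^esub> a) \<in> pw M.Rh M.fh (Suc 0)"
    using D' unfolding hat_eq to_hat_eq by simp
  \<comment> \<open>Level 1 suffices: modulo f and \<open>\<tau>\<close> the equation b g' = a is
    read in the residue field, where b vanishes.\<close>
  from M.fh_divides_J[OF dC this, of "Suc 0"] obtain M0 where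
    "b * z M0 \<ominus>\<^bsub>stalk q\<^esub> a \<in> J (Suc 0)" by blast
  moreover have zR: "z M0 \<in> R" by (rule M.CR_carr[OF z(1)])
  ultimately obtain r w where r: "r \<in> R" "w \<in> R" "b * z M0 - a = f * r + \<tau> ^ Suc 0 * w"
    using ab unfolding J_iff by auto
  have "a = b * z M0 + (\<tau> * (- w) + f * (- r))" using r(3) by (simp add: algebra_simps)
  also have "\<dots> \<in> \<mm>" by (rule max_add[OF max_mult[OF bm zR] maxI]) (simp_all add: r)
  finally show ?thesis .
qed

end

section \<open>Laurent series in two variables\<close>

definition fls_filt :: "int \<Rightarrow> 'b::zero fls set" where
  "fls_filt n = {h. \<forall>k<n. fls_nth h k = 0}"

lemma fls_filt_iff: "h \<in> fls_filt n \<longleftrightarrow> h = 0 \<or> n \<le> fls_subdegree h"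
proof
  assume "h \<in> fls_filt n"
  then show "h = 0 \<or> n \<le> fls_subdegree h" using fls_subdegree_geI[of h n] by (auto simp: fls_filt_def)
qed (auto simp: fls_filt_def)

lemma fls_filt_zero [simp]: "0 \<in> fls_filt n" by (simp add: fls_filt_def)
lemma fls_filt_minus: "g \<in> fls_filt n \<Longrightarrow> h \<in> fls_filt n \<Longrightarrow> g - h \<in> fls_filt n" for g :: "'b::group_add fls" by (simp add: fls_filt_def)
text \<open>Translates the metric, in which the distance is 2 to the power of minus the subdegree of
  the difference, into the filtration that corresponds to \<open>K_flag_filt\<close>.\<close>

lemma fls_LIMSEQ_iff:
  fixes S :: "nat \<Rightarrow> 'b::group_add fls"
  shows "S \<longlonglongrightarrow> h \<longleftrightarrow> (\<forall>n::nat. \<exists>M. \<forall>i\<ge>M. S i - h \<in> fls_filt (int n))"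
proof
  assume L: "S \<longlonglongrightarrow> h"
  show "\<forall>n::nat. \<exists>M. \<forall>i\<ge>M. S i - h \<in> fls_filt (int n)"
  proof
    fix n :: nat
    obtain M where M: "\<forall>i\<ge>M. dist (S i) h < inverse (2 ^ n)"
      using metric_LIMSEQ_D[OF L, of "inverse (2 ^ n)"] by auto
    have "S i - h \<in> fls_filt (int n)" if "i \<ge> M" for i
    proof -
      have d: "dist (S i) h < inverse (2 ^ n)" using M that by blast
      show ?thesis
      proof (cases "S i = h")
        case False
        have ge: "fls_subdegree (S i - h) \<ge> 0"
        proof (rule ccontr)
          assume "\<not> ?thesis"
          then have "dist (S i) h = 2 ^ nat (- fls_subdegree (S i - h))" using False by (simp add: dist_fls_def)
          moreover have "(1::real) \<le> 2 ^ nat (- fls_subdegree (S i - h))" by simp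
          moreover have "inverse (2 ^ n) \<le> (1::real)" by (simp add: inverse_le_1_iff)
          ultimately show False using d by linarith
        qed
        then have "inverse (2 ^ nat (fls_subdegree (S i - h))) < inverse ((2::real) ^ n)"
          using d False by (simp add: dist_fls_def)
        then have "(2::real) ^ n < 2 ^ nat (fls_subdegree (S i - h))" by simp
        then have "n < nat (fls_subdegree (S i - h))" by simp
        then have "int n \<le> fls_subdegree (S i - h)" using ge by linarith
        then show ?thesis by (simp add: fls_filt_iff)
      qed simp
    qed
    then show "\<exists>M. \<forall>i\<ge>M. S i - h \<in> fls_filt (int n)" by blast
  qed
next
  assume V: "\<forall>n::nat. \<exists>M. \<forall>i\<ge>M. S i - h \<in> fls_filt (int n)"
  show "S \<longlonglongrightarrow> h"
  proof (rule metric_LIMSEQ_I)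
    fix r :: real assume "r > 0"
    then obtain n where n: "inverse (2 ^ n) < r"
      using real_arch_pow_inv[of r "1/2"] by (auto simp: power_divide field_simps)
    obtain M where M: "\<forall>i\<ge>M. S i - h \<in> fls_filt (int n)" using V by blast
    have "dist (S i) h < r" if "i \<ge> M" for i
    proof (cases "S i = h")
      case False
      then have ge: "int n \<le> fls_subdegree (S i - h)" using M that by (auto simp: fls_filt_iff)
      then have "n \<le> nat (fls_subdegree (S i - h))" by linarith
      then have 1: "inverse (2 ^ nat (fls_subdegree (S i - h))) \<le> inverse ((2::real) ^ n)"
        by (intro le_imp_inverse_le power_increasing) auto
      have "dist (S i) h = inverse (2 ^ nat (fls_subdegree (S i - h)))"
        using False ge by (simp add: dist_fls_def)
      then show ?thesis using 1 n by linarith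
    qed (use \<open>r > 0\<close> in simp)
    then show "\<exists>M. \<forall>i\<ge>M. dist (S i) h < r" by blast
  qed
qed

lemma fps2_nth: "fls_nth (fps2_to_fls2 w) k = (if k < 0 then 0 else fps_to_fls (fps_nth w (nat k)))"
  by (simp add: fps2_to_fls2_def)

lemma fps2_add: "fps2_to_fls2 (v + w) = fps2_to_fls2 v + fps2_to_fls2 w"
  by (rule fls_eqI) (simp add: fps2_nth)

lemma fps2_minus: "fps2_to_fls2 (v - w) = fps2_to_fls2 v - fps2_to_fls2 w"
  by (rule fls_eqI) (simp add: fps2_nth)

lemma fps_to_fls_sum: "fps_to_fls (\<Sum>i\<in>A. g i) = (\<Sum>i\<in>A. fps_to_fls (g i :: 'b::comm_monoid_add fps))"
  by (induction A rule: infinite_finite_induct) auto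

lemma fps2_mult: "fps2_to_fls2 (v * w) = fps2_to_fls2 v * fps2_to_fls2 w"
proof -
  have "Abs_fps (\<lambda>j. fps_to_fls (fps_nth (v * w) j)) =
      Abs_fps (\<lambda>j. fps_to_fls (fps_nth v j)) * Abs_fps (\<lambda>j. fps_to_fls (fps_nth w j))"
    by (rule fps_ext) (simp add: fps_mult_nth fps_to_fls_sum fls_times_fps_to_fls)
  then show ?thesis by (simp add: fps2_to_fls2_def fls_times_fps_to_fls)
qed

lemma fps2_const: "fps2_to_fls2 (fps_const c) = fls_const (fps_to_fls c)"
  by (rule fls_eqI) (simp add: fps2_nth)

lemma fps2_one: "fps2_to_fls2 1 = 1"
  using fps2_const[of 1] by simp

lemma fps2_X: "fps2_to_fls2 fps_X = fls_X"
  by (rule fls_eqI) (auto simp: fps2_nth fps_X_def nat_eq_iff)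

lemma fps2_eq_0_iff: "fps2_to_fls2 w = 0 \<longleftrightarrow> w = 0"
proof
  assume a: "fps2_to_fls2 w = 0"
  show "w = 0"
  proof (rule fps_ext)
    fix n have "fls_nth (fps2_to_fls2 w) (int n) = 0" using a by simp
    then show "fps_nth w n = fps_nth 0 n" by (simp add: fps2_nth)
  qed
qed (rule fls_eqI, simp add: fps2_nth)

lemma fps2_Vf: "fps2_to_fls2 w \<in> fls_filt (int n) \<longleftrightarrow> (\<forall>i<n. fps_nth w i = 0)"
proof
  assume a: "fps2_to_fls2 w \<in> fls_filt (int n)"
  show "\<forall>i<n. fps_nth w i = 0"
  proof (intro allI impI)
    fix i assume "i < n"
    then have "fls_nth (fps2_to_fls2 w) (int i) = 0" using a by (simp add: fls_filt_def)
    then show "fps_nth w i = 0" by (simp add: fps2_nth)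
  qed
qed (auto simp: fls_filt_def fps2_nth)

text \<open>The k-th power of the maximal ideal (t, u) of k[[t,u]], in terms of the total
  degree.\<close>

definition fps2_filt :: "nat \<Rightarrow> 'b::comm_ring_1 fps fps set" where
  "fps2_filt k = {w. \<forall>i j. i + j < k \<longrightarrow> fps_nth (fps_nth w i) j = 0}"

lemma fps2_filt_add: "v \<in> fps2_filt k \<Longrightarrow> w \<in> fps2_filt k \<Longrightarrow> v + w \<in> fps2_filt k" by (simp add: fps2_filt_def)
lemma fps2_filt_minus: "v \<in> fps2_filt k \<Longrightarrow> w \<in> fps2_filt k \<Longrightarrow> v - w \<in> fps2_filt k" by (simp add: fps2_filt_def)
lemma fps2_filt_0 [simp]: "w \<in> fps2_filt 0" by (simp add: fps2_filt_def)

lemma fps2_filt_mult: assumes "v \<in> fps2_filt a" "w \<in> fps2_filt b" shows "v * w \<in> fps2_filt (a + b)"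
  unfolding fps2_filt_def
proof (intro CollectI allI impI)
  fix i j assume ij: "i + j < a + b"
  have "fps_nth (fps_nth v m * fps_nth w (i - m)) j = 0" if m: "m \<le> i" for m
    unfolding fps_mult_nth
  proof (rule sum.neutral, rule ballI)
    fix l assume "l \<in> {0..j}"
    then have "m + l < a \<or> (i - m) + (j - l) < b" using ij m by auto
    then show "fps_nth (fps_nth v m) l * fps_nth (fps_nth w (i - m)) (j - l) = 0"
      using assms by (auto simp: fps2_filt_def)
  qed
  then show "fps_nth (fps_nth (v * w) i) j = 0" by (simp add: fps_mult_nth[of v w] fps_sum_nth)
qed

lemma fps2_filt_mult_left: "v \<in> fps2_filt a \<Longrightarrow> v * w \<in> fps2_filt a"
  using fps2_filt_mult[of v a w 0] by simp

lemma fps2_filt_X_cancel: 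
  assumes "fps_X * w \<in> fps2_filt (Suc k)" shows "w \<in> fps2_filt k"
  unfolding fps2_filt_def
proof (intro CollectI allI impI)
  fix i j assume "i + j < k"
  then have "fps_nth (fps_nth (fps_X * w) (Suc i)) j = 0"
    using assms unfolding fps2_filt_def by (metis (mono_tags, lifting) mem_Collect_eq add_Suc Suc_mono)
  then show "fps_nth (fps_nth w i) j = 0" by simp
qed

text \<open>\<open>\<Phi>\<close> is the power series expansion at q. Beyond being multiplicative
  and additive, only its values on the parameters and on constants are prescribed; continuity
  (\<open>\<Phi>_mp\<close>) and nonvanishing of the constant term on units
  (\<open>\<Phi>_unit\<close>) are consequences.\<close>

locale laurent_flag = local_flag F q f \<tau>
  for F :: "'a::field poly3" and q f \<tau> +
  fixes \<Phi> :: "'a poly3 fract \<Rightarrow> 'a fps fps"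
  assumes \<Phi>_add: "r \<in> carrier (stalk q) \<Longrightarrow> s \<in> carrier (stalk q) \<Longrightarrow> \<Phi> (r + s) = \<Phi> r + \<Phi> s"
    and \<Phi>_mult: "r \<in> carrier (stalk q) \<Longrightarrow> s \<in> carrier (stalk q) \<Longrightarrow> \<Phi> (r * s) = \<Phi> r * \<Phi> s"
    and \<Phi>_f: "\<Phi> f = fps_X"
    and \<Phi>_\<tau>: "\<Phi> \<tau> = fps_const fps_X"
    and const_carr: "ratio (const3 c) 1 \<in> carrier (stalk q)"
    and \<Phi>_const: "\<Phi> (ratio (const3 c) 1) = fps_const (fps_const c)"
    and const_one: "ratio (const3 1) 1 = (1 :: 'a poly3 fract)"
begin

abbreviation "kc c \<equiv> ratio (const3 c) 1"

lemma \<Phi>_one: "\<Phi> 1 = 1"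
  using \<Phi>_const[of 1] const_one by simp

lemma \<Phi>_zero: "\<Phi> 0 = 0"
proof -
  have "\<Phi> (0 + 0) = \<Phi> 0 + \<Phi> 0" by (rule \<Phi>_add) simp_all
  then have "\<Phi> 0 + \<Phi> 0 = \<Phi> 0 + 0" by (simp only: add_0_left add_0_right)
  then show ?thesis by (simp only: add_left_cancel)
qed

lemma \<Phi>_minus: "r \<in> R \<Longrightarrow> s \<in> R \<Longrightarrow> \<Phi> (r - s) = \<Phi> r - \<Phi> s"
  using \<Phi>_add[of "r - s" s] by simp

lemma \<Phi>_pow: "r \<in> R \<Longrightarrow> \<Phi> (r ^ n) = \<Phi> r ^ n"
  by (induction n) (simp_all add: \<Phi>_one \<Phi>_mult)

lemma \<Phi>_max: "r \<in> \<mm> \<Longrightarrow> \<Phi> r \<in> fps2_filt (Suc 0)"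
proof -
  assume "r \<in> \<mm>"
  then obtain a b where ab: "a \<in> R" "b \<in> R" "r = \<tau> * a + f * b" by (rule maxE)
  have "fps_const fps_X \<in> fps2_filt (Suc 0)" "(fps_X :: 'a fps fps) \<in> fps2_filt (Suc 0)" by (simp_all add: fps2_filt_def)
  moreover have "\<Phi> r = fps_const fps_X * \<Phi> a + fps_X * \<Phi> b"
    unfolding ab(3) using ab(1,2) by (simp add: \<Phi>_add \<Phi>_mult \<Phi>_\<tau> \<Phi>_f)
  ultimately show ?thesis using fps2_filt_add fps2_filt_mult_left by metis
qed

lemma \<Phi>_mp: "r \<in> mp k \<Longrightarrow> \<Phi> r \<in> fps2_filt k"
proof (induction k arbitrary: r)
  case (Suc k)
  have "r \<in> ideal_prod (stalk q) \<mm> (mp k)" using Suc.prems by simp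
  then have "r \<in> R \<and> \<Phi> r \<in> fps2_filt (Suc k)"
  proof induction
    case (prod i j)
    have "i \<in> R" "j \<in> R" using max_sub[OF prod(1)] M.I_carr[OF prod(2)] by auto
    moreover have "\<Phi> i * \<Phi> j \<in> fps2_filt (Suc 0 + k)" by (rule fps2_filt_mult[OF \<Phi>_max[OF prod(1)] Suc.IH[OF prod(2)]])
    ultimately show ?case by (simp add: \<Phi>_mult)
  next
    case (sum s1 s2) then show ?case by (simp add: \<Phi>_add fps2_filt_add)
  qed
  then show ?case by blast
qed simp

lemma \<Phi>_unit: "r \<in> R \<Longrightarrow> r \<notin> \<mm> \<Longrightarrow> fps_nth (fps_nth (\<Phi> r) 0) 0 \<noteq> 0"
proof
  assume r: "r \<in> R" "r \<notin> \<mm>" "fps_nth (fps_nth (\<Phi> r) 0) 0 = 0"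
  have i: "inverse r \<in> R" by (rule R_inverse[OF r(1,2)])
  have "r \<noteq> 0" using r(2) max_mult[OF f_max, of 0] by auto
  then have "\<Phi> r * \<Phi> (inverse r) = 1" using \<Phi>_mult[OF r(1) i] \<Phi>_one by simp
  then have "fps_nth (fps_nth (\<Phi> r * \<Phi> (inverse r)) 0) 0 = 1" by simp
  then show False using r(3) by simp
qed

text \<open>The graph of the isomorphism between the completed local ring and k[[t,u]], kept as a
  relation so that no representative has to be chosen.\<close>

definition "RelH h w \<longleftrightarrow> (\<exists>s\<in>carrier M.CR. h = M.cls s \<and> (\<forall>k. \<exists>M. \<forall>i\<ge>M. \<Phi> (s i) - w \<in> fps2_filt k))"

lemma RelH_carr: "RelH h w \<Longrightarrow> h \<in> carrier H"
  unfolding RelH_def hat_eq using M.cls_carr by blast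

lemma RelH_hat: "r \<in> R \<Longrightarrow> RelH (to_hat q r) (\<Phi> r)"
  unfolding RelH_def to_hat_eq by (intro bexI[of _ "\<lambda>_. r"] M.CR_const) (auto simp: fps2_filt_def)

lemma RelH_add: assumes "RelH h w" "RelH h' w'" shows "RelH (h \<oplus>\<^bsub>H\<^esub> h') (w + w')"
proof -
  obtain s where s: "s \<in> carrier M.CR" "h = M.cls s" "\<forall>k. \<exists>M. \<forall>i\<ge>M. \<Phi> (s i) - w \<in> fps2_filt k" using assms(1) unfolding RelH_def by blast
  obtain s' where s': "s' \<in> carrier M.CR" "h' = M.cls s'" "\<forall>k. \<exists>M. \<forall>i\<ge>M. \<Phi> (s' i) - w' \<in> fps2_filt k" using assms(2) unfolding RelH_def by blast
  have c: "s i \<in> R" "s' i \<in> R" for i using M.CR_carr s(1) s'(1) by auto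
  show ?thesis unfolding RelH_def
  proof (intro bexI[of _ "\<lambda>i. s i + s' i"] conjI allI)
    show "(\<lambda>i. s i + s' i) \<in> carrier M.CR" using M.CR_add[OF s(1) s'(1)] by simp
    show "h \<oplus>\<^bsub>H\<^esub> h' = M.cls (\<lambda>i. s i + s' i)" unfolding s(2) s'(2) hat_eq using M.cls_add[OF s(1) s'(1)] by simp
    fix k obtain M1 M2 where M: "\<forall>i\<ge>M1. \<Phi> (s i) - w \<in> fps2_filt k" "\<forall>i\<ge>M2. \<Phi> (s' i) - w' \<in> fps2_filt k" using s(3) s'(3) by meson
    have "\<Phi> (s i + s' i) - (w + w') \<in> fps2_filt k" if "i \<ge> max M1 M2" for i
    proof -
      have eq: "\<Phi> (s i + s' i) - (w + w') = (\<Phi> (s i) - w) + (\<Phi> (s' i) - w')" by (simp add: \<Phi>_add c)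
      show ?thesis unfolding eq by (rule fps2_filt_add) (use M that in auto)
    qed
    then show "\<exists>M. \<forall>i\<ge>M. \<Phi> (s i + s' i) - (w + w') \<in> fps2_filt k" by blast
  qed
qed

lemma RelH_mult: assumes "RelH h w" "RelH h' w'" shows "RelH (h \<otimes>\<^bsub>H\<^esub> h') (w * w')"
proof -
  obtain s where s: "s \<in> carrier M.CR" "h = M.cls s" "\<forall>k. \<exists>M. \<forall>i\<ge>M. \<Phi> (s i) - w \<in> fps2_filt k" using assms(1) unfolding RelH_def by blast
  obtain s' where s': "s' \<in> carrier M.CR" "h' = M.cls s'" "\<forall>k. \<exists>M. \<forall>i\<ge>M. \<Phi> (s' i) - w' \<in> fps2_filt k" using assms(2) unfolding RelH_def by blast
  have c: "s i \<in> R" "s' i \<in> R" for i using M.CR_carr s(1) s'(1) by auto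
  show ?thesis unfolding RelH_def
  proof (intro bexI[of _ "\<lambda>i. s i * s' i"] conjI allI)
    show "(\<lambda>i. s i * s' i) \<in> carrier M.CR" using M.CR_mult[OF s(1) s'(1)] by simp
    show "h \<otimes>\<^bsub>H\<^esub> h' = M.cls (\<lambda>i. s i * s' i)" unfolding s(2) s'(2) hat_eq using M.cls_mult[OF s(1) s'(1)] by simp
    fix k obtain M1 M2 where M: "\<forall>i\<ge>M1. \<Phi> (s i) - w \<in> fps2_filt k" "\<forall>i\<ge>M2. \<Phi> (s' i) - w' \<in> fps2_filt k" using s(3) s'(3) by meson
    have "\<Phi> (s i * s' i) - (w * w') \<in> fps2_filt k" if "i \<ge> max M1 M2" for i
    proof -
      have "\<Phi> (s i * s' i) - (w * w') = (\<Phi> (s i) - w) * \<Phi> (s' i) + (\<Phi> (s' i) - w') * w"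
        by (simp add: \<Phi>_mult c algebra_simps)
      then show ?thesis using M that by (simp add: fps2_filt_add fps2_filt_mult_left)
    qed
    then show "\<exists>M. \<forall>i\<ge>M. \<Phi> (s i * s' i) - (w * w') \<in> fps2_filt k" by blast
  qed
qed

lemma RelH_pw_imp: assumes "RelH h w" "h \<in> pw H x n" "i < n" shows "fps_nth w i = 0"
proof (rule fps_ext)
  fix j
  obtain s where s: "s \<in> carrier M.CR" "h = M.cls s" "\<forall>k. \<exists>M. \<forall>i\<ge>M. \<Phi> (s i) - w \<in> fps2_filt k"
    using assms(1) unfolding RelH_def by blast
  have "M.cls s \<in> pw M.Rh M.fh n" using assms(2) unfolding s(2) hat_eq to_hat_eq .
  from M.cls_pw_D[OF s(1) this, of "Suc (i + j)"] obtain M1 where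
    M1: "\<forall>m\<ge>M1. \<exists>r\<in>R. s m \<ominus>\<^bsub>stalk q\<^esub> f ^ n * r \<in> mp (Suc (i + j))" by auto
  obtain M2 where M2: "\<forall>m\<ge>M2. \<Phi> (s m) - w \<in> fps2_filt (Suc (i + j))" using s(3) by blast
  define m where "m = max M1 M2"
  obtain r where r: "r \<in> R" "s m \<ominus>\<^bsub>stalk q\<^esub> f ^ n * r \<in> mp (Suc (i + j))" using M1 unfolding m_def by (meson max.cobounded1)
  have sm: "s m \<in> R" by (rule M.CR_carr[OF s(1)])
  have "\<Phi> (s m - f ^ n * r) \<in> fps2_filt (Suc (i + j))" using \<Phi>_mp[OF r(2)] sm r(1) by simp
  then have "\<Phi> (s m) - fps_X ^ n * \<Phi> r \<in> fps2_filt (Suc (i + j))" using sm r(1) by (simp add: \<Phi>_minus \<Phi>_mult \<Phi>_pow \<Phi>_f)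
  then have "fps_nth (fps_nth (\<Phi> (s m)) i) j = fps_nth (fps_nth (fps_X ^ n * \<Phi> r) i) j" by (simp add: fps2_filt_def)
  moreover have "fps_nth (fps_X ^ n * \<Phi> r) i = 0" using assms(3) by (simp add: fps_X_power_mult_nth)
  moreover have "fps_nth (fps_nth w i) j = fps_nth (fps_nth (\<Phi> (s m)) i) j" using M2 by (simp add: fps2_filt_def m_def)
  ultimately show "fps_nth (fps_nth w i) j = fps_nth 0 j" by simp
qed

text \<open>If the coefficient of u^0 in the limit vanishes, the representatives eventually lie in
  \<open>J k\<close>: otherwise \<open>not_J\<close> writes one of them modulo f as a unit times the
  l-th power of \<open>\<tau>\<close> with l < k, and its expansion has a nonzero coefficient at
  t^l. Then divide by f and induct.\<close>

lemma RelH_imp_pw: "RelH h w \<Longrightarrow> (\<And>i. i < n \<Longrightarrow> fps_nth w i = 0) \<Longrightarrow> h \<in> pw H x n"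
proof (induction n arbitrary: h w)
  case 0 then show ?case using RelH_carr by (simp add: H.pw_0)
next
  case (Suc n)
  obtain s where s: "s \<in> carrier M.CR" "h = M.cls s" "\<forall>k. \<exists>M. \<forall>i\<ge>M. \<Phi> (s i) - w \<in> fps2_filt k"
    using Suc.prems(1) unfolding RelH_def by blast
  have c: "s i \<in> R" for i by (rule M.CR_carr[OF s(1)])
  have "\<exists>M. \<forall>i\<ge>M. s i \<in> J k" for k
  proof -
    obtain M1 where M1: "\<forall>i\<ge>M1. \<Phi> (s i) - w \<in> fps2_filt k" using s(3) by blast
    have "s i \<in> J k" if i: "i \<ge> M1" for i
    proof (rule ccontr)
      assume "s i \<notin> J k"
      then obtain l u d where l: "l < k" "u \<in> R" "d \<in> R" "u \<notin> \<mm>" "s i = \<tau> ^ l * u + f * d"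
        using not_J[OF c] by blast
      have "fps_nth (fps_nth (\<Phi> (s i)) 0) l = 0"
        using M1 i l(1) Suc.prems(2)[of 0] by (auto simp: fps2_filt_def)
      moreover have "fps_nth (\<Phi> (s i)) 0 = fps_X ^ l * fps_nth (\<Phi> u) 0"
        unfolding l(5) using l(2,3) by (simp add: \<Phi>_add \<Phi>_mult \<Phi>_pow \<Phi>_\<tau> \<Phi>_f fps_const_power)
      ultimately have "fps_nth (fps_nth (\<Phi> u) 0) 0 = 0" by (simp add: fps_X_power_mult_nth)
      then show False using \<Phi>_unit[OF l(2,4)] by simp
    qed
    then show ?thesis by blast
  qed
  then obtain r where r: "r \<in> carrier M.CR" "M.cls s = M.fh \<otimes>\<^bsub>M.Rh\<^esub> M.cls r"
    using M.fh_divides[OF s(1)] by blast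
  have rc: "r i \<in> R" for i by (rule M.CR_carr[OF r(1)])
  define w' where "w' = fps_shift 1 w"
  have w: "w = fps_X * w'"
    unfolding w'_def by (rule fps_ext) (use Suc.prems(2)[of 0] in simp)
  have fr: "(\<lambda>i. f * r i) \<in> carrier M.CR" using M.CR_mult[OF M.CR_const[OF f_carr] r(1)] by simp
  have "M.cls s = M.cls (\<lambda>i. f * r i)" using r(2) M.cls_f_mult[OF r(1)] by simp
  then have eq: "\<forall>n. \<exists>M. \<forall>i\<ge>M. s i \<ominus>\<^bsub>stalk q\<^esub> f * r i \<in> mp n" using M.cls_eq[OF s(1) fr] by simp
  have "RelH (M.cls r) w'" unfolding RelH_def
  proof (intro bexI[OF _ r(1)] conjI refl allI)
    fix k
    obtain M1 M2 where M: "\<forall>i\<ge>M1. s i \<ominus>\<^bsub>stalk q\<^esub> f * r i \<in> mp (Suc k)" "\<forall>i\<ge>M2. \<Phi> (s i) - w \<in> fps2_filt (Suc k)"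
      using eq s(3) by meson
    have "\<Phi> (r i) - w' \<in> fps2_filt k" if i: "i \<ge> max M1 M2" for i
    proof (rule fps2_filt_X_cancel)
      have "\<Phi> (s i - f * r i) \<in> fps2_filt (Suc k)" using \<Phi>_mp[of "s i - f * r i" "Suc k"] M(1) i c rc by auto
      then have 1: "\<Phi> (s i) - fps_X * \<Phi> (r i) \<in> fps2_filt (Suc k)" using c rc by (simp add: \<Phi>_minus \<Phi>_mult \<Phi>_f)
      have 2: "\<Phi> (s i) - w \<in> fps2_filt (Suc k)" using M(2) i by simp
      have "fps_X * (\<Phi> (r i) - w') = (\<Phi> (s i) - w) - (\<Phi> (s i) - fps_X * \<Phi> (r i))"
        unfolding w by (simp add: algebra_simps)
      then show "fps_X * (\<Phi> (r i) - w') \<in> fps2_filt (Suc k)" using fps2_filt_minus[OF 2 1] by simp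
    qed
    then show "\<exists>M. \<forall>i\<ge>M. \<Phi> (r i) - w' \<in> fps2_filt k" by blast
  qed
  moreover have "fps_nth w' i = 0" if "i < n" for i using Suc.prems(2)[of "Suc i"] that by (simp add: w'_def)
  ultimately have "M.cls r \<in> pw H x n" by (rule Suc.IH)
  then have "x \<otimes>\<^bsub>H\<^esub> M.cls r \<in> pw H x (Suc n)" by (rule H.pw_Suc[OF H.x_carr])
  moreover have "h = x \<otimes>\<^bsub>H\<^esub> M.cls r" unfolding s(2) hat_eq to_hat_eq by (rule r(2))
  ultimately show ?case by simp
qed

lemma RelH_filt: "RelH h w \<Longrightarrow> h \<in> pw H x n \<longleftrightarrow> fps2_to_fls2 w \<in> fls_filt (int n)"
  unfolding fps2_Vf using RelH_pw_imp RelH_imp_pw by blast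

lemma RelH_nz: assumes "RelH h w" "h \<noteq> \<zero>\<^bsub>H\<^esub>" shows "w \<noteq> 0"
proof
  assume "w = 0"
  then have "h \<in> pw H x n" for n using RelH_imp_pw[OF assms(1)] by simp
  then show False using H.x_sep RelH_carr[OF assms(1)] assms(2) by blast
qed

end

context laurent_flag
begin

text \<open>The identification with \<open>k((t))((u))\<close> is not constructed as a map: \<open>RelF\<close> relates quotients of elements of the
  completed local ring to their series, and \<open>Rel\<close> is its closure under \<open>u\<close>-adic limits.\<close>

definition "RelF z h \<longleftrightarrow> (\<exists>a w b v. RelH a w \<and> RelH b v \<and> b \<noteq> \<zero>\<^bsub>H\<^esub> \<and> z \<in> carrier K \<and>
  \<eta> b \<otimes>\<^bsub>K\<^esub> z = \<eta> a \<and> h = fps2_to_fls2 w / fps2_to_fls2 v)"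

lemma RelFE:
  assumes "RelF z h"
  obtains a w b v where "RelH a w" "RelH b v" "b \<noteq> \<zero>\<^bsub>H\<^esub>" "a \<in> carrier H" "b \<in> carrier H" "z \<in> carrier K"
    "\<eta> a \<in> carrier K" "\<eta> b \<in> carrier K"
    "\<eta> b \<otimes>\<^bsub>K\<^esub> z = \<eta> a" "fps2_to_fls2 v \<noteq> 0" "h = fps2_to_fls2 w / fps2_to_fls2 v"
proof -
  obtain a w b v where 1: "RelH a w" "RelH b v" "b \<noteq> \<zero>\<^bsub>H\<^esub>" "z \<in> carrier K"
    "\<eta> b \<otimes>\<^bsub>K\<^esub> z = \<eta> a" "h = fps2_to_fls2 w / fps2_to_fls2 v"
    using assms unfolding RelF_def by blast
  have "fps2_to_fls2 v \<noteq> 0" unfolding fps2_eq_0_iff by (rule RelH_nz[OF 1(2,3)])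
  then show thesis
    using that[OF 1(1-3) RelH_carr[OF 1(1)] RelH_carr[OF 1(2)] 1(4) \<eta>_simps(1)[OF RelH_carr[OF 1(1)]]
      \<eta>_simps(1)[OF RelH_carr[OF 1(2)]] 1(5) _ 1(6)] by blast
qed

lemma RelF_carr: "RelF z h \<Longrightarrow> z \<in> carrier K"
  unfolding RelF_def by blast

lemma H_prod_nz: "a \<in> carrier H \<Longrightarrow> b \<in> carrier H \<Longrightarrow> a \<noteq> \<zero>\<^bsub>H\<^esub> \<Longrightarrow> b \<noteq> \<zero>\<^bsub>H\<^esub> \<Longrightarrow> a \<otimes>\<^bsub>H\<^esub> b \<noteq> \<zero>\<^bsub>H\<^esub>"
  using H.integral by blast

lemma RelF_FK: assumes "RelF z h" shows "z \<in> FK"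
proof -
  obtain a b where ab: "b \<noteq> \<zero>\<^bsub>H\<^esub>" "a \<in> carrier H" "b \<in> carrier H" "z \<in> carrier K" "\<eta> b \<otimes>\<^bsub>K\<^esub> z = \<eta> a"
    using assms by (rule RelFE) blast
  have u: "\<eta> b \<in> Units K" by (rule \<eta>_unit[OF ab(3,1)])
  have c: "\<eta> b \<in> carrier K" "inv\<^bsub>K\<^esub> \<eta> b \<in> carrier K" using u by auto
  have "\<eta> a \<otimes>\<^bsub>K\<^esub> inv\<^bsub>K\<^esub> \<eta> b = z \<otimes>\<^bsub>K\<^esub> (\<eta> b \<otimes>\<^bsub>K\<^esub> inv\<^bsub>K\<^esub> \<eta> b)"
    unfolding ab(5)[symmetric] using c ab(4) by algebra
  also have "\<dots> = z" using u ab(4) by simp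
  finally have "z = \<eta> a \<otimes>\<^bsub>K\<^esub> inv\<^bsub>K\<^esub> \<eta> b" ..
  then show ?thesis unfolding FK_def using ab(1-3) by blast
qed

lemma RelF_H: assumes "RelH a w" shows "RelF (\<eta> a) (fps2_to_fls2 w)"
proof -
  have 1: "RelH \<one>\<^bsub>H\<^esub> 1" using RelH_hat[of 1] by (simp add: to_hat_one \<Phi>_one)
  have "\<eta> a \<in> carrier K" using RelH_carr[OF assms] by (simp add: \<eta>_simps)
  then show ?thesis unfolding RelF_def
    by (intro exI[of _ a] exI[of _ w] exI[of _ "\<one>\<^bsub>H\<^esub>"] exI[of _ "1::'a fps fps"])
      (use assms 1 in \<open>auto simp: \<eta>_simps fps2_one\<close>)
qed

lemma RelF_R: "r \<in> R \<Longrightarrow> RelF (e r) (fps2_to_fls2 (\<Phi> r))"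
  unfolding e_def by (rule RelF_H[OF RelH_hat])

lemma RelF_mult: assumes "RelF z h" "RelF z' h'" shows "RelF (z \<otimes>\<^bsub>K\<^esub> z') (h * h')"
proof -
  obtain a w b v where 1: "RelH a w" "RelH b v" "b \<noteq> \<zero>\<^bsub>H\<^esub>" "a \<in> carrier H" "b \<in> carrier H" "z \<in> carrier K"
    "\<eta> a \<in> carrier K" "\<eta> b \<in> carrier K" "\<eta> b \<otimes>\<^bsub>K\<^esub> z = \<eta> a" "fps2_to_fls2 v \<noteq> 0" "h = fps2_to_fls2 w / fps2_to_fls2 v"
    using assms(1) by (rule RelFE)
  obtain a' w' b' v' where 2: "RelH a' w'" "RelH b' v'" "b' \<noteq> \<zero>\<^bsub>H\<^esub>" "a' \<in> carrier H" "b' \<in> carrier H" "z' \<in> carrier K"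
    "\<eta> a' \<in> carrier K" "\<eta> b' \<in> carrier K" "\<eta> b' \<otimes>\<^bsub>K\<^esub> z' = \<eta> a'" "fps2_to_fls2 v' \<noteq> 0" "h' = fps2_to_fls2 w' / fps2_to_fls2 v'"
    using assms(2) by (rule RelFE)
  have "\<eta> (b \<otimes>\<^bsub>H\<^esub> b') \<otimes>\<^bsub>K\<^esub> (z \<otimes>\<^bsub>K\<^esub> z') = (\<eta> b \<otimes>\<^bsub>K\<^esub> z) \<otimes>\<^bsub>K\<^esub> (\<eta> b' \<otimes>\<^bsub>K\<^esub> z')"
    unfolding \<eta>_simps(2)[OF 1(5) 2(5)] using 1(6,8) 2(6,8) by algebra
  also have "\<dots> = \<eta> (a \<otimes>\<^bsub>H\<^esub> a')" unfolding 1(9) 2(9) using 1(4) 2(4) by (simp add: \<eta>_simps)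
  finally have 3: "\<eta> (b \<otimes>\<^bsub>H\<^esub> b') \<otimes>\<^bsub>K\<^esub> (z \<otimes>\<^bsub>K\<^esub> z') = \<eta> (a \<otimes>\<^bsub>H\<^esub> a')" .
  have 4: "h * h' = fps2_to_fls2 (w * w') / fps2_to_fls2 (v * v')" unfolding 1(11) 2(11) by (simp add: fps2_mult)
  show ?thesis unfolding RelF_def
    using RelH_mult[OF 1(1) 2(1)] RelH_mult[OF 1(2) 2(2)] H_prod_nz[OF 1(5) 2(5) 1(3) 2(3)]
      K.m_closed[OF 1(6) 2(6)] 3 4 by blast
qed

lemma RelF_add: assumes "RelF z h" "RelF z' h'" shows "RelF (z \<oplus>\<^bsub>K\<^esub> z') (h + h')"
proof -
  obtain a w b v where 1: "RelH a w" "RelH b v" "b \<noteq> \<zero>\<^bsub>H\<^esub>" "a \<in> carrier H" "b \<in> carrier H" "z \<in> carrier K"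
    "\<eta> a \<in> carrier K" "\<eta> b \<in> carrier K" "\<eta> b \<otimes>\<^bsub>K\<^esub> z = \<eta> a" "fps2_to_fls2 v \<noteq> 0" "h = fps2_to_fls2 w / fps2_to_fls2 v"
    using assms(1) by (rule RelFE)
  obtain a' w' b' v' where 2: "RelH a' w'" "RelH b' v'" "b' \<noteq> \<zero>\<^bsub>H\<^esub>" "a' \<in> carrier H" "b' \<in> carrier H" "z' \<in> carrier K"
    "\<eta> a' \<in> carrier K" "\<eta> b' \<in> carrier K" "\<eta> b' \<otimes>\<^bsub>K\<^esub> z' = \<eta> a'" "fps2_to_fls2 v' \<noteq> 0" "h' = fps2_to_fls2 w' / fps2_to_fls2 v'"
    using assms(2) by (rule RelFE)
  have "\<eta> (b \<otimes>\<^bsub>H\<^esub> b') \<otimes>\<^bsub>K\<^esub> (z \<oplus>\<^bsub>K\<^esub> z') = (\<eta> b \<otimes>\<^bsub>K\<^esub> z) \<otimes>\<^bsub>K\<^esub> \<eta> b' \<oplus>\<^bsub>K\<^esub> (\<eta> b' \<otimes>\<^bsub>K\<^esub> z') \<otimes>\<^bsub>K\<^esub> \<eta> b"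
    unfolding \<eta>_simps(2)[OF 1(5) 2(5)] using 1(6,8) 2(6,8) by algebra
  also have "\<dots> = \<eta> (a \<otimes>\<^bsub>H\<^esub> b' \<oplus>\<^bsub>H\<^esub> a' \<otimes>\<^bsub>H\<^esub> b)" unfolding 1(9) 2(9) using 1(4,5) 2(4,5) by (simp add: \<eta>_simps)
  finally have 3: "\<eta> (b \<otimes>\<^bsub>H\<^esub> b') \<otimes>\<^bsub>K\<^esub> (z \<oplus>\<^bsub>K\<^esub> z') = \<eta> (a \<otimes>\<^bsub>H\<^esub> b' \<oplus>\<^bsub>H\<^esub> a' \<otimes>\<^bsub>H\<^esub> b)" .
  have 4: "h + h' = fps2_to_fls2 (w * v' + w' * v) / fps2_to_fls2 (v * v')"
    unfolding 1(11) 2(11) using 1(10) 2(10) by (simp add: fps2_mult fps2_add field_simps)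
  show ?thesis unfolding RelF_def
    using RelH_add[OF RelH_mult[OF 1(1) 2(2)] RelH_mult[OF 2(1) 1(2)]] RelH_mult[OF 1(2) 2(2)] H_prod_nz[OF 1(5) 2(5) 1(3) 2(3)]
      K.add.m_closed[OF 1(6) 2(6)] 3 4 by blast
qed

lemma RelF_minus: assumes "RelF z h" "RelF z' h'" shows "RelF (z \<ominus>\<^bsub>K\<^esub> z') (h - h')"
proof -
  have m1: "RelF (e (- 1)) (- 1)" 
  proof -
    have "\<Phi> (- 1) = - 1" using \<Phi>_minus[of 0 1] by (simp add: \<Phi>_zero \<Phi>_one)
    moreover have "fps2_to_fls2 (- 1) = (- 1 :: 'a fls fls)" using fps2_minus[of 0 "1::'a fps fps"] fps2_eq_0_iff[of "0::'a fps fps"] by (simp add: fps2_one)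
    ultimately show ?thesis using RelF_R[of "- 1"] by simp
  qed
  have z': "z' \<in> carrier K" by (rule RelF_carr[OF assms(2)])
  have "e (- 1) \<oplus>\<^bsub>K\<^esub> \<one>\<^bsub>K\<^esub> = \<zero>\<^bsub>K\<^esub>" using e_add[of "- 1" 1] by (simp add: e_one e_zero)
  then have "e (- 1) = \<ominus>\<^bsub>K\<^esub> \<one>\<^bsub>K\<^esub>" using K.minus_equality[of "e (- 1)" "\<one>\<^bsub>K\<^esub>"] by simp
  then have "e (- 1) \<otimes>\<^bsub>K\<^esub> z' = \<ominus>\<^bsub>K\<^esub> z'" using z' by (simp add: K.l_minus)
  then show ?thesis using RelF_add[OF assms(1) RelF_mult[OF m1 assms(2)]] by (simp add: a_minus_def)
qed

lemma RelF_inverse: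
  assumes "RelF z h" "h \<noteq> 0" shows "z \<in> Units K" "RelF (inv\<^bsub>K\<^esub> z) (inverse h)"
proof -
  obtain a w b v where 1: "RelH a w" "RelH b v" "b \<noteq> \<zero>\<^bsub>H\<^esub>" "a \<in> carrier H" "b \<in> carrier H" "z \<in> carrier K"
    "\<eta> a \<in> carrier K" "\<eta> b \<in> carrier K" "\<eta> b \<otimes>\<^bsub>K\<^esub> z = \<eta> a" "fps2_to_fls2 v \<noteq> 0" "h = fps2_to_fls2 w / fps2_to_fls2 v"
    using assms(1) by (rule RelFE)
  \<comment> \<open>Zero is divisible by every power of f, so the series of a vanishing numerator
    would be zero.\<close>
  have a: "a \<noteq> \<zero>\<^bsub>H\<^esub>"
  proof
    assume "a = \<zero>\<^bsub>H\<^esub>"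
    then have "fps_nth w i = 0" for i using RelH_pw_imp[OF 1(1), of "Suc i" i] H.zero_pw by simp
    then have "w = 0" by (intro fps_ext) simp
    then show False using assms(2) 1(11) fps2_eq_0_iff[of w] by simp
  qed
  have ua: "\<eta> a \<in> Units K" and ub: "\<eta> b \<in> Units K" using \<eta>_unit a 1 by auto
  have ic: "inv\<^bsub>K\<^esub> \<eta> a \<in> carrier K" using ua by simp
  have "z \<otimes>\<^bsub>K\<^esub> (\<eta> b \<otimes>\<^bsub>K\<^esub> inv\<^bsub>K\<^esub> \<eta> a) = (\<eta> b \<otimes>\<^bsub>K\<^esub> z) \<otimes>\<^bsub>K\<^esub> inv\<^bsub>K\<^esub> \<eta> a"
    using 1(6,8) ic by algebra
  also have "\<dots> = \<one>\<^bsub>K\<^esub>" unfolding 1(9) using ua by simp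
  finally have zi: "z \<otimes>\<^bsub>K\<^esub> (\<eta> b \<otimes>\<^bsub>K\<^esub> inv\<^bsub>K\<^esub> \<eta> a) = \<one>\<^bsub>K\<^esub>" .
  have bc: "\<eta> b \<otimes>\<^bsub>K\<^esub> inv\<^bsub>K\<^esub> \<eta> a \<in> carrier K" using 1(8) ic by simp
  show u: "z \<in> Units K" unfolding Units_def using zi bc 1(6) K.m_comm[OF 1(6) bc] by auto
  have izc: "inv\<^bsub>K\<^esub> z \<in> carrier K" using u by simp
  have "\<eta> a \<otimes>\<^bsub>K\<^esub> inv\<^bsub>K\<^esub> z = \<eta> b"
    unfolding 1(9)[symmetric] using u 1(6,8) izc by (simp add: K.m_assoc)
  moreover have "inverse h = fps2_to_fls2 v / fps2_to_fls2 w" unfolding 1(11) by simp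
  ultimately show "RelF (inv\<^bsub>K\<^esub> z) (inverse h)" unfolding RelF_def using 1(1,2) a izc by blast
qed

lemma RelF_one: "RelF \<one>\<^bsub>K\<^esub> 1"
  using RelF_R[of 1] by (simp add: e_one \<Phi>_one fps2_one)

lemma RelF_zero: "RelF \<zero>\<^bsub>K\<^esub> 0"
  using RelF_R[of 0] fps2_eq_0_iff[of "0 :: 'a fps fps"] by (simp add: e_zero \<Phi>_zero)

lemma RelF_pow: "RelF z h \<Longrightarrow> RelF (z [^]\<^bsub>K\<^esub> (n::nat)) (h ^ n)"
proof (induction n)
  case (Suc n)
  then show ?case using RelF_mult[of "z [^]\<^bsub>K\<^esub> n" "h ^ n" z h] by (simp add: mult.commute)
qed (simp add: RelF_one)

lemma RelF_int_pow: assumes "RelF z h" "h \<noteq> 0" shows "RelF (z [^]\<^bsub>K\<^esub> (n::int)) (h powi n)"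
proof (cases "n \<ge> 0")
  case True
  then obtain m where "n = int m" by (metis nonneg_int_cases)
  then show ?thesis using RelF_pow[OF assms(1), of m] by (simp add: int_pow_int)
next
  case False
  then obtain m where m: "n = - int m" by (metis linorder_le_cases nonpos_int_cases)
  have eq: "z [^]\<^bsub>K\<^esub> n = inv\<^bsub>K\<^esub> (z [^]\<^bsub>K\<^esub> m)" using False by (simp add: int_pow_def2 m)
  have "h powi n = inverse (h ^ m)" by (simp add: m power_int_minus)
  then show ?thesis unfolding eq using RelF_inverse(2)[OF RelF_pow[OF assms(1)], of m] assms(2) by simp
qed

text \<open>The f-adic and the u-adic filtration correspond. The f-order m of the denominator is
  split off by \<open>H.factor\<close>; its cofactor has an integral inverse and so changes no
  order. Numerator and denominator are then compared by \<open>RelH_filt\<close>.\<close>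

lemma RelF_filt: assumes "RelF z h" shows "z \<in> filt n \<longleftrightarrow> h \<in> fls_filt (int n)"
proof -
  obtain a w b v where 1: "RelH a w" "RelH b v" "b \<noteq> \<zero>\<^bsub>H\<^esub>" "a \<in> carrier H" "b \<in> carrier H" "z \<in> carrier K"
    "\<eta> a \<in> carrier K" "\<eta> b \<in> carrier K" "\<eta> b \<otimes>\<^bsub>K\<^esub> z = \<eta> a" "fps2_to_fls2 v \<noteq> 0" "h = fps2_to_fls2 w / fps2_to_fls2 v"
    using assms(1) by (rule RelFE)
  obtain m b' where b': "b' \<in> carrier H" "b' \<notin> pw H x (Suc 0)" "b = x [^]\<^bsub>H\<^esub> (m::nat) \<otimes>\<^bsub>H\<^esub> b'"
    using H.factor[OF 1(5,3)] by metis
  have \<eta>b: "\<eta> b = X [^]\<^bsub>K\<^esub> m \<otimes>\<^bsub>K\<^esub> \<eta> b'"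
    unfolding b'(3) X_def using b'(1) H.x_carr by (simp add: \<eta>_simps \<eta>_pow)
  have \<eta>b': "\<eta> b' \<in> carrier K" using b'(1) by (simp add: \<eta>_simps)
  have Xm: "X [^]\<^bsub>K\<^esub> m \<in> carrier K" using X_carr by simp
  have Xz: "X [^]\<^bsub>K\<^esub> m \<otimes>\<^bsub>K\<^esub> (z \<otimes>\<^bsub>K\<^esub> \<eta> b') = \<eta> a"
    unfolding 1(9)[symmetric] \<eta>b using Xm 1(6) \<eta>b' by algebra
  have bf: "\<eta> b' \<in> filt 0" using \<eta>_filt[OF b'(1)] b'(1) by (simp add: H.pw_0)
  have ub: "\<eta> b' \<in> Units K" by (rule \<eta>_unit0[OF b'(1,2)])
  have b'd: "b' \<in> carrier H - pw H x (Suc 0)" using b' by blast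
  have fc: "H.L.fr \<one>\<^bsub>H\<^esub> b' \<in> carrier A" by (rule fr_A_carr[OF H.one_closed b'd])
  have "z \<in> filt n \<longleftrightarrow> a \<in> pw H x (m + n)"
  proof
    assume "z \<in> filt n"
    then have "X [^]\<^bsub>K\<^esub> m \<otimes>\<^bsub>K\<^esub> (z \<otimes>\<^bsub>K\<^esub> \<eta> b') \<in> filt (m + (n + 0))" by (intro X_filt filt_mult bf)
    then show "a \<in> pw H x (m + n)" unfolding Xz \<eta>_filt[OF 1(4)] by simp
  next
    assume "a \<in> pw H x (m + n)"
    then have "X [^]\<^bsub>K\<^esub> m \<otimes>\<^bsub>K\<^esub> (z \<otimes>\<^bsub>K\<^esub> \<eta> b') \<in> filt (m + n)" unfolding Xz \<eta>_filt[OF 1(4)] .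
    then have zb: "z \<otimes>\<^bsub>K\<^esub> \<eta> b' \<in> filt n" by (rule X_filt_cancel[rotated]) (use 1(6) \<eta>b' in simp)
    have b1: "\<eta> b' \<otimes>\<^bsub>K\<^esub> \<eta>A (H.L.fr \<one>\<^bsub>H\<^esub> b') = \<one>\<^bsub>K\<^esub>" using \<eta>A_inverse[OF b'd H.one_closed] \<eta>_simps(4) by simp
    have "\<eta>A (H.L.fr \<one>\<^bsub>H\<^esub> b') \<in> filt 0" using \<eta>A_filt[OF fc, of 0] fc by (simp add: A.pw_0)
    then have "z \<otimes>\<^bsub>K\<^esub> \<eta> b' \<otimes>\<^bsub>K\<^esub> \<eta>A (H.L.fr \<one>\<^bsub>H\<^esub> b') \<in> filt (n + 0)" by (intro filt_mult zb)
    then show "z \<in> filt n" using b1 1(6) \<eta>b' \<eta>A_simps(1)[OF fc] by (simp add: K.m_assoc)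
  qed
  also have "\<dots> \<longleftrightarrow> fps2_to_fls2 w \<in> fls_filt (int (m + n))" by (rule RelH_filt[OF 1(1)])
  also have "\<dots> \<longleftrightarrow> h \<in> fls_filt (int n)"
  proof -
    have "b \<in> pw H x m" unfolding b'(3) by (rule H.pw_I[OF b'(1)])
    then have "fps2_to_fls2 v \<in> fls_filt (int m)" using RelH_filt[OF 1(2)] by simp
    moreover have "b \<notin> pw H x (Suc m)"
      using H.pw_xn_cancel[OF b'(1), of m "Suc 0"] b'(2) unfolding b'(3) by auto
    then have "fps2_to_fls2 v \<notin> fls_filt (int (Suc m))" using RelH_filt[OF 1(2)] by simp
    ultimately have s: "fls_subdegree (fps2_to_fls2 v) = int m" using 1(10) by (simp add: fls_filt_iff)
    show ?thesis
    proof (cases "fps2_to_fls2 w = 0")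
      case True then show ?thesis unfolding 1(11) by simp
    next
      case False
      then show ?thesis unfolding 1(11) fls_filt_iff using s 1(10) by (auto simp: fls_divide_subdegree)
    qed
  qed
  finally show ?thesis .
qed

definition "Rel z h \<longleftrightarrow> z \<in> carrier K \<and>
  (\<forall>n. \<exists>z' h'. RelF z' h' \<and> z \<ominus>\<^bsub>K\<^esub> z' \<in> filt n \<and> h - h' \<in> fls_filt (int n))"

text \<open>Up to the n-th step neither difference changes when z and h are replaced by a nearby
  \<open>RelF\<close> pair, and for that pair \<open>RelF_filt\<close> decides.\<close>

lemma Rel_RelF: 
  assumes "Rel z h" "RelF z' h'" shows "z \<ominus>\<^bsub>K\<^esub> z' \<in> filt n \<longleftrightarrow> h - h' \<in> fls_filt (int n)"
proof -
  obtain z1 h1 where 1: "RelF z1 h1" "z \<ominus>\<^bsub>K\<^esub> z1 \<in> filt n" "h - h1 \<in> fls_filt (int n)" using assms(1) unfolding Rel_def by blast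
  have c: "z \<in> carrier K" "z1 \<in> carrier K" "z' \<in> carrier K" using assms 1(1) RelF_carr unfolding Rel_def by auto
  have d: "z1 \<ominus>\<^bsub>K\<^esub> z' \<in> filt n \<longleftrightarrow> h1 - h' \<in> fls_filt (int n)" by (rule RelF_filt[OF RelF_minus[OF 1(1) assms(2)]])
  have "z \<ominus>\<^bsub>K\<^esub> z' \<in> filt n \<longleftrightarrow> z1 \<ominus>\<^bsub>K\<^esub> z' \<in> filt n"
  proof
    assume a: "z \<ominus>\<^bsub>K\<^esub> z' \<in> filt n"
    have "z1 \<ominus>\<^bsub>K\<^esub> z' = (z \<ominus>\<^bsub>K\<^esub> z') \<ominus>\<^bsub>K\<^esub> (z \<ominus>\<^bsub>K\<^esub> z1)" using c by algebra
    then show "z1 \<ominus>\<^bsub>K\<^esub> z' \<in> filt n" using filt_minus[OF a 1(2)] by simp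
  next
    assume a: "z1 \<ominus>\<^bsub>K\<^esub> z' \<in> filt n"
    have "z \<ominus>\<^bsub>K\<^esub> z' = (z \<ominus>\<^bsub>K\<^esub> z1) \<oplus>\<^bsub>K\<^esub> (z1 \<ominus>\<^bsub>K\<^esub> z')" using c by algebra
    then show "z \<ominus>\<^bsub>K\<^esub> z' \<in> filt n" using filt_add[OF 1(2) a] by simp
  qed
  moreover have "h1 - h' \<in> fls_filt (int n) \<longleftrightarrow> h - h' \<in> fls_filt (int n)"
    using 1(3) by (simp add: fls_filt_def)
  ultimately show ?thesis using d by simp
qed

lemma Rel_unique:
  assumes "Rel z h" "Rel z' h" shows "z = z'"
proof -
  have c: "z \<in> carrier K" "z' \<in> carrier K" using assms unfolding Rel_def by auto
  have "z \<ominus>\<^bsub>K\<^esub> z' \<in> filt n" for n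
  proof -
    obtain z1 h1 where 1: "RelF z1 h1" "z' \<ominus>\<^bsub>K\<^esub> z1 \<in> filt n" "h - h1 \<in> fls_filt (int n)" using assms(2) unfolding Rel_def by blast
    have 2: "z \<ominus>\<^bsub>K\<^esub> z1 \<in> filt n" using Rel_RelF[OF assms(1) 1(1)] 1(3) by simp
    have "z1 \<in> carrier K" by (rule RelF_carr[OF 1(1)])
    then have "z \<ominus>\<^bsub>K\<^esub> z' = (z \<ominus>\<^bsub>K\<^esub> z1) \<ominus>\<^bsub>K\<^esub> (z' \<ominus>\<^bsub>K\<^esub> z1)" using c by algebra
    then show ?thesis using filt_minus[OF 2 1(2)] by simp
  qed
  then have "z \<ominus>\<^bsub>K\<^esub> z' = \<zero>\<^bsub>K\<^esub>" using c by (intro filt_sep) auto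
  moreover have "z = (z \<ominus>\<^bsub>K\<^esub> z') \<oplus>\<^bsub>K\<^esub> z'" using c by algebra
  ultimately show ?thesis using c by simp
qed

lemma Rel_limit:
  assumes z: "z \<in> carrier K" "converges_to K filt zs z" and r: "\<And>i. RelF (zs i) (hs i)"
    and h: "\<And>n::nat. \<exists>M. \<forall>i\<ge>M. h - hs i \<in> fls_filt (int n)"
  shows "Rel z h"
  unfolding Rel_def
proof (intro conjI allI z(1))
  fix n
  obtain M1 where M1: "\<forall>i\<ge>M1. zs i \<ominus>\<^bsub>K\<^esub> z \<in> filt n" using z(2) unfolding converges_to_def by blast
  obtain M2 where M2: "\<forall>i\<ge>M2. h - hs i \<in> fls_filt (int n)" using h by blast
  define i where "i = max M1 M2"
  have c: "zs i \<in> carrier K" by (rule RelF_carr[OF r])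
  have "z \<ominus>\<^bsub>K\<^esub> zs i = \<ominus>\<^bsub>K\<^esub> (zs i \<ominus>\<^bsub>K\<^esub> z)" using c z(1) by algebra
  then have "z \<ominus>\<^bsub>K\<^esub> zs i \<in> filt n" using M1 filt_uminus by (simp add: i_def)
  then show "\<exists>z' h'. RelF z' h' \<and> z \<ominus>\<^bsub>K\<^esub> z' \<in> filt n \<and> h - h' \<in> fls_filt (int n)"
    using r[of i] M2 by (intro exI[of _ "zs i"] exI[of _ "hs i"]) (auto simp: i_def)
qed

subsection \<open>The identification with Laurent series\<close>

text \<open>A coefficient in k((t)) is a power series times a power of t. The truncations of the
  series expand to polynomials in t free of u, so \<open>RelH\<close> holds in the limit; the power
  of t is restored by \<open>RelF_int_pow\<close>.\<close>

lemma Fls_coeff: "RelF (laurent_coeff_to_K_flag q \<tau> f c) (fls_const c)"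
proof -
  define d where "d = fls_base_factor_to_fps c"
  define s where "s n = (\<Sum>i<n. kc (fps_nth d i) * \<tau> ^ i)" for n
  have sR: "s n \<in> R" for n
    unfolding s_def by (induction n) (simp_all add: const_carr)
  have sdiff: "s i - s j \<in> mp n" if "i \<ge> n" "j \<ge> n" for i j n
  proof -
    have *: "s i - s n \<in> mp n" if "i \<ge> n" for i
      using that
    proof (induction i rule: dec_induct)
      case base then show ?case using M.I_zero by simp
    next
      case (step i)
      have "\<tau> ^ i * kc (fps_nth d i) \<in> mp i" by (rule mp_pow[OF \<tau>_max const_carr])
      then have "\<tau> ^ i * kc (fps_nth d i) \<in> mp n" using M.I_mono[OF step(1)] by blast
      then have "(s i - s n) + \<tau> ^ i * kc (fps_nth d i) \<in> mp n" by (rule mp_add[OF step.IH])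
      moreover have "s (Suc i) - s n = (s i - s n) + \<tau> ^ i * kc (fps_nth d i)" by (simp add: s_def algebra_simps)
      ultimately show ?case by (simp only:)
    qed
    have "(s i - s n) - (s j - s n) \<in> mp n" using M.I_minus[OF *[OF that(1)] *[OF that(2)]] sR by simp
    moreover have "s i - s j = (s i - s n) - (s j - s n)" by simp
    ultimately show ?thesis by (simp only:)
  qed
  have sC: "s \<in> carrier M.CR"
    by (rule M.CR_I[OF sR]) (use sdiff sR in \<open>auto intro!: exI[of _ n for n]\<close>)
  have ph: "power_series_to_hat q \<tau> d = M.cls s"
    unfolding power_series_to_hat_def s_def ..
  have \<Phi>s: "\<Phi> (s n) = fps_const (\<Sum>i<n. fps_const (fps_nth d i) * fps_X ^ i)" for n
    unfolding s_def
  proof (induction n)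
    case (Suc n)
    have "(\<Sum>i<n. kc (fps_nth d i) * \<tau> ^ i) \<in> R" using sR[of n] unfolding s_def .
    then show ?case using Suc
      by (simp add: \<Phi>_add \<Phi>_mult \<Phi>_pow \<Phi>_const \<Phi>_\<tau> const_carr fps_const_power[symmetric] fps_const_mult[symmetric] fps_const_add[symmetric] del: fps_const_power fps_const_mult fps_const_add)
  qed (simp add: \<Phi>_zero)
  have R1: "RelH (power_series_to_hat q \<tau> d) (fps_const d)"
    unfolding RelH_def ph
  proof (intro bexI[OF _ sC] conjI refl allI)
    fix k
    have "\<Phi> (s n) - fps_const d \<in> fps2_filt k" if "n \<ge> k" for n
    proof -
      have "fps_nth (\<Sum>i<n. fps_const (fps_nth d i) * fps_X ^ i) j = fps_nth d j" if "j < n" for j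
        using that by (simp add: fps_sum_nth if_distrib[where f = "\<lambda>x. _ * x"] cong: if_cong)
      then show ?thesis unfolding \<Phi>s fps2_filt_def using that by auto
    qed
    then show "\<exists>M. \<forall>i\<ge>M. \<Phi> (s i) - fps_const d \<in> fps2_filt k" by blast
  qed
  have T: "RelF (\<eta> (to_hat q \<tau>)) lt"
    using RelF_R[OF \<tau>_carr] by (simp add: e_def \<Phi>_\<tau> fps2_const lt_def)
  have lt0: "(lt :: 'a fls fls) \<noteq> 0" by (simp add: lt_def)
  have "RelF (laurent_coeff_to_K_flag q \<tau> f c) (fps2_to_fls2 (fps_const d) * lt powi fls_subdegree c)"
    unfolding laurent_coeff_to_K_flag_def d_def[symmetric]
    by (rule RelF_mult[OF RelF_H[OF R1] RelF_int_pow[OF T lt0]])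
  also have "fps2_to_fls2 (fps_const d) * lt powi fls_subdegree c = fls_const c"
  proof -
    have "fps_to_fls d * fls_X powi fls_subdegree c = c"
      unfolding d_def fls_X_power_int fls_X_intpow_times_conv_shift(2)
      by (rule fls_conv_base_factor_to_fps_shift_subdegree[symmetric])
    then show ?thesis unfolding fps2_const lt_def fls_const_power_int[symmetric] fls_const_mult_const by simp
  qed
  finally show ?thesis .
qed

lemma RelF_finsum: "finite I \<Longrightarrow> (\<And>j. j \<in> I \<Longrightarrow> RelF (z j) (h j)) \<Longrightarrow> RelF (\<Oplus>\<^bsub>K\<^esub>j\<in>I. z j) (\<Sum>j\<in>I. h j)"
proof (induction I rule: finite_induct)
  case (insert j I)
  have "z \<in> I \<rightarrow> carrier K" "z j \<in> carrier K" using insert.prems RelF_carr by auto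
  then show ?case using insert by (simp add: K.finsum_insert RelF_add)
qed (simp add: RelF_zero)

text \<open>This includes the existence of the limit in \<open>laurent_to_K_flag\<close>: the
  partial sums are related to truncations of h, and \<open>RelF_filt\<close> turns the convergence
  of these into a Cauchy condition.\<close>

lemma laurent_Rel: "Rel (laurent_to_K_flag q \<tau> f h) h"
proof -
  define zs where "zs n = (\<Oplus>\<^bsub>K\<^esub>j\<in>{fls_subdegree h..int n}.
       laurent_coeff_to_K_flag q \<tau> f (fls_nth h j) \<otimes>\<^bsub>K\<^esub> \<eta> x [^]\<^bsub>K\<^esub> j)" for n
  define hs where "hs n = (\<Sum>j\<in>{fls_subdegree h..int n}. fls_const (fls_nth h j) * fls_X powi j)" for n :: nat
  have X: "RelF (\<eta> x) fls_X"
    using RelF_R[OF f_carr] by (simp add: e_def \<Phi>_f fps2_X)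
  have r: "RelF (zs n) (hs n)" for n
    unfolding zs_def hs_def by (intro RelF_finsum RelF_mult Fls_coeff RelF_int_pow X) auto
  have hnth: "fls_nth (hs n) k = (if k \<le> int n then fls_nth h k else 0)" for n k
  proof -
    have "fls_nth (hs n) k = (\<Sum>j\<in>{fls_subdegree h..int n}. fls_nth (fls_const (fls_nth h j) * fls_X powi j) k)"
      unfolding hs_def by (induction "{fls_subdegree h..int n}" rule: infinite_finite_induct) (simp_all add: fls_nth_sum)
    also have "\<dots> = (\<Sum>j\<in>{fls_subdegree h..int n}. if j = k then fls_nth h k else 0)"
      by (intro sum.cong refl) (auto simp: fls_X_intpow_times_conv_shift)
    also have "\<dots> = (if k \<in> {fls_subdegree h..int n} then fls_nth h k else 0)" by simp
    finally show ?thesis by auto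
  qed
  have hV: "h - hs i \<in> fls_filt (int n)" if "i \<ge> n" for i n using that by (simp add: fls_filt_def hnth)
  have "\<exists>z\<in>carrier K. converges_to K filt zs z"
  proof (rule limit_exists)
    show "zs i \<in> FK" for i by (rule RelF_FK[OF r])
    fix n
    have "zs i \<ominus>\<^bsub>K\<^esub> zs j \<in> filt n" if "i \<ge> n" "j \<ge> n" for i j
    proof -
      have eq: "hs i - hs j = (h - hs j) - (h - hs i)" by simp
      have "hs i - hs j \<in> fls_filt (int n)" unfolding eq by (rule fls_filt_minus[OF hV[OF that(2)] hV[OF that(1)]])
      then show ?thesis using RelF_filt[OF RelF_minus[OF r r]] by simp
    qed
    then show "\<exists>M. \<forall>i\<ge>M. \<forall>j\<ge>M. zs i \<ominus>\<^bsub>K\<^esub> zs j \<in> filt n" by blast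
  qed
  then obtain z where z: "z \<in> carrier K" "converges_to K filt zs z" by blast
  have "K_flag_lim q f zs = z" unfolding K_flag_lim_def
  proof (rule the_equality, rule conjI[OF z])
    fix y assume y: "y \<in> carrier K \<and> converges_to K filt zs y"
    show "y = z" by (rule limit_unique[OF _ z(1) RelF_carr[OF r] _ z(2)]) (use y in blast)+
  qed
  then have "laurent_to_K_flag q \<tau> f h = z" unfolding laurent_to_K_flag_def zs_def .
  moreover have "\<exists>M. \<forall>i\<ge>M. h - hs i \<in> fls_filt (int n)" for n using hV by blast
  ultimately show ?thesis using Rel_limit[OF z r] by simp
qed

lemma RelF_\<rho>_mult: "r \<in> carrier function_field \<Longrightarrow> s \<in> carrier function_field \<Longrightarrow>
    RelF (\<rho> r) g \<Longrightarrow> RelF (\<rho> s) h \<Longrightarrow> RelF (\<rho> (r * s)) (g * h)"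
  by (simp add: \<rho>_mult RelF_mult)

lemma RelF_\<rho>_add: "r \<in> carrier function_field \<Longrightarrow> s \<in> carrier function_field \<Longrightarrow>
    RelF (\<rho> r) g \<Longrightarrow> RelF (\<rho> s) h \<Longrightarrow> RelF (\<rho> (r + s)) (g + h)"
  by (simp add: \<rho>_add RelF_add)

lemma RelF_\<rho>_R: "r \<in> R \<Longrightarrow> RelF (\<rho> r) (fps2_to_fls2 (\<Phi> r))"
  by (simp add: \<rho>_R RelF_R)

lemma RelF_\<rho>_frac: 
  assumes "a \<in> R" "b \<in> R" "b \<noteq> 0" "\<Phi> b \<noteq> 0"
  shows "RelF (\<rho> (a / b)) (fps2_to_fls2 (\<Phi> a) / fps2_to_fls2 (\<Phi> b))"
proof -
  have nz: "fps2_to_fls2 (\<Phi> b) \<noteq> 0" using assms(4) by (simp add: fps2_eq_0_iff)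
  show ?thesis
    unfolding \<rho>_frac[OF assms(1-3)] unfolding divide_inverse
    by (rule RelF_mult[OF RelF_R[OF assms(1)] RelF_inverse(2)[OF RelF_R[OF assms(2)] nz]])
qed

end

section \<open>Homogeneous polynomials in three variables\<close>

definition rhom :: "('b::comm_ring_1 \<Rightarrow> 'c::comm_ring_1) \<Rightarrow> bool" where
  "rhom h \<longleftrightarrow> h 1 = 1 \<and> (\<forall>a b. h (a + b) = h a + h b) \<and> (\<forall>a b. h (a * b) = h a * h b)"

lemma rhomD:
  assumes "rhom h"
  shows "h 1 = 1" "h (a + b) = h a + h b" "h (a * b) = h a * h b" "h 0 = 0" "h (- a) = - h a"
    "h (a - b) = h a - h b" "h (a ^ n) = h a ^ n" "h (sum g I) = (\<Sum>i\<in>I. h (g i))"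
proof -
  show 1: "h 1 = 1" and 2: "h (a + b) = h a + h b" and 3: "h (a * b) = h a * h b" for a b
    using assms by (auto simp: rhom_def)
  show 4: "h 0 = 0" using 2[of 0 0] by (metis add_cancel_right_right)
  show 5: "h (- a) = - h a" for a using 2[of "- a" a] 4 by (simp add: eq_neg_iff_add_eq_0)
  show "h (a - b) = h a - h b" for a b using 2[of a "- b"] 5 by simp
  show "h (a ^ n) = h a ^ n" by (induction n) (simp_all add: 1 3)
  show "h (sum g I) = (\<Sum>i\<in>I. h (g i))" by (induction I rule: infinite_finite_induct) (simp_all add: 2 4)
qed

lemma rhom_comp: "rhom g \<Longrightarrow> rhom h \<Longrightarrow> rhom (\<lambda>a. g (h a))"
  by (simp add: rhom_def)

definition evp :: "('b::comm_ring_1 \<Rightarrow> 'c::comm_ring_1) \<Rightarrow> 'c \<Rightarrow> 'b poly \<Rightarrow> 'c" where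
  "evp h c p = poly (map_poly h p) c"

lemma evp_pCons: "rhom h \<Longrightarrow> evp h c (pCons a p) = h a + c * evp h c p"
  by (simp add: evp_def map_poly_pCons rhomD)

lemma evp_0: "evp h c 0 = 0" by (simp add: evp_def)

lemma rhom_evp:
  assumes "rhom h" shows "rhom (evp h c)"
proof -
  note e = evp_pCons[OF assms] and r = rhomD[OF assms]
  have add: "evp h c (p + q) = evp h c p + evp h c q" for p q
    by (induction p q rule: poly_induct2) (simp_all add: e r evp_0 algebra_simps)
  have sm: "evp h c (smult a p) = h a * evp h c p" for a p
    by (induction p) (simp_all add: e r evp_0 algebra_simps)
  have mult: "evp h c (p * q) = evp h c p * evp h c q" for p q
  proof (induction p)
    case (pCons a p)
    have "evp h c (pCons a p * q) = h a * evp h c q + c * evp h c (p * q)"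
      by (simp add: add sm e r)
    then show ?case using pCons by (simp add: e algebra_simps)
  qed (simp add: evp_0)
  have "evp h c 1 = 1" using e[of c 1 0] by (simp add: one_pCons r evp_0)
  then show ?thesis using add mult by (simp add: rhom_def)
qed

lemma rhom_poly_eq:
  assumes "rhom g" "rhom h" "\<And>a. g [:a:] = h [:a:]" "g [:0, 1:] = h [:0, 1:]"
  shows "g p = h p"
proof (induction p)
  case (pCons a p)
  have "pCons a p = [:a:] + [:0, 1:] * p" by simp
  then show ?case using pCons assms rhomD(2,3)[OF assms(1)] rhomD(2,3)[OF assms(2)] by metis
qed (use rhomD(4)[OF assms(1)] rhomD(4)[OF assms(2)] in simp)

definition ev3 :: "('a::field \<Rightarrow> 'c::comm_ring_1) \<Rightarrow> 'c \<Rightarrow> 'c \<Rightarrow> 'c \<Rightarrow> 'a poly3 \<Rightarrow> 'c" where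
  "ev3 h X Y Z = evp (evp (evp h X) Y) Z"

lemma rhom_ev3: "rhom h \<Longrightarrow> rhom (ev3 h X Y Z)"
  unfolding ev3_def by (intro rhom_evp)

lemma ev3_gens:
  assumes "rhom h"
  shows "ev3 h X Y Z (const3 c) = h c" "ev3 h X Y Z xvar = X" "ev3 h X Y Z yvar = Y" "ev3 h X Y Z zvar = Z"
proof -
  note 1 = rhom_evp[OF assms, of X] 
  note 2 = rhom_evp[OF 1, of Y]
  note s = evp_pCons[OF assms] evp_pCons[OF 1] evp_pCons[OF 2] evp_0 rhomD[OF assms] rhomD[OF 1] rhomD[OF 2]
  show "ev3 h X Y Z (const3 c) = h c" "ev3 h X Y Z xvar = X" "ev3 h X Y Z yvar = Y" "ev3 h X Y Z zvar = Z"
    unfolding ev3_def const3_def xvar_def yvar_def zvar_def by (simp_all add: s)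
qed

lemma rhom_const3: "rhom const3"
  by (simp add: rhom_def const3_def one_pCons)

lemma const3_1: "const3 1 = 1"
  by (simp add: const3_def one_pCons)

lemma rhom_poly3_eq:
  assumes "rhom g" "rhom h" "\<And>c. g (const3 c) = h (const3 c)" "g xvar = h xvar" "g yvar = h yvar" "g zvar = h zvar"
  shows "g P = h P"
proof (rule rhom_poly_eq[OF assms(1,2)])
  have c1: "rhom (\<lambda>a::'a poly poly. [:a:])" "rhom (\<lambda>a::'a poly. [:a:])" by (simp_all add: rhom_def one_pCons)
  have c2: "rhom (\<lambda>a::'a poly. [:[:a:]:])" by (simp add: rhom_def one_pCons)
  show "g [:Q:] = h [:Q:]" for Q
  proof (rule rhom_poly_eq[OF rhom_comp[OF assms(1) c1(1)] rhom_comp[OF assms(2) c1(1)]])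
    show "g [:[:0, 1:]:] = h [:[:0, 1:]:]" using assms(5) by (simp add: yvar_def)
    show "g [:[:r:]:] = h [:[:r:]:]" for r
      by (rule rhom_poly_eq[OF rhom_comp[OF assms(1) c2] rhom_comp[OF assms(2) c2]])
        (use assms(3,4) in \<open>simp_all add: const3_def xvar_def\<close>)
  qed
  show "g [:0, 1:] = h [:0, 1:]" using assms(6) by (simp add: zvar_def)
qed

text \<open>The universal property of k[x,y,z]. The substitutions \<open>theta\<close>,
  \<open>sigma\<close>, \<open>omega\<close> and \<open>expand_p\<close> are all instances of
  \<open>ev3\<close>, and compositions of them are computed by comparing values at the
  variables.\<close>

lemma ev3_unique:
  assumes "rhom g" "rhom h" "\<And>c. g (const3 c) = h c"
  shows "g P = ev3 h (g xvar) (g yvar) (g zvar) P"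
  by (rule rhom_poly3_eq[OF assms(1) rhom_ev3[OF assms(2)]]) (simp_all add: ev3_gens[OF assms(2)] assms(3))

abbreviation coeff3 :: "'a::zero poly poly poly \<Rightarrow> nat \<Rightarrow> nat \<Rightarrow> nat \<Rightarrow> 'a" where
  "coeff3 P i j l \<equiv> coeff (coeff (coeff P l) j) i"

lemma poly3_eqI: "(\<And>i j l. coeff3 P i j l = coeff3 Q i j l) \<Longrightarrow> P = Q"
  by (simp add: poly_eq_iff)

definition m3 :: "'a::field \<Rightarrow> nat \<Rightarrow> nat \<Rightarrow> nat \<Rightarrow> 'a poly3" where
  "m3 c i j l = monom (monom (monom c i) j) l"

lemma coeff3_m3: "coeff3 (m3 c i j l) i' j' l' = (if i' = i \<and> j' = j \<and> l' = l then c else 0)"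
  by (auto simp: m3_def)

lemma m3_eq: "m3 c i j l = const3 c * xvar ^ i * yvar ^ j * zvar ^ l"
proof -
  have mj: "monom 1 j = ([:0, 1:] :: 'b::comm_ring_1 poly) ^ j" for j by (simp add: monom_altdef)
  have c1: "rhom (\<lambda>a::'a poly poly. [:a:])" and c2: "rhom (\<lambda>a::'a poly. [:[:a:]:])" by (simp_all add: rhom_def one_pCons)
  have z: "zvar ^ l = (monom 1 l :: 'a poly3)" unfolding zvar_def mj ..
  have y: "yvar ^ j = ([:monom 1 j:] :: 'a poly3)" unfolding yvar_def mj by (rule rhomD(7)[OF c1, symmetric])
  have x: "xvar ^ i = ([:[:monom 1 i:]:] :: 'a poly3)" unfolding xvar_def mj by (rule rhomD(7)[OF c2, symmetric])
  show ?thesis unfolding x y z const3_def m3_def by (simp add: smult_monom)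
qed

lemma poly3_expand: "\<exists>S. finite S \<and> P = (\<Sum>(i, j, l)\<in>S. m3 (coeff3 P i j l) i j l)"
proof -
  obtain N where N: "\<And>i j l. coeff3 P i j l \<noteq> 0 \<Longrightarrow> i \<le> N \<and> j \<le> N \<and> l \<le> N"
  proof -
    define N2 where "N2 = Max ((\<lambda>l. degree (coeff P l)) ` {..degree P})"
    define N3 where "N3 = Max ((\<lambda>(l, j). degree (coeff (coeff P l) j)) ` ({..degree P} \<times> {..N2}))"
    have "i \<le> N3 \<and> j \<le> N2 \<and> l \<le> degree P" if nz: "coeff3 P i j l \<noteq> 0" for i j l
    proof -
      have l: "l \<le> degree P" by (rule le_degree) (use nz in auto)
      have "j \<le> degree (coeff P l)" by (rule le_degree) (use nz in auto)
      also have "\<dots> \<le> N2" unfolding N2_def using l by (intro Max_ge) auto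
      finally have j: "j \<le> N2" .
      have "i \<le> degree (coeff (coeff P l) j)" by (rule le_degree) (use nz in auto)
      also have "\<dots> \<le> N3" unfolding N3_def using l j by (intro Max_ge) (auto intro!: image_eqI[of _ _ "(l, j)"])
      finally show ?thesis using l j by blast
    qed
    then have "i \<le> max N3 (max N2 (degree P)) \<and> j \<le> max N3 (max N2 (degree P)) \<and> l \<le> max N3 (max N2 (degree P))"
      if "coeff3 P i j l \<noteq> 0" for i j l using that by (meson max.coboundedI1 max.coboundedI2)
    then show thesis using that by blast
  qed
  define S where "S = {..N} \<times> {..N} \<times> {..N}"
  have "coeff3 (\<Sum>(i, j, l)\<in>S. m3 (coeff3 P i j l) i j l) i' j' l' = coeff3 P i' j' l'" for i' j' l'
  proof -
    have "coeff3 (\<Sum>(i, j, l)\<in>S. m3 (coeff3 P i j l) i j l) i' j' l' =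
        (\<Sum>p\<in>S. if p = (i', j', l') then coeff3 P i' j' l' else 0)"
      unfolding coeff_sum by (intro sum.cong refl) (auto simp: coeff3_m3 split: prod.splits)
    also have "\<dots> = (if (i', j', l') \<in> S then coeff3 P i' j' l' else 0)" by (simp add: S_def)
    also have "\<dots> = coeff3 P i' j' l'" using N[of l' j' i'] by (auto simp: S_def)
    finally show ?thesis .
  qed
  then have "P = (\<Sum>(i, j, l)\<in>S. m3 (coeff3 P i j l) i j l)" by (intro poly3_eqI) simp
  then show ?thesis by (intro exI[of _ S]) (auto simp: S_def)
qed

text \<open>\<open>theta P = P(xT, yT, zT)\<close>; its \<open>T\<close>-coefficients are the homogeneous components of \<open>P\<close>.\<close>

definition theta :: "'a::field poly3 \<Rightarrow> 'a poly3 poly" where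
  "theta = ev3 (\<lambda>c. [:const3 c:]) (monom xvar 1) (monom yvar 1) (monom zvar 1)"

lemma rhom_theta_const: "rhom (\<lambda>c::'a::field. [:const3 c:])"
  using rhom_const3 by (auto simp: rhom_def one_pCons)

lemma rhom_theta: "rhom theta"
  unfolding theta_def by (rule rhom_ev3[OF rhom_theta_const])

lemma theta_m3: "theta (m3 c i j l) = monom (m3 c i j l) (i + j + l)"
proof -
  note t = ev3_gens[OF rhom_theta_const, of "monom xvar 1" "monom yvar 1" "monom zvar 1", folded theta_def]
  have "theta (m3 c i j l) = [:const3 c:] * monom xvar 1 ^ i * monom yvar 1 ^ j * monom zvar 1 ^ l"
    unfolding m3_eq by (simp add: rhomD[OF rhom_theta] t)
  also have "\<dots> = monom (m3 c i j l) (i + j + l)"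
    unfolding m3_eq by (simp add: monom_power mult_monom monom_0[symmetric] del: monom_0)
  finally show ?thesis .
qed

lemma coeff3_theta: "coeff3 (coeff (theta P) e) i j l = (if i + j + l = e then coeff3 P i j l else 0)"
proof -
  obtain S where S: "finite S" "P = (\<Sum>(i, j, l)\<in>S. m3 (coeff3 P i j l) i j l)" using poly3_expand by blast
  have "coeff (theta P) e = (\<Sum>(i, j, l)\<in>S. if i + j + l = e then m3 (coeff3 P i j l) i j l else 0)"
    by (subst S(2)) (auto simp: rhomD[OF rhom_theta] coeff_sum theta_m3 intro!: sum.cong split: prod.splits)
  then have "coeff3 (coeff (theta P) e) i j l =
      (\<Sum>(i', j', l')\<in>S. if i' + j' + l' = e then coeff3 (m3 (coeff3 P i' j' l') i' j' l') i j l else 0)"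
    by (simp add: coeff_sum case_prod_beta if_distrib[where f = "\<lambda>p. coeff3 p i j l"] cong: if_cong)
  also have "\<dots> = (if i + j + l = e then (\<Sum>(i', j', l')\<in>S. coeff3 (m3 (coeff3 P i' j' l') i' j' l') i j l) else 0)"
    by (auto simp: coeff3_m3 case_prod_beta intro!: sum.cong sum.neutral)
  also have "(\<Sum>(i', j', l')\<in>S. coeff3 (m3 (coeff3 P i' j' l') i' j' l') i j l) = coeff3 P i j l"
    using arg_cong[OF S(2), of "\<lambda>P. coeff3 P i j l"] by (simp add: coeff_sum case_prod_beta)
  finally show ?thesis .
qed

text \<open>Replaces a condition on coefficients by an equation for a ring homomorphism, so that
  sums, products and powers of forms need no coefficient computation.\<close>

lemma homogeneous_iff: "homogeneous d P \<longleftrightarrow> theta P = monom P d"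
proof
  assume h: "homogeneous d P"
  show "theta P = monom P d"
  proof (rule poly_eqI, rule poly3_eqI)
    fix e i j l
    show "coeff3 (coeff (theta P) e) i j l = coeff3 (coeff (monom P d) e) i j l"
      using h unfolding coeff3_theta homogeneous_def by (cases "e = d") auto
  qed
next
  assume t: "theta P = monom P d"
  show "homogeneous d P" unfolding homogeneous_def
  proof (intro allI impI)
    fix i j l assume "coeff3 P i j l \<noteq> 0"
    then have "coeff3 (coeff (theta P) (i + j + l)) i j l \<noteq> 0" by (simp add: coeff3_theta)
    then show "i + j + l = d" unfolding t by (auto split: if_splits)
  qed
qed

lemma homogeneous_comp: "homogeneous e (coeff (theta P) e)"
  unfolding homogeneous_def coeff3_theta by auto

lemma sum_comp: "P = (\<Sum>e\<le>degree (theta P). coeff (theta P) e)"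
proof (rule poly3_eqI)
  fix i j l
  have "coeff3 (\<Sum>e\<le>degree (theta P). coeff (theta P) e) i j l =
      (\<Sum>e\<le>degree (theta P). if i + j + l = e then coeff3 P i j l else 0)"
    by (simp add: coeff_sum coeff3_theta)
  also have "\<dots> = (if i + j + l \<le> degree (theta P) then coeff3 P i j l else 0)" by simp
  also have "\<dots> = coeff3 P i j l"
  proof (cases "i + j + l \<le> degree (theta P)")
    case False
    then have "coeff (theta P) (i + j + l) = 0" by (simp add: coeff_eq_0)
    then have "coeff3 (coeff (theta P) (i + j + l)) i j l = 0" by simp
    then show ?thesis unfolding coeff3_theta by simp
  qed simp
  finally show "coeff3 P i j l = coeff3 (\<Sum>e\<le>degree (theta P). coeff (theta P) e) i j l" ..
qed

lemma homogeneous_0: "homogeneous d 0" by (simp add: homogeneous_def)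
lemma homogeneous_add: "homogeneous d P \<Longrightarrow> homogeneous d Q \<Longrightarrow> homogeneous d (P + Q)"
  by (simp add: homogeneous_iff rhomD[OF rhom_theta] add_monom)
lemma homogeneous_minus: "homogeneous d P \<Longrightarrow> homogeneous d Q \<Longrightarrow> homogeneous d (P - Q)"
  by (simp add: homogeneous_iff rhomD[OF rhom_theta] diff_monom)
lemma homogeneous_mult: "homogeneous d P \<Longrightarrow> homogeneous e Q \<Longrightarrow> homogeneous (d + e) (P * Q)"
  by (simp add: homogeneous_iff rhomD[OF rhom_theta] mult_monom)
lemma homogeneous_pow: "homogeneous d P \<Longrightarrow> homogeneous (n * d) (P ^ n)"
  by (simp add: homogeneous_iff rhomD[OF rhom_theta] monom_power mult.commute)
lemma homogeneous_const: "homogeneous 0 (const3 c)"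
  using theta_m3[of c 0 0 0] by (simp add: homogeneous_iff m3_eq)
lemma homogeneous_1: "homogeneous 0 1"
  using homogeneous_const[of 1] unfolding const3_1 .
lemma homogeneous_vars: "homogeneous 1 xvar" "homogeneous 1 yvar" "homogeneous 1 zvar"
  using theta_m3[of 1 1 0 0] theta_m3[of 1 0 1 0] theta_m3[of 1 0 0 1]
  by (simp_all add: homogeneous_iff m3_eq const3_1)

lemma homogeneous_unique: "homogeneous d P \<Longrightarrow> homogeneous e P \<Longrightarrow> P \<noteq> 0 \<Longrightarrow> d = e"
  unfolding homogeneous_iff by (metis monom_eq_iff' )

lemma homogeneous_quotient:
  assumes "homogeneous e F" "homogeneous d (F * P)" "F \<noteq> 0" shows "homogeneous (d - e) P"
proof (cases "P = 0")
  case False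
  have eq: "monom F e * theta P = monom (F * P) d"
    using assms(1,2) by (simp add: homogeneous_iff rhomD[OF rhom_theta])
  have 1: "F * coeff (theta P) n = (if n + e = d then F * P else 0)" for n
  proof -
    have "coeff (monom F e * theta P) (n + e) = F * coeff (theta P) n" by (simp add: coeff_monom_mult)
    then show ?thesis unfolding eq by auto
  qed
  have "theta P = monom P (d - e)"
  proof (rule poly_eqI)
    fix n
    \<comment> \<open>The subtraction \<open>d - e\<close> is truncated; for smaller d the quotient
      would be zero.\<close>
    have "d \<ge> e"
    proof (rule ccontr)
      assume "\<not> ?thesis"
      then have "F * coeff (theta P) n = 0" for n unfolding 1 by auto
      then have "coeff (theta P) n = 0" for n using assms(3) by simp
      then have "P = 0" using sum_comp[of P] by simp
      then show False using False by simp
    qed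
    then show "coeff (theta P) n = coeff (monom P (d - e)) n" using 1[of n] assms(3) by (auto split: if_splits)
  qed
  then show ?thesis by (simp add: homogeneous_iff)
qed (simp add: homogeneous_0)

lemma ev3_scale:
  assumes "rhom h" "homogeneous d P"
  shows "ev3 h (t * X) (t * Y) (t * Z) P = t ^ d * ev3 h X Y Z P"
proof -
  obtain S where S: "finite S" "P = (\<Sum>(i, j, l)\<in>S. m3 (coeff3 P i j l) i j l)" using poly3_expand by blast
  have m: "ev3 h (t * X) (t * Y) (t * Z) (m3 (coeff3 P i j l) i j l) = t ^ d * ev3 h X Y Z (m3 (coeff3 P i j l) i j l)" for i j l
  proof (cases "coeff3 P i j l = 0")
    case True
    have "m3 0 i j l = (0 :: 'a poly3)" by (simp add: m3_def)
    then show ?thesis using True by (simp add: rhomD[OF rhom_ev3[OF assms(1)]])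
  next
    case False
    then have "d = i + j + l" using assms(2) by (simp add: homogeneous_def)
    then show ?thesis unfolding m3_eq
      by (simp add: rhomD[OF rhom_ev3[OF assms(1)]] ev3_gens[OF assms(1)] power_mult_distrib power_add mult_ac)
  qed
  show ?thesis
    by (subst (1 2) S(2)) (simp add: rhomD(8)[OF rhom_ev3[OF assms(1)]] sum_distrib_left case_prod_beta m)
qed

section \<open>The complement of the line z = 0\<close>

definition emb :: "'a::field poly3 \<Rightarrow> 'a poly3 fract" where "emb P = ratio P 1"

lemma rhom_emb: "rhom emb"
  by (simp add: rhom_def emb_def One_fract_def)

lemmas emb_hom = rhomD[OF rhom_emb]

lemma emb_eq_0_iff: "emb P = 0 \<longleftrightarrow> P = 0"
  by (simp add: emb_def Zero_fract_def eq_fract)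

lemma emb_eq_iff: "emb P = emb Q \<longleftrightarrow> P = Q"
  by (simp add: emb_def eq_fract)

lemma ratio_emb: "ratio a b = emb a / emb b"
  by (cases "b = 0") (simp_all add: emb_def Zero_fract_def eq_fract)

definition kc :: "'a::field \<Rightarrow> 'a poly3 fract" where "kc c = emb (const3 c)"

lemma rhom_kc: "rhom kc"
  using rhom_comp[OF rhom_emb rhom_const3] by (simp add: kc_def[abs_def])

lemma vars_nz: "xvar \<noteq> 0" "yvar \<noteq> 0" "zvar \<noteq> 0"
  by (simp_all add: xvar_def yvar_def zvar_def)

lemma two_emb: "(2 :: 'a poly3 fract) = kc (2 :: 'a::field)"
proof -
  have "kc (1 + 1 :: 'a) = kc 1 + kc 1" by (rule rhomD(2)[OF rhom_kc])
  also have "kc (1 :: 'a) = 1" by (rule rhomD(1)[OF rhom_kc])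
  finally show ?thesis by simp
qed

lemma homogeneous_conic: "homogeneous 2 (conic :: 'a::field poly3)"
proof -
  have two: "homogeneous 0 (2 :: 'a poly3)"
  proof -
    have "const3 2 = (2 :: 'a poly3)" using rhomD(2)[OF rhom_const3, of 1 1] const3_1 by (metis one_add_one)
    then show ?thesis using homogeneous_const[of "2 :: 'a"] by simp
  qed
  have "homogeneous (2 * 1) (yvar ^ 2 :: 'a poly3)" "homogeneous (2 * 1) (zvar ^ 2 :: 'a poly3)"
    by (rule homogeneous_pow homogeneous_vars)+
  moreover have "homogeneous (0 + 1 + 1) (2 * xvar * zvar :: 'a poly3)"
    by (intro homogeneous_mult two homogeneous_vars)
  ultimately show ?thesis unfolding conic_def by (intro homogeneous_minus homogeneous_add) (simp_all add: numeral_2_eq_2)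
qed

definition al :: "'a::field poly3 fract" where "al = emb yvar / emb zvar"
definition f0 :: "'a::field poly3 fract" where "f0 = emb conic / emb zvar ^ 2"
text \<open>\<open>'a poly poly\<close> stands for k[\<alpha>][f], with \<alpha> the inner and f the
  outer variable; \<open>io\<close> is its inclusion in the function field.\<close>

definition io :: "'a::field poly poly \<Rightarrow> 'a poly3 fract" where "io = evp (evp kc al) f0"

lemma rhom_io: "rhom io"
  unfolding io_def by (intro rhom_evp rhom_kc)

lemmas io_hom = rhomD[OF rhom_io]

lemma io_X: "io [:0, 1:] = f0" and io_const: "io [:c:] = evp kc al c"
  unfolding io_def by (simp_all add: evp_pCons rhom_evp rhom_kc evp_0 rhomD[OF rhom_evp[OF rhom_kc]])

lemma evp_kc_X: "evp kc al [:0, 1:] = al" and evp_kc_const: "evp kc al [:c:] = kc c"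
  by (simp_all add: evp_pCons rhom_kc evp_0 rhomD[OF rhom_kc])

text \<open>\<open>sigma\<close> substitutes \<open>z = 1\<close> and expresses \<open>x\<close> by \<open>y\<close> and the equation of the conic, i.e. it is
  the isomorphism of the affine chart with the spectrum of \<open>k[\<alpha>][f]\<close>.\<close>

definition sigma :: "'a::field poly3 \<Rightarrow> 'a poly poly" where
  "sigma = ev3 (\<lambda>c. [:[:c:]:]) [:smult (inverse 2) [:1, 0, 1:], [:- inverse 2:]:] [:[:0, 1:]:] 1"

lemma rhom_cc: "rhom (\<lambda>c::'a::comm_ring_1. [:[:c:]:])"
  by (simp add: rhom_def one_pCons)

lemma rhom_sigma: "rhom sigma"
  unfolding sigma_def by (rule rhom_ev3[OF rhom_cc])

lemmas sigma_hom = rhomD[OF rhom_sigma]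

lemma sigma_gens:
  "sigma (const3 c) = [:[:c:]:]" "sigma xvar = [:smult (inverse 2) [:1, 0, 1:], [:- inverse 2:]:]"
  "sigma yvar = [:[:0, 1:]:]" "sigma zvar = 1"
  unfolding sigma_def by (rule ev3_gens[OF rhom_cc])+

locale char_ne_2 =
  fixes dummy :: "'a::field itself"
  assumes two: "(2 :: 'a) \<noteq> 0"
begin

text \<open>At z = 1 the conic is \<alpha>^2 + 1 - 2x, and \<open>sigma\<close> sends x to (1 +
  \<alpha>^2 - f)/2. Here the characteristic enters.\<close>

lemma sigma_conic: "sigma (conic :: 'a poly3) = [:0, 1:]"
proof -
  have i2: "(2::'a) * inverse 2 = 1" using two by simp
  have t: "sigma 2 = (2 :: 'a poly poly)" using sigma_hom(2)[of 1 1] sigma_hom(1) by (metis one_add_one)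
  have tt: "(2 :: 'a poly poly) = [:[:2:]:]" by (metis numeral_poly)
  show ?thesis unfolding conic_def sigma_hom sigma_gens t tt
    using i2 by (simp add: power2_eq_square one_pCons)
qed

lemma io_sigma_x: "io (sigma (xvar :: 'a poly3)) = emb xvar / emb zvar"
proof -
  have z: "emb (zvar :: 'a poly3) \<noteq> 0" by (simp add: emb_eq_0_iff vars_nz)
  have two': "(2 :: 'a poly3 fract) \<noteq> 0" using two unfolding two_emb by (simp add: kc_def emb_eq_0_iff const3_def)
  have i2: "2 * kc (inverse 2 :: 'a) = 1"
    unfolding two_emb using rhomD(3)[OF rhom_kc, of 2 "inverse 2"] rhomD(1)[OF rhom_kc] two by (metis right_inverse)
  have c: "io [:smult (inverse 2) [:1, 0, 1:], [:- inverse 2:]:] = kc (inverse 2 :: 'a) * (1 + al * al) - f0 * kc (inverse 2)"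
    unfolding io_def
    by (simp add: evp_pCons rhom_evp rhom_kc evp_0 rhomD[OF rhom_evp[OF rhom_kc]] rhomD[OF rhom_kc] algebra_simps)
  have "2 * io (sigma (xvar :: 'a poly3)) = (2 * kc (inverse 2 :: 'a)) * (1 + al * al - f0)"
    unfolding sigma_gens c by (simp add: algebra_simps)
  also have "\<dots> = 1 + al * al - f0" unfolding i2 by simp
  also have "\<dots> = 2 * (emb xvar / emb zvar)"
  proof -
    have "emb (2 :: 'a poly3) = 2" using emb_hom(2)[of 1 1] emb_hom(1) by (metis one_add_one)
    then show ?thesis unfolding al_def f0_def conic_def emb_hom using z by (simp add: field_simps power2_eq_square)
  qed
  finally show ?thesis by (rule mult_left_cancel[THEN iffD1, OF two'])
qed

text \<open>Dehomogenization: a form of degree d is z^d times its value at (x/z, y/z, 1), and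
  \<open>io\<close> after \<open>sigma\<close> is this evaluation by the universal property.\<close>

lemma emb_homogeneous: 
  assumes "homogeneous d (a :: 'a poly3)" shows "emb a = emb zvar ^ d * io (sigma a)"
proof -
  have z: "emb (zvar :: 'a poly3) \<noteq> 0" by (simp add: emb_eq_0_iff vars_nz)
  have "emb a = ev3 kc (emb xvar) (emb yvar) (emb zvar) a"
    by (rule ev3_unique[OF rhom_emb rhom_kc]) (simp add: kc_def)
  also have "\<dots> = ev3 kc (emb zvar * (emb xvar / emb zvar)) (emb zvar * (emb yvar / emb zvar)) (emb zvar * 1) a"
    using z by simp
  also have "\<dots> = emb zvar ^ d * ev3 kc (emb xvar / emb zvar) (emb yvar / emb zvar) 1 a"
    by (rule ev3_scale[OF rhom_kc assms])
  also have "ev3 kc (emb xvar / emb zvar) (emb yvar / emb zvar) 1 a = io (sigma a)"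
  proof -
    have "io (sigma a) = ev3 kc (io (sigma xvar)) (io (sigma yvar)) (io (sigma zvar)) a"
      by (rule ev3_unique[OF rhom_comp[OF rhom_io rhom_sigma] rhom_kc])
        (simp add: sigma_gens io_const evp_kc_const)
    moreover have "io (sigma (yvar :: 'a poly3)) = al" by (simp add: sigma_gens io_const evp_kc_X)
    moreover have "io (sigma (zvar :: 'a poly3)) = 1" by (simp add: sigma_gens io_hom)
    ultimately show ?thesis unfolding io_sigma_x al_def by simp
  qed
  finally show ?thesis .
qed

lemma sigma_z_pow: "sigma (zvar ^ n * a) = sigma a"
  by (simp add: sigma_hom sigma_gens)

text \<open>The images of forms under \<open>sigma\<close> include the constants, \<alpha> and f.
  They are closed under products and, once degrees are equalized by powers of z, under sums.\<close>

lemma homogenize: "\<exists>d a. homogeneous d a \<and> sigma a = (A :: 'a poly poly)"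
proof -
  define P where "P A \<longleftrightarrow> (\<exists>d a. homogeneous d a \<and> sigma a = (A :: 'a poly poly))" for A
  have add: "P (A + B)" if AB: "P A" "P B" for A B
  proof -
    obtain d a e b where a: "homogeneous d a" "sigma a = A" "homogeneous e b" "sigma b = B" using AB P_def by auto
    have "homogeneous (e * 1 + d) (zvar ^ e * a)" "homogeneous (d * 1 + e) (zvar ^ d * b)"
      by (intro homogeneous_mult homogeneous_pow homogeneous_vars a)+
    then have "homogeneous (d + e) (zvar ^ e * a + zvar ^ d * b)" by (intro homogeneous_add) (simp_all add: add.commute)
    moreover have "sigma (zvar ^ e * a + zvar ^ d * b) = A + B" unfolding sigma_hom(2) sigma_z_pow a ..
    ultimately show ?thesis unfolding P_def by blast
  qed
  have mult: "P (A * B)" if AB: "P A" "P B" for A B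
  proof -
    obtain d a e b where a: "homogeneous d a" "sigma a = A" "homogeneous e b" "sigma b = B" using AB P_def by auto
    have "homogeneous (d + e) (a * b)" "sigma (a * b) = A * B" using a by (auto simp: sigma_hom intro: homogeneous_mult)
    then show ?thesis unfolding P_def by blast
  qed
  have c: "P [:[:c:]:]" for c unfolding P_def using homogeneous_const sigma_gens(1) by blast
  have z: "P 0" using c[of 0] by simp
  have y: "P [:[:0, 1:]:]" unfolding P_def using homogeneous_vars(2) sigma_gens(3) by blast
  have f: "P [:0, 1:]" unfolding P_def using homogeneous_conic sigma_conic by blast
  have cc: "P [:p:]" for p
  proof (induction p)
    case (pCons a p)
    have "[:pCons a p:] = [:[:a:]:] + [:[:0, 1:]:] * [:p:]" by simp
    then show ?case using add[OF c mult[OF y pCons(2)]] by metis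
  qed (simp add: z)
  have "P A" for A
  proof (induction A)
    case (pCons a p)
    have "pCons a p = [:a:] + [:0, 1:] * p" by simp
    then show ?case using add[OF cc mult[OF f pCons(2)]] by metis
  qed (simp add: z)
  then show ?thesis unfolding P_def .
qed

lemma homogenize2:
  obtains d a b where "homogeneous d a" "homogeneous d b" "sigma a = (A :: 'a poly poly)" "sigma b = (B :: 'a poly poly)"
proof -
  obtain d a where a1: "homogeneous d a" "sigma a = A" using homogenize by blast
  obtain e b where a2: "homogeneous e b" "sigma b = B" using homogenize by blast
  note a = a1 a2
  have "homogeneous (e * 1 + d) (zvar ^ e * a)" "homogeneous (d * 1 + e) (zvar ^ d * b)"
    by (intro homogeneous_mult homogeneous_pow homogeneous_vars a)+
  then have "homogeneous (d + e) (zvar ^ e * a)" "homogeneous (d + e) (zvar ^ d * b)" by (simp_all add: add.commute)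
  then show ?thesis using that[of "d + e" "zvar ^ e * a" "zvar ^ d * b"] a by (simp add: sigma_z_pow)
qed

lemma sigma_inj: "homogeneous d (a :: 'a poly3) \<Longrightarrow> sigma a = 0 \<Longrightarrow> a = 0"
  using emb_homogeneous[of d a] by (simp add: io_hom emb_eq_0_iff)

lemma sigma_eq: "homogeneous d (a :: 'a poly3) \<Longrightarrow> homogeneous d b \<Longrightarrow> sigma a = sigma b \<Longrightarrow> a = b"
  using sigma_inj[OF homogeneous_minus, of d a b] by (simp add: sigma_hom)

lemma io_eq_0_iff: "io (A :: 'a poly poly) = 0 \<longleftrightarrow> A = 0"
proof
  assume A: "io A = 0"
  obtain d a where a: "homogeneous d a" "sigma a = A" using homogenize by blast
  have "emb a = 0" using emb_homogeneous[OF a(1)] a(2) A by simp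
  then show "A = 0" using a(2) by (simp add: emb_eq_0_iff sigma_hom)
qed (simp add: io_hom)

lemma io_eq_iff: "io (A :: 'a poly poly) = io B \<longleftrightarrow> A = B"
  using io_eq_0_iff[of "A - B"] by (simp add: io_hom)

lemma ratio_io: "homogeneous d (a :: 'a poly3) \<Longrightarrow> homogeneous d b \<Longrightarrow> ratio a b = io (sigma a) / io (sigma b)"
  unfolding ratio_emb using emb_homogeneous[of d a] emb_homogeneous[of d b] by (simp add: emb_eq_0_iff vars_nz)

abbreviation "FF \<equiv> carrier (function_field :: 'a poly3 fract ring)"

lemma FF_iff: "r \<in> FF \<longleftrightarrow> (\<exists>A B. B \<noteq> 0 \<and> r = io A / io B)"
proof
  assume "r \<in> FF"
  then obtain a b d where ab: "homogeneous d a" "homogeneous d b" "b \<noteq> 0" "r = ratio a b" by (auto simp: stalk_def)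
  then show "\<exists>A B. B \<noteq> 0 \<and> r = io A / io B" using ratio_io[OF ab(1,2)] sigma_inj[OF ab(2)] by blast
next
  assume "\<exists>A B. B \<noteq> 0 \<and> r = io A / io B"
  then obtain A B where AB: "B \<noteq> 0" "r = io A / io B" by blast
  obtain d a b where ab: "homogeneous d a" "homogeneous d b" "sigma a = A" "sigma b = B" by (rule homogenize2)
  have "b \<noteq> 0" using AB(1) ab(4) by (auto simp: sigma_hom)
  moreover have "r = ratio a b" using ratio_io[OF ab(1,2)] ab AB by simp
  ultimately show "r \<in> FF" unfolding stalk_def ring_on_simps using ab(1,2) by blast
qed

lemma FFE: assumes "r \<in> FF" obtains A B where "B \<noteq> 0" "r = io A / io B"
  using assms FF_iff by blast

lemma FF_subring: "subring_on FF"
proof -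
  have "1 \<in> FF" unfolding FF_iff by (intro exI[of _ 1]) (simp add: io_hom)
  moreover have "r - s \<in> FF" "r * s \<in> FF" if rs: "r \<in> FF" "s \<in> FF" for r s
  proof -
    obtain A B where A: "B \<noteq> 0" "r = io A / io B" using rs(1) by (rule FFE)
    obtain C D where C: "D \<noteq> 0" "s = io C / io D" using rs(2) by (rule FFE)
    have "r - s = io (A * D - C * B) / io (B * D)" "r * s = io (A * C) / io (B * D)"
      unfolding A(2) C(2) using A(1) C(1) by (simp_all add: io_hom io_eq_0_iff field_simps)
    then show "r - s \<in> FF" "r * s \<in> FF" unfolding FF_iff using A(1) C(1) by (metis mult_eq_0_iff)+
  qed
  ultimately show ?thesis by (simp add: subring_on_def)
qed

lemma FF_inverse: "r \<in> FF \<Longrightarrow> inverse r \<in> FF"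
proof -
  assume "r \<in> FF"
  then obtain A B where A: "B \<noteq> 0" "r = io A / io B" by (rule FFE)
  show ?thesis
  proof (cases "A = 0")
    case True then show ?thesis using A subring_onD(2)[OF FF_subring] by (simp add: io_hom)
  next
    case False then show ?thesis unfolding FF_iff using A by (intro exI[of _ B] exI[of _ A]) simp
  qed
qed

lemma io_FF: "io A \<in> FF"
  unfolding FF_iff by (intro exI[of _ A] exI[of _ 1]) (simp add: io_hom)

lemma conic_nz: "(conic :: 'a poly3) \<noteq> 0"
proof
  assume "(conic :: 'a poly3) = 0"
  then have "sigma (conic :: 'a poly3) = 0" by (simp add: sigma_hom)
  then show False by (simp add: sigma_conic)
qed

text \<open>At z = 0 the conic becomes y^2, which is nonzero, so in z a = conic c the cofactor c
  must itself be divisible by z.\<close>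

lemma conic_dvd_z: "conic dvd zvar * (a :: 'a poly3) \<Longrightarrow> conic dvd a"
proof -
  assume "conic dvd zvar * a"
  then obtain c where c: "zvar * a = conic * c" by (auto simp: dvd_def)
  have "coeff (conic * c) 0 = 0" unfolding c[symmetric] by (simp add: zvar_def)
  moreover have "coeff (conic * c) 0 = (coeff yvar 0) ^ 2 * coeff c 0"
    unfolding conic_def coeff_mult_0 by (simp add: zvar_def power2_eq_square coeff_mult_0)
  ultimately have "coeff c 0 = 0" by (simp add: yvar_def)
  then obtain c' where c': "c = zvar * c'" by (metis dvdE poly_0_coeff_0 poly_eq_0_iff_dvd zvar_def minus_zero)
  have "a = conic * c'" using c unfolding c' by (simp add: mult.left_commute vars_nz)
  then show ?thesis by simp
qed

lemma conic_pow_dvd_z: "conic ^ n dvd zvar * (a :: 'a poly3) \<Longrightarrow> conic ^ n dvd a"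
proof (induction n arbitrary: a)
  case (Suc n)
  have "conic dvd zvar * a" using Suc.prems by (metis dvd_mult_left power_Suc)
  then obtain b where b: "a = conic * b" using conic_dvd_z by blast
  have "conic * conic ^ n dvd conic * (zvar * b)" using Suc.prems unfolding b by (simp add: mult_ac)
  then have "conic ^ n dvd zvar * b" using conic_nz by simp
  from Suc.IH[OF this] show ?case unfolding b power_Suc by (rule mult_dvd_mono[OF dvd_refl])
qed simp

lemma conic_pow_dvd_z_pow: "conic ^ n dvd zvar ^ m * (a :: 'a poly3) \<Longrightarrow> conic ^ n dvd a"
proof (induction m)
  case (Suc m)
  have "conic ^ n dvd zvar * (zvar ^ m * a)" using Suc.prems by (simp add: mult.assoc)
  then have "conic ^ n dvd zvar ^ m * a" by (rule conic_pow_dvd_z)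
  then show ?case by (rule Suc.IH)
qed simp

text \<open>A quotient found in the chart is rehomogenized at the price of powers of z on both
  sides; \<open>conic_pow_dvd_z_pow\<close> removes them.\<close>

lemma conic_pow_dvd_iff:
  assumes a: "homogeneous d (a :: 'a poly3)"
  shows "conic ^ n dvd a \<longleftrightarrow> [:0, 1:] ^ n dvd sigma a"
proof
  assume "conic ^ n dvd a"
  then show "[:0, 1:] ^ n dvd sigma a" by (auto simp: dvd_def sigma_hom sigma_conic)
next
  assume "[:0, 1:] ^ n dvd sigma a"
  then obtain C where C: "sigma a = [:0, 1:] ^ n * C" by (auto simp: dvd_def)
  obtain e c where c: "homogeneous e c" "sigma c = C" using homogenize by blast
  define e' where "e' = n * 2 + e"
  have "homogeneous e' (conic ^ n * c)" unfolding e'_def by (intro homogeneous_mult homogeneous_pow homogeneous_conic c)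
  then have 1: "homogeneous (d * 1 + e') (zvar ^ d * (conic ^ n * c))"
    by (intro homogeneous_mult homogeneous_pow homogeneous_vars)
  have "homogeneous (e' * 1 + d) (zvar ^ e' * a)" by (intro homogeneous_mult homogeneous_pow homogeneous_vars a)
  then have 2: "homogeneous (d * 1 + e') (zvar ^ e' * a)" by (simp add: add.commute)
  have "zvar ^ e' * a = zvar ^ d * (conic ^ n * c)"
    by (rule sigma_eq[OF 2 1]) (simp add: sigma_hom(3,7) sigma_gens sigma_conic c C)
  then have "conic ^ n dvd zvar ^ e' * a" by (metis dvd_triv_left dvd_mult)
  then show "conic ^ n dvd a" by (rule conic_pow_dvd_z_pow)
qed

lemma X_dvd_iff_order: "A \<noteq> 0 \<Longrightarrow> [:0, 1:] ^ n dvd A \<longleftrightarrow> n \<le> order 0 (A :: 'a poly poly)"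
  using order_divides[of 0 n A] by simp

lemma ord_along_conic:
  assumes "homogeneous d (a :: 'a poly3)" "a \<noteq> 0"
  shows "ord_along conic a = order 0 (sigma a)"
proof -
  have "sigma a \<noteq> 0" using sigma_inj assms by blast
  then have "(conic ^ n dvd a) = (n \<le> order 0 (sigma a))" for n
    using conic_pow_dvd_iff[OF assms(1)] X_dvd_iff_order by simp
  then show ?thesis unfolding ord_along_def by (intro Greatest_equality) auto
qed

text \<open>The value does not depend on the fraction: the two cross products are equal polynomials,
  and orders at f = 0 add under multiplication.\<close>

lemma val_along_conic:
  assumes "A \<noteq> 0" "B \<noteq> 0"
  shows "val_along conic (io A / io B) = int (order 0 A) - int (order 0 (B :: 'a poly poly))"
  unfolding val_along_def
proof (rule the_equality)
  obtain d a b where ab: "homogeneous d a" "homogeneous d b" "sigma a = A" "sigma b = B" by (rule homogenize2)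
  have nz: "a \<noteq> 0" "b \<noteq> 0" using assms ab by (auto simp: sigma_hom)
  show "\<exists>a b d. homogeneous d a \<and> homogeneous d b \<and> a \<noteq> 0 \<and> b \<noteq> 0 \<and> io A / io B = ratio a b \<and>
      int (order 0 A) - int (order 0 B) = int (ord_along conic a) - int (ord_along conic b)"
    using ab nz ratio_io[OF ab(1,2)] ord_along_conic[OF ab(1) nz(1)] ord_along_conic[OF ab(2) nz(2)]
    by (intro exI[of _ a] exI[of _ b] exI[of _ d]) simp
  fix v assume "\<exists>a b d. homogeneous d a \<and> homogeneous d b \<and> a \<noteq> 0 \<and> b \<noteq> 0 \<and> io A / io B = ratio a b \<and>
      v = int (ord_along conic a) - int (ord_along conic b)"
  then obtain a b d where c: "homogeneous d a" "homogeneous d b" "a \<noteq> 0" "b \<noteq> 0" "io A / io B = ratio a b"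
    "v = int (ord_along conic a) - int (ord_along conic b)" by blast
  have s: "sigma a \<noteq> 0" "sigma b \<noteq> 0" using sigma_inj c by blast+
  have "io A * io (sigma b) = io (sigma a) * io B"
    using c(5) ratio_io[OF c(1,2)] s assms by (simp add: io_eq_0_iff field_simps)
  then have "A * sigma b = sigma a * B" unfolding io_hom(3)[symmetric] io_eq_iff .
  then have "order 0 A + order 0 (sigma b) = order 0 (sigma a) + order 0 B"
    using order_mult[of A "sigma b" 0] order_mult[of "sigma a" B 0] assms s by simp
  then show "v = int (order 0 A) - int (order 0 B)"
    unfolding c(6) ord_along_conic[OF c(1,3)] ord_along_conic[OF c(2,4)] by linarith
qed

abbreviation "vl \<equiv> val_along (conic :: 'a poly3)"

lemma vl_mult: assumes "r \<in> FF" "s \<in> FF" "r \<noteq> 0" "s \<noteq> 0" shows "vl (r * s) = vl r + vl s"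
proof -
  obtain A B where A: "B \<noteq> 0" "r = io A / io B" using assms(1) by (rule FFE)
  obtain C D where C: "D \<noteq> 0" "s = io C / io D" using assms(2) by (rule FFE)
  have nz: "A \<noteq> 0" "C \<noteq> 0" using A C assms by (auto simp: io_hom)
  have "r * s = io (A * C) / io (B * D)" using A C by (simp add: io_hom)
  then show ?thesis using val_along_conic[of "A * C" "B * D"] val_along_conic[OF nz(1) A(1)]
      val_along_conic[OF nz(2) C(1)] A C nz by (simp add: order_mult)
qed

text \<open>Cancelling the full power of f in the denominator makes the valuation visible in the
  numerator alone; closure of the filtration under differences becomes ordinary arithmetic of
  fractions.\<close>

lemma val_filt_iff:
  "r \<in> val_filt conic n \<longleftrightarrow> (\<exists>A B :: 'a poly poly. \<not> [:0, 1:] dvd B \<and> r = io ([:0, 1:] ^ n * A) / io B)"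
proof
  assume r: "r \<in> val_filt conic n"
  then have "r \<in> FF" by (simp add: val_filt_def)
  then obtain A B where A: "B \<noteq> 0" "r = io A / io B" by (rule FFE)
  show "\<exists>A B :: 'a poly poly. \<not> [:0, 1:] dvd B \<and> r = io ([:0, 1:] ^ n * A) / io B"
  proof (cases "A = 0")
    case True
    have "\<not> [:0, 1:] dvd (1 :: 'a poly poly)" using poly_eq_0_iff_dvd[of "1 :: 'a poly poly" 0] by simp
    then show ?thesis using True A by (intro exI[of _ 0] exI[of _ 1]) (simp add: io_hom)
  next
    case False
    have "r \<noteq> 0" using False A by (simp add: io_eq_0_iff)
    then have le: "n + order 0 B \<le> order 0 A"
      using r val_along_conic[OF False A(1)] A(2) by (auto simp: val_filt_def)
    obtain B' where B': "B = [:- 0, 1:] ^ order 0 B * B'" "\<not> [:- 0, 1:] dvd B'" using order_decomp[OF A(1)] by blast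
    have "[:0, 1:] ^ (n + order 0 B) dvd A" using X_dvd_iff_order[OF False] le by simp
    then obtain A' where A': "A = [:0, 1:] ^ (n + order 0 B) * A'" by (auto simp: dvd_def)
    define m where "m = order 0 B"
    have "io ([:0, 1:] :: 'a poly poly) \<noteq> 0" by (simp add: io_eq_0_iff)
    then have "r = io ([:0, 1:] ^ n * A') / io B'"
      unfolding A(2) using A' B'(1) unfolding m_def[symmetric]
      by (simp add: io_hom power_add) 
    then show ?thesis using B'(2) by auto
  qed
next
  assume "\<exists>A B :: 'a poly poly. \<not> [:0, 1:] dvd B \<and> r = io ([:0, 1:] ^ n * A) / io B"
  then obtain A B :: "'a poly poly" where A: "\<not> [:0, 1:] dvd B" "r = io ([:0, 1:] ^ n * A) / io B" by blast
  have B: "B \<noteq> 0" using A(1) by auto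
  have oB: "order 0 B = 0" using A(1) X_dvd_iff_order[OF B, of 1] by simp
  have "r \<in> FF" unfolding FF_iff using A B by blast
  moreover have "int n \<le> vl r" if "r \<noteq> 0"
  proof -
    have nz: "[:0, 1:] ^ n * A \<noteq> 0" using that A(2) by (auto simp: io_hom)
    have "n \<le> order 0 ([:0, 1:] ^ n * A)" using X_dvd_iff_order[OF nz, of n] by (metis dvd_triv_left)
    then show ?thesis unfolding A(2) using val_along_conic[OF nz B] oB by simp
  qed
  ultimately show "r \<in> val_filt conic n" by (auto simp: val_filt_def)
qed

lemma X_prime: "[:0, 1:] dvd A * B \<Longrightarrow> [:0, 1:] dvd A \<or> [:0, 1:] dvd (B :: 'a poly poly)"
  using poly_eq_0_iff_dvd[of "A * B" 0] poly_eq_0_iff_dvd[of A 0] poly_eq_0_iff_dvd[of B 0] by simp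

lemma val_filt_minus: "r \<in> val_filt conic n \<Longrightarrow> s \<in> val_filt conic n \<Longrightarrow> r - s \<in> val_filt (conic :: 'a poly3) n"
proof -
  assume "r \<in> val_filt conic n" "s \<in> val_filt conic n"
  then obtain A B C D :: "'a poly poly" where A: "\<not> [:0, 1:] dvd B" "r = io ([:0, 1:] ^ n * A) / io B"
    and C: "\<not> [:0, 1:] dvd D" "s = io ([:0, 1:] ^ n * C) / io D" unfolding val_filt_iff by blast
  have nz: "B \<noteq> 0" "D \<noteq> 0" using A(1) C(1) by auto
  have "r - s = io ([:0, 1:] ^ n * (A * D - C * B)) / io (B * D)"
    unfolding A(2) C(2) using nz by (simp add: diff_frac_eq io_hom io_eq_0_iff algebra_simps)
  moreover have "\<not> [:0, 1:] dvd B * D" using X_prime A(1) C(1) by blast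
  ultimately show ?thesis unfolding val_filt_iff by (intro exI conjI)
qed

lemma val_filt_zero: "0 \<in> val_filt (conic :: 'a poly3) n"
  using subring_onD(2)[OF FF_subring] by (simp add: val_filt_def)

lemma f0_eq: "f0 = io ([:0, 1:] :: 'a poly poly)" by (simp add: io_X)

lemma vl_f0: "vl f0 = 1"
  using val_along_conic[of "[:0, 1:]" 1] order_power_n_n[of "0 :: 'a poly" 1] unfolding f0_eq by (simp add: io_hom)

end

section \<open>Local rings of the plane at points of the conic\<close>

context char_ne_2
begin

lemma val_filt_vl: "r \<in> FF \<Longrightarrow> r \<noteq> 0 \<Longrightarrow> r \<in> val_filt conic n \<longleftrightarrow> int n \<le> vl r"
  by (simp add: val_filt_def)

lemma FF_closed: "1 \<in> FF" "0 \<in> FF" "r \<in> FF \<Longrightarrow> s \<in> FF \<Longrightarrow> r - s \<in> FF" "r \<in> FF \<Longrightarrow> s \<in> FF \<Longrightarrow> r * s \<in> FF"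
    "r \<in> FF \<Longrightarrow> - r \<in> FF" "r \<in> FF \<Longrightarrow> s \<in> FF \<Longrightarrow> r + s \<in> FF" "r \<in> FF \<Longrightarrow> r ^ n \<in> FF"
    "r \<in> FF \<Longrightarrow> s \<in> FF \<Longrightarrow> r / s \<in> FF" "r \<in> FF \<Longrightarrow> r powi N \<in> FF"
proof -
  note s = subring_onD[OF FF_subring]
  show "1 \<in> FF" "0 \<in> FF" "r \<in> FF \<Longrightarrow> s \<in> FF \<Longrightarrow> r - s \<in> FF" "r \<in> FF \<Longrightarrow> s \<in> FF \<Longrightarrow> r * s \<in> FF"
    "r \<in> FF \<Longrightarrow> - r \<in> FF" "r \<in> FF \<Longrightarrow> s \<in> FF \<Longrightarrow> r + s \<in> FF" "r \<in> FF \<Longrightarrow> r ^ n \<in> FF" by (auto intro: s)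
  show "r \<in> FF \<Longrightarrow> s \<in> FF \<Longrightarrow> r / s \<in> FF" by (simp add: divide_inverse s FF_inverse)
  show "r \<in> FF \<Longrightarrow> r powi N \<in> FF" by (simp add: power_int_def s FF_inverse)
qed

lemma vl_1: "vl 1 = 0"
  using val_along_conic[of 1 1] by (simp add: io_hom)

lemma vl_pow: "r \<in> FF \<Longrightarrow> r \<noteq> 0 \<Longrightarrow> vl (r ^ n) = int n * vl r"
  by (induction n) (simp_all add: vl_1 vl_mult FF_closed algebra_simps)

lemma vl_inverse: assumes "r \<in> FF" "r \<noteq> 0" shows "vl (inverse r) = - vl r"
  using vl_mult[OF assms(1) FF_inverse[OF assms(1)]] assms vl_1 by simp

lemma vl_divide: "r \<in> FF \<Longrightarrow> s \<in> FF \<Longrightarrow> r \<noteq> 0 \<Longrightarrow> s \<noteq> 0 \<Longrightarrow> vl (r / s) = vl r - vl s"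
  by (simp add: divide_inverse vl_mult FF_inverse vl_inverse)

lemma vl_powi: "r \<in> FF \<Longrightarrow> r \<noteq> 0 \<Longrightarrow> vl (r powi N) = N * vl r"
  by (auto simp: power_int_def vl_pow vl_inverse FF_inverse)

lemma vl_io: "A \<noteq> 0 \<Longrightarrow> vl (io A) = int (order 0 (A :: 'a poly poly))"
  using val_along_conic[of A 1] by (simp add: io_hom)

lemma order_0_iff: "A \<noteq> 0 \<Longrightarrow> order 0 (A :: 'a poly poly) = 0 \<longleftrightarrow> coeff A 0 \<noteq> 0"
  using order_root[of A 0] by (auto simp: poly_0_coeff_0)

lemma vl_zeroE:
  assumes "r \<in> FF" "r \<noteq> 0" "vl r = 0"
  obtains A B where "coeff A 0 \<noteq> 0" "coeff B 0 \<noteq> 0" "r = io A / io (B :: 'a poly poly)"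
proof -
  obtain A B where A: "B \<noteq> 0" "r = io A / io B" using assms(1) by (rule FFE)
  have nz: "A \<noteq> 0" using A assms(2) by (auto simp: io_hom)
  have ord: "order 0 A = order 0 B" using val_along_conic[OF nz A(1)] assms(3) A(2) by simp
  obtain A' where A': "A = [:- 0, 1:] ^ order 0 A * A'" "\<not> [:- 0, 1:] dvd A'" using order_decomp[OF nz] by blast
  obtain B' where B': "B = [:- 0, 1:] ^ order 0 B * B'" "\<not> [:- 0, 1:] dvd B'" using order_decomp[OF A(1)] by blast
  define m where "m = order 0 B"
  have Am: "A = [:0, 1:] ^ m * A'" "B = [:0, 1:] ^ m * B'" using A'(1) B'(1) ord unfolding m_def by simp_all
  have "io ([:0, 1:] :: 'a poly poly) \<noteq> 0" by (simp add: io_eq_0_iff)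
  then have r: "r = io A' / io B'" unfolding A(2) Am by (simp add: io_hom)
  have "coeff A' 0 \<noteq> 0" "coeff B' 0 \<noteq> 0"
    using A'(2) B'(2) poly_eq_0_iff_dvd[of A' 0] poly_eq_0_iff_dvd[of B' 0] by (simp_all add: poly_0_coeff_0)
  then show ?thesis using that r by blast
qed

end

text \<open>The linear form \<open>ell\<close>, which does not vanish at q, turns forms into
  functions near q: it is z at the affine points and x at p.\<close>

locale plane_pt = char_ne_2 dummy for dummy :: "'a::field itself" +
  fixes q :: "'a poly3 set" and ell :: "'a poly3"
  assumes q_0: "0 \<in> q" and q_1: "1 \<notin> q"
    and q_add: "a \<in> q \<Longrightarrow> b \<in> q \<Longrightarrow> a + b \<in> q"
    and q_mult: "a \<in> q \<Longrightarrow> r * a \<in> q"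
    and q_prime: "a * b \<in> q \<Longrightarrow> a \<in> q \<or> b \<in> q"
    and q_conic: "conic \<in> q"
    and ell_notin: "ell \<notin> q" and ell_hom: "homogeneous 1 ell" and ell_ord: "coeff (sigma ell) 0 \<noteq> 0"
begin

abbreviation "R \<equiv> carrier (stalk q)"

lemma R_iff: "r \<in> R \<longleftrightarrow> (\<exists>a b d. homogeneous d a \<and> homogeneous d b \<and> b \<notin> q \<and> r = emb a / emb b)"
  by (auto simp: stalk_def ratio_emb)

lemma max_iff: "r \<in> stalk_max q \<longleftrightarrow> (\<exists>a b d. homogeneous d a \<and> homogeneous d b \<and> a \<in> q \<and> b \<notin> q \<and> r = emb a / emb b)"
  by (auto simp: stalk_max_def ratio_emb)

lemma q_pow: "a \<notin> q \<Longrightarrow> a ^ n \<notin> q"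
  by (induction n) (use q_1 q_prime in auto)

lemma q_prod: "a \<notin> q \<Longrightarrow> b \<notin> q \<Longrightarrow> a * b \<notin> q"
  using q_prime by blast

lemma R_sub: "subring_on R"
proof -
  have "1 \<in> R" unfolding R_iff using homogeneous_1 q_1 by (intro exI[of _ 1] exI[of _ 0]) (simp add: emb_hom)
  moreover have "r - s \<in> R" "r * s \<in> R" if rs: "r \<in> R" "s \<in> R" for r s
  proof -
    obtain a b d where a: "homogeneous d a" "homogeneous d b" "b \<notin> q" "r = emb a / emb b" using rs(1) unfolding R_iff by blast
    obtain a' b' d' where a': "homogeneous d' a'" "homogeneous d' b'" "b' \<notin> q" "s = emb a' / emb b'" using rs(2) unfolding R_iff by blast
    have nz: "emb b \<noteq> 0" "emb b' \<noteq> 0" using a(3) a'(3) q_0 by (auto simp: emb_eq_0_iff)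
    have "r - s = emb (a * b' - a' * b) / emb (b * b')" "r * s = emb (a * a') / emb (b * b')"
      unfolding a(4) a'(4) using nz by (simp_all add: emb_hom diff_frac_eq)
    moreover have "homogeneous (d + d') (a * b' - a' * b)"
      using homogeneous_mult[OF a(1) a'(2)] homogeneous_mult[OF a'(1) a(2)] by (simp add: add.commute homogeneous_minus)
    moreover have "homogeneous (d + d') (a * a')" "homogeneous (d + d') (b * b')" using a a' by (auto intro: homogeneous_mult)
    ultimately show "r - s \<in> R" "r * s \<in> R" unfolding R_iff using q_prod[OF a(3) a'(3)] by blast+
  qed
  ultimately show ?thesis by (simp add: subring_on_def)
qed

lemma R_FF: "R \<subseteq> FF"
proof
  fix r assume "r \<in> R"
  then obtain a b d where a: "homogeneous d a" "homogeneous d b" "b \<notin> q" "r = emb a / emb b" unfolding R_iff by blast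
  then have "b \<noteq> 0" using q_0 by auto
  then show "r \<in> FF" unfolding stalk_def ring_on_simps using a by (auto simp: ratio_emb)
qed

lemma R_FFD: "r \<in> R \<Longrightarrow> r \<in> FF"
  using R_FF by blast

lemma R_inverse: assumes "r \<in> R" "r \<notin> stalk_max q" shows "inverse r \<in> R"
proof -
  obtain a b d where a: "homogeneous d a" "homogeneous d b" "b \<notin> q" "r = emb a / emb b" using assms(1) unfolding R_iff by blast
  have "a \<notin> q" using assms(2) a unfolding max_iff by blast
  then show ?thesis unfolding R_iff using a by (intro exI[of _ b] exI[of _ a] exI[of _ d]) simp
qed

lemma one_notin_max: "1 \<notin> stalk_max q"
proof
  assume "1 \<in> stalk_max q"
  then obtain a b d where a: "homogeneous d a" "homogeneous d b" "a \<in> q" "b \<notin> q" "1 = emb a / emb b" unfolding max_iff by blast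
  then have "emb a = emb b" using q_0 by (auto simp: emb_eq_0_iff field_simps)
  then show False using a by (simp add: emb_eq_iff)
qed

lemma in_R: "homogeneous d a \<Longrightarrow> emb a / emb ell ^ d \<in> R"
  unfolding R_iff using q_pow[OF ell_notin] homogeneous_pow[OF ell_hom, of d] 
  by (intro exI[of _ a] exI[of _ "ell ^ d"] exI[of _ d]) (simp add: emb_hom)

lemma conic_dvd_iff: "homogeneous d (a :: 'a poly3) \<Longrightarrow> conic dvd a \<longleftrightarrow> coeff (sigma a) 0 = 0"
  using conic_pow_dvd_iff[of d a 1] poly_eq_0_iff_dvd[of "sigma a" 0] by (simp add: poly_0_coeff_0)

lemma notin_q_coeff: "homogeneous d b \<Longrightarrow> b \<notin> q \<Longrightarrow> coeff (sigma b) 0 \<noteq> 0"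
  using conic_dvd_iff q_mult[OF q_conic] by (metis dvdE mult.commute)

lemma vl_ratio:
  assumes "homogeneous d a" "homogeneous d b" "b \<notin> q" "a \<noteq> 0"
  shows "vl (emb a / emb b) = int (order 0 (sigma a))"
proof -
  have nz: "sigma a \<noteq> 0" "sigma b \<noteq> 0" using assms sigma_inj q_0 by blast+
  have "order 0 (sigma b) = 0" using notin_q_coeff[OF assms(2,3)] order_0_iff[OF nz(2)] by simp
  then show ?thesis using val_along_conic[OF nz] ratio_io[OF assms(1,2)] by (simp add: ratio_emb)
qed

lemma vl_R: "r \<in> R \<Longrightarrow> r \<noteq> 0 \<Longrightarrow> 0 \<le> vl r"
proof -
  assume "r \<in> R" "r \<noteq> 0"
  then obtain a b d where a: "homogeneous d a" "homogeneous d b" "b \<notin> q" "r = emb a / emb b" unfolding R_iff by blast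
  then have "a \<noteq> 0" using \<open>r \<noteq> 0\<close> by (auto simp: emb_hom)
  then show ?thesis using vl_ratio[OF a(1-3)] a(4) by simp
qed

text \<open>Expresses the ideal of the curve through the valuation along it, so that statements
  about local equations become computations with valuations.\<close>

lemma curve_ideal_iff: "r \<in> curve_ideal conic q \<longleftrightarrow> r \<in> R \<and> (r = 0 \<or> 1 \<le> vl r)"
proof
  assume "r \<in> curve_ideal conic q"
  then obtain a b d where a: "homogeneous d a" "homogeneous d b" "conic dvd a" "b \<notin> q" "r = emb a / emb b"
    by (auto simp: curve_ideal_def ratio_emb)
  have "1 \<le> vl r" if "r \<noteq> 0"
  proof -
    have a0: "a \<noteq> 0" using that a(5) by (auto simp: emb_hom)
    then have s0: "sigma a \<noteq> 0" using a(1) sigma_inj by blast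
    have "coeff (sigma a) 0 = 0" using conic_dvd_iff[OF a(1)] a(3) by simp
    then have "order 0 (sigma a) \<noteq> 0" using order_0_iff[OF s0] by simp
    then show ?thesis using vl_ratio[OF a(1,2,4) a0] a(5) by simp
  qed
  then show "r \<in> R \<and> (r = 0 \<or> 1 \<le> vl r)" using a unfolding R_iff by blast
next
  assume r: "r \<in> R \<and> (r = 0 \<or> 1 \<le> vl r)"
  then obtain a b d where a: "homogeneous d a" "homogeneous d b" "b \<notin> q" "r = emb a / emb b" unfolding R_iff by blast
  have "conic dvd a"
  proof (cases "a = 0")
    case False
    have "r \<noteq> 0" using a(3,4) False q_0 by (auto simp: emb_eq_0_iff)
    then have "order 0 (sigma a) \<noteq> 0" using r vl_ratio[OF a(1-3) False] a(4) by simp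
    moreover have "sigma a \<noteq> 0" using a(1) sigma_inj False by blast
    ultimately show ?thesis using order_0_iff[of "sigma a"] conic_dvd_iff[OF a(1)] by simp
  qed simp
  then show "r \<in> curve_ideal conic q" using a unfolding curve_ideal_def ratio_emb by blast
qed

definition "fl = emb conic / emb ell ^ 2"

lemma fl_R: "fl \<in> R"
  unfolding fl_def by (rule in_R[OF homogeneous_conic])

lemma fl_nz: "fl \<noteq> 0"
  unfolding fl_def using ell_notin q_0 conic_nz by (auto simp: emb_eq_0_iff)

lemma order_X: "order 0 ([:0, 1:] :: 'a poly poly) = 1"
  using order_power_n_n[of "0 :: 'a poly" 1] by simp

lemma vl_fl: "vl fl = 1"
proof -
  have "homogeneous 2 (ell ^ 2)" using homogeneous_pow[OF ell_hom, of 2] by simp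
  then show ?thesis
    using vl_ratio[OF homogeneous_conic _ q_pow[OF ell_notin, of 2] conic_nz]
    unfolding fl_def emb_hom(7)[symmetric] by (simp add: sigma_conic order_X)
qed

lemma cgenideal_stalk: "cgenideal (stalk q) f = {f * c | c. c \<in> R}"
proof -
  have "a \<otimes>\<^bsub>stalk q\<^esub> b = a * b" for a b by (simp add: stalk_def)
  then show ?thesis by (auto simp: cgenideal_def mult.commute)
qed

text \<open>One factor of the conic in the numerator is exchanged for \<open>ell ^ 2\<close>, which
  keeps the degree.\<close>

lemma curve_ideal_fl:
  assumes "r \<in> R" "r = 0 \<or> 1 \<le> vl r" shows "\<exists>c\<in>R. r = fl * c"
proof -
  obtain a b d where a: "homogeneous d a" "homogeneous d b" "conic dvd a" "b \<notin> q" "r = emb a / emb b"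
    using assms curve_ideal_iff[of r] by (auto simp: curve_ideal_def ratio_emb)
  obtain a' where a': "a = conic * a'" using a(3) by (auto simp: dvd_def)
  show ?thesis
  proof (cases "a' = 0")
    case True
    then show ?thesis using a(5) a' subring_onD(2)[OF R_sub] by (intro bexI[of _ 0]) (simp_all add: emb_hom)
  next
    case False
    have ha: "homogeneous (d - 2) a'" by (rule homogeneous_quotient[OF homogeneous_conic _ conic_nz]) (use a(1) a' in simp)
    have d2: "d = (d - 2) + 2"
      using homogeneous_unique[OF a(1), of "2 + (d - 2)"] homogeneous_mult[OF homogeneous_conic ha] a' False conic_nz by simp
    have "homogeneous (2 * 1) (ell ^ 2)" by (rule homogeneous_pow[OF ell_hom])
    then have "homogeneous d (a' * ell ^ 2)" using homogeneous_mult[OF ha, of 2 "ell ^ 2"] d2 by simp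
    then have c: "emb (a' * ell ^ 2) / emb b \<in> R" unfolding R_iff using a by blast
    have "emb ell \<noteq> 0" using ell_notin q_0 by (auto simp: emb_eq_0_iff)
    then have "r = fl * (emb (a' * ell ^ 2) / emb b)" unfolding fl_def a(5) a' by (simp add: emb_hom)
    then show ?thesis using c by blast
  qed
qed

lemma local_equation_iff:
  "local_equation conic q f \<longleftrightarrow> f \<in> R \<and> (\<forall>r. (r \<in> R \<and> (r = 0 \<or> 1 \<le> vl r)) \<longleftrightarrow> (\<exists>c\<in>R. r = f * c))"
  unfolding local_equation_def cgenideal_stalk set_eq_iff curve_ideal_iff by blast

lemma local_equation_fl: "local_equation conic q fl"
  unfolding local_equation_iff
proof (intro conjI allI fl_R iffI)
  fix r assume "\<exists>c\<in>R. r = fl * c"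
  then obtain c where c: "c \<in> R" "r = fl * c" by blast
  have "r \<in> R" using c fl_R subring_onD(4)[OF R_sub] by simp
  moreover have "1 \<le> vl r" if "r \<noteq> 0"
  proof -
    have "c \<noteq> 0" using that c by auto
    then show ?thesis using vl_mult[OF R_FFD[OF fl_R] R_FFD[OF c(1)] fl_nz] c vl_fl vl_R[of c] by simp
  qed
  ultimately show "r \<in> R" "r = 0 \<or> 1 \<le> vl r" by auto
qed (use curve_ideal_fl in blast)

context
  fixes f assumes f: "local_equation conic q f"
begin

lemma f_R: "f \<in> R" and f_iff: "r \<in> R \<and> (r = 0 \<or> 1 \<le> vl r) \<longleftrightarrow> (\<exists>c\<in>R. r = f * c)"
  using f unfolding local_equation_iff by auto

lemma f_nz: "f \<noteq> 0"
  using f_iff[of fl] fl_R vl_fl fl_nz by auto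

text \<open>f has positive valuation, being a multiple of itself, and it divides \<open>fl\<close>,
  whose valuation is 1.\<close>

lemma vl_f: "vl f = 1"
proof -
  have "1 \<le> vl f" using f_iff[of f] f_nz subring_onD(1)[OF R_sub] by auto
  obtain c where c: "c \<in> R" "fl = f * c" using f_iff[of fl] fl_R vl_fl by auto
  have "c \<noteq> 0" using c fl_nz by auto
  then have "1 = vl f + vl c" using vl_mult[of f c] c f_R R_FF f_nz vl_fl by auto
  then show ?thesis using \<open>1 \<le> vl f\<close> vl_R[OF c(1) \<open>c \<noteq> 0\<close>] by linarith
qed

text \<open>The exponent is the valuation. The factor left over is a quotient of two forms of equal
  degree, neither divisible by the conic; dividing both by the same power of \<open>ell\<close>
  brings them into the stalk.\<close>

lemma f_factor:
  assumes r: "r \<in> FF" "r \<noteq> 0"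
  shows "\<exists>N a b. a \<in> R \<and> b \<in> R \<and> (\<nexists>c. c \<in> R \<and> a = f * c) \<and> (\<nexists>c. c \<in> R \<and> b = f * c) \<and>
      r = f powi N * (a / b) \<and> (\<forall>n. r \<in> val_filt conic n \<longleftrightarrow> int n \<le> N)"
proof -
  define N where "N = vl r"
  have fF: "f \<in> FF" using f_R R_FF by blast
  define s where "s = r / f powi N"
  have fN: "f powi N \<in> FF" "f powi N \<noteq> 0" using fF f_nz by (auto simp: FF_closed)
  have s: "s \<in> FF" "s \<noteq> 0" "vl s = 0"
    unfolding s_def using r fN vl_divide[OF r(1) fN(1) r(2) fN(2)] vl_powi[OF fF f_nz, of N] vl_f
    by (auto simp: FF_closed N_def)
  obtain A B where A: "coeff A 0 \<noteq> 0" "coeff B 0 \<noteq> 0" "s = io A / io B" using s by (rule vl_zeroE)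
  obtain d a b where ab: "homogeneous d a" "homogeneous d b" "sigma a = A" "sigma b = B" by (rule homogenize2)
  have nz: "a \<noteq> 0" "b \<noteq> 0" using A ab by (auto simp: sigma_hom)
  have ell0: "emb ell \<noteq> 0" using ell_notin q_0 by (auto simp: emb_eq_0_iff)
  have st: "emb a / emb ell ^ d \<in> R \<and> (\<nexists>c. c \<in> R \<and> emb a / emb ell ^ d = f * c)"
    if a: "homogeneous d a" "coeff (sigma a) 0 \<noteq> 0" for a
  proof -
    have aR: "emb a / emb ell ^ d \<in> R" by (rule in_R[OF a(1)])
    have a0: "a \<noteq> 0" using a(2) by (auto simp: sigma_hom)
    have "homogeneous d (ell ^ d)" using homogeneous_pow[OF ell_hom, of d] by simp
    then have "vl (emb a / emb ell ^ d) = int (order 0 (sigma a))"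
      using vl_ratio[OF a(1) _ q_pow[OF ell_notin] a0] by (simp add: emb_hom)
    also have "order 0 (sigma a) = 0" using order_0_iff[of "sigma a"] a(2) by (metis coeff_0)
    finally have v: "vl (emb a / emb ell ^ d) = 0" by simp
    have "emb a / emb ell ^ d \<noteq> 0" using a0 ell0 by (simp add: emb_eq_0_iff)
    then show ?thesis using aR v f_iff[of "emb a / emb ell ^ d"] by auto
  qed
  have "s = (emb a / emb ell ^ d) / (emb b / emb ell ^ d)"
    using ratio_io[OF ab(1,2)] ab(3,4) A(3) ell0 by (simp add: ratio_emb)
  then have "r = f powi N * ((emb a / emb ell ^ d) / (emb b / emb ell ^ d))"
    unfolding s_def using fN(2) by (simp add: field_simps)
  moreover have "\<forall>n. r \<in> val_filt conic n \<longleftrightarrow> int n \<le> N" using val_filt_vl[OF r] by (simp add: N_def)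
  ultimately show ?thesis using st[OF ab(1)] st[OF ab(2)] A(1,2) ab(3,4) by blast
qed

text \<open>\<open>krichever_K\<close> quantifies over all local equations f. Each of them and
  \<open>fl\<close> divide one another in the stalk, so the maximal ideal and separatedness need
  only be checked for \<open>fl\<close>. Regularity holds because \<open>\<tau>\<close> has
  valuation 0 along the curve.\<close>

lemma local_flagI:
  assumes max: "stalk_max q = {\<tau> * a + fl * b | a b. a \<in> R \<and> b \<in> R}"
    and \<tau>: "\<tau> \<in> R" "\<tau> \<noteq> 0" "vl \<tau> = 0"
    and sep: "\<And>r. r \<in> R \<Longrightarrow> r \<noteq> 0 \<Longrightarrow> vl r = 0 \<Longrightarrow> \<exists>k. \<forall>a\<in>R. \<forall>b\<in>R. r \<noteq> fl * a + \<tau> ^ k * b"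
  shows "local_flag conic q f \<tau>"
proof -
  note Rc = subring_onD[OF R_sub]
  obtain w where w: "w \<in> R" "f = fl * w" using curve_ideal_fl[OF f_R] vl_f by auto
  obtain w' where w': "w' \<in> R" "fl = f * w'" using f_iff[of fl] fl_R vl_fl by auto
  show ?thesis
  proof
    show "subring_on R" by (rule R_sub)
    show "R \<subseteq> FF" by (rule R_FF)
    show "subring_on FF" by (rule FF_subring)
    show "stalk_max q = {\<tau> * a + f * b | a b. a \<in> R \<and> b \<in> R}" unfolding max
    proof (intro subset_antisym subsetI)
      fix r assume "r \<in> {\<tau> * a + fl * b | a b. a \<in> R \<and> b \<in> R}"
      then obtain a b where ab: "r = \<tau> * a + fl * b" "a \<in> R" "b \<in> R" by blast
      then have "r = \<tau> * a + f * (w' * b)" unfolding w'(2) by (simp add: mult.assoc)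
      then show "r \<in> {\<tau> * a + f * b | a b. a \<in> R \<and> b \<in> R}" using ab Rc(4)[OF w'(1) ab(3)] by blast
    next
      fix r assume "r \<in> {\<tau> * a + f * b | a b. a \<in> R \<and> b \<in> R}"
      then obtain a b where ab: "r = \<tau> * a + f * b" "a \<in> R" "b \<in> R" by blast
      then have "r = \<tau> * a + fl * (w * b)" unfolding w(2) by (simp add: mult.assoc)
      then show "r \<in> {\<tau> * a + fl * b | a b. a \<in> R \<and> b \<in> R}" using ab Rc(4)[OF w(1) ab(3)] by blast
    qed
    show "inverse r \<in> R" if "r \<in> R" "r \<notin> stalk_max q" for r using that by (rule R_inverse)
    show "1 \<notin> stalk_max q" by (rule one_notin_max)
    show "\<tau> \<in> R" by fact
    show "f \<in> R" by (rule f_R)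
    show "f \<noteq> 0" by (rule f_nz)
    show "\<exists>c\<in>R. a = f * c" if ab: "a \<in> R" "b \<in> R" "\<tau> * a = f * b" for a b
    proof -
      have "1 \<le> vl a" if a0: "a \<noteq> 0"
      proof -
        have "\<tau> * a \<noteq> 0" using \<tau> a0 by simp
        then have b0: "b \<noteq> 0" using ab(3) by auto
        have "vl \<tau> + vl a = vl f + vl b"
          using vl_mult[OF R_FFD[OF \<tau>(1)] R_FFD[OF ab(1)] \<tau>(2) a0] vl_mult[OF R_FFD[OF f_R] R_FFD[OF ab(2)] f_nz b0] ab(3)
          by simp
        then show ?thesis using \<tau>(3) vl_f vl_R[OF ab(2) b0] by linarith
      qed
      then show ?thesis using f_iff[of a] ab(1) by blast
    qed
    show "\<exists>a\<in>R. r = f * a" if r: "r \<in> R" "\<And>k. \<exists>a\<in>R. \<exists>b\<in>R. r = f * a + \<tau> ^ k * b" for r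
    proof -
      have "1 \<le> vl r" if r0: "r \<noteq> 0"
      proof (rule ccontr)
        assume "\<not> ?thesis"
        then have "vl r = 0" using vl_R[OF r(1) r0] by linarith
        then obtain k where k: "\<forall>a\<in>R. \<forall>b\<in>R. r \<noteq> fl * a + \<tau> ^ k * b" using sep[OF r(1) r0] by blast
        obtain a b where ab: "a \<in> R" "b \<in> R" "r = f * a + \<tau> ^ k * b" using r(2) by blast
        have "r = fl * (w * a) + \<tau> ^ k * b" using ab(3) unfolding w(2) by (simp add: mult.assoc)
        then show False using k Rc(4)[OF w(1) ab(1)] ab(2) by blast
      qed
      then show ?thesis using f_iff[of r] r(1) by blast
    qed
    show "r - s \<in> val_filt (conic :: 'a poly3) n" if "r \<in> val_filt conic n" "s \<in> val_filt conic n" for r s n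
      using that by (rule val_filt_minus)
    show "0 \<in> val_filt (conic :: 'a poly3) n" for n by (rule val_filt_zero)
    show "\<exists>N a b. a \<in> R \<and> b \<in> R \<and> (\<nexists>c. c \<in> R \<and> a = f * c) \<and> (\<nexists>c. c \<in> R \<and> b = f * c) \<and>
      r = f powi N * (a / b) \<and> (\<forall>n. r \<in> val_filt conic n \<longleftrightarrow> int n \<le> N)" if "r \<in> FF" "r \<noteq> 0" for r
      using that by (rule f_factor)
  qed
qed

end

end

section \<open>Points of the plane\<close>

lemma subring_UNIV: "subring_on UNIV"
  by (simp add: subring_on_def)

lemma ideal_poly3_iff: "ideal q (ring_on (UNIV :: 'b::comm_ring_1 set)) \<longleftrightarrow>
    0 \<in> q \<and> (\<forall>a\<in>q. \<forall>b\<in>q. a + b \<in> q) \<and> (\<forall>a\<in>q. \<forall>r. r * a \<in> q)"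
proof -
  interpret S: cring "ring_on (UNIV :: 'b set)" by (rule cring_ring_on[OF subring_UNIV])
  show ?thesis
  proof
    assume "ideal q (ring_on UNIV)"
    then interpret I: ideal q "ring_on (UNIV :: 'b set)" .
    show "0 \<in> q \<and> (\<forall>a\<in>q. \<forall>b\<in>q. a + b \<in> q) \<and> (\<forall>a\<in>q. \<forall>r. r * a \<in> q)"
      using I.zero_closed I.a_closed I.I_l_closed by simp
  next
    assume h: "0 \<in> q \<and> (\<forall>a\<in>q. \<forall>b\<in>q. a + b \<in> q) \<and> (\<forall>a\<in>q. \<forall>r. r * a \<in> q)"
    show "ideal q (ring_on UNIV)"
    proof (intro idealI S.ring_axioms S.add.subgroupI)
      show "\<ominus>\<^bsub>ring_on UNIV\<^esub> a \<in> q" if "a \<in> q" for a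
      proof -
        have "\<ominus>\<^bsub>ring_on UNIV\<^esub> a = (- 1) * a" using ring_on_uminus[OF subring_UNIV, of a] by simp
        then show ?thesis using h that by metis
      qed
    qed (use h in \<open>auto simp: mult.commute\<close>)
  qed
qed

lemma primeideal_poly3_iff: "primeideal q (ring_on (UNIV :: 'b::comm_ring_1 set)) \<longleftrightarrow>
    ideal q (ring_on UNIV) \<and> 1 \<notin> q \<and> (\<forall>a b. a * b \<in> q \<longrightarrow> a \<in> q \<or> b \<in> q)"
proof
  assume "primeideal q (ring_on (UNIV :: 'b set))"
  then interpret P: primeideal q "ring_on (UNIV :: 'b set)" .
  show "ideal q (ring_on UNIV) \<and> 1 \<notin> q \<and> (\<forall>a b. a * b \<in> q \<longrightarrow> a \<in> q \<or> b \<in> q)"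
    using P.ideal_axioms P.I_prime P.I_notcarr P.one_imp_carrier by auto
next
  assume h: "ideal q (ring_on UNIV) \<and> 1 \<notin> q \<and> (\<forall>a b. a * b \<in> q \<longrightarrow> a \<in> q \<or> b \<in> q)"
  show "primeideal q (ring_on (UNIV :: 'b set))"
    by (rule primeidealI) (use h cring_ring_on[OF subring_UNIV] in auto)
qed

lemma genideal_minimal: "ideal q (ring_on UNIV) \<Longrightarrow> S \<subseteq> q \<Longrightarrow> genideal (ring_on (UNIV :: 'b::comm_ring_1 set)) S \<subseteq> q"
  using ring.genideal_minimal[OF cring.axioms(1)[OF cring_ring_on[OF subring_UNIV]]] by metis

lemma genideal_ideal: "ideal (genideal (ring_on UNIV) S) (ring_on (UNIV :: 'b::comm_ring_1 set))"
  using ring.genideal_ideal[OF cring.axioms(1)[OF cring_ring_on[OF subring_UNIV]], of S] by simp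

lemma genideal_self: "S \<subseteq> genideal (ring_on (UNIV :: 'b::comm_ring_1 set)) S"
  using ring.genideal_self[OF cring.axioms(1)[OF cring_ring_on[OF subring_UNIV]], of S] by simp

text \<open>An ideal closed under homogeneous components is generated by its homogeneous elements,
  since every polynomial is the sum of its components (\<open>sum_comp\<close>).\<close>

lemma plane_pointsI:
  fixes q :: "'a::field poly3 set"
  assumes "primeideal q poly3_ring" "\<not> {xvar, yvar, zvar} \<subseteq> q"
    "\<And>P e. P \<in> q \<Longrightarrow> coeff (theta P) e \<in> q"
  shows "q \<in> plane_points"
proof -
  let ?S = "{a \<in> q. \<exists>d. homogeneous d a}"
  have i: "ideal q poly3_ring" using assms(1) primeideal_poly3_iff by blast
  note g = genideal_ideal[of ?S, unfolded ideal_poly3_iff]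
  have "P \<in> genideal poly3_ring ?S" if "P \<in> q" for P
  proof -
    have c: "coeff (theta P) e \<in> genideal poly3_ring ?S" for e
      using genideal_self[of ?S] assms(3)[OF that] homogeneous_comp by blast
    have "(\<Sum>e\<in>I. coeff (theta P) e) \<in> genideal poly3_ring ?S" for I
      by (induction I rule: infinite_finite_induct) (use g c in auto)
    then have "(\<Sum>e\<le>degree (theta P). coeff (theta P) e) \<in> genideal poly3_ring ?S" by blast
    then show ?thesis by (subst sum_comp)
  qed
  then have "q = genideal poly3_ring ?S" using genideal_minimal[OF i, of ?S] by blast
  then show ?thesis using assms(1,2) by (simp add: plane_points_def)
qed

lemma plane_pointsD:
  assumes "q \<in> plane_points"
  shows "primeideal q poly3_ring" "\<not> {xvar, yvar, zvar} \<subseteq> q"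
    "ideal q' poly3_ring \<Longrightarrow> (\<And>d a. homogeneous d a \<Longrightarrow> a \<in> q \<Longrightarrow> a \<in> q') \<Longrightarrow> q \<subseteq> q'"
proof -
  show "primeideal q poly3_ring" "\<not> {xvar, yvar, zvar} \<subseteq> q" using assms by (auto simp: plane_points_def)
  have e: "q = genideal poly3_ring {a \<in> q. \<exists>d. homogeneous d a}" using assms by (simp add: plane_points_def)
  assume "ideal q' poly3_ring" "\<And>d a. homogeneous d a \<Longrightarrow> a \<in> q \<Longrightarrow> a \<in> q'"
  then have "genideal poly3_ring {a \<in> q. \<exists>d. homogeneous d a} \<subseteq> q'" by (intro genideal_minimal) auto
  then show "q \<subseteq> q'" using e by simp
qed

lemma prime_pow_dvd_cancel:
  fixes p :: "'b::idom"
  assumes "\<And>a b. p dvd a * b \<Longrightarrow> p dvd a \<or> p dvd b" "\<not> p dvd b" "p \<noteq> 0"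
  shows "p ^ k dvd a * b \<Longrightarrow> p ^ k dvd a"
proof (induction k arbitrary: a)
  case (Suc k)
  have "p dvd a * b" using Suc.prems by (metis dvd_mult_left power_Suc)
  then obtain c where c: "a = p * c" using assms(1,2) by blast
  have "p ^ k dvd c * b" using Suc.prems assms(3) unfolding c by (simp add: mult.assoc)
  from Suc.IH[OF this] show ?case unfolding c power_Suc by (rule mult_dvd_mono[OF dvd_refl])
qed simp

subsection \<open>Points outside the line z = 0\<close>

locale affine_pt = plane_pt dummy q zvar for dummy :: "'a::field itself" and q
begin

text \<open>\<open>A \<in> k[\<alpha>][f]\<close> vanishes at \<open>q\<close>.\<close>

definition "inQ A \<longleftrightarrow> (\<exists>d a. homogeneous d a \<and> a \<in> q \<and> sigma a = A)"

text \<open>Any two forms with the same image under \<open>sigma\<close> agree up to powers of z,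
  and z does not vanish at q.\<close>

lemma inQ_iff: assumes "homogeneous d a" "sigma a = A" shows "inQ A \<longleftrightarrow> a \<in> q"
proof
  assume "inQ A"
  then obtain e b where b: "homogeneous e b" "b \<in> q" "sigma b = A" unfolding inQ_def by blast
  have "homogeneous (e * 1 + d) (zvar ^ e * a)" "homogeneous (d * 1 + e) (zvar ^ d * b)"
    by (intro homogeneous_mult homogeneous_pow homogeneous_vars assms b)+
  then have "homogeneous (d + e) (zvar ^ e * a)" "homogeneous (d + e) (zvar ^ d * b)" by (simp_all add: add.commute)
  then have "zvar ^ e * a = zvar ^ d * b" by (rule sigma_eq) (simp only: sigma_z_pow assms b)
  then have "zvar ^ e * a \<in> q" using q_mult[OF b(2)] by simp
  then show "a \<in> q" using q_prime q_pow[OF ell_notin] by blast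
qed (use assms in \<open>auto simp: inQ_def\<close>)

lemma inQ_add: "inQ A \<Longrightarrow> inQ B \<Longrightarrow> inQ (A + B)"
proof -
  assume AB: "inQ A" "inQ B"
  obtain d a b where a: "homogeneous d a" "homogeneous d b" "sigma a = A" "sigma b = B" by (rule homogenize2)
  have "a \<in> q" "b \<in> q" using AB inQ_iff a by blast+
  then show ?thesis using inQ_iff[OF homogeneous_add[OF a(1,2)] sigma_hom(2)] q_add a(3,4) by simp
qed

lemma inQ_mult_iff: "inQ (A * B) \<longleftrightarrow> inQ A \<or> inQ B"
proof -
  obtain d a b where a: "homogeneous d a" "homogeneous d b" "sigma a = A" "sigma b = B" by (rule homogenize2)
  have "inQ (A * B) \<longleftrightarrow> a * b \<in> q" by (rule inQ_iff[OF homogeneous_mult[OF a(1,2)]]) (simp add: sigma_hom a)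
  also have "\<dots> \<longleftrightarrow> a \<in> q \<or> b \<in> q" using q_prime q_mult by (metis mult.commute)
  also have "\<dots> \<longleftrightarrow> inQ A \<or> inQ B" using inQ_iff a by blast
  finally show ?thesis .
qed

lemma inQ_1: "\<not> inQ 1"
  using inQ_iff[OF homogeneous_1 sigma_hom(1)] q_1 by simp

lemma inQ_0: "inQ 0"
  using inQ_iff[OF homogeneous_0[of 0] sigma_hom(4)] q_0 by simp

lemma inQ_X: "inQ [:0, 1:]"
  using inQ_iff[OF homogeneous_conic sigma_conic] q_conic by simp

text \<open>f vanishes at q, so only the part of A free of f counts: vanishing at q is decided on
  the \<alpha>-line.\<close>

lemma inQ_coeff: "inQ A \<longleftrightarrow> inQ [:coeff A 0:]"
proof -
  obtain c A' where A: "A = pCons c A'" by (cases A)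
  have 1: "A = [:c:] + [:0, 1:] * A'" "[:c:] = A + [:0, 1:] * (- A')" unfolding A by simp_all
  have "inQ ([:0, 1:] * A')" "inQ ([:0, 1:] * (- A'))" using inQ_X inQ_mult_iff by blast+
  then have "inQ A \<longleftrightarrow> inQ [:c:]" using 1 inQ_add by metis
  then show ?thesis unfolding A by simp
qed

lemma R_io_iff: "r \<in> R \<longleftrightarrow> (\<exists>A B. \<not> inQ B \<and> r = io A / io B)"
proof
  assume "r \<in> R"
  then obtain a b d where a: "homogeneous d a" "homogeneous d b" "b \<notin> q" "r = emb a / emb b" unfolding R_iff by blast
  then have "\<not> inQ (sigma b)" "r = io (sigma a) / io (sigma b)"
    using inQ_iff[OF a(2) refl] ratio_io[OF a(1,2)] by (simp_all add: ratio_emb)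
  then show "\<exists>A B. \<not> inQ B \<and> r = io A / io B" by blast
next
  assume "\<exists>A B. \<not> inQ B \<and> r = io A / io B"
  then obtain A B where AB: "\<not> inQ B" "r = io A / io B" by blast
  obtain d a b where a: "homogeneous d a" "homogeneous d b" "sigma a = A" "sigma b = B" by (rule homogenize2)
  have "b \<notin> q" "r = emb a / emb b"
    using inQ_iff[OF a(2,4)] AB ratio_io[OF a(1,2)] a by (simp_all add: ratio_emb)
  then show "r \<in> R" unfolding R_iff using a by blast
qed

lemma max_io_iff: "r \<in> stalk_max q \<longleftrightarrow> (\<exists>A B. inQ A \<and> \<not> inQ B \<and> r = io A / io B)"
proof
  assume "r \<in> stalk_max q"
  then obtain a b d where a: "homogeneous d a" "homogeneous d b" "a \<in> q" "b \<notin> q" "r = emb a / emb b" unfolding max_iff by blast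
  then have "\<not> inQ (sigma b)" "inQ (sigma a)" "r = io (sigma a) / io (sigma b)"
    using inQ_iff[OF a(2) refl] inQ_iff[OF a(1) refl] ratio_io[OF a(1,2)] by (simp_all add: ratio_emb)
  then show "\<exists>A B. inQ A \<and> \<not> inQ B \<and> r = io A / io B" by blast
next
  assume "\<exists>A B. inQ A \<and> \<not> inQ B \<and> r = io A / io B"
  then obtain A B where AB: "inQ A" "\<not> inQ B" "r = io A / io B" by blast
  obtain d a b where a: "homogeneous d a" "homogeneous d b" "sigma a = A" "sigma b = B" by (rule homogenize2)
  have "a \<in> q" "b \<notin> q" "r = emb a / emb b"
    using inQ_iff[OF a(2,4)] inQ_iff[OF a(1,3)] AB ratio_io[OF a(1,2)] a by (simp_all add: ratio_emb)
  then show "r \<in> stalk_max q" unfolding max_iff using a by blast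
qed

lemma io_R: "io A \<in> R"
  unfolding R_io_iff using inQ_1 by (intro exI[of _ A] exI[of _ 1]) (simp add: io_hom)

lemma io_max_iff: "io A \<in> stalk_max q \<longleftrightarrow> inQ A"
proof
  assume "io A \<in> stalk_max q"
  then obtain B C where B: "inQ B" "\<not> inQ C" "io A = io B / io C" unfolding max_io_iff by blast
  have "C \<noteq> 0" using B(2) inQ_0 by auto
  then have "io (A * C) = io B" using B(3) by (simp add: io_hom io_eq_0_iff)
  then have "A * C = B" unfolding io_eq_iff .
  then show "inQ A" using B inQ_mult_iff by blast
next
  assume "inQ A"
  then show "io A \<in> stalk_max q" unfolding max_io_iff using inQ_1
    by (intro exI[of _ A] exI[of _ 1]) (simp add: io_hom)
qed

lemma fl_io: "fl = io [:0, 1:]"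
  unfolding fl_def f0_eq[symmetric] f0_def ..

context
  fixes \<pi> :: "'a poly" assumes \<pi>: "\<And>c. inQ [:c:] \<longleftrightarrow> \<pi> dvd c" and \<pi>_nz: "\<pi> \<noteq> 0"
begin

lemma \<pi>_prime: "\<pi> dvd a * b \<Longrightarrow> \<pi> dvd a \<or> \<pi> dvd b"
  using inQ_mult_iff[of "[:a:]" "[:b:]"] \<pi> by (simp add: mult.commute)

lemma \<pi>_nu: "\<not> \<pi> dvd 1"
  using inQ_1 \<pi>[of 1] by (simp add: one_pCons)

lemma degree_\<pi>: "0 < degree \<pi>"
proof (rule ccontr)
  assume "\<not> ?thesis"
  then have "is_unit \<pi>" using \<pi>_nz by (simp add: is_unit_iff_degree)
  then show False using \<pi>_nu by simp
qed

text \<open>\<open>\<pi>\<close> generates the ideal of polynomials in \<alpha> that vanish at q.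
  Together with f it generates the maximal ideal, because a numerator vanishing at q has its f-free
  coefficient divisible by \<open>\<pi>\<close>.\<close>

lemma affine_local_flag:
  assumes "local_equation conic q f"
  shows "local_flag conic q f (io [:\<pi>:])"
proof (rule local_flagI[OF assms])
  show "stalk_max q = {io [:\<pi>:] * a + fl * b | a b. a \<in> R \<and> b \<in> R}"
  proof (intro subset_antisym subsetI)
    fix r assume "r \<in> stalk_max q"
    then obtain A B where AB: "inQ A" "\<not> inQ B" "r = io A / io B" unfolding max_io_iff by blast
    obtain c A' where A: "A = pCons c A'" by (cases A)
    have "\<pi> dvd c" using AB(1) inQ_coeff[of A] \<pi> unfolding A by simp
    then obtain d where d: "c = \<pi> * d" by (auto simp: dvd_def)
    have "A = [:\<pi>:] * [:d:] + [:0, 1:] * A'" unfolding A d by simp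
    then have "r = io [:\<pi>:] * (io [:d:] / io B) + fl * (io A' / io B)"
      unfolding AB(3) fl_io by (simp only: io_hom add_divide_distrib times_divide_eq_right)
    then show "r \<in> {io [:\<pi>:] * a + fl * b | a b. a \<in> R \<and> b \<in> R}" using AB(2) R_io_iff by blast
  next
    fix r assume "r \<in> {io [:\<pi>:] * a + fl * b | a b. a \<in> R \<and> b \<in> R}"
    then obtain A B C D where 1: "\<not> inQ B" "\<not> inQ D" "r = io [:\<pi>:] * (io A / io B) + fl * (io C / io D)"
      unfolding R_io_iff by blast
    have nz: "io B \<noteq> 0" "io D \<noteq> 0" using 1 inQ_0 by (auto simp: io_eq_0_iff)
    have "r = io ([:\<pi>:] * A * D + [:0, 1:] * C * B) / io (B * D)"
      unfolding 1(3) fl_io io_hom using nz by (simp add: add_frac_eq mult_ac)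
    moreover have "inQ ([:\<pi>:] * A * D + [:0, 1:] * C * B)"
      using \<pi>[of \<pi>] inQ_X inQ_mult_iff by (intro inQ_add) (simp_all only: dvd_refl simp_thms)
    ultimately show "r \<in> stalk_max q" unfolding max_io_iff using 1 inQ_mult_iff by blast
  qed
  show "io [:\<pi>:] \<in> R" by (rule io_R)
  show "io [:\<pi>:] \<noteq> 0" using \<pi>_nz by (simp add: io_eq_0_iff)
  show "vl (io [:\<pi>:]) = 0" using vl_io[of "[:\<pi>:]"] order_0_iff[of "[:\<pi>:]"] \<pi>_nz by simp
  fix r assume r: "r \<in> R" "r \<noteq> 0" "vl r = 0"
  obtain A B where AB: "\<not> inQ B" "r = io A / io B" using r(1) unfolding R_io_iff by blast
  have B0: "B \<noteq> 0" using AB(1) inQ_0 by auto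
  have A0: "A \<noteq> 0" using AB(2) r(2) by (auto simp: io_hom)
  have cB: "coeff B 0 \<noteq> 0" using AB(1) inQ_coeff[of B] inQ_0 by auto
  then have "order 0 B = 0" using order_0_iff[OF B0] by simp
  then have "order 0 A = 0" using val_along_conic[OF A0 B0] r(3) AB(2) by simp
  then have cA: "coeff A 0 \<noteq> 0" using order_0_iff[OF A0] by simp
  show "\<exists>k. \<forall>a\<in>R. \<forall>b\<in>R. r \<noteq> fl * a + io [:\<pi>:] ^ k * b"
  proof (intro exI ballI notI)
    \<comment> \<open>At f = 0 the assumed equation makes the k-th power of \<open>\<pi>\<close>
      divide the nonzero polynomial \<open>coeff A 0\<close>; this k exceeds its degree.\<close>
    define k where "k = Suc (degree (coeff A 0))"
    fix a b assume ab: "a \<in> R" "b \<in> R" "r = fl * a + io [:\<pi>:] ^ k * b"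
    obtain A1 B1 where 1: "\<not> inQ B1" "a = io A1 / io B1" using ab(1) unfolding R_io_iff by blast
    obtain A2 B2 where 2: "\<not> inQ B2" "b = io A2 / io B2" using ab(2) unfolding R_io_iff by blast
    have nz: "io B \<noteq> 0" "io B1 \<noteq> 0" "io B2 \<noteq> 0" using AB 1 2 inQ_0 by (auto simp: io_eq_0_iff)
    have "io A * (io B1 * io B2) = (r * io B) * (io B1 * io B2)" using AB(2) nz by simp
    also have "\<dots> = io [:0, 1:] * (a * io B1) * io B * io B2 + io [:\<pi>:] ^ k * (b * io B2) * io B * io B1"
      unfolding ab(3) fl_io by (simp only: algebra_simps)
    also have "\<dots> = io [:0, 1:] * io A1 * io B * io B2 + io [:\<pi>:] ^ k * io A2 * io B * io B1"
      using 1(2) 2(2) nz by simp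
    finally have "A * (B1 * B2) = [:0, 1:] * A1 * B * B2 + [:\<pi>:] ^ k * A2 * B * B1"
      unfolding io_hom(2,3,7)[symmetric] io_eq_iff .
    then have "coeff (A * (B1 * B2)) 0 = coeff ([:0, 1:] * A1 * B * B2 + [:\<pi>:] ^ k * A2 * B * B1) 0" by simp
    then have eq: "coeff A 0 * (coeff B1 0 * coeff B2 0) = \<pi> ^ k * (coeff A2 0 * coeff B 0 * coeff B1 0)"
      by (simp add: coeff_mult_0 coeff_0_power mult.assoc)
    have "\<pi> ^ k dvd coeff A 0 * (coeff B1 0 * coeff B2 0)" unfolding eq by (rule dvd_triv_left)
    moreover have "\<not> \<pi> dvd coeff B1 0 * coeff B2 0"
      using \<pi>_prime 1(1) 2(1) inQ_coeff[of B1] inQ_coeff[of B2] \<pi> by blast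
    ultimately have "\<pi> ^ k dvd coeff A 0" using prime_pow_dvd_cancel[OF \<pi>_prime _ \<pi>_nz] by blast
    then have "degree (\<pi> ^ k) \<le> degree (coeff A 0)" using cA by (rule dvd_imp_degree_le)
    moreover have "degree (\<pi> ^ k) = k * degree \<pi>" using \<pi>_nz by (simp add: degree_power_eq)
    moreover have "k * 1 \<le> k * degree \<pi>" using degree_\<pi> by (intro mult_le_mono2) simp
    ultimately show False by (simp add: k_def)
  qed
qed

end

text \<open>k[\<alpha>] is a principal ideal domain: divide with remainder by a nonzero element of
  least degree.\<close>

lemma inQ_generator:
  assumes "c \<noteq> 0" "inQ [:c:]"
  obtains \<pi> where "\<And>c. inQ [:c:] \<longleftrightarrow> \<pi> dvd c" "\<pi> \<noteq> 0"
proof -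
  define n where "n = (LEAST n. \<exists>c. c \<noteq> 0 \<and> inQ [:c:] \<and> degree c = n)"
  obtain \<pi> where p: "\<pi> \<noteq> 0" "inQ [:\<pi>:]" "degree \<pi> = n"
    using LeastI_ex[of "\<lambda>n. \<exists>c. c \<noteq> 0 \<and> inQ [:c:] \<and> degree c = n"] assms unfolding n_def by blast
  have "inQ [:c:] \<longleftrightarrow> \<pi> dvd c" for c
  proof
    assume c: "inQ [:c:]"
    have "[:c mod \<pi>:] = [:c:] + [:\<pi>:] * [:- (c div \<pi>):]" by (simp add: minus_div_mult_eq_mod)
    moreover have "inQ ([:c:] + [:\<pi>:] * [:- (c div \<pi>):])" using c p(2) inQ_add inQ_mult_iff by blast
    ultimately have m: "inQ [:c mod \<pi>:]" by simp
    have "c mod \<pi> = 0"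
    proof (rule ccontr)
      assume nz: "c mod \<pi> \<noteq> 0"
      then have "n \<le> degree (c mod \<pi>)" unfolding n_def using m by (intro Least_le) blast
      then show False using degree_mod_less'[OF p(1) nz] p(3) by simp
    qed
    then show "\<pi> dvd c" by (simp add: mod_eq_0_iff_dvd)
  next
    assume "\<pi> dvd c"
    then obtain d where "c = \<pi> * d" by (auto simp: dvd_def)
    then have "[:c:] = [:\<pi>:] * [:d:]" by simp
    then show "inQ [:c:]" using p(2) inQ_mult_iff by metis
  qed
  then show ?thesis using that p(1) by blast
qed

end

text \<open>Restriction to y = z = 0, as a polynomial in x. On a form of degree d this is the value
  at (1:0:0) times x^d.\<close>

definition e0 :: "'a::field poly3 \<Rightarrow> 'a poly" where "e0 P = coeff (coeff P 0) 0"

lemma rhom_e0: "rhom e0"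
  by (simp add: rhom_def e0_def coeff_mult_0)

lemma e0_gens: "e0 xvar = [:0, 1:]" "e0 yvar = 0" "e0 zvar = 0" "e0 (const3 c) = [:c:]"
  by (simp_all add: e0_def xvar_def yvar_def zvar_def const3_def)

lemma conic_point_iff: "P \<in> conic_point \<longleftrightarrow> e0 P = 0"
proof
  note r = rhomD[OF rhom_e0]
  have "ideal {P. e0 P = (0 :: 'a poly)} poly3_ring" unfolding ideal_poly3_iff by (simp add: r)
  then have "(conic_point :: 'a poly3 set) \<subseteq> {P. e0 P = 0}" unfolding conic_point_def by (rule genideal_minimal) (simp add: e0_gens)
  then show "P \<in> conic_point \<Longrightarrow> e0 P = 0" by blast
next
  assume e: "e0 P = 0"
  obtain c P' where P: "P = pCons c P'" by (cases P)
  obtain d c' where c: "c = pCons d c'" by (cases c)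
  have d: "d = 0" using e unfolding e0_def P c by simp
  have eq: "P = [:c':] * yvar + P' * zvar" unfolding P c d yvar_def zvar_def by simp
  note i = genideal_ideal[of "{yvar, zvar}", unfolded ideal_poly3_iff, folded conic_point_def]
  have "yvar \<in> conic_point" "zvar \<in> conic_point" unfolding conic_point_def using genideal_self by blast+
  then show "P \<in> conic_point" unfolding eq using i by blast
qed

lemma ideal_conic_point: "ideal conic_point (poly3_ring :: 'a::field poly3 ring)"
  unfolding conic_point_def by (rule genideal_ideal)

lemma primeideal_conic_point: "primeideal conic_point (poly3_ring :: 'a::field poly3 ring)"
  unfolding primeideal_poly3_iff using ideal_conic_point by (simp add: conic_point_iff rhomD[OF rhom_e0])

lemma e0_homogeneous: assumes "homogeneous d a" shows "e0 a = monom (coeff3 a d 0 0) d"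
proof (rule poly_eqI)
  fix n
  have "coeff3 a n 0 0 \<noteq> 0 \<Longrightarrow> n = d" using assms unfolding homogeneous_def by fastforce
  then show "coeff (e0 a) n = coeff (monom (coeff3 a d 0 0) d) n" by (auto simp: e0_def)
qed

lemma conic_point_plane: "conic_point \<in> plane_points"
proof (rule plane_pointsI[OF primeideal_conic_point])
  show "\<not> {xvar, yvar, zvar} \<subseteq> (conic_point :: 'a poly3 set)" by (simp add: conic_point_iff e0_gens)
  fix P :: "'a poly3" and e assume P: "P \<in> conic_point"
  have "e0 (coeff (theta P) e) = 0"
  proof (rule poly_eqI)
    fix i
    have "coeff (e0 P) i = 0" using P by (simp add: conic_point_iff)
    then show "coeff (e0 (coeff (theta P) e)) i = coeff 0 i" by (cases "i = e") (simp_all add: e0_def coeff3_theta)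
  qed
  then show "coeff (theta P) e \<in> conic_point" by (simp add: conic_point_iff)
qed

lemma primeidealD:
  fixes q :: "'a::field poly3 set"
  assumes "primeideal q poly3_ring"
  shows "0 \<in> q" "1 \<notin> q" "a \<in> q \<Longrightarrow> b \<in> q \<Longrightarrow> a + b \<in> q" "a \<in> q \<Longrightarrow> r * a \<in> q" "a * b \<in> q \<Longrightarrow> a \<in> q \<or> b \<in> q"
    "a \<in> q \<Longrightarrow> b \<in> q \<Longrightarrow> a - b \<in> q" "a ^ n \<in> q \<Longrightarrow> a \<in> q" "ideal q poly3_ring"
proof -
  show i: "ideal q poly3_ring" using assms primeideal_poly3_iff by blast
  have h: "0 \<in> q" "1 \<notin> q" "\<And>a b. a \<in> q \<Longrightarrow> b \<in> q \<Longrightarrow> a + b \<in> q" "\<And>a r. a \<in> q \<Longrightarrow> r * a \<in> q"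
    "\<And>a b. a * b \<in> q \<Longrightarrow> a \<in> q \<or> b \<in> q"
    using assms unfolding primeideal_poly3_iff ideal_poly3_iff by blast+
  show "0 \<in> q" "1 \<notin> q" "a \<in> q \<Longrightarrow> b \<in> q \<Longrightarrow> a + b \<in> q" "a \<in> q \<Longrightarrow> r * a \<in> q" "a * b \<in> q \<Longrightarrow> a \<in> q \<or> b \<in> q"
    using h by blast+
  show "a \<in> q \<Longrightarrow> b \<in> q \<Longrightarrow> a - b \<in> q" using h(3)[of a "(- 1) * b"] h(4)[of b "- 1"] by simp
  show "a ^ n \<in> q \<Longrightarrow> a \<in> q"
  proof (induction n)
    case (Suc n)
    then show ?case using h(5)[of a "a ^ n"] by auto
  qed (use h(2) in simp)
qed

text \<open>Modulo z the conic is y^2, so a prime ideal containing both also contains y.\<close>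

lemma conic_z_y:
  fixes q :: "'a::field poly3 set"
  assumes "primeideal q poly3_ring" "conic \<in> q" "zvar \<in> q" shows "conic_point \<subseteq> q"
proof -
  note q = primeidealD[OF assms(1)]
  have "yvar ^ 2 = conic - (zvar - 2 * xvar) * (zvar :: 'a poly3)" by (simp add: conic_def algebra_simps power2_eq_square)
  also have "\<dots> \<in> q" by (rule q(6)[OF assms(2) q(4)[OF assms(3)]])
  finally have "yvar \<in> q" by (rule q(7))
  then show ?thesis unfolding conic_point_def using assms(3) by (intro genideal_minimal q(8)) simp
qed

lemma conic_in_conic_point: "conic \<in> conic_point"
  by (simp add: conic_point_iff conic_def rhomD[OF rhom_e0] e0_gens)

context char_ne_2
begin

lemma plane_ptI:
  fixes q :: "'a poly3 set"
  assumes "primeideal q poly3_ring" "conic \<in> q" "ell \<notin> q" "homogeneous 1 ell" "coeff (sigma ell) 0 \<noteq> 0"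
  shows "plane_pt q ell"
proof -
  note q = primeidealD[OF assms(1)]
  show ?thesis by unfold_locales (fact q(1) q(2) q(3) q(4) q(5) two assms)+
qed

lemma affine_ptI:
  fixes q :: "'a poly3 set"
  assumes "primeideal q poly3_ring" "conic \<in> q" "zvar \<notin> q" shows "affine_pt q"
  unfolding affine_pt_def by (rule plane_ptI[OF assms homogeneous_vars(3)]) (simp add: sigma_gens)

lemma conic_point_plane_pt: "plane_pt (conic_point :: 'a poly3 set) xvar"
  by (rule plane_ptI[OF primeideal_conic_point conic_in_conic_point _ homogeneous_vars(1)])
    (use two in \<open>simp_all add: conic_point_iff e0_gens sigma_gens\<close>)

lemma closed_point_affine:
  fixes q :: "'a poly3 set"
  assumes q: "q \<in> closed_points" "conic \<in> q" "q \<noteq> conic_point"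
  shows "affine_pt q" "\<exists>c. c \<noteq> 0 \<and> affine_pt.inQ q [:c:]"
proof -
  have qp: "q \<in> plane_points" using q(1) by (simp add: closed_points_def)
  note pp = plane_pointsD[OF qp] and pr = primeidealD[OF plane_pointsD(1)[OF qp]]
  \<comment> \<open>If z vanished at q, then q would contain \<open>conic_point\<close>, modulo
    which a form of degree d is a multiple of x^d. A form of q outside \<open>conic_point\<close>
    would put x into q as well, which is excluded for a point of the plane.\<close>
  have z: "zvar \<notin> q"
  proof
    assume z: "zvar \<in> q"
    have sub: "conic_point \<subseteq> q" by (rule conic_z_y[OF pp(1) q(2) z])
    have yz: "yvar \<in> q" "zvar \<in> q" using sub by (auto simp: conic_point_iff e0_gens)
    have "q \<subseteq> conic_point"
    proof (rule pp(3)[OF ideal_conic_point])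
      fix d a assume a: "homogeneous d a" "a \<in> q"
      define c where "c = coeff3 a d 0 0"
      have "e0 (a - const3 c * xvar ^ d) = 0"
        using e0_homogeneous[OF a(1)] by (simp add: rhomD[OF rhom_e0] e0_gens c_def monom_altdef)
      then have "a - const3 c * xvar ^ d \<in> q" using sub by (auto simp: conic_point_iff)
      then have "a - (a - const3 c * xvar ^ d) \<in> q" by (rule pr(6)[OF a(2)])
      then have cx: "const3 c * xvar ^ d \<in> q" by simp
      have "c = 0"
      proof (rule ccontr)
        assume "c \<noteq> 0"
        then have "const3 (inverse c) * (const3 c * xvar ^ d) = xvar ^ d"
          using rhomD(3)[OF rhom_const3, of "inverse c" c] const3_1[where ?'a = 'a] by (simp add: mult.assoc[symmetric])
        then have "xvar ^ d \<in> q" using pr(4)[OF cx] by metis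
        then have "xvar \<in> q" by (rule pr(7))
        then show False using pp(2) yz by simp
      qed
      then show "a \<in> conic_point" unfolding conic_point_iff e0_homogeneous[OF a(1)] c_def by simp
    qed
    then show False using sub q(3) by blast
  qed
  show A: "affine_pt q" by (rule affine_ptI[OF pp(1) q(2) z])
  interpret affine_pt dummy q by (rule A)
  \<comment> \<open>Otherwise the forms in q are multiples of the conic, and q would be properly
    contained in \<open>conic_point\<close>, against its maximality.\<close>
  show "\<exists>c. c \<noteq> 0 \<and> inQ [:c:]"
  proof (rule ccontr)
    assume n: "\<not> (\<exists>c. c \<noteq> 0 \<and> inQ [:c:])"
    have "q \<subseteq> conic_point"
    proof (rule pp(3)[OF ideal_conic_point])
      fix d a assume a: "homogeneous d a" "a \<in> q"
      have "inQ [:coeff (sigma a) 0:]" using inQ_iff[OF a(1) refl] a(2) inQ_coeff by blast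
      then have "coeff (sigma a) 0 = 0" using n by blast
      then have "conic dvd a" using conic_dvd_iff[OF a(1)] by simp
      then obtain b where "a = conic * b" by (auto simp: dvd_def)
      moreover have "e0 (conic :: 'a poly3) = 0" using conic_in_conic_point conic_point_iff by blast
      ultimately show "a \<in> conic_point" by (simp add: conic_point_iff rhomD[OF rhom_e0])
    qed
    then have "conic_point = q" using q(1) conic_point_plane by (auto simp: closed_points_def)
    then show False using q(3) by simp
  qed
qed

section \<open>Closed points of the conic away from p\<close>

definition s0 :: "'a poly3 \<Rightarrow> 'a poly" where "s0 P = coeff (sigma P) 0"

lemma rhom_s0: "rhom s0"
  by (simp add: rhom_def s0_def sigma_hom coeff_mult_0)

lemma s0_gens: "s0 xvar = smult (inverse 2) [:1, 0, 1:]" "s0 yvar = [:0, 1:]" "s0 zvar = 1" "s0 (const3 c) = [:c:]"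
  by (simp_all add: s0_def sigma_gens)

definition graded_restrict :: "'a poly3 \<Rightarrow> 'a poly poly" where
  "graded_restrict = ev3 (\<lambda>c. [:[:c:]:]) ([:0, 1:] * [:s0 xvar:]) ([:0, 1:] * [:s0 yvar:]) ([:0, 1:] * [:s0 zvar:])"

lemma rhom_lam: "rhom graded_restrict"
  unfolding graded_restrict_def by (rule rhom_ev3[OF rhom_cc])

lemma graded_restrict_homogeneous: "homogeneous d a \<Longrightarrow> graded_restrict a = monom (s0 a) d"
proof -
  assume a: "homogeneous d a"
  have c1: "rhom (\<lambda>a::'a poly. [:a:])" by (simp add: rhom_def one_pCons)
  have "graded_restrict a = [:0, 1:] ^ d * ev3 (\<lambda>c. [:[:c:]:]) [:s0 xvar:] [:s0 yvar:] [:s0 zvar:] a"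
    unfolding graded_restrict_def by (rule ev3_scale[OF rhom_cc a])
  also have "ev3 (\<lambda>c. [:[:c:]:]) [:s0 xvar:] [:s0 yvar:] [:s0 zvar:] a = [:s0 a:]"
    by (rule ev3_unique[OF rhom_comp[OF c1 rhom_s0] rhom_cc, symmetric]) (simp add: s0_gens)
  finally show ?thesis by (simp add: monom_altdef)
qed

text \<open>The point of the conic with \<open>\<pi>(\<alpha>) = 0\<close>. The outer variable of \<open>graded_restrict\<close> records the degree, which makes
  the ideal homogeneous.\<close>

definition qpt :: "'a poly \<Rightarrow> 'a poly3 set" where "qpt \<pi> = {P. [:\<pi>:] dvd graded_restrict P}"

lemma qpt_homogeneous: "homogeneous d a \<Longrightarrow> a \<in> qpt \<pi> \<longleftrightarrow> \<pi> dvd s0 a"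
  unfolding qpt_def by (auto simp: graded_restrict_homogeneous const_poly_dvd_iff)

text \<open>The coefficient of index e of \<open>graded_restrict P\<close> is the restriction of the
  component of degree e, so divisibility by the constant \<open>\<pi>\<close> holds for each
  component.\<close>

lemma qpt_comp: "P \<in> qpt \<pi> \<Longrightarrow> coeff (theta P) e \<in> qpt \<pi>"
proof -
  assume P: "P \<in> qpt \<pi>"
  have "graded_restrict P = (\<Sum>e\<le>degree (theta P). monom (s0 (coeff (theta P) e)) e)"
    by (subst sum_comp[of P]) (simp add: rhomD[OF rhom_lam] graded_restrict_homogeneous[OF homogeneous_comp])
  then have "coeff (graded_restrict P) e = (\<Sum>e'\<le>degree (theta P). if e' = e then s0 (coeff (theta P) e) else 0)"
    by (auto simp: coeff_sum intro!: sum.cong)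
  then have c: "coeff (graded_restrict P) e = (if e \<le> degree (theta P) then s0 (coeff (theta P) e) else 0)" by simp
  have "\<pi> dvd coeff (graded_restrict P) e" using P unfolding qpt_def const_poly_dvd_iff by simp
  moreover have "e > degree (theta P) \<Longrightarrow> s0 (coeff (theta P) e) = 0" by (simp add: coeff_eq_0 rhomD[OF rhom_s0])
  ultimately show ?thesis unfolding qpt_homogeneous[OF homogeneous_comp] c by (cases "e \<le> degree (theta P)") auto
qed

text \<open>The form 2x - z restricts to \<alpha>^2 on the conic, so C = c + d \<alpha> + \<alpha>^2
  D is lifted by lifting D. At y = z = 0 the same form is 2x, whence the power of 2. The control of
  the coefficient of x^n serves to show that a point with \<pi>(\<alpha>) = 0 does not specialize to
  p.\<close>

lemma s0_form: "degree C \<le> 2 * n \<Longrightarrow> \<exists>a. homogeneous n a \<and> s0 a = C \<and> coeff (e0 a) n = 2 ^ n * coeff C (2 * n)"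
proof (induction n arbitrary: C)
  case 0
  then obtain c where "C = [:c:]" by (metis degree_eq_zeroE le_0_eq mult_0_right)
  then show ?case by (intro exI[of _ "const3 c"]) (simp add: homogeneous_const s0_gens e0_gens)
next
  case (Suc n)
  obtain c C' where C': "C = pCons c C'" by (cases C)
  obtain d D where D: "C' = pCons d D" by (cases C')
  have "degree D \<le> 2 * n" using Suc.prems unfolding C' D by (auto split: if_splits)
  then obtain a where a: "homogeneous n a" "s0 a = D" "coeff (e0 a) n = 2 ^ n * coeff D (2 * n)" using Suc.IH by blast
  define b where "b = const3 c * zvar ^ Suc n + const3 d * yvar * zvar ^ n + (const3 2 * xvar - zvar) * a"
  note r = rhomD[OF rhom_s0] and re = rhomD[OF rhom_e0]
  have "homogeneous (0 + Suc n * 1) (const3 c * zvar ^ Suc n)" "homogeneous (0 + 1 + n * 1) (const3 d * yvar * zvar ^ n)"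
    by (intro homogeneous_mult homogeneous_const homogeneous_pow homogeneous_vars)+
  moreover have "homogeneous (1 + n) ((const3 2 * xvar - zvar) * a)"
    using homogeneous_mult[OF homogeneous_const[of 2] homogeneous_vars(1)] homogeneous_vars(3)
    by (intro homogeneous_mult homogeneous_minus a) simp_all
  ultimately have h: "homogeneous (Suc n) b" unfolding b_def by (intro homogeneous_add) simp_all
  have s: "s0 b = C"
    unfolding b_def r s0_gens a(2) C' D using two by (simp add: algebra_simps)
  have "e0 b = [:0, 2:] * e0 a" unfolding b_def re e0_gens by simp
  then have "coeff (e0 b) (Suc n) = 2 * coeff (e0 a) n" by simp
  then have "coeff (e0 b) (Suc n) = 2 ^ Suc n * coeff C (2 * Suc n)" unfolding a(3) C' D by simp
  then show ?case using h s by blast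
qed

lemma qpt_closed:
  assumes \<pi>: "prime_elem \<pi>"
  shows "qpt \<pi> \<in> closed_points" "conic \<in> qpt \<pi>" "qpt \<pi> \<noteq> conic_point" "affine_pt (qpt \<pi>)"
    "affine_pt.inQ (qpt \<pi>) [:c:] \<longleftrightarrow> \<pi> dvd c"
proof -
  note r = rhomD[OF rhom_lam]
  have \<pi>0: "\<pi> \<noteq> 0" and \<pi>1: "\<not> \<pi> dvd 1" and \<pi>p: "\<And>a b. \<pi> dvd a * b \<Longrightarrow> \<pi> dvd a \<or> \<pi> dvd b"
    using \<pi> by (auto simp: prime_elem_def)
  have P: "prime_elem [:\<pi>:]" using \<pi> by (simp add: prime_elem_const_poly_iff)
  have pr: "primeideal (qpt \<pi>) poly3_ring"
    unfolding primeideal_poly3_iff ideal_poly3_iff qpt_def using P by (auto simp: r prime_elem_def)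
  have z: "zvar \<notin> qpt \<pi>" using qpt_homogeneous[OF homogeneous_vars(3)] \<pi>1 by (simp add: s0_gens)
  have "s0 conic = 0" by (simp add: s0_def sigma_conic)
  then show c: "conic \<in> qpt \<pi>" using qpt_homogeneous[OF homogeneous_conic] by simp
  show "qpt \<pi> \<noteq> conic_point" using z by (auto simp: conic_point_iff e0_gens)
  show A: "affine_pt (qpt \<pi>)" by (rule affine_ptI[OF pr c z])
  have qp: "qpt \<pi> \<in> plane_points" by (rule plane_pointsI[OF pr]) (use z qpt_comp in auto)
  interpret A: affine_pt dummy "qpt \<pi>" by (rule A)
  have inQ: "A.inQ [:c:] \<longleftrightarrow> \<pi> dvd c" for c
  proof -
    obtain d a where a: "homogeneous d a" "sigma a = [:c:]" using homogenize by blast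
    show ?thesis unfolding A.inQ_iff[OF a] qpt_homogeneous[OF a(1)] s0_def a(2) by simp
  qed
  then show "A.inQ [:c:] \<longleftrightarrow> \<pi> dvd c" .
  have "q' = qpt \<pi>" if q': "q' \<in> plane_points" "qpt \<pi> \<subseteq> q'" for q'
  proof -
    note pp = plane_pointsD[OF q'(1)] and pr' = primeidealD[OF plane_pointsD(1)[OF q'(1)]]
    have c': "conic \<in> q'" using c q'(2) by blast
    have z': "zvar \<notin> q'"
    proof
      assume z: "zvar \<in> q'"
      have sub: "conic_point \<subseteq> q'" by (rule conic_z_y[OF pp(1) c' z])
      have yz: "yvar \<in> q'" "zvar \<in> q'" using sub by (auto simp: conic_point_iff e0_gens)
      define n where "n = degree \<pi>"
      \<comment> \<open>Forms of degree n restrict to polynomials of degree up to 2n, and the square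
        of \<open>\<pi>\<close> has degree exactly 2n. It therefore lifts to a form in
        \<open>qpt \<pi>\<close> that does not vanish at p.\<close>
      have "degree (\<pi> * \<pi>) \<le> 2 * n" using degree_mult_le[of \<pi> \<pi>] by (simp add: n_def)
      then obtain a where a: "homogeneous n a" "s0 a = \<pi> * \<pi>" "coeff (e0 a) n = 2 ^ n * coeff (\<pi> * \<pi>) (2 * n)"
        using s0_form by blast
      have "degree (\<pi> * \<pi>) = 2 * n" using \<pi>0 by (simp add: degree_mult_eq n_def)
      then have "coeff (\<pi> * \<pi>) (2 * n) \<noteq> 0" using \<pi>0 by (metis leading_coeff_0_iff mult_eq_0_iff)
      then have k0: "coeff (e0 a) n \<noteq> 0" unfolding a(3) using two by (simp only: mult_eq_0_iff power_eq_0_iff) simp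
      define k where "k = coeff (e0 a) n"
      have "a \<in> q'" using q'(2) qpt_homogeneous[OF a(1)] a(2) by auto
      have "k = coeff3 a n 0 0" by (simp add: k_def e0_def)
      then have "e0 (a - const3 k * xvar ^ n) = 0"
        using e0_homogeneous[OF a(1)] by (simp add: rhomD[OF rhom_e0] e0_gens monom_altdef)
      then have "a - const3 k * xvar ^ n \<in> q'" using sub by (auto simp: conic_point_iff)
      then have "a - (a - const3 k * xvar ^ n) \<in> q'" by (rule pr'(6)[OF \<open>a \<in> q'\<close>])
      then have cx: "const3 k * xvar ^ n \<in> q'" by simp
      have "const3 (inverse k) * (const3 k * xvar ^ n) = xvar ^ n"
        using rhomD(3)[OF rhom_const3, of "inverse k" k] const3_1[where ?'a = 'a] k0 by (simp add: mult.assoc[symmetric] k_def)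
      then have "xvar ^ n \<in> q'" using pr'(4)[OF cx] by metis
      then have "xvar \<in> q'" by (rule pr'(7))
      then show False using pp(2) yz by simp
    qed
    interpret B: affine_pt dummy q' by (rule affine_ptI[OF pp(1) c' z'])
    have B\<pi>: "B.inQ [:\<pi>:]"
    proof -
      obtain d a where a: "homogeneous d a" "sigma a = [:\<pi>:]" using homogenize by blast
      have "a \<in> qpt \<pi>" unfolding qpt_homogeneous[OF a(1)] s0_def a(2) by simp
      then show ?thesis unfolding B.inQ_iff[OF a] using q'(2) by blast
    qed
    obtain g where g: "\<And>c. B.inQ [:c:] \<longleftrightarrow> g dvd c" "g \<noteq> 0" using B.inQ_generator[OF \<pi>0 B\<pi>] by blast
    have "g dvd \<pi>" using g(1) B\<pi> by blast
    then obtain h where h: "\<pi> = g * h" by (auto simp: dvd_def)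
    \<comment> \<open>\<open>\<pi>\<close> is prime and equals g h; g is not a unit, since 1 does
      not vanish at \<open>q'\<close>.\<close>
    have "\<pi> dvd g"
    proof (rule ccontr)
      assume "\<not> \<pi> dvd g"
      then have "\<pi> dvd h" using \<pi>p[of g h] h by simp
      then obtain h' where "h = \<pi> * h'" by (auto simp: dvd_def)
      then have "\<pi> * 1 = \<pi> * (g * h')" using h by (simp add: mult_ac)
      then have "1 = g * h'" using \<pi>0 by (simp only: mult_cancel_left simp_thms)
      then have "g dvd 1" by (metis dvd_triv_left)
      then have "B.inQ [:1:]" using g(1) by blast
      then show False using B.inQ_1 by (simp add: one_pCons)
    qed
    have "q' \<subseteq> qpt \<pi>"
    proof (rule pp(3)[OF primeidealD(8)[OF pr]])
      fix d a assume a: "homogeneous d a" "a \<in> q'"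
      have "B.inQ [:coeff (sigma a) 0:]" using B.inQ_iff[OF a(1) refl] a(2) B.inQ_coeff by blast
      then have "\<pi> dvd coeff (sigma a) 0" using g(1) \<open>\<pi> dvd g\<close> dvd_trans by blast
      then show "a \<in> qpt \<pi>" unfolding qpt_homogeneous[OF a(1)] s0_def .
    qed
    then show ?thesis using q'(2) by blast
  qed
  then show "qpt \<pi> \<in> closed_points" unfolding closed_points_def using qp by blast
qed

lemma prime_factor_exists:
  "0 < degree b \<Longrightarrow> \<exists>\<pi> :: 'a poly. prime_elem \<pi> \<and> \<pi> dvd b"
proof (induction "degree b" arbitrary: b rule: less_induct)
  case less
  show ?case
  proof (cases "irreducible b")
    case True
    then show ?thesis using field_poly_irreducible_imp_prime[OF True] by (intro exI[of _ b] conjI dvd_refl)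
  next
    case False
    have b0: "b \<noteq> 0" using less.prems by (cases "b = 0") simp_all
    have b1: "\<not> b dvd 1" using less.prems unfolding is_unit_iff_degree[OF b0] by simp
    obtain u v where uv: "b = u * v" "\<not> u dvd 1" "\<not> v dvd 1" using False b0 b1 unfolding irreducible_def by blast
    have nz: "u \<noteq> 0" "v \<noteq> 0" using uv(1) b0 by simp_all
    have d: "degree u > 0" "degree v > 0" using uv(2,3) unfolding is_unit_iff_degree[OF nz(1)] is_unit_iff_degree[OF nz(2)] by simp_all
    then have "degree u < degree b" unfolding uv(1) degree_mult_eq[OF nz] by simp
    then obtain \<pi> where "prime_elem \<pi>" "\<pi> dvd u" using less.hyps[OF _ d(1)] by blast
    then show ?thesis unfolding uv(1) by (intro exI[of _ \<pi>] conjI dvd_mult2)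
  qed
qed

subsection \<open>The point p\<close>

text \<open>\<open>omega\<close> is the parametrization \<open>T \<mapsto> (1 + T\<^sup>2 : 2T : 2T\<^sup>2)\<close> of the conic, with \<open>T = 1/\<alpha>\<close>.\<close>

definition omega :: "'a poly3 \<Rightarrow> 'a poly" where
  "omega = ev3 (\<lambda>c. [:c:]) [:1, 0, 1:] [:0, 2:] [:0, 0, 2:]"

lemma rhom_c1: "rhom (\<lambda>c::'a. [:c:])" by (simp add: rhom_def one_pCons)

lemma rhom_omega: "rhom omega"
  unfolding omega_def by (rule rhom_ev3[OF rhom_c1])

lemma omega_gens: "omega xvar = [:1, 0, 1:]" "omega yvar = [:0, 2:]" "omega zvar = [:0, 0, 2:]" "omega (const3 c) = [:c:]"
  unfolding omega_def by (rule ev3_gens[OF rhom_c1])+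

lemma omega_conic: "omega conic = 0"
proof -
  have "omega 2 = (2 :: 'a poly)" using rhomD(2)[OF rhom_omega, of 1 1] rhomD(1)[OF rhom_omega] by (metis one_add_one)
  moreover have "(2 :: 'a poly) = [:2:]" by (metis numeral_poly)
  ultimately show ?thesis unfolding conic_def by (simp add: rhomD[OF rhom_omega] omega_gens power2_eq_square)
qed

text \<open>T = 0 is sent to (1:0:0), so the constant term is the value of the form at p.\<close>

lemma omega_coeff_0: assumes "homogeneous d a" shows "coeff (omega a) 0 = coeff (e0 a) d"
proof -
  have r1: "rhom (\<lambda>P. coeff (omega P) 0)" by (simp add: rhom_def coeff_mult_0 rhomD[OF rhom_omega])
  have r2: "rhom (\<lambda>P. poly (e0 P) (1::'a))" by (simp add: rhom_def rhomD[OF rhom_e0])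
  have "coeff (omega a) 0 = poly (e0 a) 1"
    by (rule rhom_poly3_eq[OF r1 r2]) (simp_all add: omega_gens e0_gens)
  also have "\<dots> = coeff (e0 a) d" unfolding e0_homogeneous[OF assms] by (simp add: poly_monom)
  finally show ?thesis .
qed

text \<open>At T = 1/\<alpha> the parametrization is 2 \<alpha>^-2 times ((1 + \<alpha>^2)/2 :
  \<alpha> : 1), the point at which \<open>s0\<close> evaluates. By homogeneity a form that vanishes
  along the parametrization vanishes on the conic.\<close>

lemma omega_eq_0: assumes "homogeneous d a" "omega a = 0" shows "coeff (sigma a) 0 = 0"
proof -
  define \<beta> where "\<beta> = Fraction_Field.Fract [:1:] [:0, 1 :: 'a:]"
  define k where "k = (\<lambda>c::'a. Fraction_Field.Fract [:c:] 1)"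
  have rk: "rhom (\<lambda>p::'a poly. Fraction_Field.Fract p 1)" by (simp add: rhom_def One_fract_def)
  have k: "rhom k" unfolding k_def using rhom_comp[OF rk rhom_c1] by simp
  define j where "j = (\<lambda>p::'a poly. Fraction_Field.Fract p 1)"
  have j: "rhom j" unfolding j_def by (rule rk)
  have jc: "j [:c:] = k c" for c by (simp add: j_def k_def)
  define \<alpha> where "\<alpha> = j [:0, 1:]"
  have a0: "\<alpha> \<noteq> 0" by (simp add: \<alpha>_def j_def Zero_fract_def eq_fract)
  have j2: "j (smult (inverse 2) [:1, 0, 1:]) * 2 = 1 + \<alpha> * \<alpha>"
  proof -
    have "j (smult (inverse 2) [:1, 0, 1:]) * 2 = j (smult (inverse 2) [:1, 0, 1:] * 2)"
      using rhomD(1,2,3)[OF j] by (metis one_add_one distrib_left mult.right_neutral)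
    also have "(smult (inverse 2) [:1, 0, 1:] * 2 :: 'a poly) = 1 + [:0, 1:] * [:0, 1:]"
    proof -
      have "(2 :: 'a poly) = [:2:]" by (metis numeral_poly)
      then have "(smult (inverse 2) [:1, 0, 1:] * 2 :: 'a poly) = smult (inverse 2) [:1, 0, 1:] * [:2:]" by (simp only:)
      then show ?thesis using two by (simp add: one_pCons)
    qed
    finally show ?thesis by (simp only: rhomD(1)[OF j] rhomD(2)[OF j] rhomD(3)[OF j] \<alpha>_def)
  qed
  define w where "w = evp k (inverse \<alpha>)"
  have rw: "rhom w" unfolding w_def by (rule rhom_evp[OF k])
  have k2: "k 2 = 2" using rhomD(1)[OF k] rhomD(2)[OF k, of 1 1] by (metis one_add_one)
  have "0 = w (omega a)" using assms(2) by (simp add: rhomD[OF rw])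
  also have "\<dots> = ev3 k (w (omega xvar)) (w (omega yvar)) (w (omega zvar)) a"
    by (rule ev3_unique[OF rhom_comp[OF rw rhom_omega] k])
      (simp add: omega_gens w_def evp_pCons[OF k] evp_0)
  also have "\<dots> = ev3 k (2 * inverse \<alpha> ^ 2 * j (s0 xvar)) (2 * inverse \<alpha> ^ 2 * j (s0 yvar)) (2 * inverse \<alpha> ^ 2 * j (s0 zvar)) a"
  proof -
    have "w (omega xvar) = 2 * inverse \<alpha> ^ 2 * j (s0 xvar)"
    proof -
      have "2 * inverse \<alpha> ^ 2 * j (s0 xvar) = inverse \<alpha> ^ 2 * (j (smult (inverse 2) [:1, 0, 1:]) * 2)"
        by (simp add: s0_gens)
      also have "\<dots> = w (omega xvar)"
        unfolding j2 using a0 by (simp add: omega_gens w_def evp_pCons[OF k] evp_0 rhomD[OF k] field_simps power2_eq_square)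
      finally show ?thesis ..
    qed
    moreover have "w (omega yvar) = 2 * inverse \<alpha> ^ 2 * j (s0 yvar)"
      unfolding s0_gens \<alpha>_def[symmetric] using a0
      by (simp add: omega_gens w_def evp_pCons[OF k] evp_0 rhomD[OF k] k2 field_simps power2_eq_square)
    moreover have "w (omega zvar) = 2 * inverse \<alpha> ^ 2 * j (s0 zvar)"
      by (simp add: s0_gens omega_gens w_def evp_pCons[OF k] evp_0 rhomD[OF k] rhomD[OF j] k2 power2_eq_square mult_ac)
    ultimately show ?thesis by simp
  qed
  also have "\<dots> = (2 * inverse \<alpha> ^ 2) ^ d * ev3 k (j (s0 xvar)) (j (s0 yvar)) (j (s0 zvar)) a"
    by (rule ev3_scale[OF k assms(1)])
  also have "ev3 k (j (s0 xvar)) (j (s0 yvar)) (j (s0 zvar)) a = j (s0 a)"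
    by (rule ev3_unique[OF rhom_comp[OF j rhom_s0] k, symmetric]) (simp add: s0_gens jc)
  finally have "(2 * inverse \<alpha> ^ 2) ^ d * j (s0 a) = 0" ..
  moreover have "(2 :: 'a poly fract) \<noteq> 0" using two unfolding k2[symmetric] by (simp add: k_def Zero_fract_def eq_fract)
  ultimately have "j (s0 a) = 0" using a0 by simp
  then have "s0 a = 0" by (simp add: j_def Zero_fract_def eq_fract)
  then show ?thesis by (simp add: s0_def)
qed

end

context char_ne_2
begin

interpretation P: plane_pt dummy conic_point xvar
  by (rule conic_point_plane_pt)

lemma conic_u_eq: "P.fl = conic_u"
proof -
  have "emb (xvar :: 'a poly3) \<noteq> 0" by (simp add: emb_eq_0_iff vars_nz)
  moreover have "emb (2 :: 'a poly3) = 2" using emb_hom(1,2) by (metis one_add_one)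
  ultimately show ?thesis
    unfolding P.fl_def conic_u_def ratio_emb conic_def emb_hom by (simp add: field_simps power2_eq_square)
qed

lemma e0_nz: "homogeneous d b \<Longrightarrow> b \<notin> conic_point \<Longrightarrow> coeff (e0 b) d \<noteq> 0"
  using e0_homogeneous[of d b] by (auto simp: conic_point_iff)

lemma conic_point_decomp:
  assumes "homogeneous d a" "a \<in> conic_point" "a \<noteq> (0 :: 'a poly3)"
  obtains A B where "homogeneous (d - 1) A" "homogeneous (d - 1) B" "a = A * yvar + B * zvar" "0 < d"
proof -
  obtain c B where a: "a = pCons c B" by (cases a)
  obtain c0 A where c: "c = pCons c0 A" by (cases c)
  have c0: "c0 = 0" using assms(2) unfolding conic_point_iff e0_def a c by simp
  have eq: "a = [:A:] * yvar + B * zvar" unfolding a c c0 yvar_def zvar_def by simp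
  have h: "coeff3 a i j l \<noteq> 0 \<Longrightarrow> i + j + l = d" for i j l using assms(1) unfolding homogeneous_def by blast
  have hA: "coeff3 [:A:] i j l \<noteq> 0 \<Longrightarrow> i + j + l + 1 = d" for i j l
    using h[of 0 "Suc j" i] unfolding a c by (cases l) simp_all
  have hB: "coeff3 B i j l \<noteq> 0 \<Longrightarrow> i + j + l + 1 = d" for i j l
    using h[of "Suc l" j i] unfolding a by simp
  have "0 < d"
  proof (rule ccontr)
    assume "\<not> 0 < d"
    then have "[:A:] = 0" "B = 0" using hA hB by (intro poly3_eqI; fastforce)+
    then show False using assms(3) eq by simp
  qed
  moreover have "homogeneous (d - 1) [:A:]" "homogeneous (d - 1) B"
    unfolding homogeneous_def using hA hB by fastforce+
  ultimately show ?thesis using that eq by blast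
qed

lemma conic_t_simps: "conic_t = emb yvar / emb (xvar :: 'a poly3)" "conic_t \<in> P.R" "conic_t \<noteq> (0 :: 'a poly3 fract)" "vl conic_t = 0"
proof -
  show 1: "conic_t = emb yvar / emb (xvar :: 'a poly3)" by (simp add: conic_t_def ratio_emb)
  show "conic_t \<in> P.R" using P.in_R[OF homogeneous_vars(2)] by (simp add: 1)
  show "conic_t \<noteq> (0 :: 'a poly3 fract)" by (simp add: 1 emb_eq_0_iff vars_nz)
  show "vl conic_t = 0"
    using P.vl_ratio[OF homogeneous_vars(2) homogeneous_vars(1) P.ell_notin] order_0_iff[of "sigma (yvar :: 'a poly3)"]
    unfolding 1 by (simp add: vars_nz sigma_gens)
qed

text \<open>With x = 1 the definition of u reads z(2 - z) = t^2 - u, and 2 - z is a unit at p. Hence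
  z lies in the ideal of t and u; \<open>v\<close> is the inverse of 2 - z.\<close>

lemma z_over_x:
  obtains v where "v \<in> P.R" "emb zvar / emb xvar = conic_t * (conic_t * v) - P.fl * v"
proof
  define v where "v = emb xvar / emb (const3 2 * xvar - zvar :: 'a poly3)"
  have e: "e0 (const3 2 * xvar - zvar :: 'a poly3) \<noteq> 0" using two by (simp add: rhomD[OF rhom_e0] e0_gens)
  have h: "homogeneous (0 + 1) (const3 2 * xvar)" by (rule homogeneous_mult[OF homogeneous_const homogeneous_vars(1)])
  have h: "homogeneous 1 (const3 2 * xvar - zvar :: 'a poly3)"
    using homogeneous_minus[OF h[simplified] homogeneous_vars(3)[simplified]] by simp
  show "v \<in> P.R" unfolding P.R_iff v_def using e h homogeneous_vars(1) conic_point_iff by blast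
  have nz: "emb (xvar :: 'a poly3) \<noteq> 0" by (simp add: emb_eq_0_iff vars_nz)
  have "const3 2 * xvar - zvar \<noteq> (0 :: 'a poly3)" using e rhomD(4)[OF rhom_e0] by metis
  then have nz2: "2 * emb xvar - emb (zvar :: 'a poly3) \<noteq> 0"
    unfolding two_emb by (simp add: kc_def emb_hom(3,6)[symmetric] emb_eq_0_iff)
  have v: "v * (2 * emb xvar - emb zvar) = emb xvar"
    unfolding v_def emb_hom(6) emb_hom(3) kc_def[symmetric] two_emb[symmetric] using nz2 by simp
  define t z where "t = (conic_t :: 'a poly3 fract)" and "z = emb zvar / emb (xvar :: 'a poly3)"
  have fl: "P.fl = t ^ 2 + z ^ 2 - 2 * z" unfolding conic_u_eq conic_u_def t_def z_def conic_t_def by (simp add: ratio_emb)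
  have v': "v * (2 - z) = 1" using v nz unfolding z_def by (simp add: field_simps)
  have "t * (t * v) - P.fl * v = z * (v * (2 - z))" unfolding fl by (simp add: algebra_simps power2_eq_square)
  then have "t * (t * v) - P.fl * v = z" by (simp only: v' mult_1_right)
  then show "emb zvar / emb xvar = conic_t * (conic_t * v) - P.fl * v" unfolding t_def z_def by simp
qed

lemma omega_unit: "homogeneous d b \<Longrightarrow> b \<notin> conic_point \<Longrightarrow> coeff (omega b) 0 \<noteq> 0"
  using omega_coeff_0[of d b] e0_nz[of d b] by simp

text \<open>y and z generate the homogeneous ideal of p, and \<open>z_over_x\<close> eliminates z,
  so t and u generate the maximal ideal. Separatedness modulo u is tested on the parametrization,
  where y becomes 2T.\<close>

lemma conic_point_flag: "local_flag conic conic_point conic_u (conic_t :: 'a poly3 fract)"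
  unfolding conic_u_eq[symmetric]
proof (rule P.local_flagI[OF P.local_equation_fl _ conic_t_simps(2-4)])
  note Rc = subring_onD[OF P.R_sub]
  show "stalk_max conic_point = {conic_t * a + P.fl * b | a b. a \<in> P.R \<and> b \<in> P.R}"
  proof (intro subset_antisym subsetI)
    fix r :: "'a poly3 fract" assume "r \<in> stalk_max conic_point"
    then obtain a b d where a: "homogeneous d a" "homogeneous d b" "a \<in> conic_point" "b \<notin> conic_point" "r = emb a / emb b"
      unfolding P.max_iff by blast
    show "r \<in> {conic_t * a + P.fl * b | a b. a \<in> P.R \<and> b \<in> P.R}"
    proof (cases "a = 0")
      case True
      then have "r = conic_t * 0 + P.fl * 0" using a(5) by (simp add: emb_hom)
      then show ?thesis using Rc(2) by blast
    next
      case False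
      obtain A B where A: "homogeneous (d - 1) A" "homogeneous (d - 1) B" "a = A * yvar + B * zvar" "0 < d"
        by (rule conic_point_decomp[OF a(1,3) False])
      obtain v where v: "v \<in> P.R" "emb zvar / emb xvar = conic_t * (conic_t * v) - P.fl * v" by (rule z_over_x)
      define r1 r2 where "r1 = emb (A * xvar) / emb b" and "r2 = emb (B * xvar) / emb b"
      have hd: "homogeneous d (A * xvar)" "homogeneous d (B * xvar)"
        using homogeneous_mult[OF A(1) homogeneous_vars(1)] homogeneous_mult[OF A(2) homogeneous_vars(1)] A(4) by simp_all
      have R12: "r1 \<in> P.R" "r2 \<in> P.R" unfolding r1_def r2_def P.R_iff using hd a(2,4) by blast+
      have nz: "emb (xvar :: 'a poly3) \<noteq> 0" by (simp add: emb_eq_0_iff vars_nz)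
      have "r = conic_t * r1 + (emb zvar / emb xvar) * r2"
        unfolding a(5) A(3) conic_t_simps(1) r1_def r2_def emb_hom using nz by (simp add: add_divide_distrib mult.commute)
      also have "\<dots> = conic_t * (r1 + conic_t * v * r2) + P.fl * (- (v * r2))"
        unfolding v(2) by (simp add: algebra_simps)
      finally have eq: "r = conic_t * (r1 + conic_t * v * r2) + P.fl * (- (v * r2))" .
      have "r1 + conic_t * v * r2 \<in> P.R" "- (v * r2) \<in> P.R" by (intro Rc R12 v(1) conic_t_simps(2))+
      then show ?thesis using eq by blast
    qed
  next
    fix r :: "'a poly3 fract" assume "r \<in> {conic_t * a + P.fl * b | a b. a \<in> P.R \<and> b \<in> P.R}"
    then obtain r1 r2 where r: "r1 \<in> P.R" "r2 \<in> P.R" "r = conic_t * r1 + P.fl * r2" by blast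
    obtain a b d where a: "homogeneous d a" "homogeneous d b" "b \<notin> conic_point" "r1 = emb a / emb b" using r(1) unfolding P.R_iff by blast
    obtain a' b' d' where a': "homogeneous d' a'" "homogeneous d' b'" "b' \<notin> conic_point" "r2 = emb a' / emb b'" using r(2) unfolding P.R_iff by blast
    have nz: "emb (xvar :: 'a poly3) \<noteq> 0" "emb b \<noteq> 0" "emb b' \<noteq> 0" using a(3) a'(3) P.q_0 by (auto simp: emb_eq_0_iff vars_nz)
    have eq: "r = emb (yvar * xvar * (a * b') + conic * (a' * b)) / emb (xvar ^ 2 * (b * b'))"
      unfolding r(3) a(4) a'(4) conic_t_simps(1) P.fl_def emb_hom using nz by (simp add: field_simps power2_eq_square)
    have h1: "homogeneous (1 + 1 + (d + d')) (yvar * xvar * (a * b'))"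
      by (rule homogeneous_mult[OF homogeneous_mult[OF homogeneous_vars(2,1)] homogeneous_mult[OF a(1) a'(2)]])
    have h2: "homogeneous (2 + (d' + d)) (conic * (a' * b))"
      by (rule homogeneous_mult[OF homogeneous_conic homogeneous_mult[OF a'(1) a(2)]])
    have h3: "homogeneous (2 * 1 + (d + d')) (xvar ^ 2 * (b * b'))"
      by (rule homogeneous_mult[OF homogeneous_pow[OF homogeneous_vars(1)] homogeneous_mult[OF a(2) a'(2)]])
    have h1': "homogeneous (2 + (d + d')) (yvar * xvar * (a * b'))" using h1 by (simp only: one_add_one)
    have h2': "homogeneous (2 + (d + d')) (conic * (a' * b))" using h2 by (simp only: add.commute[of d' d])
    have h3': "homogeneous (2 + (d + d')) (xvar ^ 2 * (b * b'))" using h3 by (simp only: mult_1_right)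
    note h = homogeneous_add[OF h1' h2'] h3'
    have "yvar * xvar * (a * b') + conic * (a' * b) \<in> conic_point"
    proof -
      have "e0 (conic :: 'a poly3) = 0" using conic_in_conic_point conic_point_iff by blast
      then show ?thesis by (simp add: conic_point_iff rhomD[OF rhom_e0] e0_gens)
    qed
    moreover have "xvar ^ 2 * (b * b') \<notin> conic_point" using P.q_prod P.q_pow[OF P.ell_notin] a(3) a'(3) by blast
    ultimately show "r \<in> stalk_max conic_point" unfolding P.max_iff using eq h by blast
  qed
  fix r :: "'a poly3 fract" assume r: "r \<in> P.R" "r \<noteq> 0" "vl r = 0"
  obtain a b d where a: "homogeneous d a" "homogeneous d b" "b \<notin> conic_point" "r = emb a / emb b" using r(1) unfolding P.R_iff by blast
  have a0: "a \<noteq> 0" using a(4) r(2) by (auto simp: emb_hom)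
  then have "order 0 (sigma a) = 0" using P.vl_ratio[OF a(1-3)] r(3) a(4) by simp
  moreover have "sigma a \<noteq> 0" using sigma_inj[OF a(1)] a0 by blast
  ultimately have "coeff (sigma a) 0 \<noteq> 0" using order_0_iff by blast
  then have om: "omega a \<noteq> 0" using omega_eq_0[OF a(1)] by blast
  show "\<exists>k. \<forall>a\<in>P.R. \<forall>b\<in>P.R. r \<noteq> P.fl * a + conic_t ^ k * b"
  proof (intro exI ballI notI)
    \<comment> \<open>\<open>omega\<close> kills the conic and the denominators are nonzero at T =
      0, so the assumed equation makes T^k divide the nonzero polynomial \<open>omega a\<close>,
      whose degree is less than k.\<close>
    define k where "k = Suc (degree (omega a))"
    fix s1 s2 assume s: "s1 \<in> P.R" "s2 \<in> P.R" "r = P.fl * s1 + conic_t ^ k * s2"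
    obtain a1 b1 d1 where a1: "homogeneous d1 a1" "homogeneous d1 b1" "b1 \<notin> conic_point" "s1 = emb a1 / emb b1" using s(1) unfolding P.R_iff by blast
    obtain a2 b2 d2 where a2: "homogeneous d2 a2" "homogeneous d2 b2" "b2 \<notin> conic_point" "s2 = emb a2 / emb b2" using s(2) unfolding P.R_iff by blast
    have nz: "emb (xvar :: 'a poly3) \<noteq> 0" "emb b \<noteq> 0" "emb b1 \<noteq> 0" "emb b2 \<noteq> 0"
      using a(3) a1(3) a2(3) P.q_0 by (auto simp: emb_eq_0_iff vars_nz)
    have "emb (a * (xvar ^ 2 * b1 * xvar ^ k * b2)) = (r * emb b) * (emb xvar ^ 2 * emb b1 * emb xvar ^ k * emb b2)"
      unfolding a(4) emb_hom using nz by simp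
    also have "\<dots> = emb (conic * (a1 * b * xvar ^ k * b2) + yvar ^ k * (a2 * b * xvar ^ 2 * b1))"
      unfolding s(3) a1(4) a2(4) conic_t_simps(1) P.fl_def emb_hom power_divide using nz by (simp add: field_simps)
    finally have "a * (xvar ^ 2 * b1 * xvar ^ k * b2) = conic * (a1 * b * xvar ^ k * b2) + yvar ^ k * (a2 * b * xvar ^ 2 * b1)"
      unfolding emb_eq_iff .
    then have "omega a * omega (xvar ^ 2 * b1 * xvar ^ k * b2) = omega yvar ^ k * omega (a2 * b * xvar ^ 2 * b1)"
      by (metis (no_types) rhomD(2,3,7)[OF rhom_omega] omega_conic mult_zero_left add_0_left)
    also have "omega yvar = [:0, 1:] * [:2 :: 'a:]" by (simp add: omega_gens)
    finally have "omega a * omega (xvar ^ 2 * b1 * xvar ^ k * b2) = [:0, 1:] ^ k * ([:2 :: 'a:] ^ k * omega (a2 * b * xvar ^ 2 * b1))"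
      by (simp only: power_mult_distrib mult.assoc)
    then have "[:0, 1:] ^ k dvd omega a * omega (xvar ^ 2 * b1 * xvar ^ k * b2)" by (rule dvdI)
    moreover have "\<not> [:0, 1:] dvd omega (xvar ^ 2 * b1 * xvar ^ k * b2)"
    proof -
      have "coeff (omega (xvar ^ 2 * b1 * xvar ^ k * b2)) 0 \<noteq> 0"
        using omega_unit[OF a1(2,3)] omega_unit[OF a2(2,3)]
        by (simp add: rhomD[OF rhom_omega] omega_gens coeff_mult_0 coeff_0_power)
      then show ?thesis using poly_eq_0_iff_dvd[of "omega (xvar ^ 2 * b1 * xvar ^ k * b2)" 0] by (simp add: poly_0_coeff_0)
    qed
    moreover have "[:0, 1:] dvd u * v \<Longrightarrow> [:0, 1:] dvd u \<or> [:0, 1:] dvd v" for u v :: "'a poly"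
      using poly_eq_0_iff_dvd[of "u * v" 0] poly_eq_0_iff_dvd[of u 0] poly_eq_0_iff_dvd[of v 0] by simp
    ultimately have "[:0, 1:] ^ k dvd omega a"
      using prime_pow_dvd_cancel[of "[:0, 1 :: 'a:]" "omega (xvar ^ 2 * b1 * xvar ^ k * b2)" k "omega a"] by simp
    then have "degree ([:0, 1 :: 'a:] ^ k) \<le> degree (omega a)" using om by (rule dvd_imp_degree_le)
    then show False by (simp add: degree_power_eq k_def del: power_Suc)
  qed
qed

end

section \<open>The power series expansion at p\<close>

text \<open>Solves w^2 = g coefficientwise: 2b times the n-th coefficient plus the mixed products is
  the n-th coefficient of g, and c is the inverse of 2b.\<close>

fun sqrt_coeff :: "'b::comm_ring_1 \<Rightarrow> 'b \<Rightarrow> 'b fps \<Rightarrow> nat \<Rightarrow> 'b" where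
  "sqrt_coeff b c g n =
     (if n = 0 then b else c * (fps_nth g n - (\<Sum>i\<in>{0<..<n}. sqrt_coeff b c g i * sqrt_coeff b c g (n - i))))"

declare sqrt_coeff.simps [simp del]

text \<open>Stated over a commutative ring because it is applied twice: over k in the variable t,
  and over k[[t]] in the variable u.\<close>

lemma fps_sqrt_exists:
  fixes g :: "'b::comm_ring_1 fps"
  assumes "b ^ 2 = fps_nth g 0" "2 * b * c = 1"
  shows "\<exists>w. w ^ 2 = g \<and> fps_nth w 0 = b"
proof (intro exI conjI)
  define w where "w = Abs_fps (sqrt_coeff b c g)"
  show w0: "fps_nth w 0 = b" by (simp add: w_def sqrt_coeff.simps)
  show "w ^ 2 = g"
  proof (rule fps_ext)
    fix n
    show "fps_nth (w ^ 2) n = fps_nth g n"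
    proof (cases "n = 0")
      case True then show ?thesis using assms(1) w0 by (simp add: power2_eq_square)
    next
      case False
      define S where "S = (\<Sum>i\<in>{0<..<n}. fps_nth w i * fps_nth w (n - i))"
      have wn: "fps_nth w n = c * (fps_nth g n - S)"
        using False by (simp add: w_def S_def sqrt_coeff.simps[of b c g n])
      have "{0..n} = insert 0 (insert n {0<..<n})" using False by auto
      then have "fps_nth (w ^ 2) n = 2 * b * fps_nth w n + S"
        using False w0 by (simp add: power2_eq_square fps_mult_nth S_def algebra_simps)
      also have "\<dots> = (2 * b * c) * (fps_nth g n - S) + S" unfolding wn by (simp add: mult.assoc)
      finally show ?thesis using assms(2) by simp
    qed
  qed
qed

context char_ne_2
begin

lemma conic_root: "conic_root ^ 2 = 1 + fps_X - (fps_const (fps_X :: 'a fps)) ^ 2" "fps_nth (fps_nth (conic_root :: 'a fps fps) 0) 0 = 1"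
proof -
  define g where "g = 1 + fps_X - (fps_const (fps_X :: 'a fps)) ^ 2"
  have "(1::'a) ^ 2 = fps_nth (1 - fps_X ^ 2) 0" "(2::'a) * 1 * inverse 2 = 1" using two by simp_all
  \<comment> \<open>The part of the root free of u: the square root of 1 - t^2 in k[[t]].\<close>
  then obtain v :: "'a fps" where v: "v ^ 2 = 1 - fps_X ^ 2" "fps_nth v 0 = 1" using fps_sqrt_exists by blast
  have "fps_nth (2 * v) 0 \<noteq> 0" using two v(2) by (simp add: numeral_fps_const)
  then have "(2 * v) * inverse (2 * v) = 1" by (rule inverse_mult_eq_1')
  moreover have "v ^ 2 = fps_nth g 0" unfolding g_def v(1) by (simp add: fps_const_power)
  ultimately obtain w where w: "w ^ 2 = g" "fps_nth w 0 = v" using fps_sqrt_exists by blast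
  have w00: "fps_nth (fps_nth w 0) 0 = 1" by (simp add: w(2) v(2))
  have "conic_root ^ 2 = g \<and> fps_nth (fps_nth (conic_root :: 'a fps fps) 0) 0 = 1"
    unfolding conic_root_def g_def[symmetric]
  proof (rule theI[where P = "\<lambda>w. w ^ 2 = g \<and> fps_nth (fps_nth w 0) 0 = 1" and a = w])
    show "w ^ 2 = g \<and> fps_nth (fps_nth w 0) 0 = 1" using w(1) w00 by blast
    fix w' assume w': "w' ^ 2 = g \<and> fps_nth (fps_nth w' 0) 0 = 1"
    \<comment> \<open>Two roots with constant term 1 have a sum with constant term 2, which is
      nonzero, so in a domain they agree.\<close>
    have "(w' - w) * (w' + w) = 0" using w' w(1) by (simp add: algebra_simps power2_eq_square)
    moreover have "fps_nth (fps_nth (w' + w) 0) 0 \<noteq> 0" using w' w00 two by simp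
    then have "w' + w \<noteq> 0" by (metis fps_zero_nth)
    ultimately show "w' = w" by simp
  qed
  then show "conic_root ^ 2 = 1 + fps_X - (fps_const (fps_X :: 'a fps)) ^ 2" "fps_nth (fps_nth (conic_root :: 'a fps fps) 0) 0 = 1"
    by (simp_all add: g_def)
qed

text \<open>The expansion at \<open>p\<close> after setting \<open>x = 1\<close>; \<open>z = 1 - conic_root\<close> is the root of \<open>z\<^sup>2 - 2z = u - t\<^sup>2\<close>
  without constant term.\<close>

definition expand_p :: "'a poly3 \<Rightarrow> 'a fps fps" where
  "expand_p = ev3 (\<lambda>c. fps_const (fps_const c)) 1 (fps_const fps_X) (1 - conic_root)"

lemma rhom_fc: "rhom (\<lambda>c::'a. fps_const (fps_const c))"
  by (simp add: rhom_def)

lemma rhom_eps: "rhom expand_p"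
  unfolding expand_p_def by (rule rhom_ev3[OF rhom_fc])

lemma expand_p_gens: "expand_p (const3 c) = fps_const (fps_const c)" "expand_p xvar = 1" "expand_p yvar = fps_const fps_X" "expand_p zvar = 1 - conic_root"
  unfolding expand_p_def by (rule ev3_gens[OF rhom_fc])+

lemma expand_p_conic: "expand_p conic = fps_X"
proof -
  have "expand_p 2 = 2" using rhomD(2)[OF rhom_eps, of 1 1] rhomD(1)[OF rhom_eps] by (metis one_add_one)
  then have "expand_p conic = fps_const fps_X ^ 2 + (1 - conic_root) ^ 2 - 2 * (1 - conic_root)"
    unfolding conic_def by (simp add: rhomD[OF rhom_eps] expand_p_gens)
  also have "\<dots> = fps_const fps_X ^ 2 + conic_root ^ 2 - 1" by (simp add: algebra_simps power2_eq_square)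
  also have "\<dots> = fps_X" unfolding conic_root(1) by simp
  finally show ?thesis .
qed

text \<open>The constant term of an expansion is the value at p; hence a denominator that does not
  vanish at p is invertible in k[[t,u]] by \<open>fps2_unit\<close>.\<close>

lemma expand_p_coeff_0: assumes "homogeneous d b" shows "fps_nth (fps_nth (expand_p b) 0) 0 = coeff (e0 b) d"
proof -
  have r1: "rhom (\<lambda>P. fps_nth (fps_nth (expand_p P) 0) 0)" by (simp add: rhom_def rhomD[OF rhom_eps])
  have r2: "rhom (\<lambda>P. poly (e0 P) (1::'a))" by (simp add: rhom_def rhomD[OF rhom_e0])
  have "fps_nth (fps_nth (expand_p b) 0) 0 = poly (e0 b) 1"
    by (rule rhom_poly3_eq[OF r1 r2]) (simp_all add: expand_p_gens e0_gens conic_root(2))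
  also have "\<dots> = coeff (e0 b) d" unfolding e0_homogeneous[OF assms] by (simp add: poly_monom)
  finally show ?thesis .
qed

lemma fps2_unit: assumes "fps_nth (fps_nth (v :: 'a fps fps) 0) 0 \<noteq> 0" shows "\<exists>v'. v * v' = 1"
proof -
  have "fps_nth v 0 * inverse (fps_nth v 0) = 1" by (rule inverse_mult_eq_1'[OF assms])
  then show ?thesis using fps_right_inverse by blast
qed

text \<open>The expansion of a quotient, with the denominator cleared. It is unique because k[[t,u]]
  is a domain and \<open>expand_p b\<close> is nonzero.\<close>

definition "p_rel r w \<longleftrightarrow> (\<exists>a b d. homogeneous d a \<and> homogeneous d b \<and> b \<notin> conic_point \<and>
  r = emb a / emb b \<and> w * expand_p b = expand_p a)"

definition "p_exp r = (THE w. p_rel r w)"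

lemma expand_p_nz: "homogeneous d b \<Longrightarrow> b \<notin> conic_point \<Longrightarrow> expand_p b \<noteq> 0"
  using expand_p_coeff_0[of d b] e0_nz[of d b] by auto

lemma p_exp_eq: assumes "p_rel r w" shows "p_exp r = w"
  unfolding p_exp_def
proof (rule the_equality[where P = "p_rel r" and a = w])
  show "p_rel r w" by (rule assms)
  fix w' assume "p_rel r w'"
  then obtain a' b' d' where 1: "homogeneous d' a'" "homogeneous d' b'" "b' \<notin> conic_point" "r = emb a' / emb b'" "w' * expand_p b' = expand_p a'"
    unfolding p_rel_def by blast
  obtain a b d where 2: "homogeneous d a" "homogeneous d b" "b \<notin> conic_point" "r = emb a / emb b" "w * expand_p b = expand_p a"
    using assms unfolding p_rel_def by blast
  have nz: "expand_p b \<noteq> 0" "expand_p b' \<noteq> 0" using expand_p_nz 1(2,3) 2(2,3) by blast+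
  then have "b \<noteq> 0" "b' \<noteq> 0" by (auto simp: rhomD[OF rhom_eps])
  then have "emb (a * b') = emb (a' * b)" using 1(4) 2(4) by (simp add: emb_hom emb_eq_0_iff frac_eq_eq)
  then have "expand_p (a * b') = expand_p (a' * b)" unfolding emb_eq_iff by (rule arg_cong)
  then have "(w * expand_p b) * expand_p b' = (w' * expand_p b') * expand_p b" unfolding 1(5) 2(5) by (simp only: rhomD(3)[OF rhom_eps])
  then have "(w - w') * (expand_p b * expand_p b') = 0" by (simp add: algebra_simps)
  then show "w' = w" using nz by simp
qed

lemma p_exp_ratio:
  assumes "homogeneous d a" "homogeneous d b" "b \<notin> conic_point" "w * expand_p b = expand_p a"
  shows "p_exp (emb a / emb b) = w"
  by (rule p_exp_eq) (use assms p_rel_def in blast)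

lemma p_relE:
  assumes "r \<in> carrier (stalk conic_point)"
  obtains a b d where "homogeneous d a" "homogeneous d b" "b \<notin> conic_point" "r = emb a / emb b" "p_exp r * expand_p b = expand_p a"
proof -
  obtain a b d where 1: "homogeneous d a" "homogeneous d b" "b \<notin> conic_point" "r = emb a / emb b"
    using assms by (auto simp: stalk_def ratio_emb)
  obtain v' where v': "expand_p b * v' = 1" using fps2_unit expand_p_coeff_0[OF 1(2)] e0_nz[OF 1(2,3)] by metis
  have e: "expand_p a * v' * expand_p b = expand_p a" using v' by (metis mult.assoc mult.commute mult.right_neutral)
  have "p_exp r = expand_p a * v'" unfolding 1(4) by (rule p_exp_ratio[OF 1(1-3) e])
  then show ?thesis by (intro that[OF 1]) (simp only: e)
qed

lemma conic_point_laurent_flag: "laurent_flag conic conic_point conic_u conic_t p_exp"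
proof -
  interpret P: plane_pt dummy conic_point xvar by (rule conic_point_plane_pt)
  interpret L: local_flag "conic :: 'a poly3" conic_point conic_u conic_t by (rule conic_point_flag)
  have kcr: "ratio (const3 c) 1 = emb (const3 c) / emb (1 :: 'a poly3)" for c by (rule ratio_emb)
  have 1: "1 \<notin> (conic_point :: 'a poly3 set)" by (rule P.q_1)
  show ?thesis
  proof unfold_locales
    fix r s :: "'a poly3 fract" assume rs: "r \<in> carrier (stalk conic_point)" "s \<in> carrier (stalk conic_point)"
    obtain a b d where a: "homogeneous d a" "homogeneous d b" "b \<notin> conic_point" "r = emb a / emb b" "p_exp r * expand_p b = expand_p a"
      by (rule p_relE[OF rs(1)])
    obtain a' b' d' where a': "homogeneous d' a'" "homogeneous d' b'" "b' \<notin> conic_point" "s = emb a' / emb b'" "p_exp s * expand_p b' = expand_p a'"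
      by (rule p_relE[OF rs(2)])
    have nz: "emb b \<noteq> 0" "emb b' \<noteq> 0" using a(3) a'(3) P.q_0 by (auto simp: emb_eq_0_iff)
    have bb: "homogeneous (d + d') (b * b')" "b * b' \<notin> conic_point"
      using homogeneous_mult[OF a(2) a'(2)] P.q_prod[OF a(3) a'(3)] by auto
    have "homogeneous (d + d') (a' * b)" using homogeneous_mult[OF a'(1) a(2)] by (simp add: add.commute)
    then have h: "homogeneous (d + d') (a * b' + a' * b)" by (rule homogeneous_add[OF homogeneous_mult[OF a(1) a'(2)]])
    have eq: "r + s = emb (a * b' + a' * b) / emb (b * b')" "r * s = emb (a * a') / emb (b * b')"
      unfolding a(4) a'(4) emb_hom using nz by (simp_all add: add_frac_eq)
    show "p_exp (r + s) = p_exp r + p_exp s" unfolding eq(1)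
      by (rule p_exp_ratio[OF h bb]) (simp only: rhomD(2,3)[OF rhom_eps] a(5)[symmetric] a'(5)[symmetric] ring_distribs mult_ac)
    show "p_exp (r * s) = p_exp r * p_exp s" unfolding eq(2)
      by (rule p_exp_ratio[OF homogeneous_mult[OF a(1) a'(1)] bb]) (simp only: rhomD(3)[OF rhom_eps] a(5)[symmetric] a'(5)[symmetric] mult_ac)
  next
    have h: "homogeneous 2 (xvar ^ 2 :: 'a poly3)" using homogeneous_pow[OF homogeneous_vars(1), of 2] by simp
    show "p_exp conic_u = fps_X" unfolding conic_u_eq[symmetric] P.fl_def emb_hom(7)[symmetric]
      by (rule p_exp_ratio[OF homogeneous_conic h P.q_pow[OF P.ell_notin]]) (simp add: expand_p_conic rhomD[OF rhom_eps] expand_p_gens)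
    show "p_exp conic_t = fps_const fps_X" unfolding conic_t_simps(1)
      by (rule p_exp_ratio[OF homogeneous_vars(2) homogeneous_vars(1) P.ell_notin]) (simp add: expand_p_gens)
    fix c :: 'a
    show "ratio (const3 c) 1 \<in> carrier (stalk conic_point)" unfolding P.R_iff kcr using 1 homogeneous_1 homogeneous_const by blast
    show "p_exp (ratio (const3 c) 1) = fps_const (fps_const c)" unfolding kcr
      by (rule p_exp_ratio[OF homogeneous_const homogeneous_1 1]) (simp add: expand_p_gens rhomD[OF rhom_eps])
    show "ratio (const3 1) 1 = (1 :: 'a poly3 fract)" unfolding const3_1 One_fract_def ..
  qed
qed

section \<open>The series of \<alpha> and f at p\<close>

interpretation P: plane_pt dummy conic_point xvar
  by (rule conic_point_plane_pt)

lemma p_exp_z: "emb zvar / emb xvar \<in> P.R" "p_exp (emb zvar / emb xvar) = 1 - conic_root"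
  using P.in_R[OF homogeneous_vars(3)]
  by (simp, intro p_exp_ratio[OF homogeneous_vars(3) homogeneous_vars(1) P.ell_notin], simp add: expand_p_gens)

abbreviation "s_fls \<equiv> (1 :: 'a fls fls) - fps2_to_fls2 conic_root"

text \<open>\<open>s_fls\<close> is the series of z/x. The product with 1 plus the root is a
  difference of squares, which allows \<alpha> to be rewritten as t divided by the series of z/x;
  the product is nonzero since its coefficient at u is -1.\<close>

lemma s_fls: "s_fls * (1 + fps2_to_fls2 conic_root) = lt ^ 2 - lu" "s_fls \<noteq> 0" "(1 :: 'a fps fps) - conic_root \<noteq> 0"
  "fps2_to_fls2 (1 - conic_root) = s_fls"
proof -
  have X: "fps2_to_fls2 (fps_const fps_X) = (lt :: 'a fls fls)" unfolding fps2_const lt_def by simp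
  have "s_fls * (1 + fps2_to_fls2 conic_root) = 1 - fps2_to_fls2 (conic_root ^ 2)"
    by (simp add: power2_eq_square fps2_mult algebra_simps)
  also have "\<dots> = 1 - (1 + lu - lt ^ 2)"
    unfolding conic_root(1) unfolding power2_eq_square fps2_minus fps2_add fps2_mult fps2_one fps2_X X lu_def ..
  finally show 1: "s_fls * (1 + fps2_to_fls2 conic_root) = lt ^ 2 - lu" by simp
  have "fls_nth (lt ^ 2 - lu :: 'a fls fls) 1 = - 1" by (simp add: lt_def lu_def power2_eq_square fls_const_mult_const)
  then show s: "s_fls \<noteq> 0" using 1 by auto
  show m: "fps2_to_fls2 (1 - conic_root) = s_fls" by (simp add: fps2_minus fps2_one)
  show "(1 :: 'a fps fps) - conic_root \<noteq> 0" using s unfolding m[symmetric] fps2_eq_0_iff .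
qed

lemma conic_alpha_eq: "conic_alpha = lt / s_fls"
proof -
  have "1 + fps2_to_fls2 conic_root \<noteq> (0 :: 'a fls fls)"
  proof
    assume "1 + fps2_to_fls2 conic_root = (0 :: 'a fls fls)"
    then have "lt ^ 2 - lu = (0 :: 'a fls fls)" using s_fls(1) by simp
    moreover have "fls_nth (lt ^ 2 - lu :: 'a fls fls) 1 = - 1" by (simp add: lt_def lu_def power2_eq_square fls_const_mult_const)
    ultimately show False by simp
  qed
  then show ?thesis unfolding conic_alpha_def s_fls(1)[symmetric] using s_fls(2) by simp
qed

abbreviation "f_fls \<equiv> conic_alpha ^ 2 / lt ^ 2 * (lu :: 'a fls fls)"

text \<open>The right side is the series of (conic/x^2) (x/z)^2, which is f.\<close>

lemma f_fls_eq: "f_fls = lu / (s_fls * s_fls)"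
proof -
  have "(lt :: 'a fls fls) \<noteq> 0" by (simp add: lt_def)
  then show ?thesis unfolding conic_alpha_eq using s_fls(2) by (simp add: power2_eq_square)
qed

end

section \<open>The main theorem\<close>

context char_ne_2
begin

section \<open>Partial sums in powers of f\<close>

definition alpha_poly :: "'a poly \<Rightarrow> 'a fls fls" where
  "alpha_poly P = poly (map_poly (\<lambda>c. fls_const (fls_const c)) P) conic_alpha"

lemma alpha_poly_pCons: "alpha_poly (pCons c P) = fls_const (fls_const c) + conic_alpha * alpha_poly P"
  by (simp add: alpha_poly_def map_poly_pCons)

definition partial_sum :: "int \<Rightarrow> (nat \<Rightarrow> 'a poly) \<Rightarrow> nat \<Rightarrow> 'a poly3 fract" where
  "partial_sum N Q i = (\<Sum>n<i. io [:Q n:] * f0 powi (N + int n))"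

lemma partial_sum_Suc: "partial_sum N Q (Suc i) = partial_sum N Q i + io [:Q i:] * f0 powi (N + int i)"
  by (simp add: partial_sum_def)

lemma f0_FF: "f0 \<in> FF" and f0_nz: "f0 \<noteq> (0 :: 'a poly3 fract)"
  unfolding f0_eq using io_FF by (simp_all add: io_eq_0_iff)

lemma term_FF: "io [:c:] * f0 powi m \<in> FF"
  by (intro FF_closed(4) FF_closed(9) io_FF f0_FF)

lemma partial_sum_FF: "partial_sum N Q i \<in> FF"
  unfolding partial_sum_def by (induction i) (simp_all add: FF_closed term_FF)

text \<open>\<open>val_filt\<close> extended to integer levels, since elements of W may have poles
  along C.\<close>

definition val_ge :: "int \<Rightarrow> 'a poly3 fract set" where
  "val_ge m = {r \<in> FF. r = 0 \<or> m \<le> vl r}"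

lemma val_ge_nat: "val_ge (int n) = val_filt conic n"
  by (auto simp: val_ge_def val_filt_def)

lemma val_ge_mono: "r \<in> val_ge m \<Longrightarrow> n \<le> m \<Longrightarrow> r \<in> val_ge n" by (auto simp: val_ge_def)

lemma val_ge_mult: "r \<in> val_ge m \<Longrightarrow> s \<in> val_ge n \<Longrightarrow> r * s \<in> val_ge (m + n)"
  by (cases "r = 0 \<or> s = 0") (auto simp: val_ge_def FF_closed vl_mult)

lemma val_ge_powi: "f0 powi m \<in> val_ge m"
  by (simp add: val_ge_def FF_closed f0_FF vl_powi f0_nz vl_f0)

lemma val_ge_shift: "r * f0 powi k \<in> val_ge (m + k) \<longleftrightarrow> r \<in> val_ge m"
proof
  assume "r * f0 powi k \<in> val_ge (m + k)"
  then have "r * f0 powi k * f0 powi (- k) \<in> val_ge (m + k + - k)" using val_ge_powi by (rule val_ge_mult)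
  moreover have "r * f0 powi k * f0 powi (- k) = r" using f0_nz by (simp add: power_int_minus)
  ultimately show "r \<in> val_ge m" by simp
qed (intro val_ge_mult val_ge_powi)

lemma val_ge_minus: assumes "r \<in> val_ge m" "s \<in> val_ge m" shows "r - s \<in> val_ge m"
proof -
  have "r * f0 powi (- m) - s * f0 powi (- m) \<in> val_filt conic 0"
    by (rule val_filt_minus) (use val_ge_shift[of _ "- m" m] val_ge_nat[of 0] assms in simp_all)
  then have "(r - s) * f0 powi (- m) \<in> val_ge (m + - m)" using val_ge_nat[of 0] by (simp add: left_diff_distrib)
  then show ?thesis using val_ge_shift by blast
qed

lemma val_ge_0: "0 \<in> val_ge m" by (simp add: val_ge_def FF_closed)

lemma val_ge_add: "r \<in> val_ge m \<Longrightarrow> s \<in> val_ge m \<Longrightarrow> r + s \<in> val_ge m"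
  using val_ge_minus[of r m "0 - s"] val_ge_minus[OF val_ge_0, of s m] by simp

lemma io_VI: "io A \<in> val_ge 0"
  using vl_io[of A] by (cases "A = 0") (simp_all add: val_ge_def io_FF io_hom FF_closed)

lemma partial_sum_diff: "i \<le> j \<Longrightarrow> partial_sum N Q j - partial_sum N Q i \<in> val_ge (N + int i)"
proof (induction j rule: dec_induct)
  case base then show ?case by (simp add: val_ge_0)
next
  case (step j)
  have "io [:Q j:] * f0 powi (N + int j) \<in> val_ge (0 + (N + int j))" by (intro val_ge_mult io_VI val_ge_powi)
  then have t: "io [:Q j:] * f0 powi (N + int j) \<in> val_ge (N + int i)" using step(1) by (auto intro: val_ge_mono)
  show ?case unfolding partial_sum_Suc using val_ge_add[OF step.IH t] by (simp add: algebra_simps)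
qed

lemma partial_sum_cauchy: "partial_sum N Q \<in> carrier (cauchy_ring function_field (val_filt conic))"
proof -
  interpret L: laurent_flag "conic :: 'a poly3" conic_point conic_u conic_t p_exp by (rule conic_point_laurent_flag)
  have "\<exists>M. \<forall>i\<ge>M. \<forall>j\<ge>M. partial_sum N Q i - partial_sum N Q j \<in> val_filt conic n" for n
  proof (intro exI allI impI)
    fix i j assume ij: "nat (int n - N) \<le> i" "nat (int n - N) \<le> j"
    have "partial_sum N Q k - partial_sum N Q (nat (int n - N)) \<in> val_ge (int n)" if "nat (int n - N) \<le> k" for k
      by (rule val_ge_mono[OF partial_sum_diff[OF that]]) simp
    from val_ge_minus[OF this[OF ij(1)] this[OF ij(2)]]
    show "partial_sum N Q i - partial_sum N Q j \<in> val_filt conic n" by (simp add: val_ge_nat)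
  qed
  then show ?thesis using L.FFC_iff partial_sum_FF by blast
qed

subsection \<open>Images in the field of Laurent series\<close>

context
begin

interpretation L: laurent_flag "conic :: 'a poly3" conic_point conic_u conic_t p_exp
  by (rule conic_point_laurent_flag)

lemma rel_al: "L.RelF (L.\<rho> al) conic_alpha"
proof -
  have nz: "emb (xvar :: 'a poly3) \<noteq> 0" "emb (zvar :: 'a poly3) \<noteq> 0" by (simp_all add: emb_eq_0_iff vars_nz)
  have X: "fps2_to_fls2 (fps_const fps_X) = (lt :: 'a fls fls)" unfolding fps2_const lt_def by simp
  have "p_exp (emb zvar / emb xvar) \<noteq> 0" unfolding p_exp_z(2) by (rule s_fls(3))
  from L.RelF_\<rho>_frac[OF conic_t_simps(2) p_exp_z(1) _ this]
  have "L.RelF (L.\<rho> (conic_t / (emb zvar / emb xvar))) (lt / s_fls)"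
    using nz unfolding L.\<Phi>_\<tau> p_exp_z(2) X s_fls(4) by simp
  moreover have "conic_t / (emb zvar / emb xvar) = (al :: 'a poly3 fract)" using nz by (simp add: conic_t_simps(1) al_def)
  ultimately show ?thesis unfolding conic_alpha_eq by simp
qed

text \<open>f is u divided by the square of z/x. The inverse is related separately because
  \<open>powi\<close> computes negative powers from the inverse.\<close>

lemma rel_f0: "L.RelF (L.\<rho> f0) f_fls" "L.RelF (L.\<rho> (inverse f0)) (inverse f_fls)"
proof -
  interpret P: plane_pt dummy conic_point xvar by (rule conic_point_plane_pt)
  define z where "z = emb zvar / emb (xvar :: 'a poly3)"
  have nz: "emb (xvar :: 'a poly3) \<noteq> 0" "emb (zvar :: 'a poly3) \<noteq> 0" by (simp_all add: emb_eq_0_iff vars_nz)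
  have zR: "z * z \<in> P.R" using p_exp_z(1) subring_onD(4)[OF P.R_sub] unfolding z_def by blast
  have zz: "p_exp (z * z) = (1 - conic_root) * (1 - conic_root)"
    unfolding z_def L.\<Phi>_mult[OF p_exp_z(1) p_exp_z(1)] p_exp_z(2) ..
  have f: "f0 = conic_u / (z * z)" unfolding conic_u_eq[symmetric] P.fl_def f0_def z_def using nz by (simp add: power2_eq_square)
  have u: "conic_u \<in> P.R" "conic_u \<noteq> (0 :: 'a poly3 fract)" using P.fl_R P.fl_nz unfolding conic_u_eq by auto
  have z0: "z * z \<noteq> 0" using nz by (simp add: z_def)
  have pz: "p_exp (z * z) \<noteq> 0" unfolding zz using s_fls(3) by simp
  have pu: "p_exp conic_u \<noteq> 0" unfolding L.\<Phi>_f by simp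
  have m: "fps2_to_fls2 (p_exp (z * z)) = s_fls * s_fls" unfolding zz fps2_mult s_fls(4) ..
  have fu: "fps2_to_fls2 (p_exp conic_u) = lu" unfolding L.\<Phi>_f fps2_X lu_def ..
  show "L.RelF (L.\<rho> f0) f_fls"
    using L.RelF_\<rho>_frac[OF u(1) zR z0 pz] unfolding m fu f[symmetric] f_fls_eq .
  have "inverse f0 = z * z / conic_u" unfolding f by simp
  then show "L.RelF (L.\<rho> (inverse f0)) (inverse f_fls)"
    using L.RelF_\<rho>_frac[OF zR u(1) u(2) pu] unfolding m fu f_fls_eq by simp
qed

lemma rel_const: "L.RelF (L.\<rho> (kc c)) (fls_const (fls_const c))"
proof -
  have "kc c = ratio (const3 c) 1" by (simp add: kc_def emb_def)
  then show ?thesis using L.RelF_\<rho>_R[OF L.const_carr[of c]] unfolding L.\<Phi>_const fps2_const by simp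
qed

lemma rel_zero: "L.RelF (L.\<rho> 0) 0"
  using rel_const[of 0] by (simp add: rhomD[OF rhom_kc])

lemma rel_one: "L.RelF (L.\<rho> 1) 1"
  using rel_const[of 1] by (simp add: rhomD[OF rhom_kc])

lemma rel_poly: "L.RelF (L.\<rho> (io [:P:])) (alpha_poly P)"
proof (induction P)
  case 0 show ?case using rel_zero by (simp add: io_hom alpha_poly_def)
next
  case (pCons c P)
  have io: "io [:pCons c P:] = kc c + al * io [:P:]" unfolding io_const by (rule evp_pCons[OF rhom_kc])
  have kF: "kc c \<in> FF" "al \<in> FF"
    using io_FF[of "[:[:c:]:]"] io_FF[of "[:[:0, 1:]:]"] unfolding io_const evp_kc_const evp_kc_X by auto
  show ?case unfolding io alpha_poly_pCons
    by (intro L.RelF_\<rho>_add L.RelF_\<rho>_mult kF io_FF FF_closed(4) rel_const rel_al pCons.IH)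
qed

lemma rel_pow: "r \<in> FF \<Longrightarrow> L.RelF (L.\<rho> r) h \<Longrightarrow> L.RelF (L.\<rho> (r ^ n)) (h ^ n)"
proof (induction n)
  case (Suc n)
  have "L.RelF (L.\<rho> (r * r ^ n)) (h * h ^ n)"
    by (rule L.RelF_\<rho>_mult[OF Suc.prems(1) FF_closed(7)[OF Suc.prems(1)] Suc.prems(2) Suc.IH[OF Suc.prems]])
  then show ?case by simp
qed (simp add: rel_one)

lemma rel_powi: "L.RelF (L.\<rho> (f0 powi m)) (f_fls powi m)"
  unfolding power_int_def using rel_pow[OF f0_FF rel_f0(1)] rel_pow[OF FF_inverse[OF f0_FF] rel_f0(2)] by simp

lemma rel_psum: "L.RelF (L.\<rho> (partial_sum N Q i)) (\<Sum>n<i. alpha_poly (Q n) * f_fls powi (N + int n))"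
proof (induction i)
  case 0 show ?case using rel_zero by (simp add: partial_sum_def)
next
  case (Suc i)
  show ?case unfolding partial_sum_Suc sum.lessThan_Suc
    by (rule L.RelF_\<rho>_add[OF partial_sum_FF term_FF Suc L.RelF_\<rho>_mult[OF io_FF FF_closed(9)[OF f0_FF] rel_poly rel_powi]])
qed

text \<open>The sum h is related to the limit of the partial sums in K_p,C, and by
  \<open>laurent_Rel\<close> also to its own image there; \<open>Rel_unique\<close> identifies the
  two.\<close>

lemma sums_imp_krichever:
  assumes h: "(\<lambda>n. alpha_poly (Q n) * f_fls powi (N + int n)) sums h"
    and K: "L.kcls (partial_sum N Q) \<in> krichever_K conic conic_point"
  shows "h \<in> krichever conic conic_point conic_t conic_u"
proof -
  let ?S = "\<lambda>i. \<Sum>n<i. alpha_poly (Q n) * f_fls powi (N + int n)"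
  note sp = L.\<kappa>_spec[OF partial_sum_cauchy[of N Q]]
  have "\<exists>M. \<forall>i\<ge>M. h - ?S i \<in> fls_filt (int n)" for n
  proof -
    obtain M where "\<forall>i\<ge>M. ?S i - h \<in> fls_filt (int n)" using h unfolding sums_def fls_LIMSEQ_iff by blast
    then have "\<forall>i\<ge>M. 0 - (?S i - h) \<in> fls_filt (int n)" using fls_filt_minus[OF fls_filt_zero] by blast
    then show ?thesis by (intro exI[of _ M]) simp
  qed
  then have "L.Rel (L.\<kappa> (L.kcls (partial_sum N Q))) h" by (rule L.Rel_limit[OF sp rel_psum])
  then have "laurent_to_K_flag conic_point conic_t conic_u h = L.\<kappa> (L.kcls (partial_sum N Q))"
    using L.Rel_unique L.laurent_Rel by blast
  then show ?thesis unfolding krichever_def using K by blast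
qed

text \<open>The converse comparison: partial sums close to the sequence s along C have images close
  to the limit of s, and \<open>Rel_RelF\<close> carries this closeness over to the series.\<close>

lemma krichever_imp_sums:
  assumes s: "s \<in> L.FFC" and h: "laurent_to_K_flag conic_point conic_t conic_u h = L.\<kappa> (L.kcls s)"
    and Q: "\<And>n. \<exists>M. \<forall>i\<ge>M. s i - partial_sum N Q n \<in> val_ge (N + int n)"
  shows "(\<lambda>n. alpha_poly (Q n) * f_fls powi (N + int n)) sums h"
  unfolding sums_def fls_LIMSEQ_iff
proof
  fix k :: nat
  let ?S = "\<lambda>i. \<Sum>n<i. alpha_poly (Q n) * f_fls powi (N + int n)"
  have R: "L.Rel (L.\<kappa> (L.kcls s)) h" using L.laurent_Rel[of h] unfolding h .
  note sp = L.\<kappa>_spec[OF s]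
  have sF: "s i \<in> FF" for i using s L.FFC_iff by blast
  have "?S n - h \<in> fls_filt (int k)" if n: "nat (int k - N) \<le> n" for n
  proof -
    obtain M1 where M1: "\<forall>i\<ge>M1. s i - partial_sum N Q n \<in> val_ge (N + int n)" using Q by blast
    obtain M2 where M2: "\<forall>i\<ge>M2. L.\<rho> (s i) \<ominus>\<^bsub>L.K\<^esub> L.\<kappa> (L.kcls s) \<in> L.filt k" using sp(2) unfolding converges_to_def by blast
    define i where "i = max M1 M2"
    have "s i - partial_sum N Q n \<in> val_ge (int k)" by (rule val_ge_mono[of _ "N + int n"]) (use M1 n in \<open>simp_all add: i_def\<close>)
    then have "L.\<rho> (s i - partial_sum N Q n) \<in> L.filt k" unfolding val_ge_nat by (rule L.\<rho>_filt)
    then have 1: "L.\<rho> (s i) \<ominus>\<^bsub>L.K\<^esub> L.\<rho> (partial_sum N Q n) \<in> L.filt k" unfolding L.\<rho>_minus[OF sF partial_sum_FF] .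
    have 2: "L.\<rho> (s i) \<ominus>\<^bsub>L.K\<^esub> L.\<kappa> (L.kcls s) \<in> L.filt k" using M2 by (simp add: i_def)
    have c: "L.\<rho> (s i) \<in> carrier L.K" "L.\<rho> (partial_sum N Q n) \<in> carrier L.K"
      by (rule L.\<rho>_carr[OF sF], rule L.\<rho>_carr[OF partial_sum_FF])
    have "L.\<kappa> (L.kcls s) \<ominus>\<^bsub>L.K\<^esub> L.\<rho> (partial_sum N Q n) = (L.\<rho> (s i) \<ominus>\<^bsub>L.K\<^esub> L.\<rho> (partial_sum N Q n)) \<ominus>\<^bsub>L.K\<^esub> (L.\<rho> (s i) \<ominus>\<^bsub>L.K\<^esub> L.\<kappa> (L.kcls s))"
      using c sp(1) by algebra
    then have "L.\<kappa> (L.kcls s) \<ominus>\<^bsub>L.K\<^esub> L.\<rho> (partial_sum N Q n) \<in> L.filt k" using L.filt_minus[OF 1 2] by simp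
    then have "h - ?S n \<in> fls_filt (int k)" using L.Rel_RelF[OF R rel_psum] by blast
    then have "0 - (h - ?S n) \<in> fls_filt (int k)" by (rule fls_filt_minus[OF fls_filt_zero])
    then show ?thesis by simp
  qed
  then show "\<exists>M. \<forall>n\<ge>M. ?S n - h \<in> fls_filt (int k)" by blast
qed

end

end

section \<open>The two inclusions\<close>

context char_ne_2
begin

lemma f0_pow_powi: "0 \<le> int k + j \<Longrightarrow> f0 ^ k * f0 powi j = (f0 :: 'a poly3 fract) ^ nat (int k + j)"
proof -
  assume "0 \<le> int k + j"
  then have "f0 powi (int k + j) = (f0 :: 'a poly3 fract) ^ nat (int k + j)" by (simp add: power_int_def)
  moreover have "f0 powi (int k + j) = (f0 :: 'a poly3 fract) powi int k * f0 powi j"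
    by (rule power_int_add) (simp add: f0_nz)
  ultimately show ?thesis by simp
qed

lemma partial_sum_krichever:
  "cauchy_class function_field (val_filt conic) (partial_sum N Q) \<in> krichever_K conic conic_point"
  unfolding krichever_K_def
proof (intro CollectI conjI allI impI)
  interpret L: laurent_flag "conic :: 'a poly3" conic_point conic_u conic_t p_exp by (rule conic_point_laurent_flag)
  show "L.kcls (partial_sum N Q) \<in> carrier (K_curve conic)" unfolding L.K_curve_carrier using partial_sum_cauchy by blast
next
  fix q :: "'a poly3 set" and f
  assume q: "q \<in> closed_points" "conic \<in> q" "q \<noteq> conic_point" and f: "local_equation conic q f"
  interpret A: affine_pt dummy q by (rule closed_point_affine(1)[OF q])
  obtain c where c: "c \<noteq> 0" "A.inQ [:c:]" using closed_point_affine(2)[OF q] by blast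
  obtain \<pi> where \<pi>: "\<And>c. A.inQ [:c:] \<longleftrightarrow> \<pi> dvd c" "\<pi> \<noteq> 0" using A.inQ_generator[OF c] by blast
  interpret F: local_flag conic q f "io [:\<pi>:]" by (rule A.affine_local_flag[OF \<pi> f])
  note Rc = subring_onD[OF A.R_sub]
  have fl: "A.fl = f0" unfolding A.fl_io f0_eq ..
  obtain w where w: "w \<in> A.R" "f = f0 * w"
    using A.curve_ideal_fl[OF A.f_R[OF f]] A.vl_f[OF f] unfolding fl by auto
  obtain w' where w': "w' \<in> A.R" "f0 = f * w'"
    using A.f_iff[OF f, of A.fl] A.fl_R A.vl_fl unfolding fl by auto
  have f0R: "f0 \<in> A.R" using A.fl_R unfolding fl .
  \<comment> \<open>This power of f clears the poles of all terms, the exponents starting at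
    \<open>N\<close>. The factors \<open>w\<close> and \<open>w'\<close> translate between f and
    \<open>f0\<close>, and \<open>g P n\<close> is the regular cofactor of f^n that remains.\<close>
  define m where "m = nat (- N)"
  define g where "g P n = w' ^ n * (io [:P:] * f0 ^ nat (int m + N) * w ^ m)" for P n
  have gR: "g P n \<in> A.R" for P n unfolding g_def by (intro Rc(4) Rc(7) w(1) w'(1) f0R A.io_R)
  have g: "io [:P:] * f0 powi (N + int n) * f ^ m = f ^ n * g P n" for P n
  proof -
    have m0: "0 \<le> int m + N" by (simp add: m_def)
    then have "nat (int m + (N + int n)) = n + nat (int m + N)" by simp
    then have 1: "f0 ^ m * f0 powi (N + int n) = (f0 :: 'a poly3 fract) ^ n * f0 ^ nat (int m + N)"
      using f0_pow_powi[of m "N + int n"] m0 by (simp add: power_add)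
    have "io [:P:] * f0 powi (N + int n) * f ^ m = io [:P:] * (f0 ^ m * f0 powi (N + int n)) * w ^ m"
      unfolding w(2) power_mult_distrib by (simp only: mult_ac)
    also have "\<dots> = f0 ^ n * (io [:P:] * f0 ^ nat (int m + N) * w ^ m)" unfolding 1 by (simp only: mult_ac)
    also have "f0 ^ n = f ^ n * w' ^ n" by (subst w'(2)) (rule power_mult_distrib)
    finally show ?thesis unfolding g_def by (simp only: mult.assoc)
  qed
  have fR: "f \<in> A.R" by (rule A.f_R[OF f])
  show "K_curve_to_K_flag q f (F.kcls (partial_sum N Q)) \<in> B_to_K_flag q f ` carrier (B_ring q f)"
  proof (rule F.in_B_ring[OF partial_sum_cauchy, where r = "\<lambda>i. partial_sum N Q i * f ^ m" and N = m])
    show "partial_sum N Q i * f ^ m \<in> A.R" for i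
    proof (induction i)
      case 0 show ?case using Rc(2) by (simp add: partial_sum_def)
    next
      case (Suc i)
      have "partial_sum N Q i * f ^ m + f ^ i * g (Q i) i \<in> A.R" by (rule Rc(6)[OF Suc Rc(4)[OF Rc(7)[OF fR] gR]])
      then show ?case unfolding partial_sum_Suc distrib_right g .
    qed
    show "\<exists>c\<in>A.R. partial_sum N Q j * f ^ m - partial_sum N Q i * f ^ m = f ^ i * c" if "i \<le> j" for i j
      using that
    proof (induction j rule: dec_induct)
      case base show ?case using Rc(2) by (intro bexI[of _ 0]) simp_all
    next
      case (step j)
      obtain c where c: "c \<in> A.R" "partial_sum N Q j * f ^ m - partial_sum N Q i * f ^ m = f ^ i * c" using step.IH by blast
      have "f ^ j = f ^ i * f ^ (j - i)" using step(1) by (simp add: power_add[symmetric])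
      then have "partial_sum N Q (Suc j) * f ^ m - partial_sum N Q i * f ^ m = f ^ i * (c + f ^ (j - i) * g (Q j) j)"
        unfolding partial_sum_Suc distrib_right g using c(2) by (simp add: algebra_simps)
      moreover have "c + f ^ (j - i) * g (Q j) j \<in> A.R" by (rule Rc(6)[OF c(1) Rc(4)[OF Rc(7)[OF fR] gR]])
      ultimately show ?case by blast
    qed
  qed simp
qed

text \<open>A prime factor \<open>\<pi>\<close> of the denominator \<open>b\<close> of the leading coefficient, in lowest terms, would be a pole at the closed
  point where \<open>\<pi>(\<alpha>) = 0\<close>.\<close>

lemma residue_step:
  assumes s: "s \<in> carrier (cauchy_ring function_field (val_filt conic))"
    and K: "cauchy_class function_field (val_filt conic) s \<in> krichever_K conic conic_point"
    and M: "\<forall>i\<ge>M. s i - partial_sum N Q n \<in> val_ge (N + int n)"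
  shows "\<exists>c M. \<forall>i\<ge>M. s i - (partial_sum N Q n + io [:c:] * f0 powi (N + int n)) \<in> val_ge (N + int (Suc n))"
proof -
  interpret L: laurent_flag "conic :: 'a poly3" conic_point conic_u conic_t p_exp by (rule conic_point_laurent_flag)
  define m where "m = N + int n"
  define D where "D i = (s i - partial_sum N Q n) * f0 powi (- m)" for i
  have sF: "s i \<in> FF" for i using s L.FFC_iff by blast
  have DF: "D i \<in> FF" for i unfolding D_def by (intro FF_closed(3,4,9) sF partial_sum_FF f0_FF)
  \<comment> \<open>a/b is the leading coefficient: all late terms, shifted to level 0, agree with
    it up to positive valuation. The denominator is cleared to stay within polynomials.\<close>
  define G where "G a b \<longleftrightarrow> (\<exists>M. \<forall>i\<ge>M. io [:b:] * D i - io [:a:] \<in> val_ge 1)" for a b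
  have ex: "\<exists>a b. b \<noteq> 0 \<and> G a b"
  proof -
    obtain M2 where M2: "\<forall>i\<ge>M2. \<forall>j\<ge>M2. s i - s j \<in> val_filt conic (nat (m + 1))" using s L.FFC_iff by blast
    define i0 where "i0 = max M M2"
    have "s i0 - partial_sum N Q n \<in> val_ge m" using M unfolding i0_def m_def by simp
    then have "D i0 \<in> val_ge (m + - m)" unfolding D_def by (intro val_ge_mult val_ge_powi)
    then have "D i0 \<in> val_filt conic 0" using val_ge_nat[of 0] by simp
    then obtain A B where AB: "\<not> [:0, 1:] dvd B" "D i0 = io ([:0, 1:] ^ 0 * A) / io B" unfolding val_filt_iff by blast
    \<comment> \<open>The residue at f = 0 of one late term, read off from the constant
      coefficients; beyond \<open>i0\<close> the terms change only by positive valuation.\<close>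
    define a b where "a = coeff A 0" and "b = coeff B 0"
    have b: "b \<noteq> 0" using AB(1) poly_eq_0_iff_dvd[of B 0] by (simp add: b_def poly_0_coeff_0)
    have B0: "io B \<noteq> 0" using AB(1) by (auto simp: io_eq_0_iff)
    have "[:0, 1:] dvd [:b:] * A - [:a:] * B"
      using poly_eq_0_iff_dvd[of "[:b:] * A - [:a:] * B" 0] by (simp add: poly_0_coeff_0 a_def b_def)
    then obtain A' where A': "[:b:] * A - [:a:] * B = [:0, 1:] * A'" by (auto simp: dvd_def)
    have "io [:b:] * D i0 - io [:a:] = io ([:b:] * A - [:a:] * B) / io B"
      unfolding AB(2) io_hom(6) io_hom(3) using B0 by (simp add: io_hom diff_divide_distrib)
    then have "io [:b:] * D i0 - io [:a:] = io ([:0, 1:] ^ 1 * A') / io B" unfolding A' by simp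
    then have "io [:b:] * D i0 - io [:a:] \<in> val_filt conic 1" unfolding val_filt_iff using AB(1) by blast
    then have base: "io [:b:] * D i0 - io [:a:] \<in> val_ge 1" using val_ge_nat[of 1] by simp
    have "io [:b:] * D i - io [:a:] \<in> val_ge 1" if i: "i0 \<le> i" for i
    proof -
      have "s i - s i0 \<in> val_ge (int (nat (m + 1)))" unfolding val_ge_nat using M2 i by (simp add: i0_def)
      then have "s i - s i0 \<in> val_ge (m + 1)" by (rule val_ge_mono) simp
      then have "io [:b:] * ((s i - s i0) * f0 powi (- m)) \<in> val_ge (0 + (m + 1 + - m))" by (intro val_ge_mult val_ge_powi io_VI)
      then have t: "io [:b:] * ((s i - s i0) * f0 powi (- m)) \<in> val_ge 1" by simp
      have "io [:b:] * D i - io [:a:] = (io [:b:] * D i0 - io [:a:]) + io [:b:] * ((s i - s i0) * f0 powi (- m))"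
        unfolding D_def by (simp add: algebra_simps)
      then show ?thesis using val_ge_add[OF base t] by (simp only:)
    qed
    then show ?thesis unfolding G_def using b by blast
  qed
  \<comment> \<open>A denominator of least degree plays the role of lowest terms: cancelling a
    common factor of a and b contradicts minimality.\<close>
  define d where "d = (LEAST d. \<exists>a b. b \<noteq> 0 \<and> G a b \<and> degree b = d)"
  obtain a b where ab: "b \<noteq> 0" "G a b" "degree b = d"
    using LeastI_ex[of "\<lambda>d. \<exists>a b. b \<noteq> 0 \<and> G a b \<and> degree b = d"] ex unfolding d_def by blast
  have min: "d \<le> degree b'" if "b' \<noteq> 0" "G a' b'" for a' b'
    unfolding d_def by (rule Least_le) (use that in blast)
  have "degree b = 0"
  proof (rule ccontr)
    assume "degree b \<noteq> 0"
    then obtain \<pi> where \<pi>: "prime_elem \<pi>" "\<pi> dvd b" using prime_factor_exists by blast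
    note qc = qpt_closed[OF \<pi>(1)]
    have \<pi>0: "\<pi> \<noteq> 0" using \<pi>(1) by auto
    interpret A: affine_pt dummy "qpt \<pi>" by (rule qc(4))
    note Rc = subring_onD[OF A.R_sub]
    have fl: "A.fl = f0" unfolding A.fl_io f0_eq ..
    have le: "local_equation conic (qpt \<pi>) f0" using A.local_equation_fl unfolding fl .
    have f0R: "f0 \<in> A.R" using A.fl_R unfolding fl .
    interpret F: local_flag conic "qpt \<pi>" f0 "io [:\<pi>:]" by (rule A.affine_local_flag[OF qc(5) \<pi>0 le])
    have B: "F.\<kappa> (F.kcls s) \<in> B_to_K_flag (qpt \<pi>) f0 ` carrier (B_ring (qpt \<pi>) f0)"
      using K qc(1-3) le unfolding krichever_K_def by blast
    \<comment> \<open>\<open>nat (- N)\<close> clears the poles of the partial sum,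
      \<open>nat m\<close> those of the shift by f^-m.\<close>
    define k where "k = nat (- N) + nat m"
    have fk: "f0 ^ k * f0 powi j \<in> A.R" if "0 \<le> int k + j" for j
      unfolding f0_pow_powi[OF that] by (rule Rc(7)[OF f0R])
    have "f0 ^ k * partial_sum N Q n \<in> A.R"
    proof (induction n)
      case 0 show ?case using Rc(2) by (simp add: partial_sum_def)
    next
      case (Suc n)
      have "f0 ^ k * f0 powi (N + int n) \<in> A.R" by (rule fk) (simp add: k_def)
      then have "f0 ^ k * partial_sum N Q n + io [:Q n:] * (f0 ^ k * f0 powi (N + int n)) \<in> A.R"
        using Rc(6)[OF Suc Rc(4)[OF A.io_R]] by blast
      moreover have "f0 ^ k * partial_sum N Q (Suc n) = f0 ^ k * partial_sum N Q n + io [:Q n:] * (f0 ^ k * f0 powi (N + int n))"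
        unfolding partial_sum_Suc by (simp add: algebra_simps)
      ultimately show ?case by simp
    qed
    moreover have "f0 ^ k * f0 powi (- m) \<in> A.R" by (rule fk) (simp add: k_def)
    moreover have "\<nexists>c. c \<in> A.R \<and> io [:b:] = f0 * c"
    proof
      assume "\<exists>c. c \<in> A.R \<and> io [:b:] = f0 * c"
      then have "io [:b:] = 0 \<or> 1 \<le> vl (io [:b:])" using A.f_iff[OF le, of "io [:b:]"] by blast
      then show False using vl_io[of "[:b:]"] order_0_iff[of "[:b:]"] ab(1) by (auto simp: io_eq_0_iff)
    qed
    moreover have "\<exists>M. \<forall>i\<ge>M. io [:b:] * ((s i - partial_sum N Q n) * f0 powi (- m)) - io [:a:] \<in> val_filt conic (Suc 0)"
      using ab(2) val_ge_nat[of "Suc 0"] unfolding G_def D_def by simp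
    moreover have "io [:b:] \<in> stalk_max (qpt \<pi>)" unfolding A.io_max_iff qc(5) by (rule \<pi>(2))
    ultimately have "io [:a:] \<in> stalk_max (qpt \<pi>)"
      using F.B_ring_leading_coeff[OF s B partial_sum_FF _ FF_closed(9)[OF f0_FF] _ A.io_R A.io_R] by blast
    then have "\<pi> dvd a" unfolding A.io_max_iff qc(5) .
    then obtain a' where a': "a = \<pi> * a'" by (auto simp: dvd_def)
    obtain b' where b': "b = \<pi> * b'" using \<pi>(2) by (auto simp: dvd_def)
    have b'0: "b' \<noteq> 0" using ab(1) b' by auto
    \<comment> \<open>\<open>\<pi>\<close> has valuation 0 along C, so it can be removed from the
      congruence that defines \<open>G\<close>.\<close>
    have cancel: "r \<in> val_ge 1" if r: "r \<in> FF" "io [:\<pi>:] * r \<in> val_ge 1" for r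
    proof -
      have "vl (io [:\<pi>:]) = 0" using vl_io[of "[:\<pi>:]"] order_0_iff[of "[:\<pi>:]"] \<pi>0 by simp
      moreover have "io [:\<pi>:] \<noteq> 0" using \<pi>0 by (simp add: io_eq_0_iff)
      ultimately have "r \<noteq> 0 \<Longrightarrow> 1 \<le> vl r" using r(2) vl_mult[OF io_FF r(1), of "[:\<pi>:]"] unfolding val_ge_def by simp
      then show ?thesis using r(1) unfolding val_ge_def by blast
    qed
    have io\<pi>: "io [:\<pi> * c:] = io [:\<pi>:] * io [:c:]" for c using io_hom(3)[of "[:\<pi>:]" "[:c:]"] by (simp add: mult.commute)
    have "G a' b'"
    proof -
      obtain M where "\<forall>i\<ge>M. io [:b:] * D i - io [:a:] \<in> val_ge 1" using ab(2) unfolding G_def by blast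
      then have "\<forall>i\<ge>M. io [:\<pi>:] * (io [:b':] * D i - io [:a':]) \<in> val_ge 1" unfolding a' b' io\<pi> by (simp add: algebra_simps)
      moreover have "io [:b':] * D i - io [:a':] \<in> FF" for i by (intro FF_closed(3,4) io_FF DF)
      ultimately show ?thesis unfolding G_def using cancel by blast
    qed
    then have "degree b \<le> degree b'" using min[OF b'0] ab(3) by simp
    moreover have "degree \<pi> \<noteq> 0"
    proof
      assume "degree \<pi> = 0"
      then have "\<pi> dvd 1" unfolding is_unit_iff_degree[OF \<pi>0] .
      then show False using \<pi>(1) by (simp add: prime_elem_def)
    qed
    ultimately show False unfolding b' degree_mult_eq[OF \<pi>0 b'0] by simp
  qed
  then obtain \<beta> where \<beta>: "b = [:\<beta>:]" by (rule degree_eq_zeroE)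
  have \<beta>0: "\<beta> \<noteq> 0" using ab(1) \<beta> by simp
  define c where "c = smult (inverse \<beta>) a"
  obtain M' where M': "\<forall>i\<ge>M'. io [:b:] * D i - io [:a:] \<in> val_ge 1" using ab(2) unfolding G_def by blast
  have "s i - (partial_sum N Q n + io [:c:] * f0 powi m) \<in> val_ge (m + 1)" if "M' \<le> i" for i
  proof -
    have 1: "io [:[:inverse \<beta>:]:] * io [:b:] = 1"
      unfolding io_hom(3)[symmetric] \<beta> using \<beta>0 by (simp add: io_hom(1)[symmetric] one_pCons)
    have 2: "io [:[:inverse \<beta>:]:] * io [:a:] = io [:c:]"
      unfolding io_hom(3)[symmetric] c_def by simp
    have "io [:[:inverse \<beta>:]:] * (io [:b:] * D i - io [:a:]) \<in> val_ge (0 + 1)"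
      by (rule val_ge_mult[OF io_VI]) (use M' that in blast)
    also have "io [:[:inverse \<beta>:]:] * (io [:b:] * D i - io [:a:]) = D i - io [:c:]"
      unfolding right_diff_distrib mult.assoc[symmetric] 1 2 by simp
    finally have "(D i - io [:c:]) * f0 powi m \<in> val_ge (0 + 1 + m)" by (rule val_ge_mult[OF _ val_ge_powi])
    moreover have "f0 powi (- m) * f0 powi m = (1 :: 'a poly3 fract)" using f0_nz by (simp add: power_int_minus)
    then have "D i * f0 powi m = s i - partial_sum N Q n" unfolding D_def by (simp add: mult.assoc)
    ultimately show ?thesis by (simp add: left_diff_distrib algebra_simps)
  qed
  then show ?thesis unfolding m_def by (intro exI[of _ c] exI[of _ M']) (simp add: algebra_simps)
qed

lemma krichever_expansion:
  assumes s: "s \<in> carrier (cauchy_ring function_field (val_filt conic))"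
    and K: "cauchy_class function_field (val_filt conic) s \<in> krichever_K conic conic_point"
  shows "\<exists>N Q. \<forall>n. \<exists>M. \<forall>i\<ge>M. s i - partial_sum N Q n \<in> val_ge (N + int n)"
proof -
  interpret L: laurent_flag "conic :: 'a poly3" conic_point conic_u conic_t p_exp by (rule conic_point_laurent_flag)
  have sF: "s i \<in> FF" for i using s L.FFC_iff by blast
  obtain M0 where M0: "\<forall>i\<ge>M0. \<forall>j\<ge>M0. s i - s j \<in> val_filt conic 0" using s L.FFC_iff by blast
  \<comment> \<open>A lower bound for the whole tail, whose terms differ from \<open>s M0\<close> by
    nonnegative valuation. If \<open>s M0\<close> is zero, it lies in \<open>val_ge\<close> at every
    level, whatever \<open>vl\<close> returns.\<close>
  define N where "N = min 0 (vl (s M0))"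
  have sN: "s M0 \<in> val_ge N" using sF by (simp add: val_ge_def N_def)
  have start: "s i \<in> val_ge N" if "M0 \<le> i" for i
  proof -
    have "s i - s M0 \<in> val_filt conic 0" using M0 that by blast
    then have "s i - s M0 \<in> val_ge 0" using val_ge_nat[of 0] by simp
    then have "s i - s M0 \<in> val_ge N" by (rule val_ge_mono) (simp add: N_def)
    from val_ge_add[OF this sN] show ?thesis by simp
  qed
  define P where "P n x \<longleftrightarrow> (\<exists>Q. x = partial_sum N Q n) \<and> (\<exists>M. \<forall>i\<ge>M. s i - x \<in> val_ge (N + int n))" for n x
  \<comment> \<open>The choice runs over partial sums, since the next coefficient exists only for a
    sum already fixed; the sequence of coefficients is read off afterwards.\<close>
  have "\<exists>p. \<forall>n. P n (p n) \<and> (\<exists>c. p (Suc n) = p n + io [:c:] * f0 powi (N + int n))"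
  proof (rule dependent_nat_choice)
    have "P 0 0" unfolding P_def using start by (auto simp: partial_sum_def)
    then show "\<exists>x. P 0 x" ..
    fix x n assume "P n x"
    then obtain Q M where Q: "x = partial_sum N Q n" "\<forall>i\<ge>M. s i - partial_sum N Q n \<in> val_ge (N + int n)" unfolding P_def by blast
    obtain c M' where c: "\<forall>i\<ge>M'. s i - (partial_sum N Q n + io [:c:] * f0 powi (N + int n)) \<in> val_ge (N + int (Suc n))"
      using residue_step[OF s K Q(2)] by blast
    \<comment> \<open>Changing \<open>Q\<close> at the index n leaves the sum over smaller indices
      untouched.\<close>
    have "x + io [:c:] * f0 powi (N + int n) = partial_sum N (Q(n := c)) (Suc n)"
      unfolding partial_sum_Suc Q(1) by (simp add: partial_sum_def)
    then have "P (Suc n) (x + io [:c:] * f0 powi (N + int n))" unfolding P_def using c Q(1) by blast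
    then show "\<exists>y. P (Suc n) y \<and> (\<exists>c. y = x + io [:c:] * f0 powi (N + int n))" by blast
  qed
  then obtain p Q where p: "\<And>n. P n (p n)" "\<And>n. p (Suc n) = p n + io [:Q n:] * f0 powi (N + int n)" by metis
  have "p n = partial_sum N Q n" for n
  proof (induction n)
    case 0
    obtain Q' where "p 0 = partial_sum N Q' 0" using p(1) unfolding P_def by blast
    then show ?case by (simp add: partial_sum_def)
  next
    case (Suc n) then show ?case unfolding p(2) partial_sum_Suc by simp
  qed
  then show ?thesis using p(1) unfolding P_def by metis
qed

lemma poly_values_eq: "poly_values conic_alpha = range alpha_poly"
  unfolding poly_values_def alpha_poly_def ..

lemma krichever_eq: "krichever (conic :: 'a poly3) conic_point conic_t conic_u = laurent_sums (poly_values conic_alpha) f_fls"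
proof (intro subset_antisym subsetI)
  interpret L: laurent_flag "conic :: 'a poly3" conic_point conic_u conic_t p_exp by (rule conic_point_laurent_flag)
  fix h assume "h \<in> krichever (conic :: 'a poly3) conic_point conic_t conic_u"
  then obtain g where g: "g \<in> krichever_K conic conic_point" "laurent_to_K_flag conic_point conic_t conic_u h = L.\<kappa> g"
    unfolding krichever_def by blast
  have "g \<in> carrier (K_curve conic)" using g(1) unfolding krichever_K_def by blast
  then obtain s where s: "s \<in> L.FFC" "g = L.kcls s" unfolding L.K_curve_carrier by blast
  obtain N Q where Q: "\<And>n. \<exists>M. \<forall>i\<ge>M. s i - partial_sum N Q n \<in> val_ge (N + int n)"
    using krichever_expansion[OF s(1) g(1)[unfolded s(2)]] by blast
  have "(\<lambda>n. alpha_poly (Q n) * f_fls powi (N + int n)) sums h"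
    by (rule krichever_imp_sums[OF s(1) g(2)[unfolded s(2)] Q])
  then show "h \<in> laurent_sums (poly_values conic_alpha) f_fls"
    unfolding laurent_sums_def poly_values_eq by (intro CollectI exI[of _ N] exI[of _ "\<lambda>n. alpha_poly (Q n)"]) blast
next
  fix h :: "'a fls fls" assume "h \<in> laurent_sums (poly_values conic_alpha) f_fls"
  then obtain N c where c: "\<And>n. c n \<in> range alpha_poly" "(\<lambda>n. c n * f_fls powi (N + int n)) sums h"
    unfolding laurent_sums_def poly_values_eq by blast
  obtain Q where "\<And>n. c n = alpha_poly (Q n)" using c(1) unfolding image_iff by metis
  then have "(\<lambda>n. alpha_poly (Q n) * f_fls powi (N + int n)) sums h" using c(2) by simp
  then show "h \<in> krichever conic conic_point conic_t conic_u"
    by (rule sums_imp_krichever[OF _ partial_sum_krichever])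
qed

end

theorem proposition1:
  assumes "(2 :: 'k::field) \<noteq> 0"
  shows "krichever (conic :: 'k poly3) conic_point conic_t conic_u =
           laurent_sums (poly_values conic_alpha) (conic_alpha ^ 2 / lt ^ 2 * lu)"
proof -
  interpret char_ne_2 "TYPE('k)" by unfold_locales (rule assms)
  show ?thesis by (rule krichever_eq)
qed

end
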